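(* Let $0\le v\le u$ be integers and let $D$ be a disk with coordinates $z_1,\dots,z_u$, in any one of the following geometric categories: (i) the algebraic affine space over a field $k$ of characteristic zero; (ii) the formal disk over a field $k$ of characteristic zero; (iii) a complex analytic disk ($k=\mathbb{C}$); (iv) a smooth real disk ($k=\mathbb{R}$); (v) the spectrum of the algebra of polynomials with divided powers, or of formal power series with divided powers, in $z_1,\dots,z_u$ over a field $k$ of prime characteristic. For $1\le s\le v$ let $L_s=\{z_s=0\}\subset D$ be the coordinate hyperplane. Let $\Omega$ be the de Rham DG-algebra of regular differential forms in $D\setminus\bigcup_{s=1}^v L_s$ with logarithmic singularities along the hyperplanes $L_s$, $1\le s\le v$, with the de Rham differential $d$, and let $Z=\ker(d\colon\Omega\to\Omega)$ be the graded $k$-algebra of closed forms (with the product of differential forms, graded by the degree of forms). Then the graded algebra $Z$ is Koszul.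
   Context: Description of $\Omega$: let $\Omega^0$ be the ring of regular functions on $D$, i.e. $k[z_1,\dots,z_u]$ in case (i), $k[[z_1,\dots,z_u]]$ in case (ii), holomorphic functions on the disk (an open polydisc centered at the origin of $\mathbb{C}^u$) in case (iii), real $C^\infty$ functions on the disk (a product of open intervals centered at $0$ in $\mathbb{R}^u$) in case (iv), and the algebra of divided power polynomials (respectively, divided power formal series) in case (v). Let $A$ be the exterior algebra over $k$ generated by the closed $1$-forms $dz_s/z_s$ ($1\le s\le v$) and $dz_r$ ($v<r\le u$). Then $\Omega$ is the free $A$-module generated by $\Omega^0$; that is, $\Omega^n$ is the free $\Omega^0$-module with basis the $n$-fold exterior products of these $1$-forms, with the usual product and de Rham differential (on divided powers, $d(z^{[n]})=z^{[n-1]}dz$). Koszul algebra: a nonnegatively graded associative unital algebra $Z=\bigoplus_{n\ge0}Z_n$ over a field $k$ (no finite-dimensionality of the components is assumed) is called Koszul if $Z_0=k$ and $\operatorname{Tor}^Z_{ij}(k,k)=0$ for all $i\ne j$, where $i$ is the homological grading and $j$ is the internal grading induced by the grading of $Z$, and $k=Z/\bigoplus_{n\ge1}Z_n$.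
   Formalization: In case (v) (divided powers, prime characteristic p) the claim is proved only for v = 0; for v ≥ 1 it is false, since d(z_1^{[p]}) = z_1 z_1^{[p-1]} dz_1/z_1 = p z_1^{[p]} dz_1/z_1 = 0, so Z_0 ≠ k. *)

theory Defs
  imports
    "HOL-Analysis.Analysis"
    "HOL-Algebra.Module"
    "HOL-Algebra.Elementary_Groups"
begin

section \<open>Graded algebras over a field\<close>

text \<open>An algebra over the field \<open>'k\<close> is a \<^type>\<open>module\<close> record with coefficients in the type \<open>'k\<close>.
  (The locale \<open>algebra\<close> of HOL-Algebra cannot be used: it only covers commutative algebras.)\<close>

locale graded_algebra = ring A for A :: "('k::field, 'a, 'm) module_scheme" (structure) +
  fixes gr :: "nat \<Rightarrow> 'a set"
  assumes smult_closed: "x \<in> carrier A \<Longrightarrow> c \<odot> x \<in> carrier A"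
    and smult_l_distr: "x \<in> carrier A \<Longrightarrow> (c + c') \<odot> x = c \<odot> x \<oplus> c' \<odot> x"
    and smult_r_distr: "x \<in> carrier A \<Longrightarrow> y \<in> carrier A \<Longrightarrow> c \<odot> (x \<oplus> y) = c \<odot> x \<oplus> c \<odot> y"
    and smult_assoc: "x \<in> carrier A \<Longrightarrow> (c * c') \<odot> x = c \<odot> (c' \<odot> x)"
    and smult_one: "x \<in> carrier A \<Longrightarrow> 1 \<odot> x = x"
    and smult_mult_l: "x \<in> carrier A \<Longrightarrow> y \<in> carrier A \<Longrightarrow> (c \<odot> x) \<otimes> y = c \<odot> (x \<otimes> y)"
    and smult_mult_r: "x \<in> carrier A \<Longrightarrow> y \<in> carrier A \<Longrightarrow> x \<otimes> (c \<odot> y) = c \<odot> (x \<otimes> y)"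
    and gr_subgroup: "subgroup (gr n) (add_monoid A)"
    and gr_smult: "x \<in> gr n \<Longrightarrow> c \<odot> x \<in> gr n"
    and gr_one: "\<one> \<in> gr 0"
    and gr_mult: "x \<in> gr m \<Longrightarrow> y \<in> gr n \<Longrightarrow> x \<otimes> y \<in> gr (m + n)"
    and gr_direct_sum: "x \<in> carrier A \<Longrightarrow>
      \<exists>!c. (\<forall>n. c n \<in> gr n) \<and> finite {n. c n \<noteq> \<zero>} \<and> x = (\<Oplus>n\<in>{n. c n \<noteq> \<zero>}. c n)"

definition gr_component ::
  "('k, 'a, 'm) module_scheme \<Rightarrow> (nat \<Rightarrow> 'a set) \<Rightarrow> nat \<Rightarrow> 'a \<Rightarrow> 'a" where
  "gr_component A gr n x = (THE c. (\<forall>n. c n \<in> gr n) \<and> finite {n. c n \<noteq> \<zero>\<^bsub>A\<^esub>} \<and>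
     x = (\<Oplus>\<^bsub>A\<^esub>n\<in>{n. c n \<noteq> \<zero>\<^bsub>A\<^esub>}. c n)) n"


section \<open>Bigraded Tor of the trivial module and Koszul algebras\<close>

text \<open>
  \<open>Tor\<^sup>A(k, k)\<close> is computed from a graded free resolution
  \<open>\<dots> \<rightarrow> F\<^sub>1 \<rightarrow> F\<^sub>0 \<rightarrow> k \<rightarrow> 0\<close> of the left \<open>A\<close>-module \<open>k\<close>. Here \<open>k\<close> is \<open>A\<close> modulo its components
  of positive degree, identified with \<open>gr 0\<close>, so that \<open>A\<close> acts on it through \<open>gr_component A gr 0\<close>.
  The module \<open>F\<^sub>n\<close> consists of the finitely supported functions \<open>basis n \<rightarrow> A\<close>, the generator
  \<open>b\<close> being placed in internal degree \<open>bdeg n b\<close>; \<open>bdry n b\<close> is the image in \<open>F\<^sub>n\<close> of the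
  generator \<open>b\<close> of \<open>F\<^sub>n\<^sub>+\<^sub>1\<close>, and \<open>augm b\<close> the image in \<open>k\<close> of the generator \<open>b\<close> of \<open>F\<^sub>0\<close>.
\<close>

record ('a, 'b) free_complex =
  basis :: "nat \<Rightarrow> 'b set"
  bdeg :: "nat \<Rightarrow> 'b \<Rightarrow> nat"
  bdry :: "nat \<Rightarrow> 'b \<Rightarrow> 'b \<Rightarrow> 'a"
  augm :: "'b \<Rightarrow> 'a"

definition free_module :: "('k, 'a, 'm) module_scheme \<Rightarrow> 'b set \<Rightarrow> ('b \<Rightarrow> 'a) set" where
  "free_module A B = {f. finite {b. f b \<noteq> \<zero>\<^bsub>A\<^esub>} \<and> (\<forall>b. f b \<in> carrier A) \<and>
     (\<forall>b. b \<notin> B \<longrightarrow> f b = \<zero>\<^bsub>A\<^esub>)}"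

definition lin_ext ::
  "('k, 'a, 'm) module_scheme \<Rightarrow> ('b \<Rightarrow> 'b \<Rightarrow> 'a) \<Rightarrow> ('b \<Rightarrow> 'a) \<Rightarrow> 'b \<Rightarrow> 'a" where
  "lin_ext A \<phi> f c = (\<Oplus>\<^bsub>A\<^esub>b\<in>{b. f b \<noteq> \<zero>\<^bsub>A\<^esub>}. f b \<otimes>\<^bsub>A\<^esub> \<phi> b c)"

definition augmentation ::
  "('k, 'a, 'm) module_scheme \<Rightarrow> (nat \<Rightarrow> 'a set) \<Rightarrow> ('b \<Rightarrow> 'a) \<Rightarrow> ('b \<Rightarrow> 'a) \<Rightarrow> 'a" where
  "augmentation A gr e f =
     gr_component A gr 0 (\<Oplus>\<^bsub>A\<^esub>b\<in>{b. f b \<noteq> \<zero>\<^bsub>A\<^esub>}. f b \<otimes>\<^bsub>A\<^esub> e b)"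

definition graded_free_resolution ::
  "('k, 'a, 'm) module_scheme \<Rightarrow> (nat \<Rightarrow> 'a set) \<Rightarrow> ('a, 'b) free_complex \<Rightarrow> bool" where
  "graded_free_resolution A gr P \<longleftrightarrow>
     (\<forall>n. \<forall>b\<in>basis P (Suc n). bdry P n b \<in> free_module A (basis P n) \<and>
        (\<forall>c\<in>basis P n. bdry P n b c \<in>
           (if bdeg P n c \<le> bdeg P (Suc n) b then gr (bdeg P (Suc n) b - bdeg P n c)
            else {\<zero>\<^bsub>A\<^esub>}))) \<and>
     (\<forall>b\<in>basis P 0. augm P b \<in> (if bdeg P 0 b = 0 then gr 0 else {\<zero>\<^bsub>A\<^esub>})) \<and>
     augmentation A gr (augm P) ` free_module A (basis P 0) = gr 0 \<and>
     lin_ext A (bdry P 0) ` free_module A (basis P 1) =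
       {f \<in> free_module A (basis P 0). augmentation A gr (augm P) f = \<zero>\<^bsub>A\<^esub>} \<and>
     (\<forall>n. lin_ext A (bdry P (Suc n)) ` free_module A (basis P (Suc (Suc n))) =
       {f \<in> free_module A (basis P (Suc n)). lin_ext A (bdry P n) f = (\<lambda>_. \<zero>\<^bsub>A\<^esub>)})"

text \<open>
  Lists over \<open>A\<close> suffice to index bases: the normalized bar resolution \<open>A \<otimes> (A\<^sub>+)\<^sup>\<otimes>\<^sup>n\<close> is free
  on the words of length \<open>n\<close> in a homogeneous \<open>k\<close>-basis of \<open>A\<^sub>+\<close>.
\<close>

definition tor_resolution ::
  "('k, 'a, 'm) module_scheme \<Rightarrow> (nat \<Rightarrow> 'a set) \<Rightarrow> ('a, 'a list) free_complex" where
  "tor_resolution A gr = (SOME P. graded_free_resolution A gr P)"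

text \<open>
  \<open>k \<otimes>\<^sub>A F\<^sub>i\<close> has the \<open>k\<close>-basis \<open>basis i\<close>; \<open>tor_chains A gr P i j\<close> is its part of internal degree
  \<open>j\<close>, and \<open>tor_bdry A gr P i\<close> is the map \<open>k \<otimes>\<^sub>A F\<^sub>i\<^sub>+\<^sub>1 \<rightarrow> k \<otimes>\<^sub>A F\<^sub>i\<close> induced by the differential.
\<close>

definition tor_chains ::
  "('k, 'a, 'm) module_scheme \<Rightarrow> (nat \<Rightarrow> 'a set) \<Rightarrow> ('a, 'b) free_complex \<Rightarrow> nat \<Rightarrow> nat
    \<Rightarrow> ('b \<Rightarrow> 'a) set" where
  "tor_chains A gr P i j = {f. finite {b. f b \<noteq> \<zero>\<^bsub>A\<^esub>} \<and> (\<forall>b. f b \<in> gr 0) \<and>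
     (\<forall>b. f b \<noteq> \<zero>\<^bsub>A\<^esub> \<longrightarrow> b \<in> basis P i \<and> bdeg P i b = j)}"

definition tor_bdry ::
  "('k, 'a, 'm) module_scheme \<Rightarrow> (nat \<Rightarrow> 'a set) \<Rightarrow> ('a, 'b) free_complex \<Rightarrow> nat
    \<Rightarrow> ('b \<Rightarrow> 'a) \<Rightarrow> 'b \<Rightarrow> 'a" where
  "tor_bdry A gr P i f c = gr_component A gr 0 (lin_ext A (bdry P i) f c)"

definition tor_cycles ::
  "('k, 'a, 'm) module_scheme \<Rightarrow> (nat \<Rightarrow> 'a set) \<Rightarrow> ('a, 'b) free_complex \<Rightarrow> nat \<Rightarrow> nat
    \<Rightarrow> ('b \<Rightarrow> 'a) set" where
  "tor_cycles A gr P i j = {f \<in> tor_chains A gr P i j.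
     case i of 0 \<Rightarrow> True | Suc i' \<Rightarrow> tor_bdry A gr P i' f = (\<lambda>_. \<zero>\<^bsub>A\<^esub>)}"

definition Tor ::
  "('k, 'a, 'm) module_scheme \<Rightarrow> (nat \<Rightarrow> 'a set) \<Rightarrow> nat \<Rightarrow> nat \<Rightarrow> ('a list \<Rightarrow> 'a) set monoid" where
  "Tor A gr i j = (let P = tor_resolution A gr in
     \<lparr>carrier = tor_cycles A gr P i j, monoid.mult = \<lambda>f g b. f b \<oplus>\<^bsub>A\<^esub> g b, one = \<lambda>_. \<zero>\<^bsub>A\<^esub>\<rparr>
       Mod (tor_bdry A gr P i ` tor_chains A gr P (Suc i) j))"

definition koszul :: "('k::field, 'a, 'm) module_scheme \<Rightarrow> (nat \<Rightarrow> 'a set) \<Rightarrow> bool" where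
  "koszul A gr \<longleftrightarrow> graded_algebra A gr \<and>
     bij_betw (\<lambda>c. c \<odot>\<^bsub>A\<^esub> \<one>\<^bsub>A\<^esub>) UNIV (gr 0) \<and>
     (\<forall>i j. i \<noteq> j \<longrightarrow> trivial_group (Tor A gr i j))"


section \<open>Logarithmic differential forms\<close>

text \<open>The algebra \<open>\<Omega>\<^sup>0\<close> of regular functions on a disk, with the coordinates \<open>z\<^sub>i\<close> and the partial
  derivatives \<open>\<partial>/\<partial>z\<^sub>i\<close>; coordinates are numbered by \<open>{1..u}\<close>.\<close>

record ('k, 'f) disk_algebra = "('k, 'f) module" +
  coord :: "nat \<Rightarrow> 'f"
  partial :: "nat \<Rightarrow> 'f \<Rightarrow> 'f"

definition signed :: "('k, 'f) disk_algebra \<Rightarrow> nat \<Rightarrow> 'f \<Rightarrow> 'f" where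
  "signed F n x = (if even n then x else \<ominus>\<^bsub>F\<^esub> x)"

text \<open>Let \<open>\<eta>\<^sub>s = dz\<^sub>s/z\<^sub>s\<close> for \<open>s \<le> v\<close> and \<open>\<eta>\<^sub>s = dz\<^sub>s\<close> for \<open>s > v\<close>. The form
  \<open>\<Sum>\<^sub>I \<omega>\<^sub>I \<eta>\<^sub>i\<^sub>1 \<and> \<dots> \<and> \<eta>\<^sub>i\<^sub>n\<close>, where \<open>I = {i\<^sub>1 < \<dots> < i\<^sub>n}\<close> ranges over the subsets of \<open>{1..u}\<close>, is
  represented by its coefficient function \<open>I \<mapsto> \<omega>\<^sub>I\<close>.\<close>

definition log_forms :: "nat \<Rightarrow> ('k, 'f) disk_algebra \<Rightarrow> ('k, nat set \<Rightarrow> 'f) module" where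
  "log_forms u F =
    \<lparr>carrier = {\<omega>. (\<forall>I. \<omega> I \<in> carrier F) \<and> (\<forall>I. \<not> I \<subseteq> {1..u} \<longrightarrow> \<omega> I = \<zero>\<^bsub>F\<^esub>)},
     monoid.mult = \<lambda>\<alpha> \<beta> K. \<Oplus>\<^bsub>F\<^esub>I\<in>Pow K.
       signed F (card {(i, j). i \<in> I \<and> j \<in> K - I \<and> j < i}) (\<alpha> I \<otimes>\<^bsub>F\<^esub> \<beta> (K - I)),
     one = \<lambda>I. if I = {} then \<one>\<^bsub>F\<^esub> else \<zero>\<^bsub>F\<^esub>,
     zero = \<lambda>_. \<zero>\<^bsub>F\<^esub>,
     add = \<lambda>\<alpha> \<beta> I. \<alpha> I \<oplus>\<^bsub>F\<^esub> \<beta> I,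
     smult = \<lambda>c \<alpha> I. c \<odot>\<^bsub>F\<^esub> \<alpha> I\<rparr>"

text \<open>The coefficient of \<open>\<eta>\<^sub>s\<close> in \<open>df\<close>, as \<open>dz\<^sub>s = z\<^sub>s \<eta>\<^sub>s\<close> for \<open>s \<le> v\<close>.\<close>

definition log_partial :: "nat \<Rightarrow> ('k, 'f) disk_algebra \<Rightarrow> nat \<Rightarrow> 'f \<Rightarrow> 'f" where
  "log_partial v F s f =
     (if s \<le> v then coord F s \<otimes>\<^bsub>F\<^esub> partial F s f else partial F s f)"

definition de_rham ::
  "nat \<Rightarrow> nat \<Rightarrow> ('k, 'f) disk_algebra \<Rightarrow> (nat set \<Rightarrow> 'f) \<Rightarrow> nat set \<Rightarrow> 'f" where
  "de_rham u v F \<omega> K = (if K \<subseteq> {1..u}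
     then (\<Oplus>\<^bsub>F\<^esub>s\<in>K. signed F (card {i \<in> K. i < s}) (log_partial v F s (\<omega> (K - {s}))))
     else \<zero>\<^bsub>F\<^esub>)"

definition closed_forms ::
  "nat \<Rightarrow> nat \<Rightarrow> ('k, 'f) disk_algebra \<Rightarrow> ('k, nat set \<Rightarrow> 'f) module" where
  "closed_forms u v F = (log_forms u F)
     \<lparr>carrier := {\<omega> \<in> carrier (log_forms u F). de_rham u v F \<omega> = (\<lambda>_. \<zero>\<^bsub>F\<^esub>)}\<rparr>"

definition closed_forms_deg ::
  "nat \<Rightarrow> nat \<Rightarrow> ('k, 'f) disk_algebra \<Rightarrow> nat \<Rightarrow> (nat set \<Rightarrow> 'f) set" where
  "closed_forms_deg u v F n =
     {\<omega> \<in> carrier (closed_forms u v F). \<forall>I. card I \<noteq> n \<longrightarrow> \<omega> I = \<zero>\<^bsub>F\<^esub>}"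


section \<open>Polynomials and power series, ordinary and with divided powers\<close>

text \<open>A (divided power) series is given by its coefficient function on multi-indices; multi-indices
  are functions \<open>nat \<Rightarrow> nat\<close> vanishing outside \<open>{1..u}\<close>. In \<open>coeff_algebra u X w e\<close> the
  set \<open>X\<close> restricts the coefficient functions, multiplication is
  \<open>z\<^sup>a z\<^sup>b = w a b z\<^sup>a\<^sup>+\<^sup>b\<close>, and \<open>\<partial>/\<partial>z\<^sub>i\<close> multiplies the coefficient of \<open>z\<^sup>m\<close> by \<open>e (m i)\<close>
  while lowering \<open>m i\<close> by one.\<close>

definition multi_index :: "nat \<Rightarrow> (nat \<Rightarrow> nat) set" where
  "multi_index u = {m. \<forall>i. i \<notin> {1..u} \<longrightarrow> m i = 0}"

definition coeff_algebra ::
  "nat \<Rightarrow> ((nat \<Rightarrow> nat) \<Rightarrow> 'k::field) set \<Rightarrow> ((nat \<Rightarrow> nat) \<Rightarrow> (nat \<Rightarrow> nat) \<Rightarrow> nat) \<Rightarrow> (nat \<Rightarrow> nat)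
    \<Rightarrow> ('k, (nat \<Rightarrow> nat) \<Rightarrow> 'k) disk_algebra" where
  "coeff_algebra u X w e =
    \<lparr>carrier = {f \<in> X. \<forall>m. m \<notin> multi_index u \<longrightarrow> f m = 0},
     monoid.mult = \<lambda>f g m. \<Sum>a\<in>{a. a \<le> m}. of_nat (w a (m - a)) * f a * g (m - a),
     one = \<lambda>m. if m = (\<lambda>_. 0) then 1 else 0,
     zero = \<lambda>_. 0,
     add = \<lambda>f g m. f m + g m,
     smult = \<lambda>c f m. c * f m,
     coord = \<lambda>i m. if m = (\<lambda>_. 0)(i := 1) then 1 else 0,
     partial = \<lambda>i f m. of_nat (e (Suc (m i))) * f (m(i := Suc (m i)))\<rparr>"

definition finite_support :: "((nat \<Rightarrow> nat) \<Rightarrow> 'k::field) set" where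
  "finite_support = {f. finite {m. f m \<noteq> 0}}"

definition divided_power_weight :: "nat \<Rightarrow> (nat \<Rightarrow> nat) \<Rightarrow> (nat \<Rightarrow> nat) \<Rightarrow> nat" where
  "divided_power_weight u a b = (\<Prod>i\<in>{1..u}. (a i + b i) choose (a i))"

definition polynomial_functions :: "nat \<Rightarrow> ('k::field, (nat \<Rightarrow> nat) \<Rightarrow> 'k) disk_algebra" where
  "polynomial_functions u = coeff_algebra u finite_support (\<lambda>_ _. 1) (\<lambda>n. n)"

definition power_series_functions :: "nat \<Rightarrow> ('k::field, (nat \<Rightarrow> nat) \<Rightarrow> 'k) disk_algebra" where
  "power_series_functions u = coeff_algebra u UNIV (\<lambda>_ _. 1) (\<lambda>n. n)"

definition dp_polynomial_functions :: "nat \<Rightarrow> ('k::field, (nat \<Rightarrow> nat) \<Rightarrow> 'k) disk_algebra" where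
  "dp_polynomial_functions u = coeff_algebra u finite_support (divided_power_weight u) (\<lambda>_. 1)"

definition dp_series_functions :: "nat \<Rightarrow> ('k::field, (nat \<Rightarrow> nat) \<Rightarrow> 'k) disk_algebra" where
  "dp_series_functions u = coeff_algebra u UNIV (divided_power_weight u) (\<lambda>_. 1)"


section \<open>Holomorphic and smooth functions\<close>

text \<open>Points of \<open>\<complex>\<^sup>u\<close> and \<open>\<real>\<^sup>u\<close> are functions on \<open>nat\<close> vanishing outside \<open>{1..u}\<close>; the product
  topology on function spaces restricts to the Euclidean one on them. Functions on the disk are
  extended by zero to all points.\<close>

definition polydisk :: "nat \<Rightarrow> (nat \<Rightarrow> real) \<Rightarrow> (nat \<Rightarrow> 'k::real_normed_field) set" where
  "polydisk u r = {p. (\<forall>i\<in>{1..u}. norm (p i) < r i) \<and> (\<forall>i. i \<notin> {1..u} \<longrightarrow> p i = 0)}"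

definition partial_deriv ::
  "(nat \<Rightarrow> 'k::real_normed_field) set \<Rightarrow> nat \<Rightarrow> ((nat \<Rightarrow> 'k) \<Rightarrow> 'k) \<Rightarrow> (nat \<Rightarrow> 'k) \<Rightarrow> 'k" where
  "partial_deriv D i f p = (if p \<in> D then deriv (\<lambda>t. f (p(i := t))) (p i) else 0)"

definition function_algebra ::
  "(nat \<Rightarrow> 'k::real_normed_field) set \<Rightarrow> ((nat \<Rightarrow> 'k) \<Rightarrow> 'k) set
    \<Rightarrow> ('k, (nat \<Rightarrow> 'k) \<Rightarrow> 'k) disk_algebra" where
  "function_algebra D X =
    \<lparr>carrier = {f \<in> X. \<forall>p. p \<notin> D \<longrightarrow> f p = 0},
     monoid.mult = \<lambda>f g p. f p * g p,
     one = \<lambda>p. if p \<in> D then 1 else 0,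
     zero = \<lambda>_. 0,
     add = \<lambda>f g p. f p + g p,
     smult = \<lambda>c f p. c * f p,
     coord = \<lambda>i p. if p \<in> D then p i else 0,
     partial = partial_deriv D\<rparr>"

text \<open>Holomorphic: continuous, and holomorphic in each variable separately.\<close>

definition holomorphic_functions ::
  "nat \<Rightarrow> (nat \<Rightarrow> real) \<Rightarrow> (complex, (nat \<Rightarrow> complex) \<Rightarrow> complex) disk_algebra" where
  "holomorphic_functions u r = (let D = polydisk u r in function_algebra D
     {f. continuous_on D f \<and>
        (\<forall>p\<in>D. \<forall>i\<in>{1..u}. (\<lambda>t. f (p(i := t))) holomorphic_on ball 0 (r i))})"

text \<open>Smooth: the iterated partial derivatives of all orders exist and are continuous.\<close>

definition smooth_functions ::
  "nat \<Rightarrow> (nat \<Rightarrow> real) \<Rightarrow> (real, (nat \<Rightarrow> real) \<Rightarrow> real) disk_algebra" where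
  "smooth_functions u r = (let D = polydisk u r in function_algebra D
     {f. \<forall>js. set js \<subseteq> {1..u} \<longrightarrow> (let g = fold (partial_deriv D) js f in
        continuous_on D g \<and>
        (\<forall>p\<in>D. \<forall>i\<in>{1..u}. (\<lambda>t. g (p(i := t))) differentiable at (p i)))})"


section \<open>Divided powers do not admit logarithmic poles\<close>

text \<open>In characteristic \<open>p\<close> one has \<open>d z\<^sup>[\<^sup>p\<^sup>] = z\<^sup>[\<^sup>p\<^sup>-\<^sup>1\<^sup>] dz = z z\<^sup>[\<^sup>p\<^sup>-\<^sup>1\<^sup>] (dz/z) = p z\<^sup>[\<^sup>p\<^sup>] (dz/z) = 0\<close>
  as soon as \<open>dz/z\<close> is adjoined, so the closed forms of degree zero are not only the constants.\<close>

lemma coeff_algebra_abelian_group: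
  assumes "(\<lambda>_. 0) \<in> X" "\<And>f g. f \<in> X \<Longrightarrow> g \<in> X \<Longrightarrow> (\<lambda>m. f m + g m) \<in> X"
    and "\<And>f. f \<in> X \<Longrightarrow> (\<lambda>m. - f m) \<in> X"
  shows "abelian_group (coeff_algebra u X w e)"
proof (rule abelian_groupI)
  fix f assume f: "f \<in> carrier (coeff_algebra u X w e)"
  show "\<exists>g\<in>carrier (coeff_algebra u X w e). g \<oplus>\<^bsub>coeff_algebra u X w e\<^esub> f = \<zero>\<^bsub>coeff_algebra u X w e\<^esub>"
    by (rule bexI[of _ "\<lambda>m. - f m"]) (use f assms in \<open>auto simp: coeff_algebra_def\<close>)
qed (use assms in \<open>auto simp: coeff_algebra_def algebra_simps\<close>)

lemma divided_power_log_not_koszul: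
  fixes X :: "((nat \<Rightarrow> nat) \<Rightarrow> 'p::field_prime_char) set"
  assumes X: "(\<lambda>_. 0) \<in> X" "\<And>f g. f \<in> X \<Longrightarrow> g \<in> X \<Longrightarrow> (\<lambda>m. f m + g m) \<in> X"
      "\<And>f. f \<in> X \<Longrightarrow> (\<lambda>m. - f m) \<in> X"
    and mono: "\<And>m. (\<lambda>n. if n = m then 1 else 0) \<in> X"
    and v: "1 \<le> v" "v \<le> u"
    and F: "F = coeff_algebra u X (divided_power_weight u) (\<lambda>_. 1)"
  shows "\<not> koszul (closed_forms u v F) (closed_forms_deg u v F)"
proof
  assume K: "koszul (closed_forms u v F) (closed_forms_deg u v F)"
  interpret F: abelian_group F
    unfolding F by (rule coeff_algebra_abelian_group) (use X in auto)
  define p where "p = CHAR('p)"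
  have p: "p \<ge> 2" unfolding p_def using CHAR_prime[where 'a='p] prime_ge_2_nat by blast
  define m0 :: "nat \<Rightarrow> nat" where "m0 = (\<lambda>_. 0)(1 := p)"
  define f :: "(nat \<Rightarrow> nat) \<Rightarrow> 'p" where "f = (\<lambda>n. if n = m0 then 1 else 0)"
  define \<omega> where "\<omega> = (\<lambda>I::nat set. if I = {} then f else \<zero>\<^bsub>F\<^esub>)"
  have zeroF: "\<zero>\<^bsub>F\<^esub> = (\<lambda>_. 0)" by (simp add: F coeff_algebra_def)
  have fF: "f \<in> carrier F"
    using mono[of m0] v by (auto simp: F coeff_algebra_def f_def m0_def multi_index_def)
  have lp0: "log_partial v F s \<zero>\<^bsub>F\<^esub> = \<zero>\<^bsub>F\<^esub>" for s
    by (auto simp: log_partial_def F coeff_algebra_def fun_eq_iff)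
  have lpf: "log_partial v F s f = \<zero>\<^bsub>F\<^esub>" for s
  proof (cases "s = 1")
    case False
    have "(m(s := Suc (m s))) s \<noteq> m0 s" for m
      using False by (simp add: m0_def)
    then have "f (m(s := Suc (m s))) = 0" for m
      unfolding f_def by metis
    then show ?thesis
      by (simp add: log_partial_def F coeff_algebra_def fun_eq_iff)
  next
    case True
    have "of_nat (divided_power_weight u a (m - a)) * (if a = (\<lambda>_. 0)(1 := 1) then 1 else 0) *
        f ((m - a)(1 := Suc ((m - a) 1))) = 0" if "a \<le> m" for a m
    proof (cases "a = (\<lambda>_. 0)(1 := 1) \<and> (m - a)(1 := Suc ((m - a) 1)) = m0")
      case True
      then have a: "a = (\<lambda>_. 0)(1 := 1)" and e: "(m - a)(1 := Suc ((m - a) 1)) = m0" by auto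
      have m1: "a 1 + (m - a) 1 = p" "a 1 = 1"
        using a fun_cong[OF e, of 1] by (auto simp: m0_def)
      have "(a 1 + (m - a) 1) choose a 1 = p choose 1" by (metis m1)
      then have "p dvd ((a 1 + (m - a) 1) choose a 1)" by (metis choose_one dvd_refl)
      also have "\<dots> dvd divided_power_weight u a (m - a)"
        unfolding divided_power_weight_def using v by (intro dvd_prodI) auto
      finally have "(of_nat (divided_power_weight u a (m - a)) :: 'p) = 0"
        by (simp add: of_nat_eq_0_iff_char_dvd p_def)
      then show ?thesis by simp
    qed (auto simp: f_def)
    then show ?thesis
      using True v unfolding log_partial_def F coeff_algebra_def by (simp add: sum.neutral)
  qed
  have "de_rham u v F \<omega> = (\<lambda>_. \<zero>\<^bsub>F\<^esub>)"
  proof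
    fix K
    have "log_partial v F s (\<omega> (K - {s})) = \<zero>\<^bsub>F\<^esub>" for s
      by (simp add: \<omega>_def lpf lp0)
    moreover have "\<ominus>\<^bsub>F\<^esub> \<zero>\<^bsub>F\<^esub> = \<zero>\<^bsub>F\<^esub>"
      by (metis F.a_inv_closed F.l_zero F.r_neg F.zero_closed)
    then have "signed F n \<zero>\<^bsub>F\<^esub> = \<zero>\<^bsub>F\<^esub>" for n
      by (simp add: signed_def)
    ultimately show "de_rham u v F \<omega> K = \<zero>\<^bsub>F\<^esub>"
      by (simp add: de_rham_def)
  qed
  then have "\<omega> \<in> closed_forms_deg u v F 0"
    using fF by (auto simp: closed_forms_deg_def closed_forms_def log_forms_def \<omega>_def)
  with K obtain c where "\<omega> = c \<odot>\<^bsub>closed_forms u v F\<^esub> \<one>\<^bsub>closed_forms u v F\<^esub>"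
    unfolding koszul_def bij_betw_def by blast
  then have "\<omega> {} m0 = (c \<odot>\<^bsub>closed_forms u v F\<^esub> \<one>\<^bsub>closed_forms u v F\<^esub>) {} m0" by simp
  moreover have "m0 \<noteq> (\<lambda>_. 0)" using p by (auto simp: m0_def fun_eq_iff)
  ultimately show False
    by (simp add: closed_forms_def log_forms_def \<omega>_def f_def F coeff_algebra_def)
qed

corollary dp_log_not_koszul:
  fixes F :: "('p::field_prime_char, (nat \<Rightarrow> nat) \<Rightarrow> 'p) disk_algebra"
  assumes "1 \<le> v" "v \<le> u" "F = dp_polynomial_functions u \<or> F = dp_series_functions u"
  shows "\<not> koszul (closed_forms u v F) (closed_forms_deg u v F)"
proof -
  have "finite {m. f m + g m \<noteq> 0}" if "finite {m. f m \<noteq> 0}" "finite {m. g m \<noteq> 0}"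
    for f g :: "(nat \<Rightarrow> nat) \<Rightarrow> 'p"
    by (rule finite_subset[OF _ finite_UnI[OF that]]) auto
  note fin = this
  from assms(3) show ?thesis
  proof
    assume "F = dp_polynomial_functions u"
    then show ?thesis
      by (intro divided_power_log_not_koszul[OF _ _ _ _ assms(1,2), of finite_support])
        (auto simp: dp_polynomial_functions_def finite_support_def fin)
  next
    assume "F = dp_series_functions u"
    then show ?thesis
      by (intro divided_power_log_not_koszul[OF _ _ _ _ assms(1,2), of UNIV])
        (auto simp: dp_series_functions_def)
  qed
qed

end

theory Submission
  imports Defs "HOL-Library.Function_Algebras" "HOL-Complex_Analysis.Cauchy_Integral_Formula"
begin

text \<open>
  Let \<open>A\<close> be the exterior algebra on \<open>\<eta>\<^sub>1, \<dots>, \<eta>\<^sub>u\<close>, let \<open>B\<close> be the exact forms and \<open>H\<close> the cohomology of \<open>\<Omega>\<close>.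
  One-variable antiderivatives give a logarithmic Poincare lemma: \<open>H\<close> is the exterior algebra on
  \<open>\<eta>\<^sub>1, \<dots>, \<eta>\<^sub>v\<close>, while \<open>\<Omega>\<close> is free over \<open>A\<close>. So the sequences \<open>0 \<rightarrow> Z \<rightarrow> \<Omega> \<rightarrow> B \<rightarrow> 0\<close> and
  \<open>0 \<rightarrow> B \<rightarrow> Z \<rightarrow> H \<rightarrow> 0\<close> show, by induction on \<open>q\<close>, that \<open>Tor\<^sub>q(k, Z)\<close> over \<open>A\<close> vanishes in internal degrees
  above \<open>q + 1\<close>. A bound of this kind is inherited by successive syzygies over \<open>Z\<close>, which are therefore
  generated in degree one, and \<open>k\<close> has a linear free resolution over \<open>Z\<close>. Every other graded free
  resolution is homotopy equivalent to it, so its Tor is diagonal.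

  The antiderivatives are taken termwise on series and by \<open>f \<mapsto> z\<^sub>t \<integral>\<^sub>0\<^sup>1 f(\<dots>, x z\<^sub>t, \<dots>) dx\<close> on functions. The
  complex and the real case are treated together, as functions all of whose iterated partial
  derivatives over the base field exist and are continuous; for \<open>k = \<complex>\<close> these are the holomorphic
  functions by the Cauchy formula.
\<close>

section \<open>The logarithmic Poincare lemma\<close>

text \<open>The obstacle is that \<open>Z\<close> has no manageable presentation, so its syzygies
  over itself cannot be attacked directly, while its \<open>Tor\<close> over the small subalgebra
  \<open>A\<close> can. That \<open>Tor\<close> is the homology of the Koszul complex: finitely
  supported families \<open>x\<close> in the module, indexed by multi-indices \<open>a\<close>, with
  differential \<open>a \<mapsto> \<Sum>s. \<eta> s x (a + e_s)\<close> and homological degree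
  \<open>\<Sum>s. a s\<close>. This has the form of the de Rham differential of divided power
  polynomials, so one contraction argument, over abstract operators \<open>\<delta>\<close> and
  \<open>J\<close>, gives both the Poincare lemma and the acyclicity of the Koszul complex of a free
  module. The bound \<open>q + 1\<close> reproduces itself: at \<open>q = 0\<close> it says that
  degree one generates, and passing from the kernel of a free cover back to the module raises
  \<open>q\<close> and the internal degree by one each. Since \<open>Tor\<close> is defined by a
  resolution picked by choice, whose bases consist of words over the algebra, a comparison theorem
  and an encoding of bases by words are needed as well.\<close>

lemma sum_fun_apply: "(\<Sum>a\<in>S. g a) x = (\<Sum>a\<in>S. g a x)"
  for g :: "'i \<Rightarrow> 'b \<Rightarrow> 'a::comm_monoid_add"
  by (induction S rule: infinite_finite_induct) auto

section \<open>Signs, exterior multiplication and contraction on coefficient functions\<close>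

definition alt :: "nat \<Rightarrow> 'a::ab_group_add \<Rightarrow> 'a" where
  "alt n x = (if even n then x else - x)"

lemma alt_0 [simp]: "alt n 0 = 0"
  and alt_add: "alt n (x + y) = alt n x + alt n y"
  and alt_uminus: "alt n (- x) = - alt n x"
  and alt_diff: "alt n (x - y) = alt n x - alt n y"
  and alt_alt [simp]: "alt n (alt n x) = x"
  and alt_plus: "alt (m + n) x = alt m (alt n x)"
  by (auto simp: alt_def)

lemma alt_sum: "alt n (sum f S) = (\<Sum>i\<in>S. alt n (f i))"
  by (simp add: alt_def sum_negf)

definition before :: "nat \<Rightarrow> nat set \<Rightarrow> nat" where
  "before s K = card {i \<in> K. i < s}"

lemma before_insert:
  "before t (insert s K) = (if s < t \<and> s \<notin> K then Suc (before t K) else before t K)"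
proof (cases "s < t \<and> s \<notin> K")
  case True
  then have "{i \<in> insert s K. i < t} = insert s {i \<in> K. i < t}" by auto
  then show ?thesis using True by (simp add: before_def)
next
  case False
  then have "{i \<in> insert s K. i < t} = {i \<in> K. i < t}" by auto
  then show ?thesis using False by (simp add: before_def)
qed

text \<open>Exterior multiplication by the \<open>s\<close>-th basis one-form, and contraction with its dual vector.\<close>

definition ext :: "nat \<Rightarrow> (nat set \<Rightarrow> 'a::ab_group_add) \<Rightarrow> nat set \<Rightarrow> 'a" where
  "ext s \<omega> K = (if s \<in> K then alt (before s K) (\<omega> (K - {s})) else 0)"

definition con :: "nat \<Rightarrow> (nat set \<Rightarrow> 'a::ab_group_add) \<Rightarrow> nat set \<Rightarrow> 'a" where
  "con s \<omega> K = (if s \<in> K then 0 else alt (before s K) (\<omega> (insert s K)))"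

lemma ext_add: "ext s (\<alpha> + \<beta>) = ext s \<alpha> + ext s \<beta>"
  and ext_diff: "ext s (\<alpha> - \<beta>) = ext s \<alpha> - ext s \<beta>"
  and ext_0 [simp]: "ext s 0 = 0"
  and con_add: "con s (\<alpha> + \<beta>) = con s \<alpha> + con s \<beta>"
  and con_0 [simp]: "con s 0 = 0"
  by (auto simp: ext_def con_def fun_eq_iff alt_add alt_diff alt_uminus)

lemma ext_sum: "ext s (sum f S) = (\<Sum>i\<in>S. ext s (f i))"
  by (induction S rule: infinite_finite_induct) (auto simp: ext_add simp del: plus_fun_apply zero_fun_apply)

lemma con_sum: "con s (sum f S) = (\<Sum>i\<in>S. con s (f i))"
  by (induction S rule: infinite_finite_induct) (auto simp: con_add simp del: plus_fun_apply zero_fun_apply)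

lemma ext_ext_same [simp]: "ext s (ext s \<omega>) = 0"
  by (auto simp: ext_def fun_eq_iff)

text \<open>Removing the smaller of \<open>s\<close> and \<open>t\<close> lowers the position of the
  larger one by one, while removing the larger leaves the position of the smaller unchanged; the two
  orders of removal therefore differ by exactly one sign.\<close>

lemma ext_ext:
  assumes "s \<noteq> t" shows "ext s (ext t \<omega>) = - ext t (ext s \<omega>)"
proof
  fix K
  show "ext s (ext t \<omega>) K = (- ext t (ext s \<omega>)) K"
  proof (cases "s \<in> K \<and> t \<in> K")
    case True
    define L where "L = K - {s, t}"
    have K: "K = insert s (insert t L)" "s \<notin> L" "t \<notin> L" using True by (auto simp: L_def)
    have "K - {s} = insert t L" "K - {t} = insert s L" "K - {s} - {t} = L" "K - {t} - {s} = L"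
      using K assms by auto
    then show ?thesis
      using True assms K(2,3) unfolding ext_def by (simp add: K(1) before_insert) (auto simp: alt_def)
  qed (use assms in \<open>auto simp: ext_def\<close>)
qed

text \<open>The sign count is that of \<open>ext_ext\<close>, with \<open>t\<close> inserted instead
  of removed. The case \<open>s = t\<close> is kept as two complementary projections,
  \<open>con_ext_same\<close> and \<open>ext_con_same\<close>, because the homotopy applies
  different coefficient operators in the two.\<close>

lemma con_ext:
  assumes "s \<noteq> t" shows "con t (ext s \<omega>) = - ext s (con t \<omega>)"
proof
  fix K
  show "con t (ext s \<omega>) K = (- ext s (con t \<omega>)) K"
  proof (cases "s \<in> K \<and> t \<notin> K")
    case True
    define L where "L = K - {s}"
    have K: "K = insert s L" "s \<notin> L" "t \<notin> L" using True by (auto simp: L_def)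
    have "insert t K - {s} = insert t L" "K - {s} = L" using K assms by auto
    then show ?thesis
      using True assms K(2,3) unfolding ext_def con_def by (simp add: K(1) before_insert) (auto simp: alt_def)
  qed (use assms in \<open>auto simp: ext_def con_def\<close>)
qed

lemma con_ext_same: "con s (ext s \<omega>) K = (if s \<in> K then 0 else \<omega> K)"
  by (auto simp: ext_def con_def before_insert)

lemma ext_con_same: "ext s (con s \<omega>) K = (if s \<in> K then \<omega> K else 0)"
proof (cases "s \<in> K")
  case True
  then have "insert s (K - {s}) = K" by auto
  then have "before s K = before s (K - {s})" by (metis before_insert less_irrefl)
  then show ?thesis using True by (auto simp: ext_def con_def insert_absorb)
qed (simp add: ext_def)

text \<open>Terms off the diagonal cancel in pairs. Vanishing on the diagonal is a separate
  hypothesis since \<open>g s s = - g s s\<close> does not give \<open>g s s = 0\<close> in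
  characteristic two.\<close>

lemma sum_antisymmetric:
  fixes g :: "'i \<Rightarrow> 'i \<Rightarrow> 'a::ab_group_add"
  assumes "finite S" "\<And>s t. s \<in> S \<Longrightarrow> t \<in> S \<Longrightarrow> s \<noteq> t \<Longrightarrow> g s t = - g t s" "\<And>s. s \<in> S \<Longrightarrow> g s s = 0"
  shows "(\<Sum>s\<in>S. \<Sum>t\<in>S. g s t) = 0"
  using assms
proof (induction S rule: finite_induct)
  case (insert x F)
  have "(\<Sum>s\<in>F. g s x) = - (\<Sum>t\<in>F. g x t)"
    unfolding sum_negf[symmetric]
    by (rule sum.cong[OF refl], rule insert.prems(1)) (use insert.hyps in auto)
  moreover have "(\<Sum>s\<in>F. \<Sum>t\<in>F. g s t) = 0"
    by (rule insert.IH) (rule insert.prems; (rule insertI2)?; assumption)+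
  ultimately show ?case using insert.hyps insert.prems(2)[of x] by (simp add: sum.distrib)
qed simp

text \<open>The algebra behind integration in one variable. For \<open>s \<le> v\<close>,
  \<open>\<delta> s\<close> stands for \<open>z_s d/dz_s\<close> and \<open>J s\<close> for its
  inverse on functions vanishing at \<open>z_s = 0\<close>, so the two composites agree; for
  \<open>s > v\<close>, \<open>\<delta> s\<close> is \<open>d/dz_s\<close> and \<open>J s\<close>
  the antiderivative vanishing at \<open>z_s = 0\<close>, only a right inverse. Coefficients form a
  bare abelian group so that the Koszul complex is an instance too.\<close>

locale de_rham_operators =
  fixes n v :: nat and X :: "'x::ab_group_add set" and \<delta> J :: "nat \<Rightarrow> 'x \<Rightarrow> 'x"
  assumes X_0: "0 \<in> X" and X_add: "x \<in> X \<Longrightarrow> y \<in> X \<Longrightarrow> x + y \<in> X" and X_uminus: "x \<in> X \<Longrightarrow> - x \<in> X"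
    and \<delta>_closed: "s \<in> {1..n} \<Longrightarrow> x \<in> X \<Longrightarrow> \<delta> s x \<in> X"
    and J_closed: "s \<in> {1..n} \<Longrightarrow> x \<in> X \<Longrightarrow> J s x \<in> X"
    and \<delta>_add: "s \<in> {1..n} \<Longrightarrow> x \<in> X \<Longrightarrow> y \<in> X \<Longrightarrow> \<delta> s (x + y) = \<delta> s x + \<delta> s y"
    and J_add: "s \<in> {1..n} \<Longrightarrow> x \<in> X \<Longrightarrow> y \<in> X \<Longrightarrow> J s (x + y) = J s x + J s y"
    and \<delta>_commute: "s \<in> {1..n} \<Longrightarrow> t \<in> {1..n} \<Longrightarrow> x \<in> X \<Longrightarrow> \<delta> s (\<delta> t x) = \<delta> t (\<delta> s x)"
    and \<delta>_J_commute: "s \<in> {1..n} \<Longrightarrow> t \<in> {1..n} \<Longrightarrow> s \<noteq> t \<Longrightarrow> x \<in> X \<Longrightarrow> \<delta> s (J t x) = J t (\<delta> s x)"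
    and \<delta>_J_log: "s \<in> {1..n} \<Longrightarrow> s \<le> v \<Longrightarrow> x \<in> X \<Longrightarrow> \<delta> s (J s x) = J s (\<delta> s x)"
    and \<delta>_J: "s \<in> {1..n} \<Longrightarrow> v < s \<Longrightarrow> x \<in> X \<Longrightarrow> \<delta> s (J s x) = x"
begin

definition forms :: "(nat set \<Rightarrow> 'x) set" where
  "forms = {\<omega>. (\<forall>I. \<omega> I \<in> X) \<and> (\<forall>I. \<not> I \<subseteq> {1..n} \<longrightarrow> \<omega> I = 0)}"

text \<open>Writing the differential through \<open>ext\<close> reduces its square and its
  homotopies to the relations among \<open>ext\<close>, \<open>con\<close>, \<open>\<delta>\<close>
  and \<open>J\<close>; no sign is computed again.\<close>

definition diffl :: "(nat set \<Rightarrow> 'x) \<Rightarrow> nat set \<Rightarrow> 'x" where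
  "diffl \<omega> = (\<Sum>s\<in>{1..n}. ext s (\<lambda>I. \<delta> s (\<omega> I)))"

text \<open>Restriction to \<open>z\<^sub>t = 0\<close>.\<close>

definition eps :: "nat \<Rightarrow> 'x \<Rightarrow> 'x" where
  "eps t x = x - J t (\<delta> t x)"

primrec eps_upto :: "nat \<Rightarrow> 'x \<Rightarrow> 'x" where
  "eps_upto 0 x = x"
| "eps_upto (Suc k) x = eps (Suc k) (eps_upto k x)"

lemma X_diff: "x \<in> X \<Longrightarrow> y \<in> X \<Longrightarrow> x - y \<in> X"
  using X_add[of x "- y"] X_uminus by simp

lemma X_alt: "x \<in> X \<Longrightarrow> alt m x \<in> X"
  by (auto simp: alt_def X_uminus)

lemma \<delta>_0 [simp]: "s \<in> {1..n} \<Longrightarrow> \<delta> s 0 = 0"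
  using \<delta>_add[of s 0 0] X_0 by simp

lemma J_0 [simp]: "s \<in> {1..n} \<Longrightarrow> J s 0 = 0"
  using J_add[of s 0 0] X_0 by simp

lemma \<delta>_uminus: "s \<in> {1..n} \<Longrightarrow> x \<in> X \<Longrightarrow> \<delta> s (- x) = - \<delta> s x"
  using \<delta>_add[of s x "- x"] X_uminus[of x] \<delta>_0[of s] by (simp add: eq_neg_iff_add_eq_0 add.commute)

lemma J_uminus: "s \<in> {1..n} \<Longrightarrow> x \<in> X \<Longrightarrow> J s (- x) = - J s x"
  using J_add[of s x "- x"] X_uminus[of x] J_0[of s] by (simp add: eq_neg_iff_add_eq_0 add.commute)

lemma \<delta>_alt: "s \<in> {1..n} \<Longrightarrow> x \<in> X \<Longrightarrow> \<delta> s (alt m x) = alt m (\<delta> s x)"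
  and J_alt: "s \<in> {1..n} \<Longrightarrow> x \<in> X \<Longrightarrow> J s (alt m x) = alt m (J s x)"
  by (auto simp: alt_def \<delta>_uminus J_uminus)

lemma formsD: "\<omega> \<in> forms \<Longrightarrow> \<omega> I \<in> X" "\<omega> \<in> forms \<Longrightarrow> \<not> I \<subseteq> {1..n} \<Longrightarrow> \<omega> I = 0"
  by (auto simp: forms_def)

lemma forms_0: "0 \<in> forms"
  and forms_add: "\<alpha> \<in> forms \<Longrightarrow> \<beta> \<in> forms \<Longrightarrow> \<alpha> + \<beta> \<in> forms"
  and forms_diff: "\<alpha> \<in> forms \<Longrightarrow> \<beta> \<in> forms \<Longrightarrow> \<alpha> - \<beta> \<in> forms"
  by (auto simp: forms_def X_0 X_add X_diff X_uminus)

lemma forms_sum: "(\<And>i. i \<in> S \<Longrightarrow> f i \<in> forms) \<Longrightarrow> sum f S \<in> forms"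
  by (induction S rule: infinite_finite_induct) (simp_all only: sum.infinite sum.empty sum.insert forms_0 forms_add insertI1 insertI2 not_False_eq_True simp_thms)

lemma forms_\<delta>: "s \<in> {1..n} \<Longrightarrow> \<omega> \<in> forms \<Longrightarrow> (\<lambda>I. \<delta> s (\<omega> I)) \<in> forms"
  and forms_J: "s \<in> {1..n} \<Longrightarrow> \<omega> \<in> forms \<Longrightarrow> (\<lambda>I. J s (\<omega> I)) \<in> forms"
  by (auto simp: forms_def \<delta>_closed J_closed)

lemma forms_ext: "s \<in> {1..n} \<Longrightarrow> \<omega> \<in> forms \<Longrightarrow> ext s \<omega> \<in> forms"
proof -
  assume s: "s \<in> {1..n}" and \<omega>: "\<omega> \<in> forms"
  have "ext s \<omega> I = 0" if "\<not> I \<subseteq> {1..n}" for I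
  proof -
    have "\<not> I - {s} \<subseteq> {1..n}" using that s by blast
    then show ?thesis using formsD(2)[OF \<omega>] by (simp add: ext_def)
  qed
  then show ?thesis using formsD(1)[OF \<omega>] by (auto simp: forms_def ext_def X_alt X_0)
qed

lemma forms_con: "s \<in> {1..n} \<Longrightarrow> \<omega> \<in> forms \<Longrightarrow> con s \<omega> \<in> forms"
  by (auto simp: forms_def con_def X_alt X_0)

lemma diffl_closed: "\<omega> \<in> forms \<Longrightarrow> diffl \<omega> \<in> forms"
  unfolding diffl_def by (intro forms_sum forms_ext forms_\<delta>)

lemma \<delta>_ext: "t \<in> {1..n} \<Longrightarrow> \<omega> \<in> forms \<Longrightarrow> (\<lambda>I. \<delta> t (ext s \<omega> I)) = ext s (\<lambda>I. \<delta> t (\<omega> I))"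
  and \<delta>_con: "t \<in> {1..n} \<Longrightarrow> \<omega> \<in> forms \<Longrightarrow> (\<lambda>I. \<delta> t (con s \<omega> I)) = con s (\<lambda>I. \<delta> t (\<omega> I))"
  and J_ext: "t \<in> {1..n} \<Longrightarrow> \<omega> \<in> forms \<Longrightarrow> (\<lambda>I. J t (ext s \<omega> I)) = ext s (\<lambda>I. J t (\<omega> I))"
  by (auto simp: fun_eq_iff ext_def con_def \<delta>_alt J_alt formsD)

text \<open>\<open>\<delta>\<close> and \<open>J\<close> are additive on \<open>X\<close> only, so
  pushing them through a sum needs membership of every partial sum.\<close>

lemma additive_sum_forms:
  assumes "\<And>x y. x \<in> X \<Longrightarrow> y \<in> X \<Longrightarrow> f (x + y) = (f x + f y :: 'x)" "\<And>i. i \<in> S \<Longrightarrow> \<omega> i \<in> forms"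
  shows "(\<lambda>I. f (sum \<omega> S I)) = (\<Sum>i\<in>S. (\<lambda>I. f (\<omega> i I)))"
proof -
  have f0: "f 0 = 0" using assms(1)[of 0 0] X_0 by (metis add.right_neutral add_left_cancel)
  show ?thesis using assms(2)
  proof (induction S rule: infinite_finite_induct)
    case (insert x F)
    have "\<omega> x I \<in> X" "sum \<omega> F I \<in> X" for I
      using insert.prems forms_sum[of F \<omega>] formsD by auto
    then have "(\<lambda>I. f ((\<omega> x + sum \<omega> F) I)) = (\<lambda>I. f (\<omega> x I)) + (\<lambda>I. f (sum \<omega> F I))"
      by (auto simp: fun_eq_iff assms(1))
    then show ?case using insert by (simp only: sum.insert insertI2 not_False_eq_True)
  qed (auto simp: f0 fun_eq_iff)
qed

text \<open>The double sum is antisymmetric: \<open>ext s\<close> and \<open>ext t\<close>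
  anticommute while \<open>\<delta> s\<close> and \<open>\<delta> t\<close> commute.\<close>

lemma diffl_diffl: assumes \<omega>: "\<omega> \<in> forms" shows "diffl (diffl \<omega>) = 0"
proof -
  have "diffl (diffl \<omega>) = (\<Sum>s\<in>{1..n}. ext s (\<Sum>t\<in>{1..n}. ext t (\<lambda>I. \<delta> s (\<delta> t (\<omega> I)))))"
    unfolding diffl_def
  proof (rule sum.cong[OF refl])
    fix s assume s: "s \<in> {1..n}"
    have "(\<lambda>I. \<delta> s ((\<Sum>t\<in>{1..n}. ext t (\<lambda>I. \<delta> t (\<omega> I))) I)) = (\<Sum>t\<in>{1..n}. (\<lambda>I. \<delta> s (ext t (\<lambda>I. \<delta> t (\<omega> I)) I)))"
      by (rule additive_sum_forms) (use \<delta>_add[OF s] \<omega> in \<open>auto intro!: forms_ext forms_\<delta>\<close>)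
    also have "\<dots> = (\<Sum>t\<in>{1..n}. ext t (\<lambda>I. \<delta> s (\<delta> t (\<omega> I))))"
      by (rule sum.cong[OF refl]) (rule \<delta>_ext[OF s forms_\<delta>[OF _ \<omega>]])
    finally show "ext s (\<lambda>I. \<delta> s ((\<Sum>t\<in>{1..n}. ext t (\<lambda>I. \<delta> t (\<omega> I))) I)) = ext s (\<Sum>t\<in>{1..n}. ext t (\<lambda>I. \<delta> s (\<delta> t (\<omega> I))))"
      by simp
  qed
  also have "\<dots> = 0"
    unfolding ext_sum
  proof (rule sum_antisymmetric)
    fix s t assume st: "s \<in> {1..n}" "t \<in> {1..n}" "s \<noteq> t"
    have "(\<lambda>I. \<delta> s (\<delta> t (\<omega> I))) = (\<lambda>I. \<delta> t (\<delta> s (\<omega> I)))"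
      using \<delta>_commute[OF st(1,2)] formsD[OF \<omega>] by auto
    then show "ext s (ext t (\<lambda>I. \<delta> s (\<delta> t (\<omega> I)))) = - ext t (ext s (\<lambda>I. \<delta> t (\<delta> s (\<omega> I))))"
      by (simp only: ext_ext[OF st(3)])
  qed auto
  finally show ?thesis .
qed

lemma diffl_add: assumes "\<alpha> \<in> forms" "\<beta> \<in> forms" shows "diffl (\<alpha> + \<beta>) = diffl \<alpha> + diffl \<beta>"
  unfolding diffl_def sum.distrib[symmetric]
proof (rule sum.cong[OF refl])
  fix s assume s: "s \<in> {1..n}"
  have "(\<lambda>I. \<delta> s ((\<alpha> + \<beta>) I)) = (\<lambda>I. \<delta> s (\<alpha> I)) + (\<lambda>I. \<delta> s (\<beta> I))"
    using assms s by (auto simp: fun_eq_iff \<delta>_add formsD)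
  then show "ext s (\<lambda>I. \<delta> s ((\<alpha> + \<beta>) I)) = ext s (\<lambda>I. \<delta> s (\<alpha> I)) + ext s (\<lambda>I. \<delta> s (\<beta> I))"
    by (simp only: ext_add)
qed

lemma diffl_0 [simp]: "diffl 0 = 0"
  using diffl_add[OF forms_0 forms_0] by (metis add.right_neutral add_left_cancel)

lemma diffl_diff: assumes "\<alpha> \<in> forms" "\<beta> \<in> forms" shows "diffl (\<alpha> - \<beta>) = diffl \<alpha> - diffl \<beta>"
  using diffl_add[of "\<alpha> - \<beta>" \<beta>] assms forms_diff by (simp add: algebra_simps)

text \<open>The diagonal term of \<open>homotopy\<close>. At \<open>K\<close> containing
  \<open>s\<close> only the first summand survives and is
  \<open>\<delta> s (J s (\<omega> K))\<close>: all of \<open>\<omega> K\<close> for an ordinary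
  direction, \<open>\<omega> K\<close> minus its restriction for a logarithmic one. At the other
  \<open>K\<close> only the second survives, and \<open>J s (\<delta> s (\<omega> K))\<close> is
  again \<open>\<omega> K\<close> minus its restriction.\<close>

lemma ext_con_forms:
  assumes "s \<in> {1..n}" "\<omega> \<in> forms"
  shows "ext s (con s (\<lambda>I. \<delta> s (J s (\<omega> I)))) + con s (ext s (\<lambda>I. J s (\<delta> s (\<omega> I)))) =
    \<omega> - (\<lambda>K. if s \<in> K \<and> v < s then 0 else eps s (\<omega> K))"
proof
  fix K
  show "(ext s (con s (\<lambda>I. \<delta> s (J s (\<omega> I)))) + con s (ext s (\<lambda>I. J s (\<delta> s (\<omega> I))))) K =
    (\<omega> - (\<lambda>K. if s \<in> K \<and> v < s then 0 else eps s (\<omega> K))) K"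
    using \<delta>_J_log[OF assms(1) _ formsD(1)[OF assms(2)]] \<delta>_J[OF assms(1) _ formsD(1)[OF assms(2)]]
    by (cases "v < s") (auto simp: eps_def con_ext_same ext_con_same)
qed

text \<open>Cartan's formula for contraction with the \<open>t\<close>-th vector followed by
  \<open>J t\<close>. Directions \<open>s \<noteq> t\<close> cancel by anticommutation of
  \<open>con t\<close> with \<open>ext s\<close>; what the diagonal direction leaves is restriction
  to \<open>z_t = 0\<close>, which kills \<open>dz_t\<close> for \<open>t > v\<close> but retains
  \<open>dz_t/z_t\<close> for \<open>t \<le> v\<close>.\<close>

lemma homotopy:
  assumes t: "t \<in> {1..n}" and \<omega>: "\<omega> \<in> forms"
  shows "diffl (con t (\<lambda>I. J t (\<omega> I))) + con t (\<lambda>I. J t (diffl \<omega> I)) =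
    \<omega> - (\<lambda>K. if t \<in> K \<and> v < t then 0 else eps t (\<omega> K))"
proof -
  have 1: "diffl (con t (\<lambda>I. J t (\<omega> I))) = (\<Sum>s\<in>{1..n}. ext s (con t (\<lambda>I. \<delta> s (J t (\<omega> I)))))"
    unfolding diffl_def by (rule sum.cong[OF refl]) (simp only: \<delta>_con forms_J[OF t \<omega>])
  have "(\<lambda>I. J t (diffl \<omega> I)) = (\<Sum>s\<in>{1..n}. (\<lambda>I. J t (ext s (\<lambda>I. \<delta> s (\<omega> I)) I)))"
    unfolding diffl_def
    by (rule additive_sum_forms) (use J_add[OF t] \<omega> in \<open>auto intro!: forms_ext forms_\<delta>\<close>)
  also have "\<dots> = (\<Sum>s\<in>{1..n}. ext s (\<lambda>I. J t (\<delta> s (\<omega> I))))"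
    by (rule sum.cong[OF refl]) (rule J_ext[OF t forms_\<delta>[OF _ \<omega>]])
  finally have 2: "con t (\<lambda>I. J t (diffl \<omega> I)) = (\<Sum>s\<in>{1..n}. con t (ext s (\<lambda>I. J t (\<delta> s (\<omega> I)))))"
    by (simp only: con_sum)
  have "diffl (con t (\<lambda>I. J t (\<omega> I))) + con t (\<lambda>I. J t (diffl \<omega> I)) =
      (\<Sum>s\<in>{1..n}. ext s (con t (\<lambda>I. \<delta> s (J t (\<omega> I)))) + con t (ext s (\<lambda>I. J t (\<delta> s (\<omega> I)))))"
    unfolding 1 2 sum.distrib ..
  also have "\<dots> = (\<Sum>s\<in>{1..n}. if s = t then \<omega> - (\<lambda>K. if t \<in> K \<and> v < t then 0 else eps t (\<omega> K)) else 0)"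
  proof (rule sum.cong[OF refl])
    fix s assume s: "s \<in> {1..n}"
    show "ext s (con t (\<lambda>I. \<delta> s (J t (\<omega> I)))) + con t (ext s (\<lambda>I. J t (\<delta> s (\<omega> I)))) =
      (if s = t then \<omega> - (\<lambda>K. if t \<in> K \<and> v < t then 0 else eps t (\<omega> K)) else 0)"
    proof (cases "s = t")
      case True
      show ?thesis using ext_con_forms[OF t \<omega>] unfolding True by (simp only: refl if_True)
    next
      case False
      have "(\<lambda>I. \<delta> s (J t (\<omega> I))) = (\<lambda>I. J t (\<delta> s (\<omega> I)))"
        using \<delta>_J_commute[OF s t False formsD(1)[OF \<omega>]] by auto
      then show ?thesis unfolding con_ext[OF False] if_not_P[OF False] by (simp only: add.right_inverse)
    qed
  qed
  also have "\<dots> = \<omega> - (\<lambda>K. if t \<in> K \<and> v < t then 0 else eps t (\<omega> K))" using t by (simp only: sum.delta finite_atLeastAtMost if_True)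
  finally show ?thesis .
qed

lemma eps_0: "t \<in> {1..n} \<Longrightarrow> eps t 0 = 0"
  by (simp add: eps_def)

text \<open>Infinite sets have \<open>card\<close> 0, so index sets outside \<open>{1..n}\<close>,
  where forms vanish anyway, are split off before elements are counted.\<close>

lemma con_degree:
  assumes "\<omega> \<in> forms" "\<And>I. card I \<noteq> m \<Longrightarrow> \<omega> I = 0" "Suc (card I) \<noteq> m"
  shows "con t \<omega> I = 0"
proof (cases "t \<in> I \<or> \<not> insert t I \<subseteq> {1..n}")
  case True
  then have "t \<in> I \<or> \<omega> (insert t I) = 0" using formsD(2)[OF assms(1), of "insert t I"] by blast
  then show ?thesis by (auto simp: con_def)
next
  case False
  then have "finite I" using finite_subset[of "insert t I" "{1..n}"] by auto
  then have "card (insert t I) \<noteq> m" using False assms(3) by simp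
  then show ?thesis using assms(2) by (simp add: con_def)
qed

lemma ext_degree:
  assumes "\<omega> \<in> forms" "\<And>I. card I \<noteq> m \<Longrightarrow> \<omega> I = 0" "card I \<noteq> Suc m"
  shows "ext t \<omega> I = 0"
proof (cases "t \<in> I \<and> I - {t} \<subseteq> {1..n}")
  case True
  then have "finite (I - {t})" by (meson finite_atLeastAtMost finite_subset)
  then have "card (I - {t}) \<noteq> m"
    using True assms(3) by (metis card.remove finite_Diff2 finite.emptyI finite.insertI)
  then have "\<omega> (I - {t}) = 0" by (rule assms(2))
  then show ?thesis by (simp add: ext_def)
next
  case False
  then show ?thesis using formsD(2)[OF assms(1), of "I - {t}"] by (auto simp: ext_def)
qed

lemma diffl_degree:
  assumes "\<omega> \<in> forms" "\<And>I. card I \<noteq> m \<Longrightarrow> \<omega> I = 0" "card I \<noteq> Suc m"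
  shows "diffl \<omega> I = 0"
proof -
  have "diffl \<omega> I = (\<Sum>s\<in>{1..n}. ext s (\<lambda>I. \<delta> s (\<omega> I)) I)"
    unfolding diffl_def sum_fun_apply ..
  also have "\<dots> = 0"
    by (rule sum.neutral) (use assms in \<open>auto intro!: ext_degree[of _ m] forms_\<delta>\<close>)
  finally show ?thesis .
qed

text \<open>The homotopies for \<open>t = 1, \<dots>, k\<close> are applied one after another; each replaces a closed form by a
  cohomologous one, restricted to \<open>z\<^sub>t = 0\<close>.\<close>

lemma poincare_upto:
  assumes \<omega>: "\<omega> \<in> forms" "diffl \<omega> = 0" and "k \<le> n"
  shows "\<exists>\<psi>\<in>forms. \<omega> - diffl \<psi> = (\<lambda>K. if K \<inter> {1..k} \<subseteq> {..v} then eps_upto k (\<omega> K) else 0) \<and>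
    (\<forall>m. (\<forall>I. card I \<noteq> m \<longrightarrow> \<omega> I = 0) \<longrightarrow> (\<forall>I. Suc (card I) \<noteq> m \<longrightarrow> \<psi> I = 0))"
  using assms(3)
proof (induction k)
  case 0
  have "\<omega> - diffl 0 = (\<lambda>K. if K \<inter> {1..0} \<subseteq> {..v} then eps_upto 0 (\<omega> K) else 0)"
    unfolding diffl_0 by (simp add: fun_eq_iff)
  then show ?case by (intro bexI[OF _ forms_0] conjI allI impI) (assumption, rule zero_fun_apply)
next
  case (Suc k)
  obtain \<psi> where \<psi>: "\<psi> \<in> forms"
    "\<omega> - diffl \<psi> = (\<lambda>K. if K \<inter> {1..k} \<subseteq> {..v} then eps_upto k (\<omega> K) else 0)"
    and deg': "\<forall>m. (\<forall>I. card I \<noteq> m \<longrightarrow> \<omega> I = 0) \<longrightarrow> (\<forall>I. Suc (card I) \<noteq> m \<longrightarrow> \<psi> I = 0)"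
    using Suc.IH[OF Suc_leD[OF Suc.prems]] by (elim bexE conjE) assumption
  have deg: "\<psi> I = 0" if "\<forall>I. card I \<noteq> m \<longrightarrow> \<omega> I = 0" "Suc (card I) \<noteq> m" for m I
    using deg' that by blast
  \<comment> \<open>The next homotopy is applied to the form already reduced, so that its remainder
    composes with the earlier restrictions.\<close>
  define \<omega>' where "\<omega>' = \<omega> - diffl \<psi>"
  have t: "Suc k \<in> {1..n}" using Suc by auto
  have \<omega>': "\<omega>' \<in> forms" "diffl \<omega>' = 0"
    unfolding \<omega>'_def using \<omega> \<psi>(1) by (auto simp: diffl_diff diffl_closed forms_diff diffl_diffl)
  define \<phi> where "\<phi> = con (Suc k) (\<lambda>I. J (Suc k) (\<omega>' I))"
  have \<phi>: "\<phi> \<in> forms" unfolding \<phi>_def by (intro forms_con forms_J t \<omega>')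
  have "con (Suc k) (\<lambda>I. J (Suc k) (diffl \<omega>' I)) = 0"
    unfolding \<omega>'(2) using t by (auto simp: fun_eq_iff con_def)
  then have h: "diffl \<phi> = \<omega>' - (\<lambda>K. if Suc k \<in> K \<and> v < Suc k then 0 else eps (Suc k) (\<omega>' K))"
    using homotopy[OF t \<omega>'(1)] by (simp add: \<phi>_def)
  show ?case
  proof (intro bexI[of _ "\<psi> + \<phi>"] conjI allI impI)
    show "\<psi> + \<phi> \<in> forms" using \<psi> \<phi> forms_add by auto
    have *: "K \<inter> {1..Suc k} \<subseteq> {..v} \<longleftrightarrow> K \<inter> {1..k} \<subseteq> {..v} \<and> (Suc k \<in> K \<longrightarrow> Suc k \<le> v)" for K
      by (fastforce simp: le_Suc_eq subset_iff)
    have "\<omega> - diffl (\<psi> + \<phi>) = (\<lambda>K. if Suc k \<in> K \<and> v < Suc k then 0 else eps (Suc k) (\<omega>' K))"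
      unfolding diffl_add[OF \<psi>(1) \<phi>] h \<omega>'_def by simp
    also have "\<dots> = (\<lambda>K. if K \<inter> {1..Suc k} \<subseteq> {..v} then eps_upto (Suc k) (\<omega> K) else 0)"
      unfolding \<omega>'_def \<psi>(2) * using eps_0[OF t] by (auto simp: fun_eq_iff)
    finally show "\<omega> - diffl (\<psi> + \<phi>) = (\<lambda>K. if K \<inter> {1..Suc k} \<subseteq> {..v} then eps_upto (Suc k) (\<omega> K) else 0)" .
    fix m and I :: "nat set" assume m: "\<forall>I. card I \<noteq> m \<longrightarrow> \<omega> I = 0" "Suc (card I) \<noteq> m"
    have d: "diffl \<psi> I' = 0" if "card I' \<noteq> m" for I'
    proof (cases m)
      case 0
      \<comment> \<open>In degree 0 every index set satisfies
        \<open>Suc (card I) \<noteq> m\<close>: there is no form of degree -1 and the primitive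
        vanishes.\<close>
      then have "\<psi> = 0" using deg[OF m(1)] by (simp add: fun_eq_iff)
      then show ?thesis by simp
    next
      case (Suc m')
      show ?thesis by (rule diffl_degree[OF \<psi>(1), of m']) (use deg[OF m(1)] Suc that in auto)
    qed
    have "\<phi> I = 0"
      unfolding \<phi>_def by (rule con_degree[OF forms_J[OF t \<omega>'(1)] _ m(2)]) (use m(1) d t in \<open>simp add: \<omega>'_def\<close>)
    then show "(\<psi> + \<phi>) I = 0" using deg[OF m] by simp
  qed
qed

lemmas poincare = poincare_upto[OF _ _ order_refl]

end

text \<open>The Koszul complex of the exterior algebra is the de Rham complex of divided power polynomials:
  \<open>\<partial>/\<partial>z\<^sub>s\<close> shifts the multi-index.\<close>

lemma koszul_complex_exact:
  fixes x :: "(nat \<Rightarrow> nat) \<Rightarrow> nat set \<Rightarrow> 'f::ab_group_add"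
  assumes X: "0 \<in> X" "\<And>x y. x \<in> X \<Longrightarrow> y \<in> X \<Longrightarrow> x + y \<in> X" "\<And>x. x \<in> X \<Longrightarrow> - x \<in> X"
    and x: "finite {a. x a \<noteq> 0}" "\<And>a I. x a I \<in> X" "\<And>a I. \<not> I \<subseteq> {1..n} \<Longrightarrow> x a I = 0" "\<And>a I. card I \<noteq> Suc m \<Longrightarrow> x a I = 0"
    and cycle: "\<And>a. (\<Sum>s\<in>{1..n}. ext s (x (a(s := Suc (a s))))) = 0"
  shows "\<exists>y. finite {a. y a \<noteq> 0} \<and> (\<forall>a I. y a I \<in> X) \<and> (\<forall>a I. \<not> I \<subseteq> {1..n} \<longrightarrow> y a I = 0) \<and>
     (\<forall>a I. card I \<noteq> m \<longrightarrow> y a I = 0) \<and> (\<forall>a. x a = (\<Sum>s\<in>{1..n}. ext s (y (a(s := Suc (a s))))))"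
proof -
  define XX where "XX = {f :: (nat \<Rightarrow> nat) \<Rightarrow> 'f. finite {a. f a \<noteq> 0} \<and> (\<forall>a. f a \<in> X)}"
  define \<delta> where "\<delta> s f a = f (a(s := Suc (a s)))" for s :: nat and f :: "(nat \<Rightarrow> nat) \<Rightarrow> 'f" and a
  \<comment> \<open>Integration of divided powers raises the exponent by one; the value 0 at
    \<open>a s = 0\<close> is the choice of the constant of integration.\<close>
  define J where "J s f a = (if a s = 0 then 0 else f (a(s := a s - 1)))" for s :: nat and f :: "(nat \<Rightarrow> nat) \<Rightarrow> 'f" and a
  have fin\<delta>: "finite {a. \<delta> s f a \<noteq> 0}" if "finite {a. f a \<noteq> 0}" for s f
  proof -
    have "{a. \<delta> s f a \<noteq> 0} \<subseteq> (\<lambda>a. a(s := a s - 1)) ` {a. f a \<noteq> 0}"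
    proof
      fix a assume "a \<in> {a. \<delta> s f a \<noteq> 0}"
      then have "a(s := Suc (a s)) \<in> {a. f a \<noteq> 0}" "a = (\<lambda>a. a(s := a s - 1)) (a(s := Suc (a s)))"
        by (auto simp: \<delta>_def)
      then show "a \<in> (\<lambda>a. a(s := a s - 1)) ` {a. f a \<noteq> 0}" by blast
    qed
    then show ?thesis using that finite_surj by blast
  qed
  have finJ: "finite {a. J s f a \<noteq> 0}" if "finite {a. f a \<noteq> 0}" for s f
  proof -
    have "{a. J s f a \<noteq> 0} \<subseteq> (\<lambda>a. a(s := Suc (a s))) ` {a. f a \<noteq> 0}"
    proof
      fix a assume "a \<in> {a. J s f a \<noteq> 0}"
      then have "a(s := a s - 1) \<in> {a. f a \<noteq> 0}" "a = (\<lambda>a. a(s := Suc (a s))) (a(s := a s - 1))"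
        by (auto simp: J_def split: if_splits)
      then show "a \<in> (\<lambda>a. a(s := Suc (a s))) ` {a. f a \<noteq> 0}" by blast
    qed
    then show ?thesis using that finite_surj by blast
  qed
  \<comment> \<open>With threshold 0 no direction is logarithmic, and \<open>J s\<close> need only
    be a right inverse of \<open>\<delta> s\<close>.\<close>
  interpret de_rham_operators n 0 XX \<delta> J
  proof
    show "x + y \<in> XX" if "x \<in> XX" "y \<in> XX" for x y
    proof -
      have "finite {a. x a + y a \<noteq> 0}"
        by (rule finite_subset[of _ "{a. x a \<noteq> 0} \<union> {a. y a \<noteq> 0}"]) (use that in \<open>auto simp: XX_def\<close>)
      then show ?thesis using that X by (auto simp: XX_def)
    qed
    show "\<delta> s x \<in> XX" "J s x \<in> XX" if "x \<in> XX" for s x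
      using that fin\<delta>[of x s] finJ[of x s] X(1) by (auto simp: XX_def) (auto simp: \<delta>_def J_def)
  qed (use X in \<open>auto simp: XX_def \<delta>_def J_def fun_eq_iff fun_upd_twist\<close>)
  \<comment> \<open>A family of forms indexed by \<open>a\<close> becomes a form whose coefficients
    are families.\<close>
  define \<omega> where "\<omega> I a = x a I" for I a
  have ext_app: "ext s \<alpha> I a = ext s (\<lambda>I. \<alpha> I a) I" for s I a and \<alpha> :: "nat set \<Rightarrow> (nat \<Rightarrow> nat) \<Rightarrow> 'f"
    by (auto simp: ext_def alt_def)
  have diffl_app: "diffl \<alpha> I a = (\<Sum>s\<in>{1..n}. ext s (\<lambda>I. \<alpha> I (a(s := Suc (a s))))) I" for \<alpha> I a
  proof -
    show ?thesis unfolding diffl_def sum_fun_apply ext_app \<delta>_def ..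
  qed
  have \<omega>: "\<omega> \<in> forms"
  proof -
    have "finite {a. \<omega> I a \<noteq> 0}" for I
      by (rule finite_subset[OF _ x(1)]) (auto simp: \<omega>_def)
    then have "\<omega> I \<in> XX" for I using x by (auto simp: XX_def \<omega>_def)
    then show ?thesis using x unfolding forms_def by (auto simp: \<omega>_def fun_eq_iff)
  qed
  have "diffl \<omega> = 0" using cycle by (auto simp: fun_eq_iff diffl_app \<omega>_def)
  from poincare[OF \<omega> this] obtain \<psi> where \<psi>: "\<psi> \<in> forms"
    "\<omega> - diffl \<psi> = (\<lambda>K. if K \<inter> {1..n} \<subseteq> {..0} then eps_upto n (\<omega> K) else 0)"
    "\<forall>m. (\<forall>I. card I \<noteq> m \<longrightarrow> \<omega> I = 0) \<longrightarrow> (\<forall>I. Suc (card I) \<noteq> m \<longrightarrow> \<psi> I = 0)" by (elim bexE conjE) assumption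
  have deg\<psi>: "\<psi> I = 0" if "card I \<noteq> m" for I
    using \<psi>(3)[rule_format, of "Suc m" I] that x(4) by (auto simp: \<omega>_def fun_eq_iff)
  have eps0: "eps_upto k 0 = 0" if "k \<le> n" for k
    using that by (induction k) (auto simp: eps_def)
  have "(\<lambda>K. if K \<inter> {1..n} \<subseteq> {..0} then eps_upto n (\<omega> K) else 0) = 0"
  proof
    fix K :: "nat set"
    have "\<omega> K = 0" if "K \<inter> {1..n} \<subseteq> {..0}"
    proof (cases "K \<subseteq> {1..n}")
      case True
      with that have "K = {}" by force
      then show ?thesis using x(4) by (auto simp: \<omega>_def fun_eq_iff)
    qed (use formsD(2)[OF \<omega>] in auto)
    then show "(if K \<inter> {1..n} \<subseteq> {..0} then eps_upto n (\<omega> K) else 0) = 0 K" using eps0[of n] by auto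
  qed
  then have eq: "\<omega> = diffl \<psi>" using \<psi>(2) by simp
  show ?thesis
  proof (intro exI[of _ "\<lambda>a I. \<psi> I a"] conjI allI impI)
    have "{a. (\<lambda>I. \<psi> I a) \<noteq> 0} \<subseteq> (\<Union>I\<in>Pow {1..n}. {a. \<psi> I a \<noteq> 0})"
    proof
      fix a assume "a \<in> {a. (\<lambda>I. \<psi> I a) \<noteq> 0}"
      then obtain I where "\<psi> I a \<noteq> 0" by (auto simp: fun_eq_iff)
      moreover from this have "I \<subseteq> {1..n}" using formsD(2)[OF \<psi>(1)] by (metis zero_fun_apply)
      ultimately show "a \<in> (\<Union>I\<in>Pow {1..n}. {a. \<psi> I a \<noteq> 0})" by blast
    qed
    moreover have "finite {a. \<psi> I a \<noteq> 0}" for I using formsD(1)[OF \<psi>(1), of I] by (auto simp: XX_def)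
    ultimately show "finite {a. (\<lambda>I. \<psi> I a) \<noteq> 0}" by (meson finite_Pow_iff finite_UN_I finite_atLeastAtMost finite_subset)
    show "\<psi> I a \<in> X" for I a using formsD(1)[OF \<psi>(1), of I] by (auto simp: XX_def)
    show "\<psi> I a = 0" if "\<not> I \<subseteq> {1..n}" for I a using formsD(2)[OF \<psi>(1) that] by simp
    show "\<psi> I a = 0" if "card I \<noteq> m" for I a using deg\<psi>[OF that] by simp
    show "x a = (\<Sum>s\<in>{1..n}. ext s (\<lambda>I. \<psi> I (a(s := Suc (a s)))))" for a
      using eq by (auto simp: fun_eq_iff \<omega>_def diffl_app)
  qed
qed

section \<open>Graded algebras and Tor\<close>

text \<open>Forms are added pointwise, so zero and addition of the record are those of the type;
  this trades \<open>finsum\<close> for \<open>sum\<close>. The last assumption is the condition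
  that the degree zero component is \<open>k\<close>.\<close>

locale additive_graded_algebra = graded_algebra A gr
  for A :: "('k::field, 'a::ab_group_add, 'm) module_scheme" (structure) and gr +
  assumes zero_eq: "\<zero> = 0"
    and add_eq: "add A = (+)"
    and vector_space_smult: "vector_space (smult A)"
    and gr_0: "bij_betw (\<lambda>c. c \<odot> \<one>) UNIV (gr 0)"
begin

lemma carrier_0 [simp, intro]: "0 \<in> carrier A"
  using zero_closed by (simp add: zero_eq)

lemma carrier_add [intro]: "x \<in> carrier A \<Longrightarrow> y \<in> carrier A \<Longrightarrow> x + y \<in> carrier A"
  using a_closed[of x y] by (simp add: add_eq)

lemma a_inv_eq: "x \<in> carrier A \<Longrightarrow> \<ominus> x = - x"
  using r_neg[of x] by (simp add: add_eq zero_eq eq_neg_iff_add_eq_0 add.commute)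

lemma carrier_uminus [intro]: "x \<in> carrier A \<Longrightarrow> - x \<in> carrier A"
  using a_inv_closed[of x] by (simp add: a_inv_eq)

lemma carrier_diff [intro]: "x \<in> carrier A \<Longrightarrow> y \<in> carrier A \<Longrightarrow> x - y \<in> carrier A"
  using carrier_add[of x "- y"] by auto

lemma carrier_sum [intro]: "(\<And>i. i \<in> S \<Longrightarrow> f i \<in> carrier A) \<Longrightarrow> sum f S \<in> carrier A"
  by (induction S rule: infinite_finite_induct) auto

lemma distr_r: "x \<in> carrier A \<Longrightarrow> y \<in> carrier A \<Longrightarrow> z \<in> carrier A \<Longrightarrow> x \<otimes> (y + z) = x \<otimes> y + x \<otimes> z"
  using r_distr[of y z x] by (simp add: add_eq)

lemma distr_l: "x \<in> carrier A \<Longrightarrow> y \<in> carrier A \<Longrightarrow> z \<in> carrier A \<Longrightarrow> (x + y) \<otimes> z = x \<otimes> z + y \<otimes> z"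
  using l_distr[of x y z] by (simp add: add_eq)

lemma mult_0_r [simp]: "x \<in> carrier A \<Longrightarrow> x \<otimes> 0 = 0"
  using r_null by (simp add: zero_eq)

lemma mult_0_l [simp]: "x \<in> carrier A \<Longrightarrow> 0 \<otimes> x = 0"
  using l_null by (simp add: zero_eq)

lemma mult_sum_r: "x \<in> carrier A \<Longrightarrow> (\<And>i. i \<in> S \<Longrightarrow> f i \<in> carrier A) \<Longrightarrow> x \<otimes> sum f S = (\<Sum>i\<in>S. x \<otimes> f i)"
  by (induction S rule: infinite_finite_induct) (auto simp: distr_r carrier_sum)

lemma mult_sum_l: "x \<in> carrier A \<Longrightarrow> (\<And>i. i \<in> S \<Longrightarrow> f i \<in> carrier A) \<Longrightarrow> sum f S \<otimes> x = (\<Sum>i\<in>S. f i \<otimes> x)"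
  by (induction S rule: infinite_finite_induct) (auto simp: distr_l carrier_sum)

lemma finsum_eq: "(\<And>i. i \<in> S \<Longrightarrow> f i \<in> carrier A) \<Longrightarrow> finsum A f S = sum f S"
proof (induction S rule: infinite_finite_induct)
  case (insert x S)
  then show ?case by (subst finsum_insert) (auto simp: add_eq)
qed (simp_all add: finsum_infinite zero_eq)

lemma gr_carrier [intro]: "x \<in> gr n \<Longrightarrow> x \<in> carrier A"
  using gr_subgroup[of n] by (auto simp: subgroup_def)

lemma gr_zero [simp, intro]: "0 \<in> gr n"
  using gr_subgroup[of n] by (auto simp: subgroup_def zero_eq)

lemma gr_add [intro]: "x \<in> gr n \<Longrightarrow> y \<in> gr n \<Longrightarrow> x + y \<in> gr n"
  using gr_subgroup[of n] by (auto simp: subgroup_def add_eq)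

lemma gr_uminus [intro]: "x \<in> gr n \<Longrightarrow> - x \<in> gr n"
  using subgroup.m_inv_closed[OF gr_subgroup[of n], of x] a_inv_eq[OF gr_carrier, of x n]
  by (simp add: a_inv_def)

lemma gr_diff [intro]: "x \<in> gr n \<Longrightarrow> y \<in> gr n \<Longrightarrow> x - y \<in> gr n"
  using gr_add[of x n "- y"] by auto

lemma gr_sum [intro]: "(\<And>i. i \<in> S \<Longrightarrow> f i \<in> gr n) \<Longrightarrow> sum f S \<in> gr n"
  by (induction S rule: infinite_finite_induct) auto

abbreviation cmp :: "nat \<Rightarrow> 'a \<Rightarrow> 'a" where
  "cmp \<equiv> gr_component A gr"

lemma decomposition_iff:
  "((\<forall>n. c n \<in> gr n) \<and> finite {n. c n \<noteq> 0} \<and> x = (\<Oplus>n\<in>{n. c n \<noteq> 0}. c n)) \<longleftrightarrow>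
   ((\<forall>n. c n \<in> gr n) \<and> finite {n. c n \<noteq> 0} \<and> x = (\<Sum>n\<in>{n. c n \<noteq> 0}. c n))"
proof (cases "\<forall>n. c n \<in> gr n")
  case True
  then show ?thesis by (subst finsum_eq) auto
qed blast

lemma decomposition_ex1:
  assumes "x \<in> carrier A"
  shows "\<exists>!c. (\<forall>n. c n \<in> gr n) \<and> finite {n. c n \<noteq> 0} \<and> x = (\<Sum>n\<in>{n. c n \<noteq> 0}. c n)"
  using gr_direct_sum[OF assms] unfolding zero_eq decomposition_iff .

lemma cmp_eq:
  assumes "x \<in> carrier A"
  shows "(\<lambda>n. cmp n x) = (THE c. (\<forall>n. c n \<in> gr n) \<and> finite {n. c n \<noteq> 0} \<and> x = (\<Sum>n\<in>{n. c n \<noteq> 0}. c n))"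
  unfolding gr_component_def zero_eq decomposition_iff ..

lemma cmp_props:
  assumes "x \<in> carrier A"
  shows "cmp n x \<in> gr n" "finite {n. cmp n x \<noteq> 0}" "x = (\<Sum>n\<in>{n. cmp n x \<noteq> 0}. cmp n x)"
  using theI'[OF decomposition_ex1[OF assms], folded cmp_eq[OF assms]] by auto

lemma cmp_unique:
  assumes "\<And>n. c n \<in> gr n" "finite S" "\<And>n. n \<notin> S \<Longrightarrow> c n = 0" "x = (\<Sum>n\<in>S. c n)"
  shows "cmp n x = c n"
proof -
  have x: "x \<in> carrier A" using assms(1) by (auto simp: assms(4) intro: gr_carrier)
  have f: "finite {n. c n \<noteq> 0}" using assms(2) by (rule finite_subset[rotated]) (use assms(3) in auto)
  have "x = (\<Sum>n\<in>{n. c n \<noteq> 0}. c n)"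
    unfolding assms(4) by (rule sum.mono_neutral_right) (use assms in auto)
  then have "c = (\<lambda>n. cmp n x)"
    unfolding cmp_eq[OF x] by (intro the1_equality[symmetric] decomposition_ex1 x) (use f assms(1) in auto)
  then show ?thesis by auto
qed

lemma cmp_sum_superset:
  assumes "x \<in> carrier A" "finite S" "{n. cmp n x \<noteq> 0} \<subseteq> S"
  shows "x = (\<Sum>n\<in>S. cmp n x)"
  by (subst cmp_props(3)[OF assms(1)], rule sum.mono_neutral_left) (use assms in auto)

lemma cmp_add:
  assumes "x \<in> carrier A" "y \<in> carrier A"
  shows "cmp n (x + y) = cmp n x + cmp n y"
proof (rule cmp_unique[where S="{n. cmp n x \<noteq> 0} \<union> {n. cmp n y \<noteq> 0}"])
  show "x + y = (\<Sum>n\<in>{n. cmp n x \<noteq> 0} \<union> {n. cmp n y \<noteq> 0}. cmp n x + cmp n y)"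
    by (subst sum.distrib, subst (1 2) cmp_sum_superset[symmetric]) (use assms cmp_props in auto)
qed (use assms cmp_props in auto)

lemma cmp_gr: "x \<in> gr m \<Longrightarrow> cmp n x = (if n = m then x else 0)"
  by (rule cmp_unique[where S="{m}"]) auto

lemma cmp_0 [simp]: "cmp n 0 = 0"
  by (subst cmp_gr[of 0 0]) auto

lemma cmp_sum: "(\<And>i. i \<in> S \<Longrightarrow> f i \<in> carrier A) \<Longrightarrow> cmp n (sum f S) = (\<Sum>i\<in>S. cmp n (f i))"
  by (induction S rule: infinite_finite_induct) (auto simp: cmp_add carrier_sum)

lemma cmp_uminus: "x \<in> carrier A \<Longrightarrow> cmp n (- x) = - cmp n x"
  using cmp_add[of x "- x" n] by (simp add: carrier_uminus eq_neg_iff_add_eq_0 add.commute)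

lemma cmp_diff: "x \<in> carrier A \<Longrightarrow> y \<in> carrier A \<Longrightarrow> cmp n (x - y) = cmp n x - cmp n y"
  using cmp_add[of x "- y" n] cmp_uminus[of y n] carrier_uminus[of y] by simp

lemma cmp_mult_gr:
  assumes "x \<in> carrier A" "y \<in> gr k"
  shows "cmp n (x \<otimes> y) = (if k \<le> n then cmp (n - k) x \<otimes> y else 0)"
proof (rule cmp_unique[where S="(\<lambda>n. n + k) ` {n. cmp n x \<noteq> 0}"])
  have y: "y \<in> carrier A" using assms gr_carrier by auto
  have "x \<otimes> y = (\<Sum>n\<in>{n. cmp n x \<noteq> 0}. cmp n x \<otimes> y)"
    by (subst cmp_props(3)[OF assms(1)], subst mult_sum_l) (use y cmp_props(1)[OF assms(1)] in \<open>auto simp: gr_carrier\<close>)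
  also have "\<dots> = (\<Sum>n\<in>(\<lambda>n. n + k) ` {n. cmp n x \<noteq> 0}. if k \<le> n then cmp (n - k) x \<otimes> y else 0)"
    by (subst sum.reindex) auto
  finally show "x \<otimes> y = (\<Sum>n\<in>(\<lambda>n. n + k) ` {n. cmp n x \<noteq> 0}. if k \<le> n then cmp (n - k) x \<otimes> y else 0)" .
  show "(if k \<le> n then cmp (n - k) x \<otimes> y else 0) \<in> gr n" for n
    using gr_mult[of "cmp (n - k) x" "n - k" y k] assms cmp_props by auto
  show "(if k \<le> n then cmp (n - k) x \<otimes> y else 0) = 0" if "n \<notin> (\<lambda>n. n + k) ` {n. cmp n x \<noteq> 0}" for n
  proof (cases "k \<le> n")
    case True
    then have "n = (n - k) + k" by simp
    with that have "cmp (n - k) x = 0" by blast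
    with y show ?thesis by simp
  qed simp
qed (use cmp_props assms in auto)

text \<open>A component of positive degree in the second factor moves the product out of degree 0.
  Hence the augmentation is multiplicative, which is what lets reduction to \<open>k\<close> act
  entry by entry.\<close>

lemma cmp_0_mult:
  assumes "x \<in> carrier A" "y \<in> carrier A"
  shows "cmp 0 (x \<otimes> y) = cmp 0 x \<otimes> cmp 0 y"
proof -
  define S where "S = insert 0 {n. cmp n y \<noteq> 0}"
  have S: "finite S" "0 \<in> S" using cmp_props assms by (auto simp: S_def)
  have "y = (\<Sum>n\<in>S. cmp n y)" by (rule cmp_sum_superset) (use assms S S_def in auto)
  then have "x \<otimes> y = (\<Sum>n\<in>S. x \<otimes> cmp n y)"
    using mult_sum_r[of x S "\<lambda>n. cmp n y"] assms cmp_props gr_carrier by metis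
  then have "cmp 0 (x \<otimes> y) = (\<Sum>n\<in>S. cmp 0 (x \<otimes> cmp n y))"
    by (simp, intro cmp_sum) (use assms cmp_props in auto)
  also have "\<dots> = (\<Sum>n\<in>S. if n = 0 then cmp 0 x \<otimes> cmp 0 y else 0)"
    by (rule sum.cong) (use assms in \<open>auto simp: cmp_mult_gr[OF assms(1) cmp_props(1)[OF assms(2)], of 0]\<close>)
  also have "\<dots> = cmp 0 x \<otimes> cmp 0 y" using S by simp
  finally show ?thesis .
qed

lemma cmp_carrier [intro]: "x \<in> carrier A \<Longrightarrow> cmp n x \<in> carrier A"
  using cmp_props gr_carrier by blast

text \<open>The part of internal degree \<open>j\<close> of the free module on one generator of degree \<open>d\<close>.\<close>

definition grd :: "nat \<Rightarrow> nat \<Rightarrow> 'a set" where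
  "grd j d = (if d \<le> j then gr (j - d) else {0})"

definition cmpd :: "nat \<Rightarrow> nat \<Rightarrow> 'a \<Rightarrow> 'a" where
  "cmpd j d x = (if d \<le> j then cmp (j - d) x else 0)"

lemma grd_0 [simp, intro]: "0 \<in> grd j d" and
  grd_add [intro]: "x \<in> grd j d \<Longrightarrow> y \<in> grd j d \<Longrightarrow> x + y \<in> grd j d" and
  grd_uminus [intro]: "x \<in> grd j d \<Longrightarrow> - x \<in> grd j d" and
  grd_diff [intro]: "x \<in> grd j d \<Longrightarrow> y \<in> grd j d \<Longrightarrow> x - y \<in> grd j d" and
  grd_carrier: "x \<in> grd j d \<Longrightarrow> x \<in> carrier A"
  by (auto simp: grd_def gr_carrier split: if_splits)

lemma grd_sum [intro]: "(\<And>i. i \<in> S \<Longrightarrow> f i \<in> grd j d) \<Longrightarrow> sum f S \<in> grd j d"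
  by (induction S rule: infinite_finite_induct) auto

lemma grd_mult:
  assumes "x \<in> grd j d" "y \<in> grd d e" shows "x \<otimes> y \<in> grd j e"
proof (cases "d \<le> j \<and> e \<le> d")
  case True
  then have "x \<otimes> y \<in> gr ((j - d) + (d - e))" using assms by (intro gr_mult) (auto simp: grd_def)
  moreover have "(j - d) + (d - e) = j - e" using True by simp
  ultimately show ?thesis using True by (auto simp: grd_def)
next
  case False
  then have "x = 0 \<or> y = 0" using assms by (auto simp: grd_def split: if_splits)
  then have "x \<otimes> y = 0" using assms grd_carrier by auto
  then show ?thesis by simp
qed

lemma cmpd_in: "x \<in> carrier A \<Longrightarrow> cmpd j d x \<in> grd j d"
  using cmp_props by (auto simp: cmpd_def grd_def)

lemma cmpd_0 [simp]: "cmpd j d 0 = 0"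
  by (simp add: cmpd_def)

lemma cmpd_grd: "x \<in> grd j d \<Longrightarrow> cmpd j d x = x"
  by (auto simp: cmpd_def grd_def cmp_gr split: if_splits)

lemma cmpd_sum: "(\<And>i. i \<in> S \<Longrightarrow> f i \<in> carrier A) \<Longrightarrow> cmpd j d (sum f S) = (\<Sum>i\<in>S. cmpd j d (f i))"
  by (auto simp: cmpd_def cmp_sum)

lemma cmpd_mult:
  assumes "x \<in> carrier A" "y \<in> grd d e"
  shows "cmpd j e (x \<otimes> y) = cmpd j d x \<otimes> y"
proof (cases "e \<le> d")
  case True
  then have y: "y \<in> gr (d - e)" using assms by (simp add: grd_def)
  have yc: "y \<in> carrier A" using assms grd_carrier by auto
  show ?thesis using True yc by (auto simp: cmpd_def cmp_mult_gr[OF assms(1) y])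
next
  case False
  then show ?thesis using assms cmpd_in[OF assms(1), of j d] by (auto simp: grd_def grd_carrier cmpd_def cmp_carrier)
qed

section \<open>Free left modules and matrices between them\<close>

lemma free_module_iff:
  "f \<in> free_module A B \<longleftrightarrow> finite {b. f b \<noteq> 0} \<and> (\<forall>b. f b \<in> carrier A) \<and> (\<forall>b. b \<notin> B \<longrightarrow> f b = 0)"
  by (auto simp: free_module_def zero_eq)

lemma free_moduleD: "f \<in> free_module A B \<Longrightarrow> finite {b. f b \<noteq> 0}" "f \<in> free_module A B \<Longrightarrow> f b \<in> carrier A"
  "f \<in> free_module A B \<Longrightarrow> b \<notin> B \<Longrightarrow> f b = 0" "f \<in> free_module A B \<Longrightarrow> f b \<noteq> 0 \<Longrightarrow> b \<in> B"
  by (auto simp: free_module_iff)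

lemma free_module_support: "f \<in> free_module A B \<Longrightarrow> {b. f b \<noteq> 0} \<subseteq> B"
  by (auto simp: free_module_iff)

lemma free_module_0 [simp, intro]: "0 \<in> free_module A B"
  by (auto simp: free_module_iff)

lemma free_module_add [intro]:
  assumes "f \<in> free_module A B" "g \<in> free_module A B" shows "f + g \<in> free_module A B"
proof -
  have "finite {b. f b + g b \<noteq> 0}"
    by (rule finite_subset[of _ "{b. f b \<noteq> 0} \<union> {b. g b \<noteq> 0}"]) (use assms in \<open>auto simp: free_module_iff\<close>)
  then show ?thesis using assms by (auto simp: free_module_iff)
qed

lemma free_module_uminus [intro]: "f \<in> free_module A B \<Longrightarrow> - f \<in> free_module A B"
  by (auto simp: free_module_iff)

lemma free_module_diff [intro]: "f \<in> free_module A B \<Longrightarrow> g \<in> free_module A B \<Longrightarrow> f - g \<in> free_module A B"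
  using free_module_add[of f B "- g"] by auto

lemma free_module_sum [intro]: "(\<And>i. i \<in> S \<Longrightarrow> f i \<in> free_module A B) \<Longrightarrow> sum f S \<in> free_module A B"
  by (induction S rule: infinite_finite_induct) auto

lemma free_module_mult [intro]:
  assumes "x \<in> carrier A" "f \<in> free_module A B" shows "(\<lambda>b. x \<otimes> f b) \<in> free_module A B"
proof -
  have "finite {b. x \<otimes> f b \<noteq> 0}"
    by (rule finite_subset[of _ "{b. f b \<noteq> 0}"]) (use assms in \<open>auto simp: free_module_iff\<close>)
  then show ?thesis using assms by (auto simp: free_module_iff)
qed

definition is_matrix :: "'b set \<Rightarrow> 'c set \<Rightarrow> ('b \<Rightarrow> 'c \<Rightarrow> 'a) \<Rightarrow> bool" where
  "is_matrix B C \<phi> \<longleftrightarrow> (\<forall>b\<in>B. \<phi> b \<in> free_module A C)"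

lemma is_matrixD: "is_matrix B C \<phi> \<Longrightarrow> b \<in> B \<Longrightarrow> \<phi> b \<in> free_module A C"
  "is_matrix B C \<phi> \<Longrightarrow> b \<in> B \<Longrightarrow> \<phi> b c \<in> carrier A"
  by (auto simp: is_matrix_def free_module_iff)

lemma entry_closed: "is_matrix B C \<phi> \<Longrightarrow> f \<in> free_module A B \<Longrightarrow> f b \<noteq> 0 \<Longrightarrow> \<phi> b c \<in> carrier A"
  by (meson free_moduleD(4) is_matrixD(2))

text \<open>Coefficients stand on the left of the matrix entries because the modules are left
  modules. In contrast to \<open>lin_ext\<close>, source and target may be indexed by different
  types; maps between two resolutions and the augmentation need this.\<close>

definition lin :: "('b \<Rightarrow> 'c \<Rightarrow> 'a) \<Rightarrow> ('b \<Rightarrow> 'a) \<Rightarrow> 'c \<Rightarrow> 'a" where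
  "lin \<phi> f = (\<Sum>b\<in>{b. f b \<noteq> 0}. (\<lambda>c. f b \<otimes> \<phi> b c))"

lemma lin_apply: "lin \<phi> f c = (\<Sum>b\<in>{b. f b \<noteq> 0}. f b \<otimes> \<phi> b c)"
  unfolding lin_def sum_fun_apply ..

lemma lin_eq:
  assumes f: "f \<in> free_module A B" and T: "finite T" "{b. f b \<noteq> 0} \<subseteq> T" "T \<subseteq> B"
    and \<phi>: "is_matrix B C \<phi>"
  shows "lin \<phi> f = (\<Sum>b\<in>T. (\<lambda>c. f b \<otimes> \<phi> b c))"
  unfolding lin_def
proof (rule sum.mono_neutral_left)
  show "\<forall>i\<in>T - {b. f b \<noteq> 0}. (\<lambda>c. f i \<otimes> \<phi> i c) = 0"
    using T(3) is_matrixD(2)[OF \<phi>] by (auto simp: fun_eq_iff subset_iff)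
qed (use T in auto)

lemma lin_ext_eq: "f \<in> free_module A B \<Longrightarrow> is_matrix B C \<phi> \<Longrightarrow> lin_ext A \<phi> f = lin \<phi> f"
  by (rule ext, simp add: lin_ext_def zero_eq lin_apply, rule finsum_eq)
    (auto intro: entry_closed free_moduleD(2))

lemma lin_closed:
  assumes "f \<in> free_module A B" "is_matrix B C \<phi>" shows "lin \<phi> f \<in> free_module A C"
  unfolding lin_def using assms
  by (intro free_module_sum free_module_mult) (auto intro: is_matrixD free_moduleD(1,2,4))

lemma lin_add:
  assumes "f \<in> free_module A B" "g \<in> free_module A B" "is_matrix B C \<phi>"
  shows "lin \<phi> (f + g) = lin \<phi> f + lin \<phi> g"
proof -
  define T where "T = {b. f b \<noteq> 0} \<union> {b. g b \<noteq> 0}"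
  have T: "finite T" "T \<subseteq> B" using assms(1,2) by (auto simp: free_module_iff T_def)
  have "lin \<phi> (f + g) = (\<Sum>b\<in>T. (\<lambda>c. (f + g) b \<otimes> \<phi> b c))"
    by (rule lin_eq[OF free_module_add]) (use assms T in \<open>auto simp: T_def\<close>)
  also have "\<dots> = (\<Sum>b\<in>T. (\<lambda>c. f b \<otimes> \<phi> b c) + (\<lambda>c. g b \<otimes> \<phi> b c))"
    by (rule sum.cong) (use T is_matrixD(2)[OF assms(3)] free_moduleD(2)[OF assms(1)] free_moduleD(2)[OF assms(2)] in \<open>auto simp: fun_eq_iff distr_l\<close>)
  also have "\<dots> = lin \<phi> f + lin \<phi> g"
    unfolding sum.distrib by (subst (1 2) lin_eq[OF _ T(1) _ T(2) assms(3)]) (use assms in \<open>auto simp: T_def\<close>)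
  finally show ?thesis .
qed

lemma lin_0 [simp]: "lin \<phi> 0 = 0"
  by (simp add: lin_def)

lemma lin_uminus:
  assumes "f \<in> free_module A B" "is_matrix B C \<phi>" shows "lin \<phi> (- f) = - lin \<phi> f"
  using lin_add[OF assms(1) free_module_uminus[OF assms(1)] assms(2)]
  by (simp add: eq_neg_iff_add_eq_0 add.commute)

lemma lin_diff:
  assumes "f \<in> free_module A B" "g \<in> free_module A B" "is_matrix B C \<phi>"
  shows "lin \<phi> (f - g) = lin \<phi> f - lin \<phi> g"
  using lin_add[OF assms(1) free_module_uminus[OF assms(2)] assms(3)] lin_uminus[OF assms(2,3)] by simp

lemma lin_sum:
  assumes "\<And>i. i \<in> S \<Longrightarrow> f i \<in> free_module A B" "is_matrix B C \<phi>"
  shows "lin \<phi> (sum f S) = (\<Sum>i\<in>S. lin \<phi> (f i))"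
  using assms(1)
proof (induction S rule: infinite_finite_induct)
  case (insert x F)
  then have "lin \<phi> (f x + sum f F) = lin \<phi> (f x) + lin \<phi> (sum f F)"
    by (intro lin_add[OF _ _ assms(2)]) auto
  moreover have "lin \<phi> (sum f F) = (\<Sum>i\<in>F. lin \<phi> (f i))" using insert by blast
  ultimately show ?case unfolding sum.insert[OF insert(1,2)] by argo
qed (simp_all only: sum.infinite sum.empty lin_0 not_False_eq_True)

lemma lin_mult:
  assumes "x \<in> carrier A" "f \<in> free_module A B" "is_matrix B C \<phi>"
  shows "lin \<phi> (\<lambda>b. x \<otimes> f b) = (\<lambda>c. x \<otimes> lin \<phi> f c)"
proof -
  have "lin \<phi> (\<lambda>b. x \<otimes> f b) = (\<Sum>b\<in>{b. f b \<noteq> 0}. (\<lambda>c. (x \<otimes> f b) \<otimes> \<phi> b c))"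
    by (rule lin_eq[OF free_module_mult[OF assms(1,2)] _ _ _ assms(3)])
      (use assms(1) free_moduleD(1)[OF assms(2)] free_module_support[OF assms(2)] in auto)
  also have "\<dots> = (\<lambda>c. x \<otimes> lin \<phi> f c)"
    unfolding fun_eq_iff sum_fun_apply lin_apply
  proof
    fix c
    have "x \<otimes> (\<Sum>b | f b \<noteq> 0. f b \<otimes> \<phi> b c) = (\<Sum>b | f b \<noteq> 0. x \<otimes> (f b \<otimes> \<phi> b c))"
      by (rule mult_sum_r) (use assms entry_closed[OF assms(3,2)] free_moduleD(2)[OF assms(2)] in \<open>auto intro!: m_closed\<close>)
    also have "\<dots> = (\<Sum>b | f b \<noteq> 0. x \<otimes> f b \<otimes> \<phi> b c)"
      by (rule sum.cong) (use assms entry_closed[OF assms(3,2)] free_moduleD(2)[OF assms(2)] in \<open>auto intro!: m_assoc[symmetric]\<close>)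
    finally show "(\<Sum>b | f b \<noteq> 0. x \<otimes> f b \<otimes> \<phi> b c) = x \<otimes> (\<Sum>b | f b \<noteq> 0. f b \<otimes> \<phi> b c)" ..
  qed
  finally show ?thesis .
qed

lemma lin_comp:
  assumes "f \<in> free_module A B" "is_matrix B C \<phi>" "is_matrix C D \<psi>"
  shows "lin \<psi> (lin \<phi> f) = lin (\<lambda>b. lin \<psi> (\<phi> b)) f"
proof -
  have "lin \<psi> (lin \<phi> f) = (\<Sum>b\<in>{b. f b \<noteq> 0}. lin \<psi> (\<lambda>c. f b \<otimes> \<phi> b c))"
    unfolding lin_def[of \<phi>] using assms
    by (intro lin_sum[OF _ assms(3)] free_module_mult) (auto intro: is_matrixD free_moduleD(1,2,4))
  also have "\<dots> = (\<Sum>b\<in>{b. f b \<noteq> 0}. (\<lambda>c. f b \<otimes> lin \<psi> (\<phi> b) c))"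
    by (rule sum.cong[OF refl], rule lin_mult[OF _ _ assms(3)]) (use assms in \<open>auto intro: is_matrixD free_moduleD(1,2,4)\<close>)
  finally show ?thesis unfolding lin_def[of "\<lambda>b. lin \<psi> (\<phi> b)"] .
qed

lemma is_matrix_comp:
  "is_matrix B C \<phi> \<Longrightarrow> is_matrix C D \<psi> \<Longrightarrow> is_matrix B D (\<lambda>b. lin \<psi> (\<phi> b))"
  unfolding is_matrix_def using lin_closed[of _ C D \<psi>] by (auto simp: is_matrix_def)

lemma lin_matrix_add:
  assumes "f \<in> free_module A B" "is_matrix B C \<phi>" "is_matrix B C \<psi>"
  shows "lin (\<lambda>b. \<phi> b + \<psi> b) f = lin \<phi> f + lin \<psi> f"
  unfolding lin_def sum.distrib[symmetric]
  by (rule sum.cong) (use assms entry_closed[OF assms(2,1)] entry_closed[OF assms(3,1)] in \<open>auto simp: fun_eq_iff distr_r free_moduleD(2)\<close>)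

lemma lin_matrix_diff:
  assumes "f \<in> free_module A B" "is_matrix B C \<phi>" "is_matrix B C \<psi>"
  shows "lin (\<lambda>b. \<phi> b - \<psi> b) f = lin \<phi> f - lin \<psi> f"
proof -
  have "is_matrix B C (\<lambda>b. \<phi> b - \<psi> b)" using assms by (auto simp: is_matrix_def)
  from lin_matrix_add[OF assms(1) this assms(3)] show ?thesis by (simp add: algebra_simps)
qed

definition unit_vec :: "'b \<Rightarrow> 'b \<Rightarrow> 'a" where
  "unit_vec b = (\<lambda>c. if c = b then \<one> else 0)"

lemma unit_vec_closed: "b \<in> B \<Longrightarrow> unit_vec b \<in> free_module A B"
  by (auto simp: unit_vec_def free_module_iff intro: finite_subset[of _ "{b}"])

lemma lin_unit_vec: 
  assumes "b \<in> B" "is_matrix B C \<phi>" shows "lin \<phi> (unit_vec b) = \<phi> b"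
proof -
  have "lin \<phi> (unit_vec b) = (\<Sum>b'\<in>{b}. (\<lambda>c. unit_vec b b' \<otimes> \<phi> b' c))"
    by (rule lin_eq[OF unit_vec_closed]) (use assms in \<open>auto simp: unit_vec_def\<close>)
  then show ?thesis using assms by (auto simp: fun_eq_iff unit_vec_def is_matrix_def free_module_iff)
qed

lemma lin_unit_vec_id:
  assumes "f \<in> free_module A B" shows "lin unit_vec f = f"
proof
  fix c
  have "lin unit_vec f c = (\<Sum>b | f b \<noteq> 0. if b = c then f c else 0)"
    unfolding lin_apply by (rule sum.cong) (use assms in \<open>auto simp: unit_vec_def free_module_iff\<close>)
  then show "lin unit_vec f c = f c" using assms by (auto simp: free_module_iff)
qed

section \<open>Homogeneous vectors, graded matrices and reduction modulo positive degrees\<close>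

definition homog :: "('b \<Rightarrow> nat) \<Rightarrow> nat \<Rightarrow> ('b \<Rightarrow> 'a) \<Rightarrow> bool" where
  "homog dg j f \<longleftrightarrow> (\<forall>b. f b \<in> grd j (dg b))"

definition hcomp :: "('b \<Rightarrow> nat) \<Rightarrow> nat \<Rightarrow> ('b \<Rightarrow> 'a) \<Rightarrow> 'b \<Rightarrow> 'a" where
  "hcomp dg j f = (\<lambda>b. cmpd j (dg b) (f b))"

definition graded_matrix :: "'b set \<Rightarrow> ('b \<Rightarrow> nat) \<Rightarrow> 'c set \<Rightarrow> ('c \<Rightarrow> nat) \<Rightarrow> ('b \<Rightarrow> 'c \<Rightarrow> 'a) \<Rightarrow> bool" where
  "graded_matrix B dB C dC \<phi> \<longleftrightarrow> is_matrix B C \<phi> \<and> (\<forall>b\<in>B. homog dC (dB b) (\<phi> b))"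

lemma homog_diff: "homog dg j f \<Longrightarrow> homog dg j g \<Longrightarrow> homog dg j (f - g)"
  and homog_0: "homog dg j 0"
  by (auto simp: homog_def)

lemma homog_unit_vec: "homog dg (dg b) (unit_vec b)"
  by (auto simp: homog_def unit_vec_def grd_def gr_one)

lemma graded_matrix_unit_vec: "graded_matrix B dg B dg unit_vec"
  by (auto simp: graded_matrix_def is_matrix_def unit_vec_closed homog_unit_vec)

lemma graded_matrix_diff: "graded_matrix B dB C dC \<phi> \<Longrightarrow> graded_matrix B dB C dC \<psi> \<Longrightarrow> graded_matrix B dB C dC (\<lambda>b. \<phi> b - \<psi> b)"
  by (auto simp: graded_matrix_def is_matrix_def homog_diff)

lemma homog_lin:
  assumes "f \<in> free_module A B" "graded_matrix B dB C dC \<phi>" "homog dB j f"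
  shows "homog dC j (lin \<phi> f)"
  unfolding homog_def lin_apply
proof (intro allI grd_sum)
  fix c b assume "b \<in> {b. f b \<noteq> 0}"
  then have "b \<in> B" using free_module_support[OF assms(1)] by auto
  then show "f b \<otimes> \<phi> b c \<in> grd j (dC c)"
    by (intro grd_mult[of _ _ "dB b"]) (use assms in \<open>auto simp: homog_def graded_matrix_def\<close>)
qed

lemma graded_matrix_comp:
  assumes "graded_matrix B dB C dC \<phi>" "graded_matrix C dC D dD \<psi>"
  shows "graded_matrix B dB D dD (\<lambda>b. lin \<psi> (\<phi> b))"
  using assms is_matrix_comp[of B C \<phi> D \<psi>] homog_lin[OF _ assms(2)]
  by (auto simp: graded_matrix_def is_matrix_def)

lemma hcomp_closed: 
  assumes "f \<in> free_module A B" shows "hcomp dg j f \<in> free_module A B" "homog dg j (hcomp dg j f)"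
proof -
  have "finite {b. hcomp dg j f b \<noteq> 0}"
    by (rule finite_subset[of _ "{b. f b \<noteq> 0}"]) (use assms in \<open>auto simp: free_module_iff hcomp_def cmpd_def\<close>)
  then show "hcomp dg j f \<in> free_module A B"
    using assms by (auto simp: free_module_iff hcomp_def cmpd_def)
  show "homog dg j (hcomp dg j f)"
    using assms by (auto simp: homog_def hcomp_def free_module_iff intro!: cmpd_in)
qed

lemma hcomp_homog: "homog dg j f \<Longrightarrow> hcomp dg j f = f"
  by (auto simp: homog_def hcomp_def cmpd_grd)

text \<open>An entry at generators of degrees \<open>d\<close> and \<open>e\<close> shifts degrees
  by \<open>d - e\<close>, as recorded in \<open>cmpd_mult\<close>. The lemma serves to replace any
  preimage of a homogeneous vector by a homogeneous one.\<close>

lemma lin_hcomp: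
  assumes f: "f \<in> free_module A B" and \<phi>: "graded_matrix B dB C dC \<phi>"
  shows "lin \<phi> (hcomp dB j f) = hcomp dC j (lin \<phi> f)"
proof
  fix c
  have m: "is_matrix B C \<phi>" and c: "b \<in> B \<Longrightarrow> \<phi> b c \<in> grd (dB b) (dC c)" for b
    using \<phi> by (auto simp: graded_matrix_def homog_def)
  have "lin \<phi> (hcomp dB j f) = (\<Sum>b\<in>{b. f b \<noteq> 0}. (\<lambda>c. hcomp dB j f b \<otimes> \<phi> b c))"
    by (rule lin_eq[OF hcomp_closed(1)[OF f] _ _ _ m])
       (use f in \<open>auto simp: free_module_iff hcomp_def cmpd_def\<close>)
  then have "lin \<phi> (hcomp dB j f) c = (\<Sum>b\<in>{b. f b \<noteq> 0}. cmpd j (dC c) (f b \<otimes> \<phi> b c))"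
    by (simp add: sum_fun_apply hcomp_def) (rule sum.cong, use free_moduleD(2)[OF f] free_module_support[OF f] in \<open>auto intro!: cmpd_mult[OF _ c, symmetric]\<close>)
  also have "\<dots> = hcomp dC j (lin \<phi> f) c"
    unfolding hcomp_def lin_apply
    by (rule cmpd_sum[symmetric]) (use f entry_closed[OF m f] free_moduleD(2)[OF f] in \<open>auto intro!: m_closed\<close>)
  finally show "lin \<phi> (hcomp dB j f) c = hcomp dC j (lin \<phi> f) c" .
qed

text \<open>The tensor product \<open>k \<otimes> F\<close> is realised inside \<open>F\<close>
  itself, as the vectors with entries in \<open>gr 0\<close>, and \<open>red\<close> is the
  projection onto it.\<close>

definition red :: "('b \<Rightarrow> 'a) \<Rightarrow> 'b \<Rightarrow> 'a" where
  "red f = (\<lambda>b. cmp 0 (f b))"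

lemma red_closed:
  assumes "f \<in> free_module A B" shows "red f \<in> free_module A B"
proof -
  have "finite {b. red f b \<noteq> 0}"
    by (rule finite_subset[of _ "{b. f b \<noteq> 0}"]) (use assms in \<open>auto simp: free_module_iff red_def\<close>)
  then show ?thesis using assms by (auto simp: free_module_iff red_def)
qed

text \<open>By multiplicativity of the augmentation, the positive part of the coefficients of
  \<open>f\<close> does not influence the reduced image: the map descends to
  \<open>k \<otimes> F\<close>.\<close>

lemma red_lin_red:
  assumes f: "f \<in> free_module A B" and \<phi>: "is_matrix B C \<phi>"
  shows "red (lin \<phi> (red f)) = red (lin \<phi> f)"
proof
  fix c
  have "lin \<phi> (red f) = (\<Sum>b\<in>{b. f b \<noteq> 0}. (\<lambda>c. red f b \<otimes> \<phi> b c))"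
    by (rule lin_eq[OF red_closed[OF f] _ _ _ \<phi>]) (use f in \<open>auto simp: free_module_iff red_def\<close>)
  then have "red (lin \<phi> (red f)) c = (\<Sum>b\<in>{b. f b \<noteq> 0}. cmp 0 (cmp 0 (f b) \<otimes> \<phi> b c))"
    by (simp add: sum_fun_apply red_def) (rule cmp_sum, use f entry_closed[OF \<phi> f] free_moduleD(2)[OF f] in \<open>auto intro!: m_closed cmp_carrier\<close>)
  also have "\<dots> = (\<Sum>b\<in>{b. f b \<noteq> 0}. cmp 0 (f b \<otimes> \<phi> b c))"
  proof (rule sum.cong[OF refl])
    fix b assume "b \<in> {b. f b \<noteq> 0}"
    then have *: "f b \<in> carrier A" "\<phi> b c \<in> carrier A"
      using free_moduleD(2)[OF f] entry_closed[OF \<phi> f] by auto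
    have "cmp 0 (cmp 0 (f b)) = cmp 0 (f b)" by (subst cmp_gr[OF cmp_props(1)]) (use * in auto)
    then show "cmp 0 (cmp 0 (f b) \<otimes> \<phi> b c) = cmp 0 (f b \<otimes> \<phi> b c)"
      using * by (simp add: cmp_0_mult cmp_carrier)
  qed
  also have "\<dots> = red (lin \<phi> f) c"
    unfolding red_def lin_apply by (rule cmp_sum[symmetric]) (use f entry_closed[OF \<phi> f] free_moduleD(2)[OF f] in \<open>auto intro!: m_closed\<close>)
  finally show "red (lin \<phi> (red f)) c = red (lin \<phi> f) c" .
qed

lemma red_add: "f \<in> free_module A B \<Longrightarrow> g \<in> free_module A B \<Longrightarrow> red (f + g) = red f + red g"
  and red_diff: "f \<in> free_module A B \<Longrightarrow> g \<in> free_module A B \<Longrightarrow> red (f - g) = red f - red g"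
  and red_0: "red 0 = 0"
  by (auto simp: red_def fun_eq_iff free_module_iff cmp_add cmp_diff)

end

lemma all_nat_split: "(\<forall>n. P n) \<longleftrightarrow> P 0 \<and> (\<forall>n. P (Suc n))"
  using not0_implies_Suc by metis

section \<open>Graded free resolutions and their comparison\<close>

context additive_graded_algebra
begin

lemma lin_cong: "f \<in> free_module A B \<Longrightarrow> (\<And>b. b \<in> B \<Longrightarrow> \<phi> b = \<psi> b) \<Longrightarrow> lin \<phi> f = lin \<psi> f"
  unfolding lin_def using free_module_support[of f B] by (intro sum.cong) auto

lemma red_lin_zero:
  assumes f: "f \<in> free_module A B" and \<phi>: "is_matrix B C \<phi>" and 0: "\<And>b. b \<in> B \<Longrightarrow> red (\<phi> b) = 0"
  shows "red (lin \<phi> f) = 0"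
proof
  fix c
  have "red (lin \<phi> f) c = (\<Sum>b\<in>{b. f b \<noteq> 0}. cmp 0 (f b \<otimes> \<phi> b c))"
    unfolding red_def lin_apply
    by (rule cmp_sum) (use f entry_closed[OF \<phi> f] free_moduleD(2)[OF f] in \<open>auto intro!: m_closed\<close>)
  also have "\<dots> = (\<Sum>b\<in>{b. f b \<noteq> 0}. 0)"
  proof (rule sum.cong[OF refl])
    fix b assume "b \<in> {b. f b \<noteq> 0}"
    then have b: "f b \<in> carrier A" "\<phi> b c \<in> carrier A" "b \<in> B"
      using free_moduleD(2)[OF f] entry_closed[OF \<phi> f] free_module_support[OF f] by auto
    then have "cmp 0 (\<phi> b c) = 0" using 0[of b] by (simp add: red_def fun_eq_iff)
    then show "cmp 0 (f b \<otimes> \<phi> b c) = 0" using b by (simp add: cmp_0_mult cmp_carrier)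
  qed
  finally show "red (lin \<phi> f) c = 0 c" by simp
qed

text \<open>A single column, indexed by \<open>unit\<close>, so that the facts on \<open>lin\<close>
  cover the augmentation; together with \<open>cyc\<close> it gives exactness the same form at
  position 0 as elsewhere.\<close>

definition aug_matrix :: "('a, 'b) free_complex \<Rightarrow> 'b \<Rightarrow> unit \<Rightarrow> 'a" where
  "aug_matrix P b = (\<lambda>_. augm P b)"

definition cyc :: "('a, 'b) free_complex \<Rightarrow> nat \<Rightarrow> ('b \<Rightarrow> 'a) \<Rightarrow> bool" where
  "cyc P n f \<longleftrightarrow> (case n of 0 \<Rightarrow> red (lin (aug_matrix P) f) = 0 | Suc m \<Rightarrow> lin (bdry P m) f = 0)"

abbreviation chains :: "('a, 'b) free_complex \<Rightarrow> nat \<Rightarrow> ('b \<Rightarrow> 'a) set" where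
  "chains P n \<equiv> free_module A (basis P n)"

abbreviation gmat :: "('a, 'b) free_complex \<Rightarrow> nat \<Rightarrow> ('a, 'c) free_complex \<Rightarrow> nat \<Rightarrow> ('b \<Rightarrow> 'c \<Rightarrow> 'a) \<Rightarrow> bool" where
  "gmat P n Q m \<equiv> graded_matrix (basis P n) (bdeg P n) (basis Q m) (bdeg Q m)"

lemma gmatD:
  assumes "graded_matrix B dB C dC \<phi>"
  shows "is_matrix B C \<phi>" "b \<in> B \<Longrightarrow> \<phi> b \<in> free_module A C" "b \<in> B \<Longrightarrow> homog dC (dB b) (\<phi> b)"
  using assms by (auto simp: graded_matrix_def is_matrix_def)

lemma augmentation_eq:
  assumes "f \<in> chains P 0" "\<And>b. b \<in> basis P 0 \<Longrightarrow> augm P b \<in> carrier A"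
  shows "augmentation A gr (augm P) f = red (lin (aug_matrix P) f) ()"
proof -
  have "(\<Oplus>b\<in>{b. f b \<noteq> 0}. f b \<otimes> augm P b) = (\<Sum>b | f b \<noteq> 0. f b \<otimes> augm P b)"
    by (rule finsum_eq) (use assms free_module_support[OF assms(1)] free_moduleD(2)[OF assms(1)] in \<open>auto intro!: m_closed\<close>)
  then show ?thesis
    by (simp add: augmentation_def zero_eq red_def lin_apply aug_matrix_def)
qed

text \<open>Replaces \<open>lin_ext\<close> and \<open>finsum\<close> by \<open>lin\<close> and
  \<open>sum\<close>, and merges the exactness conditions into one. The translation of exactness is
  valid only once the entries are known to lie in the algebra, so it is made under the first two
  clauses.\<close>

lemma graded_free_resolution_iff:
  "graded_free_resolution A gr P \<longleftrightarrow>
    (\<forall>n. gmat P (Suc n) P n (bdry P n)) \<and>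
    (\<forall>b\<in>basis P 0. augm P b \<in> (if bdeg P 0 b = 0 then gr 0 else {0})) \<and>
    (\<lambda>f. red (lin (aug_matrix P) f) ()) ` chains P 0 = gr 0 \<and>
    (\<forall>n. lin (bdry P n) ` chains P (Suc n) = {f \<in> chains P n. cyc P n f})" (is "_ = (?M \<and> ?N \<and> ?I \<and> ?E)")
proof -
  have grd: "(if bdeg P n c \<le> bdeg P (Suc n) b then gr (bdeg P (Suc n) b - bdeg P n c) else {\<zero>}) =
    grd (bdeg P (Suc n) b) (bdeg P n c)" for n b c
    by (simp add: grd_def zero_eq)
  have 1: "(\<forall>n. \<forall>b\<in>basis P (Suc n). bdry P n b \<in> chains P n \<and>
        (\<forall>c\<in>basis P n. bdry P n b c \<in>
           (if bdeg P n c \<le> bdeg P (Suc n) b then gr (bdeg P (Suc n) b - bdeg P n c) else {\<zero>}))) \<longleftrightarrow> ?M"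
    unfolding grd graded_matrix_def is_matrix_def homog_def
    using free_moduleD(3) grd_0 by (metis (no_types, lifting))
  have c: "\<And>b. b \<in> basis P 0 \<Longrightarrow> augm P b \<in> carrier A" if ?N
    using that by (auto split: if_splits)
  have 3: "augmentation A gr (augm P) ` chains P 0 = gr 0 \<longleftrightarrow> ?I" if ?N
    using augmentation_eq[OF _ c[OF that]] by (simp cong: image_cong_simp)
  have le: "lin_ext A (bdry P n) f = lin (bdry P n) f" if ?M "f \<in> chains P (Suc n)" for n f
    using that by (meson lin_ext_eq gmatD)
  have 4: "lin_ext A (bdry P 0) ` chains P 1 = {f \<in> chains P 0. augmentation A gr (augm P) f = \<zero>} \<longleftrightarrow>
      lin (bdry P 0) ` chains P (Suc 0) = {f \<in> chains P 0. cyc P 0 f}" if ?M ?N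
  proof -
    have "lin_ext A (bdry P 0) ` chains P 1 = lin (bdry P 0) ` chains P (Suc 0)"
      using le[OF that(1)] by (auto simp: image_iff)
    moreover have "{f \<in> chains P 0. augmentation A gr (augm P) f = \<zero>} = {f \<in> chains P 0. cyc P 0 f}"
      using augmentation_eq[OF _ c[OF that(2)]] by (auto simp: cyc_def zero_eq fun_eq_iff)
    ultimately show ?thesis by simp
  qed
  have 5: "lin_ext A (bdry P (Suc n)) ` chains P (Suc (Suc n)) =
       {f \<in> chains P (Suc n). lin_ext A (bdry P n) f = (\<lambda>_. \<zero>)} \<longleftrightarrow>
      lin (bdry P (Suc n)) ` chains P (Suc (Suc n)) = {f \<in> chains P (Suc n). cyc P (Suc n) f}" if ?M for n
  proof -
    have "lin_ext A (bdry P (Suc n)) ` chains P (Suc (Suc n)) = lin (bdry P (Suc n)) ` chains P (Suc (Suc n))"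
      using le[OF that] by (auto simp: image_iff)
    moreover have "{f \<in> chains P (Suc n). lin_ext A (bdry P n) f = (\<lambda>_. \<zero>)} = {f \<in> chains P (Suc n). cyc P (Suc n) f}"
      using le[OF that] by (auto simp: cyc_def zero_eq zero_fun_def)
    ultimately show ?thesis by simp
  qed
  have 6: "?E \<longleftrightarrow> lin (bdry P 0) ` chains P (Suc 0) = {f \<in> chains P 0. cyc P 0 f} \<and>
     (\<forall>n. lin (bdry P (Suc n)) ` chains P (Suc (Suc n)) = {f \<in> chains P (Suc n). cyc P (Suc n) f})"
    by (rule all_nat_split)
  show ?thesis
  \<comment> \<open>If one of the two clauses fails, both sides are false, and the exactness
    conditions need no translation.\<close>
  proof (cases "?M \<and> ?N")
    case True
    then have M: ?M and N: ?N by simp_all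
    show ?thesis
      unfolding graded_free_resolution_def zero_eq 1[unfolded zero_eq] 6 3[OF N] 4[OF M N, unfolded zero_eq]
        5[OF M, unfolded zero_eq] ..
  qed (simp only: graded_free_resolution_def zero_eq 1[unfolded zero_eq] de_Morgan_conj, argo)
qed

lemma resolutionD:
  assumes "graded_free_resolution A gr P"
  shows "gmat P (Suc n) P n (bdry P n)"
    and "\<And>b. b \<in> basis P 0 \<Longrightarrow> augm P b \<in> (if bdeg P 0 b = 0 then gr 0 else {0})"
    and "(\<lambda>f. red (lin (aug_matrix P) f) ()) ` chains P 0 = gr 0"
    and "lin (bdry P n) ` chains P (Suc n) = {f \<in> chains P n. cyc P n f}"
proof -
  note R = iffD1[OF graded_free_resolution_iff assms]
  from R show "gmat P (Suc n) P n (bdry P n)" by (elim conjE) (erule allE)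
  from R show "\<And>b. b \<in> basis P 0 \<Longrightarrow> augm P b \<in> (if bdeg P 0 b = 0 then gr 0 else {0})" by (elim conjE) (erule bspec)
  from R show "(\<lambda>f. red (lin (aug_matrix P) f) ()) ` chains P 0 = gr 0" by (elim conjE)
  from R show "lin (bdry P n) ` chains P (Suc n) = {f \<in> chains P n. cyc P n f}" by (elim conjE) (erule allE)+
qed

lemma aug_graded_matrix:
  assumes "graded_free_resolution A gr P"
  shows "graded_matrix (basis P 0) (bdeg P 0) UNIV (\<lambda>_. 0) (aug_matrix P)"
  by (auto simp: graded_matrix_def is_matrix_def homog_def aug_matrix_def free_module_iff grd_def
      dest!: resolutionD(2)[OF assms] split: if_splits)

lemma cmp_cmp_0: "x \<in> carrier A \<Longrightarrow> cmp 0 (cmp 0 x) = cmp 0 x"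
  using cmp_gr[OF cmp_props(1)] by simp

lemma red_red: "f \<in> free_module A B \<Longrightarrow> red (red f) = red f"
  by (simp add: red_def cmp_cmp_0 free_moduleD(2))

text \<open>Exactness yields some preimage; its component of degree \<open>j\<close> maps to the
  component of degree \<open>j\<close> of \<open>f\<close>, which is \<open>f\<close>.\<close>

lemma homog_lift:
  assumes P: "graded_free_resolution A gr P" and f: "f \<in> chains P n" "cyc P n f" "homog (bdeg P n) j f"
  shows "\<exists>g\<in>chains P (Suc n). homog (bdeg P (Suc n)) j g \<and> lin (bdry P n) g = f"
proof -
  note m = resolutionD(1)[OF P]
  have "f \<in> lin (bdry P n) ` chains P (Suc n)"
    unfolding resolutionD(4)[OF P] using f by simp
  then obtain g where g: "g \<in> chains P (Suc n)" "lin (bdry P n) g = f" by (elim imageE) simp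
  show ?thesis
    using hcomp_closed[OF g(1)] lin_hcomp[OF g(1) m, of j] hcomp_homog[OF f(3)] g(2) by metis
qed

lemma cyc_lin:
  assumes "graded_free_resolution A gr P" "g \<in> chains P (Suc n)"
  shows "cyc P n (lin (bdry P n) g)" "lin (bdry P n) g \<in> chains P n"
proof -
  have "lin (bdry P n) g \<in> {f \<in> chains P n. cyc P n f}"
    unfolding resolutionD(4)[OF assms(1), symmetric] using assms(2) by (rule imageI)
  then show "cyc P n (lin (bdry P n) g)" "lin (bdry P n) g \<in> chains P n" by simp_all
qed

lemma cyc_bdry:
  assumes P: "graded_free_resolution A gr P" and b: "b \<in> basis P (Suc n)"
  shows "cyc P n (bdry P n b)" "bdry P n b \<in> chains P n" "homog (bdeg P n) (bdeg P (Suc n) b) (bdry P n b)"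
proof -
  have m: "gmat P (Suc n) P n (bdry P n)" by (fact resolutionD[OF P])
  have "lin (bdry P n) (unit_vec b) = bdry P n b" by (rule lin_unit_vec[OF b gmatD(1)[OF m]])
  then show "cyc P n (bdry P n b)" using cyc_lin(1)[OF P unit_vec_closed[OF b]] by simp
qed (use resolutionD(1)[OF P] b in \<open>auto simp: graded_matrix_def is_matrix_def\<close>)

lemma graded_matrix_choice:
  assumes "\<And>b. b \<in> B \<Longrightarrow> \<exists>g\<in>free_module A C. homog dC (dB b) g \<and> R b g"
  obtains \<phi> where "graded_matrix B dB C dC \<phi>" "\<And>b. b \<in> B \<Longrightarrow> R b (\<phi> b)"
proof -
  from assms obtain \<phi> where "\<And>b. b \<in> B \<Longrightarrow> \<phi> b \<in> free_module A C \<and> homog dC (dB b) (\<phi> b) \<and> R b (\<phi> b)"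
    by metis
  then show ?thesis by (intro that[of \<phi>]) (auto simp: graded_matrix_def is_matrix_def)
qed

text \<open>The comparison theorem: the image of each generator is a lift of the image of its
  boundary. The invariant \<open>I\<close> records that cycles go to cycles, the only fact about
  earlier maps that the next lift uses. At position 0 the augmentations agree only after
  \<open>red\<close>, because \<open>k\<close> is the algebra modulo positive degrees.\<close>

lemma chain_map_ex:
  fixes P :: "('a, 'b) free_complex" and Q :: "('a, 'c) free_complex"
  assumes P: "graded_free_resolution A gr P" and Q: "graded_free_resolution A gr Q"
  shows "\<exists>\<alpha>. (\<forall>n. gmat P n Q n (\<alpha> n)) \<and>
     (\<forall>b\<in>basis P 0. red (lin (aug_matrix Q) (\<alpha> 0 b)) = red (aug_matrix P b)) \<and>
     (\<forall>n. \<forall>b\<in>basis P (Suc n). lin (bdry Q n) (\<alpha> (Suc n) b) = lin (\<alpha> n) (bdry P n b))"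
proof -
  define I where "I n \<phi> \<longleftrightarrow> gmat P n Q n \<phi> \<and> (\<forall>f\<in>chains P n. cyc P n f \<longrightarrow> cyc Q n (lin \<phi> f)) \<and>
     (n = 0 \<longrightarrow> (\<forall>b\<in>basis P 0. red (lin (aug_matrix Q) (\<phi> b)) = red (aug_matrix P b)))" for n \<phi>
  define S where "S n \<phi> \<psi> \<longleftrightarrow> (\<forall>b\<in>basis P (Suc n). lin (bdry Q n) (\<psi> b) = lin \<phi> (bdry P n b))" for n \<phi> \<psi>
  have mP: "gmat P (Suc n) P n (bdry P n)" and mQ: "gmat Q (Suc n) Q n (bdry Q n)" for n
    by (fact resolutionD(1,3)[OF P] resolutionD(1,3)[OF Q] aug_graded_matrix[OF P] aug_graded_matrix[OF Q])+
  have eP: "graded_matrix (basis P 0) (bdeg P 0) UNIV (\<lambda>_. 0) (aug_matrix P)"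
    and eQ: "graded_matrix (basis Q 0) (bdeg Q 0) UNIV (\<lambda>_. 0) (aug_matrix Q)"
    and onto: "(\<lambda>f. red (lin (aug_matrix Q) f) ()) ` chains Q 0 = gr 0"
    by (fact resolutionD(1,3)[OF P] resolutionD(1,3)[OF Q] aug_graded_matrix[OF P] aug_graded_matrix[OF Q])+
  have "\<exists>\<alpha>. \<forall>n. I n (\<alpha> n) \<and> S n (\<alpha> n) (\<alpha> (Suc n))"
  proof (rule dependent_nat_choice)
    have "\<exists>g\<in>chains Q 0. homog (bdeg Q 0) (bdeg P 0 b) g \<and> red (lin (aug_matrix Q) g) = red (aug_matrix P b)"
      if b: "b \<in> basis P 0" for b
    proof (cases "bdeg P 0 b = 0")
      case True
      then have "augm P b \<in> gr 0" using gmatD(3)[OF eP b] by (auto simp: homog_def aug_matrix_def grd_def)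
      then obtain g where g: "g \<in> chains Q 0" "red (lin (aug_matrix Q) g) () = augm P b"
        unfolding onto[symmetric] by (elim imageE) simp
      \<comment> \<open>Both the generator and the augmentation sit in internal degree 0, so passing
        to that component of \<open>g\<close> leaves the reduced augmentation unchanged.\<close>
      have "lin (aug_matrix Q) (hcomp (bdeg Q 0) 0 g) = hcomp (\<lambda>_. 0) 0 (lin (aug_matrix Q) g)"
        by (rule lin_hcomp[OF g(1) eQ])
      moreover have "hcomp (\<lambda>_. 0) 0 h = red h" for h :: "unit \<Rightarrow> 'a"
        by (simp add: hcomp_def red_def cmpd_def)
      ultimately have "red (lin (aug_matrix Q) (hcomp (bdeg Q 0) 0 g)) = red (aug_matrix P b)"
        using g(2) \<open>augm P b \<in> gr 0\<close> by (auto simp: red_def aug_matrix_def fun_eq_iff)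
      then show ?thesis using True hcomp_closed[OF g(1)] by metis
    next
      case False
      then have "augm P b = 0" using resolutionD(2)[OF P b] by simp
      then have "red (lin (aug_matrix Q) 0) = red (aug_matrix P b)" by (auto simp: red_def aug_matrix_def fun_eq_iff)
      then show ?thesis using homog_0 by blast
    qed
    then obtain \<phi> where \<phi>: "gmat P 0 Q 0 \<phi>"
      "\<And>b. b \<in> basis P 0 \<Longrightarrow> red (lin (aug_matrix Q) (\<phi> b)) = red (aug_matrix P b)"
      by (rule graded_matrix_choice[where B="basis P 0" and dB="bdeg P 0"]) (assumption, rule that, assumption, simp)
    \<comment> \<open>Agreement on generators extends to all chains, since the difference of the two
      matrices reduces to zero. This gives cycles to cycles at position 0.\<close>
    have "red (lin (aug_matrix Q) (lin \<phi> f)) = red (lin (aug_matrix P) f)" if f: "f \<in> chains P 0" for f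
    proof -
      note M = is_matrix_comp[OF gmatD(1)[OF \<phi>(1)] gmatD(1)[OF eQ]] gmatD(1)[OF eP]
      have "red (lin (\<lambda>b. lin (aug_matrix Q) (\<phi> b) - aug_matrix P b) f) = 0"
        by (rule red_lin_zero[OF f, of UNIV])
           (use M \<phi>(2) in \<open>auto simp: is_matrix_def red_diff[where B=UNIV]\<close>)
      then show ?thesis
        unfolding lin_comp[OF f gmatD(1)[OF \<phi>(1)] gmatD(1)[OF eQ]] lin_matrix_diff[OF f M]
        by (subst (asm) red_diff[where B=UNIV]) (auto intro!: lin_closed[OF f] M)
    qed
    then have "I 0 \<phi>" using \<phi> unfolding I_def cyc_def by simp
    then show "\<exists>\<phi>. I 0 \<phi>" by (rule exI[of _ \<phi>])
  next
    fix \<phi> n assume I: "I n \<phi>"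
    then have \<phi>: "gmat P n Q n \<phi>" "\<And>f. f \<in> chains P n \<Longrightarrow> cyc P n f \<Longrightarrow> cyc Q n (lin \<phi> f)" by (auto simp: I_def)
    have "\<exists>g\<in>chains Q (Suc n). homog (bdeg Q (Suc n)) (bdeg P (Suc n) b) g \<and> lin (bdry Q n) g = lin \<phi> (bdry P n b)"
      if b: "b \<in> basis P (Suc n)" for b
      by (rule homog_lift[OF Q lin_closed[OF cyc_bdry(2)[OF P b] gmatD(1)[OF \<phi>(1)]]
        \<phi>(2)[OF cyc_bdry(2,1)[OF P b]] homog_lin[OF cyc_bdry(2)[OF P b] \<phi>(1) cyc_bdry(3)[OF P b]]])
    then obtain \<psi> where \<psi>: "gmat P (Suc n) Q (Suc n) \<psi>"
      "\<And>b. b \<in> basis P (Suc n) \<Longrightarrow> lin (bdry Q n) (\<psi> b) = lin \<phi> (bdry P n b)"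
      by (rule graded_matrix_choice[where B="basis P (Suc n)" and dB="bdeg P (Suc n)"]) (assumption, rule that, assumption, simp)
    have "lin (bdry Q n) (lin \<psi> f) = lin \<phi> (lin (bdry P n) f)" if f: "f \<in> chains P (Suc n)" for f
      unfolding lin_comp[OF f gmatD(1)[OF \<psi>(1)] gmatD(1)[OF mQ]] lin_comp[OF f gmatD(1)[OF mP] gmatD(1)[OF \<phi>(1)]]
      by (rule lin_cong[OF f \<psi>(2)])
    then have "I (Suc n) \<psi>" using \<psi>(1) unfolding I_def cyc_def by simp
    then show "\<exists>\<psi>. I (Suc n) \<psi> \<and> S n \<phi> \<psi>" using \<psi>(2) unfolding S_def by blast
  qed
  then obtain \<alpha> where \<alpha>': "\<forall>n. I n (\<alpha> n) \<and> S n (\<alpha> n) (\<alpha> (Suc n))" by (rule exE)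
  have \<alpha>: "I n (\<alpha> n)" "S n (\<alpha> n) (\<alpha> (Suc n))" for n using spec[OF \<alpha>', of n] by simp_all
  show ?thesis
  proof (intro exI[of _ \<alpha>] conjI allI ballI)
    show "gmat P n Q n (\<alpha> n)" for n using \<alpha>(1)[of n] unfolding I_def by (rule conjunct1)
    show "red (lin (aug_matrix Q) (\<alpha> 0 b)) = red (aug_matrix P b)" if "b \<in> basis P 0" for b
      using \<alpha>(1)[of 0, unfolded I_def] that by simp
    show "lin (bdry Q n) (\<alpha> (Suc n) b) = lin (\<alpha> n) (bdry P n b)" if "b \<in> basis P (Suc n)" for n b
      by (rule bspec[OF \<alpha>(2)[of n, unfolded S_def] that])
  qed
qed

text \<open>The homotopy is built by lifting \<open>\<theta> - s \<partial>\<close> through the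
  boundary. The invariant that \<open>\<theta>\<close> equals \<open>\<partial> s\<close> on cycles
  makes this difference a cycle one position further.\<close>

lemma null_homotopy_ex:
  fixes P :: "('a, 'b) free_complex"
  assumes P: "graded_free_resolution A gr P" and \<theta>: "\<And>n. gmat P n P n (\<theta> n)"
    and aug: "\<And>b. b \<in> basis P 0 \<Longrightarrow> red (lin (aug_matrix P) (\<theta> 0 b)) = 0"
    and comm: "\<And>n b. b \<in> basis P (Suc n) \<Longrightarrow> lin (bdry P n) (\<theta> (Suc n) b) = lin (\<theta> n) (bdry P n b)"
  shows "\<exists>s. (\<forall>n. gmat P n P (Suc n) (s n)) \<and> (\<forall>b\<in>basis P 0. \<theta> 0 b = lin (bdry P 0) (s 0 b)) \<and>
     (\<forall>n. \<forall>b\<in>basis P (Suc n). \<theta> (Suc n) b = lin (bdry P (Suc n)) (s (Suc n) b) + lin (s n) (bdry P n b))"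
proof -
  define I where "I n \<phi> \<longleftrightarrow> gmat P n P (Suc n) \<phi> \<and>
     (\<forall>f\<in>chains P n. cyc P n f \<longrightarrow> lin (\<theta> n) f = lin (bdry P n) (lin \<phi> f)) \<and>
     (n = 0 \<longrightarrow> (\<forall>b\<in>basis P 0. \<theta> 0 b = lin (bdry P 0) (\<phi> b)))" for n \<phi>
  define S where "S n \<phi> \<psi> \<longleftrightarrow> (\<forall>b\<in>basis P (Suc n). lin (bdry P (Suc n)) (\<psi> b) = \<theta> (Suc n) b - lin \<phi> (bdry P n b))" for n \<phi> \<psi>
  have m: "gmat P (Suc n) P n (bdry P n)" for n
    by (fact resolutionD[OF P])
  have "\<exists>s. \<forall>n. I n (s n) \<and> S n (s n) (s (Suc n))"
  proof (rule dependent_nat_choice)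
    have "\<exists>g\<in>chains P (Suc 0). homog (bdeg P (Suc 0)) (bdeg P 0 b) g \<and> lin (bdry P 0) g = \<theta> 0 b"
      if b: "b \<in> basis P 0" for b
      by (rule homog_lift[OF P gmatD(2)[OF \<theta> b] _ gmatD(3)[OF \<theta> b]]) (simp add: cyc_def aug[OF b])
    then obtain \<phi> where \<phi>: "gmat P 0 P (Suc 0) \<phi>"
      "\<And>b. b \<in> basis P 0 \<Longrightarrow> lin (bdry P 0) (\<phi> b) = \<theta> 0 b"
      by (rule graded_matrix_choice[where B="basis P 0" and dB="bdeg P 0"]) (assumption, rule that, assumption, simp)
    have "lin (\<theta> 0) f = lin (bdry P 0) (lin \<phi> f)" if f: "f \<in> chains P 0" for f
      unfolding lin_comp[OF f gmatD(1)[OF \<phi>(1)] gmatD(1)[OF m]] by (rule lin_cong[OF f \<phi>(2)[symmetric]])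
    then have "I 0 \<phi>" using \<phi> unfolding I_def by simp
    then show "\<exists>\<phi>. I 0 \<phi>" by (rule exI[of _ \<phi>])
  next
    fix \<phi> n assume I: "I n \<phi>"
    then have \<phi>: "gmat P n P (Suc n) \<phi>"
      "\<And>f. f \<in> chains P n \<Longrightarrow> cyc P n f \<Longrightarrow> lin (\<theta> n) f = lin (bdry P n) (lin \<phi> f)" by (auto simp: I_def)
    have "\<exists>g\<in>chains P (Suc (Suc n)). homog (bdeg P (Suc (Suc n))) (bdeg P (Suc n) b) g \<and>
        lin (bdry P (Suc n)) g = \<theta> (Suc n) b - lin \<phi> (bdry P n b)"
      if b: "b \<in> basis P (Suc n)" for b
    proof (rule homog_lift[OF P])
      note c = cyc_bdry[OF P b]
      have l: "lin \<phi> (bdry P n b) \<in> chains P (Suc n)" by (rule lin_closed[OF c(2) gmatD(1)[OF \<phi>(1)]])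
      note t = gmatD(2)[OF \<theta> b]
      show "\<theta> (Suc n) b - lin \<phi> (bdry P n b) \<in> chains P (Suc n)" using l t by auto
      show "cyc P (Suc n) (\<theta> (Suc n) b - lin \<phi> (bdry P n b))"
        using comm[OF b] \<phi>(2)[OF c(2,1)] by (simp add: cyc_def lin_diff[OF t l gmatD(1)[OF m]])
      show "homog (bdeg P (Suc n)) (bdeg P (Suc n) b) (\<theta> (Suc n) b - lin \<phi> (bdry P n b))"
        by (intro homog_diff gmatD(3)[OF \<theta> b] homog_lin[OF c(2) \<phi>(1) c(3)])
    qed
    then obtain \<psi> where \<psi>: "gmat P (Suc n) P (Suc (Suc n)) \<psi>"
      "\<And>b. b \<in> basis P (Suc n) \<Longrightarrow> lin (bdry P (Suc n)) (\<psi> b) = \<theta> (Suc n) b - lin \<phi> (bdry P n b)"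
      by (rule graded_matrix_choice[where B="basis P (Suc n)" and dB="bdeg P (Suc n)"]) (assumption, rule that, assumption, simp)
    have "lin (bdry P (Suc n)) (lin \<psi> f) = lin (\<theta> (Suc n)) f - lin \<phi> (lin (bdry P n) f)"
      if f: "f \<in> chains P (Suc n)" for f
      unfolding lin_comp[OF f gmatD(1)[OF \<psi>(1)] gmatD(1)[OF m]] lin_comp[OF f gmatD(1)[OF m] gmatD(1)[OF \<phi>(1)]]
      by (subst lin_matrix_diff[OF f gmatD(1)[OF \<theta>] is_matrix_comp[OF gmatD(1)[OF m] gmatD(1)[OF \<phi>(1)]], symmetric])
        (rule lin_cong[OF f \<psi>(2)])
    then have "I (Suc n) \<psi>" using \<psi>(1) unfolding I_def cyc_def by simp
    then show "\<exists>\<psi>. I (Suc n) \<psi> \<and> S n \<phi> \<psi>" using \<psi>(2) unfolding S_def by blast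
  qed
  then obtain s where s': "\<forall>n. I n (s n) \<and> S n (s n) (s (Suc n))" by (rule exE)
  have s: "I n (s n)" "S n (s n) (s (Suc n))" for n using spec[OF s', of n] by simp_all
  show ?thesis
  proof (intro exI[of _ s] conjI allI ballI)
    show "gmat P n P (Suc n) (s n)" for n using s(1)[of n] unfolding I_def by (rule conjunct1)
    show "\<theta> 0 b = lin (bdry P 0) (s 0 b)" if "b \<in> basis P 0" for b
      using s(1)[of 0, unfolded I_def] that by simp
    show "\<theta> (Suc n) b = lin (bdry P (Suc n)) (s (Suc n) b) + lin (s n) (bdry P n b)" if "b \<in> basis P (Suc n)" for n b
      using bspec[OF s(2)[of n, unfolded S_def] that] by (simp only: diff_add_cancel)
  qed
qed

section \<open>Bigraded Tor compared with a linear resolution\<close>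

lemma trivial_Mod_self:
  assumes "comm_group G" shows "trivial_group (G Mod carrier G)"
proof -
  interpret comm_group G by fact
  have n: "carrier G \<lhd> G" by (rule subgroup_imp_normal[OF subgroup_self])
  have "carrier G #>\<^bsub>G\<^esub> a = carrier G" if "a \<in> carrier G" for a
    using coset_join2[OF that subgroup_self that] .
  then have "rcosets\<^bsub>G\<^esub> (carrier G) = {carrier G}" using one_closed by (auto simp: RCOSETS_def)
  then show ?thesis
    using normal.factorgroup_is_group[OF n] by (auto simp: trivial_group_def FactGroup_def)
qed

text \<open>A nonzero entry in \<open>gr 0\<close> at a generator \<open>b\<close> is homogeneous of
  total degree \<open>j\<close> only if \<open>bdeg P i b = j\<close>, because distinct components
  of the algebra meet in zero. Reduced chains can thus be handled by \<open>homog\<close> and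
  \<open>red\<close>.\<close>

lemma tor_chains_iff:
  "f \<in> tor_chains A gr P i j \<longleftrightarrow> f \<in> chains P i \<and> homog (bdeg P i) j f \<and> red f = f"
proof
  assume f: "f \<in> tor_chains A gr P i j"
  then have f': "finite {b. f b \<noteq> 0}" "\<And>b. f b \<in> gr 0" "\<And>b. f b \<noteq> 0 \<Longrightarrow> b \<in> basis P i \<and> bdeg P i b = j"
    by (auto simp: tor_chains_def zero_eq)
  have "f b \<in> grd j (bdeg P i b)" for b
    using f'(2)[of b] f'(3)[of b] by (cases "f b = 0") (auto simp: grd_def)
  then show "f \<in> chains P i \<and> homog (bdeg P i) j f \<and> red f = f"
    using f' by (auto simp: free_module_iff homog_def red_def cmp_gr[OF f'(2)])
next
  assume f: "f \<in> chains P i \<and> homog (bdeg P i) j f \<and> red f = f"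
  then have c: "cmp 0 (f b) = f b" for b by (metis red_def)
  then have g0: "f b \<in> gr 0" for b by (metis cmp_props(1) f free_moduleD(2))
  have "bdeg P i b = j" if "f b \<noteq> 0" for b
  proof (rule ccontr)
    assume ne: "bdeg P i b \<noteq> j"
    have "f b \<in> grd j (bdeg P i b)" using f by (auto simp: homog_def)
    then have "f b \<in> gr (j - bdeg P i b)" "j - bdeg P i b \<noteq> 0" using ne that by (auto simp: grd_def split: if_splits)
    then show False using c[of b] cmp_gr[of "f b" "j - bdeg P i b" 0] that by auto
  qed
  then show "f \<in> tor_chains A gr P i j"
    using f g0 by (auto simp: tor_chains_def zero_eq free_module_iff)
qed

lemma tor_bdry_eq:
  assumes "graded_free_resolution A gr P" "f \<in> chains P (Suc i)"
  shows "tor_bdry A gr P i f = red (lin (bdry P i) f)"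
  using lin_ext_eq[OF assms(2) gmatD(1)[OF resolutionD(1)[OF assms(1)]]]
  by (auto simp: tor_bdry_def red_def fun_eq_iff)

lemma tor_bdry_chains:
  assumes P: "graded_free_resolution A gr P" and f: "f \<in> tor_chains A gr P (Suc i) j"
  shows "tor_bdry A gr P i f \<in> tor_chains A gr P i j"
proof -
  have f': "f \<in> chains P (Suc i)" "homog (bdeg P (Suc i)) j f" using f by (auto simp: tor_chains_iff)
  have m: "gmat P (Suc i) P i (bdry P i)" by (fact resolutionD[OF P])
  define g where "g = lin (bdry P i) f"
  have g: "g \<in> chains P i" "homog (bdeg P i) j g"
    unfolding g_def using lin_closed[OF f'(1) gmatD(1)[OF m]] homog_lin[OF f'(1) m f'(2)] by auto
  have "red g b \<in> grd j (bdeg P i b)" for b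
  proof -
    have "g b \<in> grd j (bdeg P i b)" using g by (auto simp: homog_def)
    then show ?thesis by (auto simp: red_def grd_def cmp_gr split: if_splits)
  qed
  moreover have "red (red g) = red g"
    by (rule red_red[OF g(1)])
  ultimately show ?thesis
    unfolding tor_bdry_eq[OF P f'(1)] g_def[symmetric] tor_chains_iff homog_def using red_closed[OF g(1)] by blast
qed

text \<open>The identity of \<open>P\<close> is homotopic to the map that goes through
  \<open>Q\<close>. Off the diagonal the passage through \<open>Q\<close> reduces to zero, and on a
  reduced cycle the homotopy leaves only a reduced boundary.\<close>

lemma tor_cycle_is_boundary:
  fixes Q :: "('a, 'c) free_complex" and P :: "('a, 'b) free_complex"
  assumes Q: "graded_free_resolution A gr Q" and lin_Q: "\<And>n b. b \<in> basis Q n \<Longrightarrow> bdeg Q n b = n"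
    and P: "graded_free_resolution A gr P" and ij: "i \<noteq> j" and c: "c \<in> tor_cycles A gr P i j"
  shows "c \<in> tor_bdry A gr P i ` tor_chains A gr P (Suc i) j"
proof -
  obtain \<alpha> where \<alpha>: "\<And>n. gmat P n Q n (\<alpha> n)"
     "\<And>b. b \<in> basis P 0 \<Longrightarrow> red (lin (aug_matrix Q) (\<alpha> 0 b)) = red (aug_matrix P b)"
     "\<And>n b. b \<in> basis P (Suc n) \<Longrightarrow> lin (bdry Q n) (\<alpha> (Suc n) b) = lin (\<alpha> n) (bdry P n b)"
    using chain_map_ex[OF P Q] by blast
  obtain \<beta> where \<beta>: "\<And>n. gmat Q n P n (\<beta> n)"
     "\<And>b. b \<in> basis Q 0 \<Longrightarrow> red (lin (aug_matrix P) (\<beta> 0 b)) = red (aug_matrix Q b)"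
     "\<And>n b. b \<in> basis Q (Suc n) \<Longrightarrow> lin (bdry P n) (\<beta> (Suc n) b) = lin (\<beta> n) (bdry Q n b)"
    using chain_map_ex[OF Q P] by blast
  have mP: "gmat P (Suc n) P n (bdry P n)" and mQ: "gmat Q (Suc n) Q n (bdry Q n)" for n
    by (fact resolutionD(1,3)[OF P] resolutionD(1,3)[OF Q] aug_graded_matrix[OF P] aug_graded_matrix[OF Q])+
  have eP: "graded_matrix (basis P 0) (bdeg P 0) UNIV (\<lambda>_. 0) (aug_matrix P)"
    and eQ: "graded_matrix (basis Q 0) (bdeg Q 0) UNIV (\<lambda>_. 0) (aug_matrix Q)"
    by (fact resolutionD(1,3)[OF P] resolutionD(1,3)[OF Q] aug_graded_matrix[OF P] aug_graded_matrix[OF Q])+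
  note iP = gmatD(1)[OF mP] and iQ = gmatD(1)[OF mQ] and ieP = gmatD(1)[OF eP] and ieQ = gmatD(1)[OF eQ]
    and i\<alpha> = gmatD(1)[OF \<alpha>(1)] and i\<beta> = gmatD(1)[OF \<beta>(1)]
  have \<beta>comm: "lin (bdry P n) (lin (\<beta> (Suc n)) f) = lin (\<beta> n) (lin (bdry Q n) f)" if f: "f \<in> chains Q (Suc n)" for n f
    unfolding lin_comp[OF f i\<beta> iP] lin_comp[OF f iQ i\<beta>] by (rule lin_cong[OF f \<beta>(3)])
  have \<beta>aug: "red (lin (aug_matrix P) (lin (\<beta> 0) f)) = red (lin (aug_matrix Q) f)" if f: "f \<in> chains Q 0" for f
  proof -
    note M = is_matrix_comp[OF i\<beta> ieP] ieQ
    have "red (lin (\<lambda>b. lin (aug_matrix P) (\<beta> 0 b) - aug_matrix Q b) f) = 0"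
      by (rule red_lin_zero[OF f, of UNIV])
         (use M \<beta>(2) in \<open>auto simp: is_matrix_def red_diff[where B=UNIV]\<close>)
    then show ?thesis
      unfolding lin_comp[OF f i\<beta> ieP] lin_matrix_diff[OF f M]
      by (subst (asm) red_diff[where B=UNIV]) (auto intro!: lin_closed[OF f] M)
  qed
  define \<theta> where "\<theta> n b = unit_vec b - lin (\<beta> n) (\<alpha> n b)" for n b
  have m\<theta>: "gmat P n P n (\<theta> n)" for n
    unfolding \<theta>_def by (intro graded_matrix_diff graded_matrix_unit_vec graded_matrix_comp[OF \<alpha>(1) \<beta>(1)])
  have i\<beta>\<alpha>: "is_matrix (basis P n) (basis P n) (\<lambda>b. lin (\<beta> n) (\<alpha> n b))" for n
    by (rule is_matrix_comp[OF i\<alpha> i\<beta>])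
  have iu: "is_matrix (basis P n) (basis P n) unit_vec" for n by (auto simp: is_matrix_def unit_vec_closed)
  have lin\<theta>: "lin (\<theta> n) f = f - lin (\<beta> n) (lin (\<alpha> n) f)" if f: "f \<in> chains P n" for n f
    unfolding \<theta>_def lin_matrix_diff[OF f iu i\<beta>\<alpha>] lin_unit_vec_id[OF f] lin_comp[OF f i\<alpha> i\<beta>] ..
  have "\<exists>s. (\<forall>n. gmat P n P (Suc n) (s n)) \<and> (\<forall>b\<in>basis P 0. \<theta> 0 b = lin (bdry P 0) (s 0 b)) \<and>
     (\<forall>n. \<forall>b\<in>basis P (Suc n). \<theta> (Suc n) b = lin (bdry P (Suc n)) (s (Suc n) b) + lin (s n) (bdry P n b))"
  proof (rule null_homotopy_ex[OF P m\<theta>])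
    fix b assume b: "b \<in> basis P 0"
    have "lin (aug_matrix P) (\<theta> 0 b) = aug_matrix P b - lin (aug_matrix P) (lin (\<beta> 0) (\<alpha> 0 b))"
      unfolding \<theta>_def using lin_diff[OF unit_vec_closed[OF b] is_matrixD(1)[OF i\<beta>\<alpha> b] ieP] lin_unit_vec[OF b ieP] by simp
    moreover have "red (aug_matrix P b - lin (aug_matrix P) (lin (\<beta> 0) (\<alpha> 0 b))) =
        red (aug_matrix P b) - red (lin (aug_matrix P) (lin (\<beta> 0) (\<alpha> 0 b)))"
      by (rule red_diff[where B=UNIV]) (use is_matrixD(1)[OF ieP b] lin_closed[OF is_matrixD(1)[OF i\<beta>\<alpha> b] ieP] in auto)
    ultimately show "red (lin (aug_matrix P) (\<theta> 0 b)) = 0"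
      using \<beta>aug[OF is_matrixD(1)[OF i\<alpha> b]] \<alpha>(2)[OF b] by simp
  next
    fix n b assume b: "b \<in> basis P (Suc n)"
    have "lin (bdry P n) (\<theta> (Suc n) b) = bdry P n b - lin (bdry P n) (lin (\<beta> (Suc n)) (\<alpha> (Suc n) b))"
      unfolding \<theta>_def using lin_diff[OF unit_vec_closed[OF b] is_matrixD(1)[OF i\<beta>\<alpha> b] iP] lin_unit_vec[OF b iP] by simp
    also have "\<dots> = bdry P n b - lin (\<beta> n) (lin (\<alpha> n) (bdry P n b))"
      using \<beta>comm[OF is_matrixD(1)[OF i\<alpha> b]] \<alpha>(3)[OF b] by simp
    also have "\<dots> = lin (\<theta> n) (bdry P n b)" using lin\<theta>[OF is_matrixD(1)[OF iP b]] by simp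
    finally show "lin (bdry P n) (\<theta> (Suc n) b) = lin (\<theta> n) (bdry P n b)" .
  qed
  then obtain s where s: "\<And>n. gmat P n P (Suc n) (s n)" "\<And>b. b \<in> basis P 0 \<Longrightarrow> \<theta> 0 b = lin (bdry P 0) (s 0 b)"
     "\<And>n b. b \<in> basis P (Suc n) \<Longrightarrow> \<theta> (Suc n) b = lin (bdry P (Suc n)) (s (Suc n) b) + lin (s n) (bdry P n b)"
    by blast
  note ims = gmatD(1)[OF s(1)]
  have "c \<in> tor_chains A gr P i j" and c': "c \<in> chains P i" "homog (bdeg P i) j c" "red c = c"
    using c by (auto simp: tor_cycles_def tor_chains_iff)
  \<comment> \<open>The homotopy image has entries of all degrees; its reduction is the chain of
    \<open>Tor\<close> that bounds \<open>c\<close>.\<close>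
  define e where "e = red (lin (s i) c)"
  have sc: "lin (s i) c \<in> chains P (Suc i)" "homog (bdeg P (Suc i)) j (lin (s i) c)"
    using lin_closed[OF c'(1) ims] homog_lin[OF c'(1) s(1) c'(2)] by auto
  have e: "e \<in> tor_chains A gr P (Suc i) j"
  proof -
    have "red (lin (s i) c) b \<in> grd j (bdeg P (Suc i) b)" for b
    proof -
      have "lin (s i) c b \<in> grd j (bdeg P (Suc i) b)" using sc by (auto simp: homog_def)
      then show ?thesis by (auto simp: red_def grd_def cmp_gr split: if_splits)
    qed
    moreover have "red (red (lin (s i) c)) = red (lin (s i) c)"
      by (rule red_red[OF sc(1)])
    ultimately show ?thesis unfolding e_def tor_chains_iff homog_def using red_closed[OF sc(1)] by blast
  qed
  \<comment> \<open>Generators of \<open>Q\<close> at position \<open>i\<close> have degree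
    \<open>i\<close>, so the entries of a vector of internal degree \<open>j\<close> lie in degree
    \<open>j - i\<close> of the algebra, or vanish for \<open>j < i\<close>; as
    \<open>i \<noteq> j\<close>, nothing is left in \<open>gr 0\<close>.\<close>
  have "red (lin (\<alpha> i) c) = 0"
  proof
    fix b
    have a: "lin (\<alpha> i) c \<in> chains Q i" "homog (bdeg Q i) j (lin (\<alpha> i) c)"
      using lin_closed[OF c'(1) i\<alpha>] homog_lin[OF c'(1) \<alpha>(1) c'(2)] by auto
    show "red (lin (\<alpha> i) c) b = 0 b"
    proof (cases "b \<in> basis Q i")
      case True
      then have "lin (\<alpha> i) c b \<in> grd j i"
        using spec[OF a(2)[unfolded homog_def], of b] by (simp only: lin_Q)
      then show ?thesis using ij by (auto simp: red_def grd_def cmp_gr split: if_splits)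
    qed (use free_moduleD(3)[OF a(1)] in \<open>auto simp: red_def\<close>)
  qed
  then have "red (lin (\<beta> i) (lin (\<alpha> i) c)) = 0"
    using red_lin_red[OF lin_closed[OF c'(1) i\<alpha>] i\<beta>] by (metis lin_0 red_0)
  then have rc: "red (lin (\<theta> i) c) = c"
    unfolding lin\<theta>[OF c'(1)] using c'(3) red_diff[OF c'(1) lin_closed[OF lin_closed[OF c'(1) i\<alpha>] i\<beta>]] by simp
  have "red (lin (\<theta> i) c) = red (lin (bdry P i) (lin (s i) c))"
  proof (cases i)
    case 0
    have "lin (\<theta> 0) c = lin (\<lambda>b. lin (bdry P 0) (s 0 b)) c"
      by (rule lin_cong[where B="basis P 0"]) (use c' s(2) 0 in auto)
    also have "\<dots> = lin (bdry P 0) (lin (s 0) c)"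
      by (rule lin_comp[symmetric, OF _ ims iP]) (use c' 0 in auto)
    finally show ?thesis using 0 by simp
  next
    case (Suc n)
    have cS: "c \<in> chains P (Suc n)" using c' Suc by auto
    have "lin (\<theta> (Suc n)) c = lin (\<lambda>b. lin (bdry P (Suc n)) (s (Suc n) b) + lin (s n) (bdry P n b)) c"
      by (rule lin_cong[OF cS s(3)])
    also have "\<dots> = lin (bdry P (Suc n)) (lin (s (Suc n)) c) + lin (s n) (lin (bdry P n) c)"
      unfolding lin_matrix_add[OF cS is_matrix_comp[OF ims iP] is_matrix_comp[OF iP ims]]
        lin_comp[OF cS ims iP] lin_comp[OF cS iP ims] ..
    finally have eq: "lin (\<theta> (Suc n)) c = lin (bdry P (Suc n)) (lin (s (Suc n)) c) + lin (s n) (lin (bdry P n) c)" .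
    \<comment> \<open>The cycle condition holds only after reduction, and this suffices: the reduced
      second homotopy term depends only on the reduced boundary of \<open>c\<close>.\<close>
    have "red (lin (bdry P n) c) = 0"
      using c cS Suc tor_bdry_eq[OF P cS] by (auto simp: tor_cycles_def zero_eq zero_fun_def)
    then have "red (lin (s n) (lin (bdry P n) c)) = 0"
      using red_lin_red[OF lin_closed[OF cS iP] ims] by (metis lin_0 red_0)
    then show ?thesis
      unfolding Suc eq using red_add[OF lin_closed[OF lin_closed[OF cS ims] iP] lin_closed[OF lin_closed[OF cS iP] ims]] by simp
  qed
  also have "\<dots> = tor_bdry A gr P i e"
    unfolding e_def tor_bdry_eq[OF P red_closed[OF sc(1)]] red_lin_red[OF sc(1) iP] ..
  finally show ?thesis using rc e by auto
qed

text \<open>The existence of \<open>Q\<close> makes the choice in \<open>tor_resolution\<close>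
  produce a resolution \<open>P\<close>, in general a different one, and off the diagonal all
  reduced cycles of \<open>P\<close> are boundaries by comparison with \<open>Q\<close>.\<close>

theorem koszul_if_linear_resolution:
  fixes Q :: "('a, 'a list) free_complex"
  assumes Q: "graded_free_resolution A gr Q" and lin_Q: "\<And>n b. b \<in> basis Q n \<Longrightarrow> bdeg Q n b = n"
  shows "koszul A gr"
  unfolding koszul_def
proof (intro conjI allI impI)
  show "graded_algebra A gr" by (rule graded_algebra_axioms)
  show "bij_betw (\<lambda>c. c \<odot> \<one>) UNIV (gr 0)" by (rule gr_0)
  fix i j :: nat assume ij: "i \<noteq> j"
  define P where "P = tor_resolution A gr"
  have P: "graded_free_resolution A gr P"
    unfolding P_def tor_resolution_def by (rule someI[where P="graded_free_resolution A gr", OF Q])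
  define G :: "('a list \<Rightarrow> 'a) monoid" where "G = \<lparr>carrier = tor_cycles A gr P i j, monoid.mult = \<lambda>f g b. f b \<oplus> g b, one = \<lambda>_. \<zero>\<rparr>"
  have cyc: "f \<in> tor_cycles A gr P i j \<longleftrightarrow> f \<in> tor_chains A gr P i j \<and>
      (case i of 0 \<Rightarrow> True | Suc i' \<Rightarrow> red (lin (bdry P i') f) = 0)" for f
    using tor_bdry_eq[OF P] by (auto simp: tor_cycles_def tor_chains_iff zero_eq zero_fun_def split: nat.splits)
  have mP: "gmat P (Suc n) P n (bdry P n)" for n by (fact resolutionD[OF P])
  note iP = gmatD(1)[OF mP]
  have z: "0 \<in> tor_cycles A gr P i j"
    by (auto simp: cyc tor_chains_iff homog_0 red_0 split: nat.splits)
  have d: "f - g \<in> tor_cycles A gr P i j" if "f \<in> tor_cycles A gr P i j" "g \<in> tor_cycles A gr P i j" for f g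
  proof -
    have fg: "f \<in> chains P i" "g \<in> chains P i" using that by (auto simp: cyc tor_chains_iff)
    have "red (lin (bdry P i') (f - g)) = 0" if "i = Suc i'" for i'
    proof -
      have fg': "f \<in> chains P (Suc i')" "g \<in> chains P (Suc i')" using fg \<open>i = Suc i'\<close> by auto
      show ?thesis
        using \<open>f \<in> tor_cycles A gr P i j\<close> \<open>g \<in> tor_cycles A gr P i j\<close> \<open>i = Suc i'\<close>
        unfolding lin_diff[OF fg' iP] red_diff[OF lin_closed[OF fg'(1) iP] lin_closed[OF fg'(2) iP]] cyc by simp
    qed
    then show ?thesis
      using that fg by (auto simp: cyc tor_chains_iff homog_diff red_diff split: nat.splits)
  qed
  have n: "- f \<in> tor_cycles A gr P i j" if "f \<in> tor_cycles A gr P i j" for f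
    using d[OF z that] by simp
  have a: "f + g \<in> tor_cycles A gr P i j" if "f \<in> tor_cycles A gr P i j" "g \<in> tor_cycles A gr P i j" for f g
    using d[OF that(1) n[OF that(2)]] by simp
  have mult: "f \<otimes>\<^bsub>G\<^esub> g = f + g" and one: "\<one>\<^bsub>G\<^esub> = 0" and car: "carrier G = tor_cycles A gr P i j" for f g
    by (auto simp: G_def add_eq zero_eq zero_fun_def fun_eq_iff)
  have G: "comm_group G"
  proof (rule comm_groupI)
    show "\<exists>y\<in>carrier G. y \<otimes>\<^bsub>G\<^esub> x = \<one>\<^bsub>G\<^esub>" if "x \<in> carrier G" for x
      using n[of x] that by (intro bexI[of _ "- x"]) (auto simp: mult one car)
  qed (auto simp: mult one car z a add.assoc add.commute)
  have "tor_bdry A gr P i ` tor_chains A gr P (Suc i) j = carrier G"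
  proof
    show "carrier G \<subseteq> tor_bdry A gr P i ` tor_chains A gr P (Suc i) j"
      using tor_cycle_is_boundary[OF Q lin_Q P ij] by (auto simp: car)
    show "tor_bdry A gr P i ` tor_chains A gr P (Suc i) j \<subseteq> carrier G"
    proof
      fix f assume "f \<in> tor_bdry A gr P i ` tor_chains A gr P (Suc i) j"
      then obtain g where g: "g \<in> tor_chains A gr P (Suc i) j" and f: "f = tor_bdry A gr P i g" by auto
      have gc: "g \<in> chains P (Suc i)" using g by (auto simp: tor_chains_iff)
      have "red (lin (bdry P i') (red (lin (bdry P i) g))) = 0" if "i = Suc i'" for i'
      proof -
        have "lin (bdry P i) g \<in> chains P (Suc i')" using lin_closed[OF gc iP] that by auto
        then have "red (lin (bdry P i') (red (lin (bdry P i) g))) = red (lin (bdry P i') (lin (bdry P i) g))"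
          by (rule red_lin_red[OF _ iP])
        also have "lin (bdry P i') (lin (bdry P i) g) = 0"
          using cyc_lin(1)[OF P gc] that by (simp add: cyc_def)
        finally show ?thesis unfolding red_0 .
      qed
      then show "f \<in> carrier G"
        using tor_bdry_chains[OF P g] unfolding f tor_bdry_eq[OF P gc] car cyc by (auto split: nat.splits)
    qed
  qed
  then have "Tor A gr i j = G Mod carrier G"
    by (simp add: Tor_def Let_def P_def[symmetric] G_def)
  then show "trivial_group (Tor A gr i j)" using trivial_Mod_self[OF G] by simp
qed

end

section \<open>Linear resolutions\<close>

lemma finite_support_compose:
  assumes "finite {a. x a \<noteq> 0}" "h 0 = 0"
  shows "finite {a. h (x a) \<noteq> 0}"
  by (rule finite_subset[OF _ assms(1)]) (use assms(2) in auto)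

lemma finite_support_diff:
  fixes x y :: "'i \<Rightarrow> 'a::ab_group_add"
  assumes "finite {a. x a \<noteq> 0}" "finite {a. y a \<noteq> 0}"
  shows "finite {a. x a - y a \<noteq> 0}"
  by (rule finite_subset[OF _ finite_UnI[OF assms]]) auto

text \<open>A self-delimiting code over two distinguished letters: each word is preceded by its
  length in unary, as copies of \<open>e\<close> closed by \<open>z\<close>. It can be decoded
  whenever \<open>e \<noteq> z\<close>, whatever letters the words contain.\<close>

fun flat :: "'a \<Rightarrow> 'a \<Rightarrow> 'a list list \<Rightarrow> 'a list" where
  "flat e z [] = []"
| "flat e z (w # ws) = replicate (length w) e @ z # w @ flat e z ws"

lemma replicate_append_cancel:
  assumes "e \<noteq> z" "replicate m e @ z # xs = replicate n e @ z # ys"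
  shows "m = n \<and> xs = ys"
  using assms(2)
proof (induction m arbitrary: n)
  case 0
  then show ?case using assms(1) by (cases n) auto
next
  case (Suc m)
  then show ?case using assms(1) by (cases n) auto
qed

lemma flat_inject:
  assumes "e \<noteq> z" "flat e z xs = flat e z ys" shows "xs = ys"
  using assms(2)
proof (induction xs arbitrary: ys)
  case Nil
  then show ?case by (cases ys) auto
next
  case (Cons w ws)
  then obtain w' ws' where ys: "ys = w' # ws'" by (cases ys) auto
  have "length w = length w' \<and> w @ flat e z ws = w' @ flat e z ws'"
    by (rule replicate_append_cancel[OF assms(1)]) (use Cons.prems in \<open>simp add: ys\<close>)
  then have "w = w' \<and> flat e z ws = flat e z ws'" by (metis append_eq_append_conv)
  then show ?case using Cons.IH[of ws'] by (simp add: ys)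
qed

text \<open>This is what lets lists over the algebra index the bases of all modules of a resolution.\<close>

lemma finite_support_encoding:
  fixes e :: "'a::ab_group_add"
  assumes "e \<noteq> 0"
  shows "\<exists>enc :: ('a list \<Rightarrow> 'a) \<Rightarrow> 'a list. inj_on enc {f. finite {w. f w \<noteq> 0}}"
proof -
  \<comment> \<open>The function is listed as its graph on the support, each argument prefixed by
    its value. The enumeration is arbitrary, since only the set of entries is used to recover
    \<open>f\<close>.\<close>
  define L where "L f = map (\<lambda>w. f w # w) (SOME xs. set xs = {w. f w \<noteq> 0})" for f :: "'a list \<Rightarrow> 'a"
  have L: "set (L f) = (\<lambda>w. f w # w) ` {w. f w \<noteq> 0}" if "finite {w. f w \<noteq> 0}" for f
    unfolding L_def using someI_ex[OF finite_list[OF that]] by simp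
  have "inj_on (\<lambda>f. flat e 0 (L f)) {f. finite {w. f w \<noteq> 0}}"
  proof (rule inj_onI)
    fix f g :: "'a list \<Rightarrow> 'a"
    assume fg: "f \<in> {f. finite {w. f w \<noteq> 0}}" "g \<in> {f. finite {w. f w \<noteq> 0}}" "flat e 0 (L f) = flat e 0 (L g)"
    then have "L f = L g" by (intro flat_inject[OF assms])
    then have eq: "(\<lambda>w. f w # w) ` {w. f w \<noteq> 0} = (\<lambda>w. g w # w) ` {w. g w \<noteq> 0}" using L[of f] L[of g] fg(1,2) by simp
    have "f w = g w" for w
    proof (cases "f w = 0 \<and> g w = 0")
      case False
      then have "f w # w \<in> (\<lambda>w. g w # w) ` {w. g w \<noteq> 0} \<or> g w # w \<in> (\<lambda>w. f w # w) ` {w. f w \<noteq> 0}"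
        using eq by blast
      then show ?thesis by auto
    qed auto
    then show "f = g" by auto
  qed
  then show ?thesis by blast
qed

text \<open>The last assumption is the bound on \<open>Tor\<close> over the exterior algebra: Koszul
  cycles with values in degree at least two bound. Multi-indices are all functions on
  \<open>nat\<close>; only the coordinates in \<open>{1..u}\<close> are shifted, so the complex is a
  direct sum of copies of the usual one.\<close>

locale koszul_module_algebra = additive_graded_algebra A gr
  for A :: "('k::field, 'a::ab_group_add, 'm) module_scheme" (structure) and gr +
  fixes u :: nat and \<eta> :: "nat \<Rightarrow> 'a"
  assumes \<eta>_gr: "s \<in> {1..u} \<Longrightarrow> \<eta> s \<in> gr 1"
    and \<eta>_square: "s \<in> {1..u} \<Longrightarrow> \<eta> s \<otimes> \<eta> s = 0"
    and \<eta>_anticommute: "s \<in> {1..u} \<Longrightarrow> t \<in> {1..u} \<Longrightarrow> s \<noteq> t \<Longrightarrow> \<eta> s \<otimes> \<eta> t = - (\<eta> t \<otimes> \<eta> s)"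
    and koszul_exact: "finite {a. x a \<noteq> 0} \<Longrightarrow> (\<And>a. x a \<in> gr (Suc (Suc m))) \<Longrightarrow>
      (\<And>a. (\<Sum>s\<in>{1..u}. \<eta> s \<otimes> x (a(s := Suc (a s)))) = 0) \<Longrightarrow>
      \<exists>y. finite {a. y a \<noteq> 0} \<and> (\<forall>a. y a \<in> gr (Suc m)) \<and> (\<forall>a. x a = (\<Sum>s\<in>{1..u}. \<eta> s \<otimes> y (a(s := Suc (a s)))))"
begin

lemma \<eta>_carrier: "s \<in> {1..u} \<Longrightarrow> \<eta> s \<in> carrier A"
  using \<eta>_gr gr_carrier by blast

definition koszul_d :: "((nat \<Rightarrow> nat) \<Rightarrow> 'b \<Rightarrow> 'a) \<Rightarrow> (nat \<Rightarrow> nat) \<Rightarrow> 'b \<Rightarrow> 'a" where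
  "koszul_d x a = (\<Sum>s\<in>{1..u}. (\<lambda>b. \<eta> s \<otimes> x (a(s := Suc (a s))) b))"

lemma koszul_d_apply: "koszul_d x a b = (\<Sum>s\<in>{1..u}. \<eta> s \<otimes> x (a(s := Suc (a s))) b)"
  by (simp add: koszul_d_def sum_fun_apply)

lemma koszul_d_diff:
  assumes "\<And>a b. x a b \<in> carrier A" "\<And>a b. y a b \<in> carrier A"
  shows "koszul_d (\<lambda>a. x a - y a) a = koszul_d x a - koszul_d y a"
proof
  fix b
  have "\<eta> s \<otimes> (x a b - y a b) = \<eta> s \<otimes> x a b - \<eta> s \<otimes> y a b" if "s \<in> {1..u}" for s a
    using distr_r[of "\<eta> s" "x a b - y a b" "y a b"] \<eta>_carrier[OF that] assms carrier_diff by (simp add: eq_diff_eq)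
  then show "koszul_d (\<lambda>a. x a - y a) a b = (koszul_d x a - koszul_d y a) b"
    by (simp add: koszul_d_apply sum_subtractf)
qed

lemma koszul_d_square:
  assumes "\<And>a b. x a b \<in> carrier A"
  shows "koszul_d (koszul_d x) a = 0"
proof
  fix b
  have "koszul_d (koszul_d x) a b = (\<Sum>s\<in>{1..u}. \<Sum>t\<in>{1..u}. (\<eta> s \<otimes> \<eta> t) \<otimes> x (a(s := Suc (a s), t := Suc ((a(s := Suc (a s))) t))) b)"
    unfolding koszul_d_apply
  proof (rule sum.cong[OF refl])
    fix s assume s: "s \<in> {1..u}"
    let ?a = "a(s := Suc (a s))"
    have "\<eta> s \<otimes> (\<Sum>t\<in>{1..u}. \<eta> t \<otimes> x (?a(t := Suc (?a t))) b) = (\<Sum>t\<in>{1..u}. \<eta> s \<otimes> (\<eta> t \<otimes> x (?a(t := Suc (?a t))) b))"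
      by (rule mult_sum_r) (use s \<eta>_carrier assms in auto)
    also have "\<dots> = (\<Sum>t\<in>{1..u}. (\<eta> s \<otimes> \<eta> t) \<otimes> x (?a(t := Suc (?a t))) b)"
      by (rule sum.cong[OF refl], rule m_assoc[symmetric]) (use s \<eta>_carrier assms in auto)
    finally show "\<eta> s \<otimes> (\<Sum>t\<in>{1..u}. \<eta> t \<otimes> x (?a(t := Suc (?a t))) b) = (\<Sum>t\<in>{1..u}. (\<eta> s \<otimes> \<eta> t) \<otimes> x (?a(t := Suc (?a t))) b)" .
  qed
  also have "\<dots> = 0"
  proof (rule sum_antisymmetric)
    fix s t assume st: "s \<in> {1..u}" "t \<in> {1..u}" "s \<noteq> t"
    have eq: "a(s := Suc (a s), t := Suc ((a(s := Suc (a s))) t)) = a(t := Suc (a t), s := Suc ((a(t := Suc (a t))) s))"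
      using st(3) by (auto simp: fun_eq_iff)
    have "(- (\<eta> t \<otimes> \<eta> s)) \<otimes> z = - ((\<eta> t \<otimes> \<eta> s) \<otimes> z)" if "z \<in> carrier A" for z
    proof -
      have c: "\<eta> t \<otimes> \<eta> s \<in> carrier A" using \<eta>_carrier st by auto
      have "(- (\<eta> t \<otimes> \<eta> s)) \<otimes> z + (\<eta> t \<otimes> \<eta> s) \<otimes> z = 0"
        using distr_l[OF carrier_uminus[OF c] c that] that by simp
      then show ?thesis by (simp add: eq_neg_iff_add_eq_0)
    qed
    then show "(\<eta> s \<otimes> \<eta> t) \<otimes> x (a(s := Suc (a s), t := Suc ((a(s := Suc (a s))) t))) b =
       - ((\<eta> t \<otimes> \<eta> s) \<otimes> x (a(t := Suc (a t), s := Suc ((a(t := Suc (a t))) s))) b)"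
      unfolding eq \<eta>_anticommute[OF st] using assms by blast
  qed (use \<eta>_square assms in auto)
  finally show "koszul_d (koszul_d x) a b = 0 b" by simp
qed

text \<open>\<open>lin \<phi>\<close> is linear for multiplication from the left, the side on which
  the \<open>\<eta> s\<close> act; maps of free modules are therefore chain maps of Koszul
  complexes.\<close>

lemma koszul_d_lin:
  assumes "\<And>a. x a \<in> free_module A B" "is_matrix B C \<phi>"
  shows "lin \<phi> (koszul_d x a) = koszul_d (\<lambda>a. lin \<phi> (x a)) a"
proof -
  have "lin \<phi> (koszul_d x a) = (\<Sum>s\<in>{1..u}. lin \<phi> (\<lambda>b. \<eta> s \<otimes> x (a(s := Suc (a s))) b))"
    unfolding koszul_d_def by (rule lin_sum[OF _ assms(2)]) (use assms \<eta>_carrier in auto)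
  also have "\<dots> = koszul_d (\<lambda>a. lin \<phi> (x a)) a"
    unfolding koszul_d_def by (rule sum.cong[OF refl], rule lin_mult[OF _ _ assms(2)]) (use assms \<eta>_carrier in auto)
  finally show ?thesis .
qed

lemma koszul_d_gr:
  assumes "\<And>a b. x a b \<in> gr i" shows "koszul_d x a b \<in> gr (Suc i)"
  unfolding koszul_d_apply
proof (rule gr_sum)
  fix s assume s: "s \<in> {1..u}"
  show "\<eta> s \<otimes> x (a(s := Suc (a s))) b \<in> gr (Suc i)"
    using gr_mult[OF \<eta>_gr[OF s] assms] by simp
qed

lemma koszul_d_free: "(\<And>a. x a \<in> free_module A B) \<Longrightarrow> koszul_d x a \<in> free_module A B"
  unfolding koszul_d_def by (intro free_module_sum free_module_mult \<eta>_carrier)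

definition deg_part :: "nat \<Rightarrow> ('b \<Rightarrow> 'a) set \<Rightarrow> ('b \<Rightarrow> 'a) set" where
  "deg_part i Y = {f \<in> Y. \<forall>b. f b \<in> gr i}"

text \<open>The invariant of the construction: a submodule of a free module with generators of degree \<open>0\<close>,
  such that \<open>Tor\<^sub>q\<close> over the exterior algebra of the \<open>\<eta> s\<close> vanishes in degrees above \<open>q + 1\<close>.\<close>

definition stage_closed :: "'b set \<Rightarrow> ('b \<Rightarrow> 'a) set \<Rightarrow> bool" where
  "stage_closed B Y \<longleftrightarrow> Y \<subseteq> free_module A B \<and> 0 \<in> Y \<and> (\<forall>f\<in>Y. \<forall>g\<in>Y. f - g \<in> Y) \<and>
     (\<forall>x\<in>carrier A. \<forall>f\<in>Y. (\<lambda>b. x \<otimes> f b) \<in> Y) \<and> (\<forall>f\<in>Y. \<forall>i. (\<lambda>b. cmp i (f b)) \<in> Y) \<and>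
     (\<forall>f\<in>deg_part 0 Y. f = 0)"

definition stage :: "'b set \<Rightarrow> ('b \<Rightarrow> 'a) set \<Rightarrow> bool" where
  "stage B Y \<longleftrightarrow> stage_closed B Y \<and>
     (\<forall>i x. finite {a. x a \<noteq> 0} \<longrightarrow> (\<forall>a. x a \<in> deg_part (Suc (Suc i)) Y) \<longrightarrow> (\<forall>a. koszul_d x a = 0) \<longrightarrow>
        (\<exists>y. finite {a. y a \<noteq> 0} \<and> (\<forall>a. y a \<in> deg_part (Suc i) Y) \<and> (\<forall>a. x a = koszul_d y a)))"

lemma stageD:
  assumes "stage B Y"
  shows "f \<in> Y \<Longrightarrow> f \<in> free_module A B" "0 \<in> Y" "f \<in> Y \<Longrightarrow> g \<in> Y \<Longrightarrow> f - g \<in> Y"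
    "x \<in> carrier A \<Longrightarrow> f \<in> Y \<Longrightarrow> (\<lambda>b. x \<otimes> f b) \<in> Y" "f \<in> Y \<Longrightarrow> (\<lambda>b. cmp i (f b)) \<in> Y"
    "f \<in> deg_part 0 Y \<Longrightarrow> f = 0"
proof -
  note S = conjunct1[OF assms[unfolded stage_def], unfolded stage_closed_def]
  have 1: "Y \<subseteq> free_module A B" using S by (elim conjE)
  show "f \<in> Y \<Longrightarrow> f \<in> free_module A B" using 1 by (rule subsetD)
  show "0 \<in> Y" using S by (elim conjE)
  have 3: "\<forall>f\<in>Y. \<forall>g\<in>Y. f - g \<in> Y" using S by (elim conjE)
  show "f \<in> Y \<Longrightarrow> g \<in> Y \<Longrightarrow> f - g \<in> Y" by (rule bspec[OF bspec[OF 3]])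
  have 4: "\<forall>x\<in>carrier A. \<forall>f\<in>Y. (\<lambda>b. x \<otimes> f b) \<in> Y" using S by (elim conjE)
  show "x \<in> carrier A \<Longrightarrow> f \<in> Y \<Longrightarrow> (\<lambda>b. x \<otimes> f b) \<in> Y" by (rule bspec[OF bspec[OF 4]])
  have 5: "\<forall>f\<in>Y. \<forall>i. (\<lambda>b. cmp i (f b)) \<in> Y" using S by (elim conjE)
  show "f \<in> Y \<Longrightarrow> (\<lambda>b. cmp i (f b)) \<in> Y" by (rule spec[OF bspec[OF 5]])
  have 6: "\<forall>f\<in>deg_part 0 Y. f = 0" using S by (elim conjE)
  show "f \<in> deg_part 0 Y \<Longrightarrow> f = 0" by (rule bspec[OF 6])
qed

lemma stage_exact:
  assumes "stage B Y" "finite {a. x a \<noteq> 0}" "\<And>a. x a \<in> deg_part (Suc (Suc i)) Y" "\<And>a. koszul_d x a = 0"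
  obtains y where "finite {a. y a \<noteq> 0}" "\<And>a. y a \<in> deg_part (Suc i) Y" "\<And>a. x a = koszul_d y a"
proof -
  have "\<exists>y. finite {a. y a \<noteq> 0} \<and> (\<forall>a. y a \<in> deg_part (Suc i) Y) \<and> (\<forall>a. x a = koszul_d y a)"
    by (rule mp[OF mp[OF mp[OF spec[OF spec[OF conjunct2[OF assms(1)[unfolded stage_def]]]]]]]) (use assms(2-) in auto)
  then show ?thesis using that by (elim exE conjE) (erule that, (erule spec)+)
qed

lemma stage_add: assumes "stage B Y" "f \<in> Y" "g \<in> Y" shows "f + g \<in> Y"
  using stageD(3)[OF assms(1,2) stageD(3)[OF assms(1) stageD(2)[OF assms(1)] assms(3)]] by simp

lemma stage_sum: assumes "stage B Y" "\<And>i. i \<in> S \<Longrightarrow> f i \<in> Y" shows "sum f S \<in> Y"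
  using assms(2)
  by (induction S rule: infinite_finite_induct)
    (auto simp: stageD(2)[OF assms(1)] stage_add[OF assms(1)] simp del: plus_fun_apply zero_fun_apply)

text \<open>The starting module is the augmentation ideal inside the free module of rank one. In
  positive degrees it coincides with the algebra, and its invariant involves only such degrees, so
  \<open>koszul_exact\<close> applies.\<close>

lemma base_stage: "stage {b} {f \<in> free_module A {b}. red f = 0}"
  unfolding stage_def stage_closed_def
proof (intro conjI allI impI ballI)
  show "{f \<in> free_module A {b}. red f = 0} \<subseteq> free_module A {b}" by blast
  show "0 \<in> {f \<in> free_module A {b}. red f = 0}" by (simp only: mem_Collect_eq red_0 free_module_0 simp_thms)
  show "f - g \<in> {f \<in> free_module A {b}. red f = 0}"
    if "f \<in> {f \<in> free_module A {b}. red f = 0}" "g \<in> {f \<in> free_module A {b}. red f = 0}" for f g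
    using that by (simp add: red_diff[where B="{b}"] free_module_diff)
  show "(\<lambda>c. x \<otimes> f c) \<in> {f \<in> free_module A {b}. red f = 0}"
    if "x \<in> carrier A" "f \<in> {f \<in> free_module A {b}. red f = 0}" for x f
    using that by (auto simp: red_def fun_eq_iff cmp_0_mult free_moduleD(2) cmp_carrier)
  show "(\<lambda>c. cmp i (f c)) \<in> {f \<in> free_module A {b}. red f = 0}" if f: "f \<in> {f \<in> free_module A {b}. red f = 0}" for i f
  proof -
    have ff: "f \<in> free_module A {b}" and r: "cmp 0 (f c) = 0" for c using f by (auto simp: red_def fun_eq_iff)
    have "finite {c. cmp i (f c) \<noteq> 0}" by (rule finite_support_compose[OF free_moduleD(1)[OF ff]]) simp
    moreover have "cmp 0 (cmp i (f c)) = 0" for c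
      using cmp_gr[OF cmp_props(1)[OF free_moduleD(2)[OF ff]], of 0 i c] r by auto
    ultimately show ?thesis using ff by (auto simp: free_module_iff red_def fun_eq_iff)
  qed
  show "f = 0" if "f \<in> deg_part 0 {f \<in> free_module A {b}. red f = 0}" for f
    using that cmp_gr[of _ 0 0] by (fastforce simp: deg_part_def red_def fun_eq_iff)
  fix i :: nat and x :: "(nat \<Rightarrow> nat) \<Rightarrow> 'b \<Rightarrow> 'a"
  assume x: "finite {a. x a \<noteq> 0}" "\<forall>a. x a \<in> deg_part (Suc (Suc i)) {f \<in> free_module A {b}. red f = 0}"
    "\<forall>a. koszul_d x a = 0"
  have "\<exists>y. finite {a. y a \<noteq> 0} \<and> (\<forall>a. y a \<in> gr (Suc i)) \<and> (\<forall>a. x a b = (\<Sum>s\<in>{1..u}. \<eta> s \<otimes> y (a(s := Suc (a s)))))"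
  proof (rule koszul_exact)
    show "finite {a. x a b \<noteq> 0}" by (rule finite_support_compose[OF x(1)]) simp
    show "x a b \<in> gr (Suc (Suc i))" for a using x(2) by (simp add: deg_part_def)
    show "(\<Sum>s\<in>{1..u}. \<eta> s \<otimes> x (a(s := Suc (a s))) b) = 0" for a
      using x(3) koszul_d_apply[of x a b] by simp
  qed
  then obtain y where y: "finite {a. y a \<noteq> 0}" "\<And>a. y a \<in> gr (Suc i)"
    "\<And>a. x a b = (\<Sum>s\<in>{1..u}. \<eta> s \<otimes> y (a(s := Suc (a s))))" by blast
  show "\<exists>y. finite {a. y a \<noteq> 0} \<and> (\<forall>a. y a \<in> deg_part (Suc i) {f \<in> free_module A {b}. red f = 0}) \<and> (\<forall>a. x a = koszul_d y a)"
  proof (intro exI[of _ "\<lambda>a c. if c = b then y a else 0"] conjI allI)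
    show "finite {a. (\<lambda>c. if c = b then y a else 0) \<noteq> 0}"
      by (rule finite_subset[OF _ y(1)]) (auto simp: fun_eq_iff)
    have "finite {c. (if c = b then y a else 0) \<noteq> 0}" for a by (rule finite_subset[of _ "{b}"]) auto
    then show "(\<lambda>c. if c = b then y a else 0) \<in> deg_part (Suc i) {f \<in> free_module A {b}. red f = 0}" for a
      using y(2)[of a] cmp_gr[OF y(2)[of a], of 0] by (auto simp: deg_part_def free_module_iff red_def fun_eq_iff gr_carrier)
    show "x a = koszul_d (\<lambda>a c. if c = b then y a else 0) a" for a
    proof
      fix c
      show "x a c = koszul_d (\<lambda>a c. if c = b then y a else 0) a c"
      proof (cases "c = b")
        case False
        then have "x a c = 0" using x(2) by (auto simp: deg_part_def free_module_iff)
        then show ?thesis using False \<eta>_carrier by (simp add: koszul_d_apply)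
      qed (simp add: koszul_d_apply y(3))
    qed
  qed
qed

lemma vector_space_fun: "vector_space (\<lambda>c (f :: 'b \<Rightarrow> 'a) b. c \<odot> f b)"
proof -
  interpret V: vector_space "smult A" by (rule vector_space_smult)
  show ?thesis
    by standard (auto simp: fun_eq_iff V.scale_right_distrib V.scale_left_distrib)
qed

text \<open>A basis over \<open>k\<close> of the degree one part, chosen as a maximal independent
  set since the dimension may be infinite. It supplies the generators of the next free
  module.\<close>

definition basis_of :: "('b \<Rightarrow> 'a) set \<Rightarrow> ('b \<Rightarrow> 'a) set" where
  "basis_of Y = (SOME V. V \<subseteq> deg_part 1 Y \<and> \<not> module.dependent (\<lambda>c f b. c \<odot> f b) V \<and>
     deg_part 1 Y \<subseteq> module.span (\<lambda>c f b. c \<odot> f b) V)"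

lemma basis_of:
  shows "basis_of Y \<subseteq> deg_part 1 Y" "\<not> module.dependent (\<lambda>c f b. c \<odot> f b) (basis_of Y)"
    "deg_part 1 Y \<subseteq> module.span (\<lambda>c f b. c \<odot> f b) (basis_of Y)"
proof -
  interpret V: vector_space "\<lambda>c (f :: 'b \<Rightarrow> 'a) b. c \<odot> f b" by (rule vector_space_fun)
  have "\<exists>V. V \<subseteq> deg_part 1 Y \<and> \<not> V.dependent V \<and> deg_part 1 Y \<subseteq> V.span V"
    using V.maximal_independent_subset[of "deg_part 1 Y"] by metis
  from someI_ex[OF this] show "basis_of Y \<subseteq> deg_part 1 Y" "\<not> V.dependent (basis_of Y)"
    "deg_part 1 Y \<subseteq> V.span (basis_of Y)" unfolding basis_of_def by blast+
qed

section \<open>One step of the resolution: free cover of a stage and its kernel\<close>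

context
  fixes B :: "'b set" and Y :: "('b \<Rightarrow> 'a) set" and B' :: "'c set" and \<phi> :: "'c \<Rightarrow> 'b \<Rightarrow> 'a"
  assumes Y: "stage B Y" and \<phi>: "bij_betw \<phi> B' (basis_of Y)"
begin

lemma next_entry: "b \<in> B' \<Longrightarrow> \<phi> b \<in> Y" "b \<in> B' \<Longrightarrow> \<phi> b c \<in> gr 1"
  using bij_betwE[OF \<phi>] basis_of(1)[of Y] by (auto simp: deg_part_def)

lemma next_matrix: "is_matrix B' B \<phi>"
  using next_entry(1) stageD(1)[OF Y] by (auto simp: is_matrix_def)

text \<open>A stage is normalised to sit in a free module generated in degree 0; the parameter
  \<open>d\<close> puts back the true degrees, \<open>d = n\<close> at position \<open>n\<close> of
  the resolution.\<close>

lemma next_graded_matrix: "graded_matrix B' (\<lambda>_. Suc d) B (\<lambda>_. d) \<phi>"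
  using next_matrix next_entry(2) by (auto simp: graded_matrix_def homog_def grd_def)

lemma next_range: assumes "f \<in> free_module A B'" shows "lin \<phi> f \<in> Y"
  unfolding lin_def
proof (rule stage_sum[OF Y])
  fix b assume "b \<in> {b. f b \<noteq> 0}"
  then have "b \<in> B'" using free_module_support[OF assms] by auto
  then show "(\<lambda>c. f b \<otimes> \<phi> b c) \<in> Y"
    by (intro stageD(4)[OF Y] free_moduleD(2)[OF assms] next_entry)
qed

lemma next_degree:
  assumes "f \<in> free_module A B'" "\<And>b. f b \<in> gr i" shows "lin \<phi> f \<in> deg_part (Suc i) Y"
  unfolding deg_part_def
proof (intro CollectI conjI allI)
  show "lin \<phi> f c \<in> gr (Suc i)" for c
    unfolding lin_apply
  proof (rule gr_sum)
    fix b assume "b \<in> {b. f b \<noteq> 0}"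
    then have "b \<in> B'" using free_module_support[OF assms(1)] by auto
    from gr_mult[OF assms(2) next_entry(2)[OF this]] show "f b \<otimes> \<phi> b c \<in> gr (Suc i)" by simp
  qed
qed (rule next_range[OF assms(1)])

lemma scalar_mult: "x \<in> carrier A \<Longrightarrow> (c \<odot> \<one>) \<otimes> x = c \<odot> x"
  using smult_mult_l[of \<one> x c] by simp

lemma scalar_gr: "c \<odot> \<one> \<in> gr 0"
  using gr_smult[OF gr_one] .

lemma scalar_zero: "c \<odot> \<one> = 0 \<longleftrightarrow> c = 0"
proof -
  interpret V: vector_space "smult A" by (rule vector_space_smult)
  have "inj (\<lambda>c. c \<odot> \<one>)" using gr_0 by (simp add: bij_betw_def)
  moreover have "0 \<odot> \<one> = 0" by simp
  ultimately show ?thesis by (metis injD)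
qed

text \<open>Exactness at homological degree 0 says that degree one generates: an element of higher
  degree is a combination of the \<open>\<eta> s\<close> with coefficients in the module one degree
  lower, and induction applies to these. In degree one itself the chosen basis spans.\<close>

lemma next_surj:
  assumes "f \<in> deg_part (Suc i) Y"
  shows "\<exists>g\<in>free_module A B'. (\<forall>b. g b \<in> gr i) \<and> lin \<phi> g = f"
  using assms
proof (induction i arbitrary: f)
  case 0
  interpret V: vector_space "\<lambda>c (f :: 'b \<Rightarrow> 'a) b. c \<odot> f b" by (rule vector_space_fun)
  have "f \<in> V.span (basis_of Y)" using basis_of(3)[of Y] 0 by auto
  then obtain t r where t: "finite t" "t \<subseteq> basis_of Y" "f = (\<Sum>w\<in>t. (\<lambda>b. r w \<odot> w b))"
    unfolding V.span_explicit by blast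
  define g where "g b = (if b \<in> B' \<and> \<phi> b \<in> t then r (\<phi> b) \<odot> \<one> else 0)" for b
  define T where "T = {b \<in> B'. \<phi> b \<in> t}"
  have T: "bij_betw \<phi> T t"
    using \<phi> t(2) unfolding bij_betw_def T_def inj_on_def by auto
  then have finT: "finite T" using t(1) bij_betw_finite by blast
  have sub: "{b. g b \<noteq> 0} \<subseteq> T" "T \<subseteq> B'" by (auto simp: g_def T_def)
  have g0: "g b \<in> gr 0" for b using scalar_gr by (auto simp: g_def)
  have g: "g \<in> free_module A B'"
    using finite_subset[OF sub(1) finT] gr_carrier[OF g0] by (auto simp: free_module_iff) (simp add: g_def)
  have "lin \<phi> g = (\<Sum>b\<in>T. (\<lambda>c. g b \<otimes> \<phi> b c))" by (rule lin_eq[OF g finT sub next_matrix])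
  also have "\<dots> = (\<Sum>b\<in>T. (\<lambda>c. r (\<phi> b) \<odot> \<phi> b c))"
    by (rule sum.cong[OF refl])
      (auto simp: T_def g_def fun_eq_iff intro!: scalar_mult is_matrixD(2)[OF next_matrix])
  also have "\<dots> = f" unfolding t(3) by (rule sum.reindex_bij_betw[OF T])
  finally show ?case using g g0 by blast
next
  case (Suc i)
  \<comment> \<open>Placed at the multi-index 0, any element is a Koszul cycle: a shifted index is
    never 0.\<close>
  define x where "x a = (if a = (\<lambda>_. 0) then f else 0)" for a :: "nat \<Rightarrow> nat"
  have nz: "a(s := Suc (a s)) \<noteq> (\<lambda>_. 0)" for a :: "nat \<Rightarrow> nat" and s by (metis fun_upd_same nat.distinct(1))
  have x1: "finite {a. x a \<noteq> 0}" by (rule finite_subset[of _ "{\<lambda>_. 0}"]) (auto simp: x_def)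
  have x2: "x a \<in> deg_part (Suc (Suc i)) Y" for a
    using Suc.prems stageD(2)[OF Y] by (auto simp: x_def deg_part_def)
  have x3: "koszul_d x a = 0" for a
  proof -
    have "x (a(s := Suc (a s))) = 0" for s unfolding x_def by (rule if_not_P[OF nz])
    then show ?thesis using \<eta>_carrier by (simp add: koszul_d_apply fun_eq_iff)
  qed
  obtain y where y: "finite {a. y a \<noteq> 0}" "\<And>a. y a \<in> deg_part (Suc i) Y" "\<And>a. x a = koszul_d y a"
    by (rule stage_exact[OF Y x1 x2 x3]) (rule that, assumption, blast, blast)
  from bchoice[OF ballI[OF Suc.IH[OF y(2), unfolded Bex_def]], of UNIV]
  obtain g where g': "\<forall>a\<in>UNIV. g a \<in> free_module A B' \<and> (\<forall>b. g a b \<in> gr i) \<and> lin \<phi> (g a) = y a" by (rule exE)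
  then have g: "g a \<in> free_module A B'" "g a b \<in> gr i" "lin \<phi> (g a) = y a" for a b by simp_all
  have "lin \<phi> (koszul_d g (\<lambda>_. 0)) = koszul_d (\<lambda>a. lin \<phi> (g a)) (\<lambda>_. 0)"
    by (rule koszul_d_lin[OF g(1) next_matrix])
  also have "\<dots> = f" unfolding g(3) y(3)[symmetric] by (simp add: x_def)
  finally have "lin \<phi> (koszul_d g (\<lambda>_. 0)) = f" .
  then show ?case
    by (intro bexI[of _ "koszul_d g (\<lambda>_. 0)"] conjI allI koszul_d_gr[where x=g, OF g(2)] koszul_d_free[where x=g, OF g(1)])
qed

text \<open>Homogeneous components of an element of \<open>Y\<close> stay in \<open>Y\<close>; that
  of degree 0 vanishes and the others are covered by \<open>next_surj\<close>.\<close>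

lemma next_image: "lin \<phi> ` free_module A B' = Y"
proof
  show "lin \<phi> ` free_module A B' \<subseteq> Y" using next_range by auto
  show "Y \<subseteq> lin \<phi> ` free_module A B'"
  proof
    fix f assume f: "f \<in> Y"
    note ff = stageD(1)[OF Y f]
    define N where "N = (\<Union>b\<in>{b. f b \<noteq> 0}. {i. cmp i (f b) \<noteq> 0})"
    have N: "finite N" unfolding N_def using free_moduleD(1,2)[OF ff] cmp_props(2) by auto
    have "f = (\<Sum>i\<in>N. (\<lambda>b. cmp i (f b)))"
    proof
      fix b
      have "{n. cmp n (f b) \<noteq> 0} \<subseteq> N" by (cases "f b = 0") (auto simp: N_def)
      then show "f b = (\<Sum>i\<in>N. (\<lambda>b. cmp i (f b))) b"
        unfolding sum_fun_apply by (rule cmp_sum_superset[OF free_moduleD(2)[OF ff] N])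
    qed
    moreover have "\<exists>g\<in>free_module A B'. lin \<phi> g = (\<lambda>b. cmp i (f b))" for i
    proof -
      have p: "(\<lambda>b. cmp i (f b)) \<in> deg_part i Y"
        using stageD(5)[OF Y f] cmp_props(1)[OF free_moduleD(2)[OF ff]] by (auto simp: deg_part_def)
      show ?thesis
      proof (cases i)
        case 0
        then have "(\<lambda>b. cmp i (f b)) = 0" using stageD(6)[OF Y] p by blast
        then show ?thesis by (metis lin_0 free_module_0)
      qed (use next_surj p in blast)
    qed
    then obtain g where g: "\<And>i. g i \<in> free_module A B'" "\<And>i. lin \<phi> (g i) = (\<lambda>b. cmp i (f b))" by metis
    have "lin \<phi> (sum g N) = (\<Sum>i\<in>N. lin \<phi> (g i))" by (rule lin_sum[OF g(1) next_matrix])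
    ultimately have "f = lin \<phi> (sum g N)" unfolding g(2) by simp
    then show "f \<in> lin \<phi> ` free_module A B'" using free_module_sum[of N g B'] g(1) by blast
  qed
qed

text \<open>Coefficients in \<open>gr 0\<close> are scalars, so a relation among them contradicts
  the independence of the basis. The kernel consequently starts in degree one, as the invariant
  requires.\<close>

lemma next_injective:
  assumes f: "f \<in> free_module A B'" "\<And>b. f b \<in> gr 0" "lin \<phi> f = 0"
  shows "f = 0"
proof
  interpret V: vector_space "\<lambda>c (f :: 'b \<Rightarrow> 'a) b. c \<odot> f b" by (rule vector_space_fun)
  fix b0
  have "\<exists>c. f b = c \<odot> \<one>" for b using gr_0 f(2)[of b] by (auto simp: bij_betw_def image_iff)
  then obtain r where r: "\<And>b. f b = r b \<odot> \<one>" by metis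
  define T where "T = {b. f b \<noteq> 0}"
  have T: "finite T" "T \<subseteq> B'" using free_moduleD(1)[OF f(1)] free_module_support[OF f(1)] by (auto simp: T_def)
  have inj: "inj_on \<phi> T" using \<phi> T(2) by (meson bij_betw_def inj_on_subset)
  have "0 = (\<Sum>b\<in>T. (\<lambda>c. f b \<otimes> \<phi> b c))" using f(3) unfolding lin_def T_def by simp
  also have "\<dots> = (\<Sum>b\<in>T. (\<lambda>c. r b \<odot> \<phi> b c))"
    by (rule sum.cong[OF refl])
      (use T(2) in \<open>auto simp: fun_eq_iff r intro!: scalar_mult is_matrixD(2)[OF next_matrix]\<close>)
  also have "\<dots> = (\<Sum>w\<in>\<phi> ` T. (\<lambda>c. r (the_inv_into T \<phi> w) \<odot> w c))"
    by (subst sum.reindex[OF inj]) (simp add: the_inv_into_f_f[OF inj])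
  finally have s0: "(\<Sum>w\<in>\<phi> ` T. (\<lambda>c. r (the_inv_into T \<phi> w) \<odot> w c)) = 0" by simp
  have sub: "\<phi> ` T \<subseteq> basis_of Y" using T(2) bij_betwE[OF \<phi>] by blast
  show "f b0 = 0 b0"
  proof (cases "b0 \<in> T")
    case True
    have "r (the_inv_into T \<phi> (\<phi> b0)) = 0"
      by (rule V.independentD[OF basis_of(2) _ sub s0]) (use T True in auto)
    then have "r b0 = 0" using the_inv_into_f_f[OF inj True] by simp
    then show ?thesis using r[of b0] scalar_zero by simp
  qed (simp add: T_def)
qed

text \<open>The long exact sequence of \<open>Tor\<close> done by hand. A cycle \<open>x\<close> in
  the kernel bounds some \<open>y\<close> in the free module; \<open>lin \<phi>\<close> sends
  \<open>y\<close> to a cycle of \<open>Y\<close>, which bounds some \<open>z\<close>; a lift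
  \<open>g\<close> of \<open>z\<close> corrects \<open>y\<close> to \<open>y - koszul_d g\<close>,
  which lies in the kernel and still bounds \<open>x\<close>.\<close>

lemma next_stage: "stage B' {f \<in> free_module A B'. lin \<phi> f = 0}" (is "stage B' ?Y")
  unfolding stage_def stage_closed_def
proof (intro conjI allI impI ballI)
  note m = next_matrix
  show "?Y \<subseteq> free_module A B'" by blast
  show "0 \<in> ?Y" by (simp only: mem_Collect_eq lin_0 free_module_0 simp_thms)
  show "f - g \<in> ?Y" if "f \<in> ?Y" "g \<in> ?Y" for f g
    using that by (simp add: lin_diff[OF _ _ m] free_module_diff)
  show "(\<lambda>b. x \<otimes> f b) \<in> ?Y" if "x \<in> carrier A" "f \<in> ?Y" for x f
    using that lin_mult[OF that(1) _ m, of f] by (auto simp: fun_eq_iff)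
  show "(\<lambda>b. cmp i (f b)) \<in> ?Y" if f: "f \<in> ?Y" for i f
  proof -
    have ff: "f \<in> free_module A B'" and f0: "lin \<phi> f = 0" using f by auto
    \<comment> \<open>With generators in degree 1, entries of degree \<open>i\<close> make up the
      component of internal degree \<open>Suc i\<close>.\<close>
    have h: "hcomp (\<lambda>_. Suc 0) (Suc i) f = (\<lambda>b. cmp i (f b))" by (auto simp: hcomp_def cmpd_def)
    have "lin \<phi> (\<lambda>b. cmp i (f b)) = hcomp (\<lambda>_. 0) (Suc i) (lin \<phi> f)"
      using lin_hcomp[OF ff next_graded_matrix[of 0], of "Suc i"] unfolding h .
    then have "lin \<phi> (\<lambda>b. cmp i (f b)) = 0" unfolding f0 by (auto simp: hcomp_def fun_eq_iff)
    then show ?thesis using hcomp_closed(1)[OF ff, of "\<lambda>_. Suc 0" "Suc i"] unfolding h by blast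
  qed
  show "f = 0" if "f \<in> deg_part 0 ?Y" for f
    by (rule next_injective) (use that in \<open>auto simp: deg_part_def\<close>)
  fix i :: nat and x :: "(nat \<Rightarrow> nat) \<Rightarrow> 'c \<Rightarrow> 'a"
  assume x: "finite {a. x a \<noteq> 0}" "\<forall>a. x a \<in> deg_part (Suc (Suc i)) ?Y" "\<forall>a. koszul_d x a = 0"
  have xf: "x a \<in> free_module A B'" and x0: "lin \<phi> (x a) = 0" and xg: "x a b \<in> gr (Suc (Suc i))" for a b
    using x(2) by (auto simp: deg_part_def)
  have "\<exists>y. finite {a. y a \<noteq> 0} \<and> (\<forall>a. y a \<in> gr (Suc i)) \<and> (\<forall>a. x a b = (\<Sum>s\<in>{1..u}. \<eta> s \<otimes> y (a(s := Suc (a s)))))" for b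
  proof (rule koszul_exact)
    show "finite {a. x a b \<noteq> 0}" by (rule finite_support_compose[OF x(1)]) simp
    show "(\<Sum>s\<in>{1..u}. \<eta> s \<otimes> x (a(s := Suc (a s))) b) = 0" for a
      using x(3) koszul_d_apply[of x a b] by simp
  qed (rule xg)
  from choice[OF allI[OF this]] obtain y0 where y0': "\<forall>b. finite {a. y0 b a \<noteq> 0} \<and> (\<forall>a. y0 b a \<in> gr (Suc i)) \<and>
    (\<forall>a. x a b = (\<Sum>s\<in>{1..u}. \<eta> s \<otimes> y0 b (a(s := Suc (a s)))))" by (rule exE)
  have y0: "finite {a. y0 b a \<noteq> 0}" "y0 b a \<in> gr (Suc i)"
    "x a b = (\<Sum>s\<in>{1..u}. \<eta> s \<otimes> y0 b (a(s := Suc (a s))))" for a b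
  proof -
    note S = spec[OF y0', of b]
    show "finite {a. y0 b a \<noteq> 0}" by (rule conjunct1[OF S])
    show "y0 b a \<in> gr (Suc i)" by (rule spec[OF conjunct1[OF conjunct2[OF S]]])
    show "x a b = (\<Sum>s\<in>{1..u}. \<eta> s \<otimes> y0 b (a(s := Suc (a s))))" by (rule spec[OF conjunct2[OF conjunct2[OF S]]])
  qed
  define T where "T = (\<Union>a\<in>{a. x a \<noteq> 0}. {b. x a b \<noteq> 0})"
  have T: "finite T" unfolding T_def using x(1) free_moduleD(1)[OF xf] by auto
  have TB: "T \<subseteq> B'" unfolding T_def using free_module_support[OF xf] by blast
  have xT: "x a b = 0" if "b \<notin> T" for a b
    using that by (cases "x a = 0") (auto simp: T_def)
  \<comment> \<open>Solutions were chosen for each coordinate separately; off the finite set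
    \<open>T\<close>, where \<open>x\<close> vanishes, they are replaced by 0 to keep
    \<open>y\<close> finitely supported.\<close>
  define y where "y a b = (if b \<in> T then y0 b a else 0)" for a b
  have yfin: "finite {a. y a \<noteq> 0}"
    by (rule finite_subset[of _ "\<Union>b\<in>T. {a. y0 b a \<noteq> 0}"]) (use T y0(1) in \<open>auto simp: y_def fun_eq_iff split: if_splits\<close>)
  have yg: "y a b \<in> gr (Suc i)" for a b using y0(2) by (simp add: y_def)
  have yf: "y a \<in> free_module A B'" for a
  proof -
    have yT: "{b. y a b \<noteq> 0} \<subseteq> T" by (auto simp: y_def)
    show ?thesis using finite_subset[OF yT T] gr_carrier[OF yg] TB yT by (auto simp: free_module_iff)
  qed
  have xy: "x a = koszul_d y a" for a
  proof
    fix b show "x a b = koszul_d y a b"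
      by (cases "b \<in> T") (use y0(3) xT \<eta>_carrier in \<open>auto simp: koszul_d_apply y_def\<close>)
  qed
  define w where "w a = lin \<phi> (y a)" for a
  have w1: "finite {a. w a \<noteq> 0}" unfolding w_def by (rule finite_support_compose[where h="lin \<phi>", OF yfin lin_0])
  have w2: "w a \<in> deg_part (Suc (Suc i)) Y" for a unfolding w_def by (rule next_degree[OF yf yg])
  have w3: "koszul_d w a = 0" for a
    unfolding w_def koszul_d_lin[OF yf m, symmetric] xy[symmetric] by (rule x0)
  obtain z where z: "finite {a. z a \<noteq> 0}" "\<And>a. z a \<in> deg_part (Suc i) Y" "\<And>a. w a = koszul_d z a"
    by (rule stage_exact[OF Y w1 w2 w3]) (rule that, assumption, blast, blast)
  \<comment> \<open>The clause \<open>z a = 0 \<longrightarrow> g = 0\<close> makes the chosen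
    family of lifts finitely supported.\<close>
  have "\<exists>g. g \<in> free_module A B' \<and> (\<forall>b. g b \<in> gr i) \<and> lin \<phi> g = z a \<and> (z a = 0 \<longrightarrow> g = 0)" for a
  proof (cases "z a = 0")
    case True
    have "0 \<in> free_module A B' \<and> (\<forall>b. (0 :: 'c \<Rightarrow> 'a) b \<in> gr i) \<and> lin \<phi> 0 = z a \<and> (z a = 0 \<longrightarrow> (0 :: 'c \<Rightarrow> 'a) = 0)"
      unfolding True lin_0 by simp
    then show ?thesis by (rule exI[where x="0 :: 'c \<Rightarrow> 'a"])
  qed (use next_surj[OF z(2)[of a]] in blast)
  from choice[OF allI[OF this]] obtain g where g': "\<forall>a. g a \<in> free_module A B' \<and> (\<forall>b. g a b \<in> gr i) \<and>
    lin \<phi> (g a) = z a \<and> (z a = 0 \<longrightarrow> g a = 0)" by (rule exE)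
  then have g: "g a \<in> free_module A B'" "g a b \<in> gr i" "lin \<phi> (g a) = z a" "z a = 0 \<Longrightarrow> g a = 0" for a b by simp_all
  have gfin: "finite {a. g a \<noteq> 0}" by (rule finite_subset[OF _ z(1)]) (use g(4) in auto)
  have dgfin: "finite {a. koszul_d g a \<noteq> 0}"
  proof (rule finite_subset)
    show "{a. koszul_d g a \<noteq> 0} \<subseteq> (\<Union>s\<in>{1..u}. (\<lambda>a. a(s := a s - 1)) ` {a. g a \<noteq> 0})"
    proof
      fix a assume a: "a \<in> {a. koszul_d g a \<noteq> 0}"
      have "\<exists>s\<in>{1..u}. g (a(s := Suc (a s))) \<noteq> 0"
      proof (rule ccontr)
        assume "\<not> (\<exists>s\<in>{1..u}. g (a(s := Suc (a s))) \<noteq> 0)"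
        then have "koszul_d g a = 0" using \<eta>_carrier by (auto simp: koszul_d_apply fun_eq_iff)
        then show False using a by simp
      qed
      then obtain s where s: "s \<in> {1..u}" "a(s := Suc (a s)) \<in> {a. g a \<noteq> 0}" by blast
      moreover have "a = (\<lambda>a. a(s := a s - 1)) (a(s := Suc (a s)))" by auto
      ultimately show "a \<in> (\<Union>s\<in>{1..u}. (\<lambda>a. a(s := a s - 1)) ` {a. g a \<noteq> 0})" by blast
    qed
  qed (use gfin in auto)
  show "\<exists>y. finite {a. y a \<noteq> 0} \<and> (\<forall>a. y a \<in> deg_part (Suc i) ?Y) \<and> (\<forall>a. x a = koszul_d y a)"
  proof (intro exI[of _ "\<lambda>a. y a - koszul_d g a"] conjI allI)
    show "finite {a. y a - koszul_d g a \<noteq> 0}" by (rule finite_support_diff[OF yfin dgfin])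
    have cy: "y a b \<in> carrier A" and cg: "koszul_d g a b \<in> carrier A" for a b
      by (rule free_moduleD(2)[OF yf], rule free_moduleD(2)[OF koszul_d_free], rule g(1))
    show "x a = koszul_d (\<lambda>a. y a - koszul_d g a) a" for a
      unfolding koszul_d_diff[OF cy cg] xy using koszul_d_square[of g a] free_moduleD(2)[OF g(1)] by simp
    show "y a - koszul_d g a \<in> deg_part (Suc i) ?Y" for a
    proof -
      have "lin \<phi> (y a - koszul_d g a) = w a - koszul_d (\<lambda>a. lin \<phi> (g a)) a"
        unfolding lin_diff[OF yf koszul_d_free[where x=g, OF g(1)] m] koszul_d_lin[OF g(1) m] w_def ..
      also have "\<dots> = 0" unfolding g(3) z(3) by simp
      finally show ?thesis
        using free_module_diff[OF yf koszul_d_free[where x=g, OF g(1)], of a a] gr_diff[OF yg koszul_d_gr[where x=g, OF g(2)]]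
        by (simp add: deg_part_def)
    qed
  qed
qed

end

text \<open>The step is iterated from the augmentation ideal. Basis elements of a stage are finitely
  supported functions on words and are renamed by words through \<open>enc\<close>, so that all free
  modules of the resolution have the index type which \<open>Tor\<close> prescribes.\<close>

theorem koszul: "koszul A gr"
proof -
  have one: "\<one> \<noteq> 0"
  proof
    assume z: "\<one> = 0"
    interpret V: vector_space "smult A" by (rule vector_space_smult)
    have "inj (\<lambda>c. c \<odot> \<one>)" using gr_0 by (simp add: bij_betw_def)
    then have "(0::'k) = 1" by (rule injD) (simp add: z)
    then show False by simp
  qed
  obtain enc :: "('a list \<Rightarrow> 'a) \<Rightarrow> 'a list" where enc: "inj_on enc {f. finite {w. f w \<noteq> 0}}"
    using finite_support_encoding[OF one] by blast
  define dec where "dec = the_inv_into {f. finite {w. f w \<noteq> 0}} enc"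
  \<comment> \<open>Each pair consists of the index set of a free module and the submodule to be
    covered next, which is the kernel of the preceding map.\<close>
  define F where "F = rec_nat ({[]}, {f \<in> free_module A {[]}. red f = 0})
    (\<lambda>_ (B, Y). (enc ` basis_of Y, {f \<in> free_module A (enc ` basis_of Y). lin dec f = 0}))"
  define Bs where "Bs n = fst (F n)" for n
  define Ys where "Ys n = snd (F n)" for n
  have F0: "Bs 0 = {[]}" "Ys 0 = {f \<in> free_module A {[]}. red f = 0}" by (auto simp: Bs_def Ys_def F_def)
  have FS: "Bs (Suc n) = enc ` basis_of (Ys n)" "Ys (Suc n) = {f \<in> free_module A (Bs (Suc n)). lin dec f = 0}" for n
    by (auto simp: Bs_def Ys_def F_def split: prod.splits)
  have dec: "bij_betw dec (enc ` basis_of Y) (basis_of Y)" if "Y \<subseteq> free_module A B" for B :: "'a list set" and Y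
  proof -
    have sub: "basis_of Y \<subseteq> {f. finite {w. f w \<noteq> 0}}"
    proof
      fix f assume "f \<in> basis_of Y"
      then have "f \<in> free_module A B" using basis_of(1)[of Y] that by (auto simp: deg_part_def)
      then show "f \<in> {f. finite {w. f w \<noteq> 0}}" by (simp add: free_moduleD(1))
    qed
    have "dec (enc f) = f" if "f \<in> basis_of Y" for f
      unfolding dec_def by (rule the_inv_into_f_f[OF enc]) (use that sub in auto)
    then show ?thesis by (intro bij_betwI[where g=enc]) auto
  qed
  have st: "stage (Bs n) (Ys n)" for n
  proof (induction n)
    case 0
    show ?case unfolding F0 by (rule base_stage)
  next
    case (Suc n)
    have "Ys n \<subseteq> free_module A (Bs n)" using stageD(1)[OF Suc] by blast
    from next_stage[OF Suc dec[OF this]] show ?case unfolding FS .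
  qed
  have bij: "bij_betw dec (Bs (Suc n)) (basis_of (Ys n))" for n
    unfolding FS by (rule dec[of _ "Bs n"]) (use stageD(1)[OF st] in blast)
  \<comment> \<open>One matrix serves at all positions: the name of a generator encodes its own
    boundary, and \<open>dec\<close> reads it off.\<close>
  define Q :: "('a, 'a list) free_complex" where
    "Q = \<lparr>basis = Bs, bdeg = (\<lambda>n _. n), bdry = (\<lambda>_. dec), augm = (\<lambda>_. \<one>)\<rparr>"
  have aug: "lin (aug_matrix Q) f () = f []" if f: "f \<in> free_module A {[]}" for f
  proof -
    have m: "is_matrix {[]} UNIV (aug_matrix Q)"
      by (auto simp: is_matrix_def free_module_iff aug_matrix_def Q_def)
    have "lin (aug_matrix Q) f = (\<Sum>b\<in>{[]}. (\<lambda>c. f b \<otimes> aug_matrix Q b c))"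
      by (rule lin_eq[OF f _ _ _ m]) (use free_module_support[OF f] in auto)
    then show ?thesis using free_moduleD(2)[OF f] by (simp add: aug_matrix_def Q_def)
  qed
  have cyc: "{f \<in> chains Q n. cyc Q n f} = Ys n" for n
  proof (cases n)
    case 0
    have "red (lin (aug_matrix Q) f) = 0 \<longleftrightarrow> red f = 0" if f: "f \<in> free_module A {[]}" for f
    proof -
      have "red f = 0 \<longleftrightarrow> cmp 0 (f []) = 0"
        using free_moduleD(3)[OF f] unfolding red_def fun_eq_iff by (metis cmp_0 singletonD zero_fun_apply)
      then show ?thesis using aug[OF f] by (auto simp: red_def fun_eq_iff)
    qed
    then show ?thesis unfolding 0 F0 cyc_def by (auto simp: Q_def F0)
  next
    case (Suc m)
    then show ?thesis using FS(2)[of m] by (simp add: cyc_def Q_def)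
  qed
  show ?thesis
  proof (rule koszul_if_linear_resolution[of Q])
    show "graded_free_resolution A gr Q"
      unfolding graded_free_resolution_iff
    proof (intro conjI allI ballI)
      show "gmat Q (Suc n) Q n (bdry Q n)" for n
        using next_graded_matrix[OF st[of n] bij[of n], of n] by (simp add: Q_def)
      show "augm Q b \<in> (if bdeg Q 0 b = 0 then gr 0 else {0})" for b by (simp add: Q_def gr_one)
      show "lin (bdry Q n) ` chains Q (Suc n) = {f \<in> chains Q n. cyc Q n f}" for n
        unfolding cyc using next_image[OF st[of n] bij[of n]] by (simp add: Q_def)
      show "(\<lambda>f. red (lin (aug_matrix Q) f) ()) ` chains Q 0 = gr 0"
      proof
        have Q0: "chains Q 0 = free_module A {[]}" by (simp add: Q_def F0)
        show "(\<lambda>f. red (lin (aug_matrix Q) f) ()) ` chains Q 0 \<subseteq> gr 0"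
          unfolding Q0 red_def by (intro image_subsetI) (simp add: aug cmp_props(1) free_moduleD(2))
        show "gr 0 \<subseteq> (\<lambda>f. red (lin (aug_matrix Q) f) ()) ` chains Q 0"
        proof
          fix x assume x: "x \<in> gr 0"
          define f where "f b = (if b = [] then x else 0)" for b :: "'a list"
          have "finite {b. f b \<noteq> 0}" by (rule finite_subset[of _ "{[]}"]) (auto simp: f_def)
          then have f: "f \<in> free_module A {[]}" using gr_carrier[OF x] by (auto simp: free_module_iff f_def)
          have "red (lin (aug_matrix Q) f) () = x" unfolding red_def aug[OF f] using cmp_gr[OF x] by (simp add: f_def)
          then show "x \<in> (\<lambda>f. red (lin (aug_matrix Q) f) ()) ` chains Q 0" unfolding Q0 using f by blast
        qed
      qed
    qed
    show "bdeg Q n b = n" for n b by (simp add: Q_def)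
  qed
qed

end

section \<open>The algebra of closed logarithmic forms\<close>

text \<open>Its parity is the sign of the shuffle that merges two disjoint increasing lists;
  additivity in each argument is all that associativity of the product needs.\<close>

definition inversions :: "nat set \<Rightarrow> nat set \<Rightarrow> nat" where
  "inversions I J = card {(i, j). i \<in> I \<and> j \<in> J \<and> j < i}"

lemma finite_inversions: "finite I \<Longrightarrow> finite J \<Longrightarrow> finite {(i, j). i \<in> I \<and> j \<in> J \<and> j < (i::nat)}"
  by (rule finite_subset[of _ "I \<times> J"]) auto

lemma inversions_union_left:
  assumes "finite I" "finite I'" "finite J" "I \<inter> I' = {}"
  shows "inversions (I \<union> I') J = inversions I J + inversions I' J"
proof -
  have "{(i, j). i \<in> I \<union> I' \<and> j \<in> J \<and> j < i} = {(i, j). i \<in> I \<and> j \<in> J \<and> j < i} \<union> {(i, j). i \<in> I' \<and> j \<in> J \<and> j < i}"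
    by auto
  then show ?thesis
    unfolding inversions_def using assms(4)
    by (simp add: card_Un_disjoint[OF finite_inversions[OF assms(1,3)] finite_inversions[OF assms(2,3)]] disjoint_iff)
qed

lemma inversions_union_right:
  assumes "finite I" "finite J" "finite J'" "J \<inter> J' = {}"
  shows "inversions I (J \<union> J') = inversions I J + inversions I J'"
proof -
  have "{(i, j). i \<in> I \<and> j \<in> J \<union> J' \<and> j < i} = {(i, j). i \<in> I \<and> j \<in> J \<and> j < i} \<union> {(i, j). i \<in> I \<and> j \<in> J' \<and> j < i}"
    by auto
  then show ?thesis
    unfolding inversions_def using assms(4)
    by (simp add: card_Un_disjoint[OF finite_inversions[OF assms(1,2)] finite_inversions[OF assms(1,3)]] disjoint_iff)
qed

lemma inversions_empty [simp]: "inversions {} J = 0"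
  by (simp add: inversions_def)

lemma inversions_singleton_left: "inversions {s} J = before s J"
proof -
  have "{(i, j). i \<in> {s} \<and> j \<in> J \<and> j < i} = Pair s ` {j \<in> J. j < s}" by auto
  then show ?thesis by (simp add: inversions_def before_def card_image inj_on_def)
qed

text \<open>Every element of \<open>I\<close> lies either above or below \<open>s\<close>, so
  \<open>inversions I {s} + before s I = card I\<close>; the sum in question is twice a
  number.\<close>

lemma inversions_singleton_right:
  assumes "finite I" "s \<notin> I" shows "even (inversions I {s} + card I + before s I)"
proof -
  have "{(i, j). i \<in> I \<and> j \<in> {s} \<and> j < i} = (\<lambda>i. (i, s)) ` {i \<in> I. s < i}" by auto
  then have "inversions I {s} = card {i \<in> I. s < i}" by (simp add: inversions_def card_image inj_on_def)
  moreover have "I = {i \<in> I. s < i} \<union> {i \<in> I. i < s}"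
  proof (intro equalityI subsetI)
    fix i assume i: "i \<in> I"
    then have "i \<noteq> s" using assms(2) by auto
    then show "i \<in> {i \<in> I. s < i} \<union> {i \<in> I. i < s}" using i by auto
  qed auto
  then have "card I = card ({i \<in> I. s < i} \<union> {i \<in> I. i < s})" by (rule arg_cong)
  then have "card I = card {i \<in> I. s < i} + before s I"
    unfolding before_def using card_Un_disjoint[of "{i \<in> I. s < i}" "{i \<in> I. i < s}"] assms(1) by (auto simp: disjoint_iff)
  ultimately have "inversions I {s} + card I + before s I = 2 * (card {i \<in> I. s < i} + before s I)" by simp
  then show ?thesis by (metis dvd_triv_left)
qed

lemma alt_parity: "even (m + n) \<Longrightarrow> alt m x = alt n x"
  by (auto simp: alt_def)

text \<open>What is needed of the regular functions: a commutative algebra on which the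
  \<open>\<delta> s\<close> are derivations, with \<open>eps_const\<close> saying that restriction
  to the origin yields a scalar. Distributivity, associativity and commutativity are required on the
  whole type, where the concrete products satisfy them, which avoids closure conditions in the sign
  computations.\<close>

locale log_disk = de_rham_operators u v "carrier F" "log_partial v F" J
  for u v :: nat and F :: "('k::field, 'f::ab_group_add) disk_algebra" and J +
  assumes v_le_u: "v \<le> u"
    and zero_F: "\<zero>\<^bsub>F\<^esub> = 0" and add_F: "add F = (+)"
    and mult_closed: "f \<in> carrier F \<Longrightarrow> g \<in> carrier F \<Longrightarrow> f \<otimes>\<^bsub>F\<^esub> g \<in> carrier F"
    and one_closed: "\<one>\<^bsub>F\<^esub> \<in> carrier F" and one_nonzero: "\<one>\<^bsub>F\<^esub> \<noteq> 0"
    and smult_closed: "f \<in> carrier F \<Longrightarrow> c \<odot>\<^bsub>F\<^esub> f \<in> carrier F"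
    and mult_add: "f \<otimes>\<^bsub>F\<^esub> (g + h) = f \<otimes>\<^bsub>F\<^esub> g + f \<otimes>\<^bsub>F\<^esub> h"
    and mult_assoc: "(f \<otimes>\<^bsub>F\<^esub> g) \<otimes>\<^bsub>F\<^esub> h = f \<otimes>\<^bsub>F\<^esub> (g \<otimes>\<^bsub>F\<^esub> h)"
    and mult_commute: "f \<otimes>\<^bsub>F\<^esub> g = g \<otimes>\<^bsub>F\<^esub> f"
    and one_mult: "f \<in> carrier F \<Longrightarrow> \<one>\<^bsub>F\<^esub> \<otimes>\<^bsub>F\<^esub> f = f"
    and vector_space_F: "vector_space (smult F)"
    and smult_mult: "(c \<odot>\<^bsub>F\<^esub> f) \<otimes>\<^bsub>F\<^esub> g = c \<odot>\<^bsub>F\<^esub> (f \<otimes>\<^bsub>F\<^esub> g)"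
    and \<delta>_smult: "s \<in> {1..u} \<Longrightarrow> f \<in> carrier F \<Longrightarrow> log_partial v F s (c \<odot>\<^bsub>F\<^esub> f) = c \<odot>\<^bsub>F\<^esub> log_partial v F s f"
    and \<delta>_mult: "s \<in> {1..u} \<Longrightarrow> f \<in> carrier F \<Longrightarrow> g \<in> carrier F \<Longrightarrow>
      log_partial v F s (f \<otimes>\<^bsub>F\<^esub> g) = log_partial v F s f \<otimes>\<^bsub>F\<^esub> g + f \<otimes>\<^bsub>F\<^esub> log_partial v F s g"
    and eps_const: "f \<in> carrier F \<Longrightarrow> \<exists>c. eps_upto u f = c \<odot>\<^bsub>F\<^esub> \<one>\<^bsub>F\<^esub>"
begin

abbreviation mul (infixl "\<star>" 70) where "f \<star> g \<equiv> f \<otimes>\<^bsub>F\<^esub> g"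
abbreviation scal (infixr "\<bullet>\<^sub>F" 75) where "c \<bullet>\<^sub>F f \<equiv> c \<odot>\<^bsub>F\<^esub> f"
abbreviation \<delta> where "\<delta> \<equiv> log_partial v F"

interpretation VF: vector_space "smult F" by (rule vector_space_F)

lemma mult_0 [simp]: "f \<star> 0 = 0" "0 \<star> f = 0"
  using mult_add[of f 0 0] mult_commute[of 0 f] by simp_all

lemma mult_one: "f \<in> carrier F \<Longrightarrow> f \<star> \<one>\<^bsub>F\<^esub> = f"
  using one_mult[of f] mult_commute[of f "\<one>\<^bsub>F\<^esub>"] by simp

lemma mult_add_left: "(f + g) \<star> h = f \<star> h + g \<star> h"
  using mult_add[of h f g] by (simp add: mult_commute[of _ h])

lemma mult_uminus: "f \<star> (- g) = - (f \<star> g)" "(- f) \<star> g = - (f \<star> g)"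
  using mult_add[of f g "- g"] mult_add_left[of f "- f" g] by (simp_all add: eq_neg_iff_add_eq_0 add.commute)

lemma mult_alt: "f \<star> alt n g = alt n (f \<star> g)" "alt n f \<star> g = alt n (f \<star> g)"
  by (auto simp: alt_def mult_uminus)

lemma mult_sum: "f \<star> sum g S = (\<Sum>i\<in>S. f \<star> g i)" "sum g S \<star> f = (\<Sum>i\<in>S. g i \<star> f)"
  by (induction S rule: infinite_finite_induct) (simp_all add: mult_add mult_add_left)

lemma smult_alt: "c \<bullet>\<^sub>F alt n f = alt n (c \<bullet>\<^sub>F f)"
  by (auto simp: alt_def)

lemma mult_smult: "f \<star> (c \<bullet>\<^sub>F g) = c \<bullet>\<^sub>F (f \<star> g)"
  using smult_mult[of c g f] by (simp add: mult_commute[of f])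

lemma X_sum: "(\<And>i. i \<in> S \<Longrightarrow> f i \<in> carrier F) \<Longrightarrow> sum f S \<in> carrier F"
  by (induction S rule: infinite_finite_induct) (auto simp: X_0 X_add)

lemma \<delta>_sum: "s \<in> {1..u} \<Longrightarrow> (\<And>i. i \<in> S \<Longrightarrow> f i \<in> carrier F) \<Longrightarrow> \<delta> s (sum f S) = (\<Sum>i\<in>S. \<delta> s (f i))"
  by (induction S rule: infinite_finite_induct) (auto simp: \<delta>_add X_sum)

lemma abelian_group_F: "abelian_group F"
proof (rule abelian_groupI)
  show "\<exists>y\<in>carrier F. y \<oplus>\<^bsub>F\<^esub> x = \<zero>\<^bsub>F\<^esub>" if "x \<in> carrier F" for x
    using X_uminus[OF that] by (intro bexI[of _ "- x"]) (auto simp: add_F zero_F)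
qed (auto simp: add_F zero_F X_0 X_add add.assoc add.commute)

interpretation FG: abelian_group F by (rule abelian_group_F)

lemma a_inv_F: "x \<in> carrier F \<Longrightarrow> \<ominus>\<^bsub>F\<^esub> x = - x"
  using FG.r_neg[of x] by (simp add: add_F zero_F eq_neg_iff_add_eq_0 add.commute)

lemma signed_F: "x \<in> carrier F \<Longrightarrow> signed F n x = alt n x"
  by (simp add: signed_def alt_def a_inv_F)

lemma finsum_F: "(\<And>i. i \<in> S \<Longrightarrow> f i \<in> carrier F) \<Longrightarrow> finsum F f S = sum f S"
proof (induction S rule: infinite_finite_induct)
  case (insert x S)
  then show ?case by (subst FG.finsum_insert) (auto simp: add_F)
qed (simp_all add: FG.finsum_infinite zero_F)

definition wedge :: "(nat set \<Rightarrow> 'f) \<Rightarrow> (nat set \<Rightarrow> 'f) \<Rightarrow> nat set \<Rightarrow> 'f" where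
  "wedge \<alpha> \<beta> K = (\<Sum>I\<in>Pow K. alt (inversions I (K - I)) (\<alpha> I \<star> \<beta> (K - I)))"

lemma carrier_log_forms: "carrier (log_forms u F) = forms"
  by (auto simp: log_forms_def forms_def zero_F)

lemma mult_log_forms:
  assumes "\<alpha> \<in> forms" "\<beta> \<in> forms"
  shows "\<alpha> \<otimes>\<^bsub>log_forms u F\<^esub> \<beta> = wedge \<alpha> \<beta>"
proof
  fix K
  have "(\<alpha> \<otimes>\<^bsub>log_forms u F\<^esub> \<beta>) K = finsum F (\<lambda>I. signed F (inversions I (K - I)) (\<alpha> I \<star> \<beta> (K - I))) (Pow K)"
    by (simp add: log_forms_def inversions_def)
  also have "\<dots> = finsum F (\<lambda>I. alt (inversions I (K - I)) (\<alpha> I \<star> \<beta> (K - I))) (Pow K)"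
    using assms by (simp add: signed_F mult_closed formsD)
  also have "\<dots> = wedge \<alpha> \<beta> K"
    unfolding wedge_def by (rule finsum_F) (intro X_alt mult_closed formsD(1)[OF assms(1)] formsD(1)[OF assms(2)])
  finally show "(\<alpha> \<otimes>\<^bsub>log_forms u F\<^esub> \<beta>) K = wedge \<alpha> \<beta> K" .
qed

lemma diffl_apply: "diffl \<omega> K = (\<Sum>s\<in>{1..u}. ext s (\<lambda>I. \<delta> s (\<omega> I)) K)"
  unfolding diffl_def sum_fun_apply ..

lemma de_rham_eq:
  assumes "\<omega> \<in> forms" shows "de_rham u v F \<omega> = diffl \<omega>"
proof
  fix K
  show "de_rham u v F \<omega> K = diffl \<omega> K"
  proof (cases "K \<subseteq> {1..u}")
    case True
    have c: "\<delta> s (\<omega> I) \<in> carrier F" if "s \<in> K" for s I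
      using that True formsD(1)[OF assms] \<delta>_closed by blast
    have "de_rham u v F \<omega> K = finsum F (\<lambda>s. signed F (before s K) (\<delta> s (\<omega> (K - {s})))) K"
      using True by (simp add: de_rham_def before_def)
    also have "\<dots> = (\<Sum>s\<in>K. signed F (before s K) (\<delta> s (\<omega> (K - {s}))))"
      by (rule finsum_F) (simp add: signed_F c X_alt)
    also have "\<dots> = (\<Sum>s\<in>K. ext s (\<lambda>I. \<delta> s (\<omega> I)) K)"
      by (rule sum.cong) (simp_all add: signed_F c ext_def)
    also have "\<dots> = diffl \<omega> K"
      unfolding diffl_apply by (rule sum.mono_neutral_left) (use True in \<open>auto simp: ext_def\<close>)
    finally show ?thesis .
  next
    case False
    then show ?thesis using formsD(2)[OF diffl_closed[OF assms] False] by (simp add: de_rham_def zero_F)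
  qed
qed

lemma wedge_add: "wedge \<alpha> (\<beta> + \<gamma>) = wedge \<alpha> \<beta> + wedge \<alpha> \<gamma>" "wedge (\<alpha> + \<beta>) \<gamma> = wedge \<alpha> \<gamma> + wedge \<beta> \<gamma>"
  by (auto simp: fun_eq_iff wedge_def mult_add mult_add_left alt_add sum.distrib)

lemma wedge_0: "wedge \<alpha> 0 = 0" "wedge 0 \<alpha> = 0"
  by (auto simp: fun_eq_iff wedge_def)

lemma wedge_sum: "wedge \<alpha> (sum f S) = (\<Sum>i\<in>S. wedge \<alpha> (f i))" "wedge (sum f S) \<alpha> = (\<Sum>i\<in>S. wedge (f i) \<alpha>)"
  by (induction S rule: infinite_finite_induct)
    (simp_all add: wedge_add wedge_0 del: plus_fun_apply zero_fun_apply)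

lemma smult_sum: "c \<bullet>\<^sub>F sum f S = (\<Sum>i\<in>S. c \<bullet>\<^sub>F f i)"
  by (rule VF.scale_sum_right)

lemma wedge_smult: "wedge (\<lambda>I. c \<bullet>\<^sub>F \<alpha> I) \<beta> = (\<lambda>I. c \<bullet>\<^sub>F wedge \<alpha> \<beta> I)" "wedge \<alpha> (\<lambda>I. c \<bullet>\<^sub>F \<beta> I) = (\<lambda>I. c \<bullet>\<^sub>F wedge \<alpha> \<beta> I)"
  by (auto simp: fun_eq_iff wedge_def smult_mult mult_smult smult_sum smult_alt)

lemma wedge_closed: assumes "\<alpha> \<in> forms" "\<beta> \<in> forms" shows "wedge \<alpha> \<beta> \<in> forms"
proof -
  have "wedge \<alpha> \<beta> K = 0" if "\<not> K \<subseteq> {1..u}" for K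
    unfolding wedge_def
  proof (rule sum.neutral, rule ballI)
    fix I assume "I \<in> Pow K"
    with that have "\<not> I \<subseteq> {1..u} \<or> \<not> K - I \<subseteq> {1..u}" by blast
    then have "\<alpha> I = 0 \<or> \<beta> (K - I) = 0" using formsD(2)[OF assms(1), of I] formsD(2)[OF assms(2), of "K - I"] by blast
    then have "\<alpha> I \<star> \<beta> (K - I) = 0" by auto
    then show "alt (inversions I (K - I)) (\<alpha> I \<star> \<beta> (K - I)) = 0" by simp
  qed
  moreover have "wedge \<alpha> \<beta> K \<in> carrier F" for K
    unfolding wedge_def by (intro X_sum X_alt mult_closed formsD assms)
  ultimately show ?thesis by (auto simp: forms_def)
qed

text \<open>Both sides run over the ordered partitions of \<open>K\<close> into three parts
  \<open>A\<close>, \<open>B\<close>, \<open>C\<close>, with sign exponent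
  \<open>inversions A B + inversions A C + inversions B C\<close>. For infinite \<open>K\<close>
  both sums are 0 by convention.\<close>

lemma wedge_assoc: "wedge (wedge \<alpha> \<beta>) \<gamma> = wedge \<alpha> (wedge \<beta> \<gamma>)"
proof
  fix K
  show "wedge (wedge \<alpha> \<beta>) \<gamma> K = wedge \<alpha> (wedge \<beta> \<gamma>) K"
  proof (cases "finite K")
    case False
    then show ?thesis by (simp add: wedge_def)
  next
    case True
    define t where "t A B C = alt (inversions A B + inversions A C + inversions B C) (\<alpha> A \<star> (\<beta> B \<star> \<gamma> C))" for A B C
    have l: "alt (inversions I (K - I)) (wedge \<alpha> \<beta> I \<star> \<gamma> (K - I)) = (\<Sum>A\<in>Pow I. t A (I - A) (K - I))" if I: "I \<in> Pow K" for I
    proof -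
      have "alt (inversions I (K - I)) (wedge \<alpha> \<beta> I \<star> \<gamma> (K - I)) =
         (\<Sum>A\<in>Pow I. alt (inversions I (K - I)) (alt (inversions A (I - A)) ((\<alpha> A \<star> \<beta> (I - A)) \<star> \<gamma> (K - I))))"
        unfolding wedge_def mult_sum mult_alt alt_sum ..
      also have "\<dots> = (\<Sum>A\<in>Pow I. t A (I - A) (K - I))"
      proof (rule sum.cong[OF refl])
        fix A assume A: "A \<in> Pow I"
        have fin: "finite A" "finite (I - A)" "finite (K - I)" using A I True by (auto intro: finite_subset)
        have "inversions (A \<union> (I - A)) (K - I) = inversions A (K - I) + inversions (I - A) (K - I)"
          by (rule inversions_union_left[OF fin]) auto
        moreover have "A \<union> (I - A) = I" using A by auto
        ultimately have "inversions I (K - I) = inversions A (K - I) + inversions (I - A) (K - I)" by simp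
        then show "alt (inversions I (K - I)) (alt (inversions A (I - A)) ((\<alpha> A \<star> \<beta> (I - A)) \<star> \<gamma> (K - I))) = t A (I - A) (K - I)"
          unfolding t_def alt_plus[symmetric] mult_assoc by (simp add: add.commute add.left_commute)
      qed
      finally show ?thesis .
    qed
    have r: "alt (inversions A (K - A)) (\<alpha> A \<star> wedge \<beta> \<gamma> (K - A)) = (\<Sum>B\<in>Pow (K - A). t A B (K - A - B))" if A: "A \<in> Pow K" for A
    proof -
      have "alt (inversions A (K - A)) (\<alpha> A \<star> wedge \<beta> \<gamma> (K - A)) =
         (\<Sum>B\<in>Pow (K - A). alt (inversions A (K - A)) (alt (inversions B (K - A - B)) (\<alpha> A \<star> (\<beta> B \<star> \<gamma> (K - A - B)))))"
        unfolding wedge_def mult_sum mult_alt alt_sum ..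
      also have "\<dots> = (\<Sum>B\<in>Pow (K - A). t A B (K - A - B))"
      proof (rule sum.cong[OF refl])
        fix B assume B: "B \<in> Pow (K - A)"
        have fin: "finite A" "finite B" "finite (K - A - B)" using A B True by (auto intro: finite_subset)
        have "inversions A (B \<union> (K - A - B)) = inversions A B + inversions A (K - A - B)"
          by (rule inversions_union_right[OF fin]) auto
        moreover have "B \<union> (K - A - B) = K - A" using B by auto
        ultimately have "inversions A (K - A) = inversions A B + inversions A (K - A - B)" by simp
        then show "alt (inversions A (K - A)) (alt (inversions B (K - A - B)) (\<alpha> A \<star> (\<beta> B \<star> \<gamma> (K - A - B)))) = t A B (K - A - B)"
          unfolding t_def alt_plus[symmetric] by simp
      qed
      finally show ?thesis .
    qed
    have "wedge (wedge \<alpha> \<beta>) \<gamma> K = (\<Sum>I\<in>Pow K. \<Sum>A\<in>Pow I. t A (I - A) (K - I))"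
      by (subst wedge_def) (rule sum.cong[OF refl l])
    also have "\<dots> = (\<Sum>(I, A)\<in>(SIGMA I:Pow K. Pow I). t A (I - A) (K - I))"
      by (rule sum.Sigma) (use True in \<open>auto intro: finite_subset\<close>)
    also have "\<dots> = (\<Sum>(A, B)\<in>(SIGMA A:Pow K. Pow (K - A)). t A B (K - A - B))"
    proof (rule sum.reindex_bij_witness[where i="\<lambda>(A, B). (A \<union> B, A)" and j="\<lambda>(I, A). (A, I - A)"])
      fix p assume "p \<in> (SIGMA I:Pow K. Pow I)"
      then obtain I A where p: "p = (I, A)" "I \<subseteq> K" "A \<subseteq> I" by auto
      then have "K - A - (I - A) = K - I" "A \<union> (I - A) = I" by auto
      then show "(case (case p of (I, A) \<Rightarrow> (A, I - A)) of (A, B) \<Rightarrow> t A B (K - A - B)) = (case p of (I, A) \<Rightarrow> t A (I - A) (K - I))"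
        "(case (case p of (I, A) \<Rightarrow> (A, I - A)) of (A, B) \<Rightarrow> (A \<union> B, A)) = p"
        by (simp_all add: p(1))
      show "(case p of (I, A) \<Rightarrow> (A, I - A)) \<in> (SIGMA A:Pow K. Pow (K - A))" using p by auto
    qed auto
    also have "\<dots> = (\<Sum>A\<in>Pow K. \<Sum>B\<in>Pow (K - A). t A B (K - A - B))"
      by (rule sum.Sigma[symmetric]) (use True in auto)
    also have "\<dots> = wedge \<alpha> (wedge \<beta> \<gamma>) K"
      unfolding wedge_def[of \<alpha> "wedge \<beta> \<gamma>"] by (rule sum.cong[OF refl r[symmetric]])
    finally show ?thesis .
  qed
qed

definition unit_form :: "nat set \<Rightarrow> 'f" where
  "unit_form = (\<lambda>I. if I = {} then \<one>\<^bsub>F\<^esub> else 0)"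

definition \<eta> :: "nat \<Rightarrow> nat set \<Rightarrow> 'f" where
  "\<eta> s = (\<lambda>I. if I = {s} then \<one>\<^bsub>F\<^esub> else 0)"

text \<open>The grading involution, which carries the sign of the graded Leibniz rule.\<close>

definition bar :: "(nat set \<Rightarrow> 'f) \<Rightarrow> nat set \<Rightarrow> 'f" where
  "bar \<alpha> I = alt (card I) (\<alpha> I)"

lemma finite_form: "\<omega> \<in> forms \<Longrightarrow> infinite K \<Longrightarrow> \<omega> K = 0"
  using formsD(2)[of \<omega> K] finite_subset[of K "{1..u}"] by auto

lemma unit_form_closed: "unit_form \<in> forms"
  by (auto simp: unit_form_def forms_def one_closed X_0)

lemma \<eta>_closed: "s \<in> {1..u} \<Longrightarrow> \<eta> s \<in> forms"
  by (auto simp: \<eta>_def forms_def one_closed X_0)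

lemma wedge_single:
  assumes "finite K" "A \<subseteq> K" "\<And>I. I \<subseteq> K \<Longrightarrow> I \<noteq> A \<Longrightarrow> \<alpha> I \<star> \<beta> (K - I) = 0"
  shows "wedge \<alpha> \<beta> K = alt (inversions A (K - A)) (\<alpha> A \<star> \<beta> (K - A))"
proof -
  have "wedge \<alpha> \<beta> K = (\<Sum>I\<in>{A}. alt (inversions I (K - I)) (\<alpha> I \<star> \<beta> (K - I)))"
    unfolding wedge_def by (rule sum.mono_neutral_right) (use assms in auto)
  then show ?thesis by simp
qed

lemma wedge_unit: assumes "\<omega> \<in> forms" shows "wedge unit_form \<omega> = \<omega>" "wedge \<omega> unit_form = \<omega>"
proof -
  show "wedge unit_form \<omega> = \<omega>"
  proof
    fix K show "wedge unit_form \<omega> K = \<omega> K"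
    proof (cases "finite K")
      case True
      then show ?thesis
        by (subst wedge_single[of K "{}"]) (use assms in \<open>auto simp: unit_form_def one_mult formsD alt_def\<close>)
    qed (use finite_form[OF assms] in \<open>simp add: wedge_def\<close>)
  qed
  show "wedge \<omega> unit_form = \<omega>"
  proof
    fix K show "wedge \<omega> unit_form K = \<omega> K"
    proof (cases "finite K")
      case True
      then show ?thesis
        by (subst wedge_single[of K K])
          (use assms in \<open>auto simp: unit_form_def one_mult mult_one formsD inversions_def alt_def\<close>)
    qed (use finite_form[OF assms] in \<open>simp add: wedge_def\<close>)
  qed
qed

lemma wedge_\<eta>: assumes "\<omega> \<in> forms" shows "wedge (\<eta> s) \<omega> = ext s \<omega>"
proof
  fix K
  show "wedge (\<eta> s) \<omega> K = ext s \<omega> K"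
  proof (cases "finite K \<and> s \<in> K")
    case True
    then have "wedge (\<eta> s) \<omega> K = alt (inversions {s} (K - {s})) (\<eta> s {s} \<star> \<omega> (K - {s}))"
      by (intro wedge_single) (auto simp: \<eta>_def)
    moreover have "before s K = before s (K - {s})"
      using True before_insert[of s s "K - {s}"] by (simp add: insert_absorb)
    ultimately show ?thesis using True assms by (simp add: inversions_singleton_left \<eta>_def one_mult formsD ext_def)
  next
    case False
    have "wedge (\<eta> s) \<omega> K = 0"
    proof (cases "finite K")
      case True
      with False show ?thesis by (auto simp: wedge_def \<eta>_def intro!: sum.neutral)
    qed (simp add: wedge_def)
    then show ?thesis using False finite_form[OF assms, of "K - {s}"] by (auto simp: ext_def)
  qed
qed

text \<open>Moving the one-form from the right of a form to its left costs the parity of the degree,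
  which \<open>bar\<close> compensates; hence the same \<open>ext s\<close> as in
  \<open>wedge_\<eta>\<close>.\<close>

lemma wedge_bar_\<eta>: assumes "\<alpha> \<in> forms" shows "wedge (bar \<alpha>) (\<eta> s) = ext s \<alpha>"
proof
  fix K
  show "wedge (bar \<alpha>) (\<eta> s) K = ext s \<alpha> K"
  proof (cases "finite K \<and> s \<in> K")
    case True
    then have K: "K - (K - {s}) = {s}" by auto
    have "wedge (bar \<alpha>) (\<eta> s) K = alt (inversions (K - {s}) (K - (K - {s}))) (bar \<alpha> (K - {s}) \<star> \<eta> s (K - (K - {s})))"
    proof (rule wedge_single)
      fix I assume "I \<subseteq> K" "I \<noteq> K - {s}"
      then have "K - I \<noteq> {s}" using True by blast
      then show "bar \<alpha> I \<star> \<eta> s (K - I) = 0" by (simp add: \<eta>_def)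
    qed (use True in auto)
    also have "\<dots> = alt (inversions (K - {s}) {s} + card (K - {s})) (\<alpha> (K - {s}))"
      unfolding K alt_plus using assms
      by (simp add: \<eta>_def bar_def mult_alt mult_one one_mult formsD)
    also have "\<dots> = alt (before s (K - {s})) (\<alpha> (K - {s}))"
      by (rule alt_parity, rule inversions_singleton_right) (use True in auto)
    also have "before s (K - {s}) = before s K"
      using True before_insert[of s s "K - {s}"] by (simp add: insert_absorb)
    finally show ?thesis using True by (simp add: ext_def)
  next
    case False
    have "wedge (bar \<alpha>) (\<eta> s) K = 0"
    proof (cases "finite K")
      case True
      then have "s \<notin> K" using False by simp
      then have "\<eta> s (K - I) = 0" for I by (auto simp: \<eta>_def)
      then show ?thesis by (simp add: wedge_def)
    qed (simp add: wedge_def)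
    then show ?thesis using False finite_form[OF assms, of "K - {s}"] by (auto simp: ext_def)
  qed
qed

text \<open>Both are instances of associativity, with \<open>ext s\<close> read as multiplication by
  \<open>\<eta> s\<close> on the left, or, for the second, as multiplication of
  \<open>bar \<alpha>\<close> on the right.\<close>

lemma ext_wedge:
  assumes "s \<in> {1..u}" "\<alpha> \<in> forms" "\<beta> \<in> forms"
  shows "ext s (wedge \<alpha> \<beta>) = wedge (ext s \<alpha>) \<beta>" "ext s (wedge \<alpha> \<beta>) = wedge (bar \<alpha>) (ext s \<beta>)"
proof -
  show "ext s (wedge \<alpha> \<beta>) = wedge (ext s \<alpha>) \<beta>"
    unfolding wedge_\<eta>[OF wedge_closed[OF assms(2,3)], symmetric] wedge_\<eta>[OF assms(2), symmetric] wedge_assoc ..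
  then show "ext s (wedge \<alpha> \<beta>) = wedge (bar \<alpha>) (ext s \<beta>)"
    unfolding wedge_bar_\<eta>[OF assms(2), symmetric] wedge_\<eta>[OF assms(3), symmetric] wedge_assoc by simp
qed

lemma \<delta>_wedge:
  assumes "s \<in> {1..u}" "\<alpha> \<in> forms" "\<beta> \<in> forms"
  shows "(\<lambda>I. \<delta> s (wedge \<alpha> \<beta> I)) = wedge (\<lambda>I. \<delta> s (\<alpha> I)) \<beta> + wedge \<alpha> (\<lambda>I. \<delta> s (\<beta> I))"
proof
  fix K
  note c = mult_closed[OF formsD(1)[OF assms(2)] formsD(1)[OF assms(3)]]
  have "\<delta> s (wedge \<alpha> \<beta> K) = (\<Sum>I\<in>Pow K. \<delta> s (alt (inversions I (K - I)) (\<alpha> I \<star> \<beta> (K - I))))"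
    unfolding wedge_def by (rule \<delta>_sum[OF assms(1)]) (intro X_alt c)
  also have "\<dots> = (\<Sum>I\<in>Pow K. alt (inversions I (K - I)) (\<delta> s (\<alpha> I) \<star> \<beta> (K - I)) + alt (inversions I (K - I)) (\<alpha> I \<star> \<delta> s (\<beta> (K - I))))"
    unfolding \<delta>_alt[OF assms(1) c] \<delta>_mult[OF assms(1) formsD(1)[OF assms(2)] formsD(1)[OF assms(3)]] alt_add ..
  finally show "\<delta> s (wedge \<alpha> \<beta> K) = (wedge (\<lambda>I. \<delta> s (\<alpha> I)) \<beta> + wedge \<alpha> (\<lambda>I. \<delta> s (\<beta> I))) K"
    by (simp add: wedge_def sum.distrib)
qed

lemma diffl_wedge:
  assumes "\<alpha> \<in> forms" "\<beta> \<in> forms"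
  shows "diffl (wedge \<alpha> \<beta>) = wedge (diffl \<alpha>) \<beta> + wedge (bar \<alpha>) (diffl \<beta>)"
proof -
  have "diffl (wedge \<alpha> \<beta>) = (\<Sum>s\<in>{1..u}. wedge (ext s (\<lambda>I. \<delta> s (\<alpha> I))) \<beta> + wedge (bar \<alpha>) (ext s (\<lambda>I. \<delta> s (\<beta> I))))"
    unfolding diffl_def
    by (rule sum.cong[OF refl])
      (simp only: \<delta>_wedge[OF _ assms] ext_add ext_wedge(1)[OF _ forms_\<delta>[OF _ assms(1)] assms(2)]
         ext_wedge(2)[OF _ assms(1) forms_\<delta>[OF _ assms(2)]])
  then show ?thesis unfolding diffl_def wedge_sum sum.distrib .
qed

section \<open>Closed forms as a graded algebra\<close>

definition Zf :: "(nat set \<Rightarrow> 'f) set" where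
  "Zf = {\<omega> \<in> forms. diffl \<omega> = 0}"

abbreviation ZA where "ZA \<equiv> closed_forms u v F"
abbreviation Zgr where "Zgr \<equiv> closed_forms_deg u v F"

lemma ZA_simps:
  "carrier ZA = Zf" "\<zero>\<^bsub>ZA\<^esub> = 0" "add ZA = (+)" "\<one>\<^bsub>ZA\<^esub> = unit_form"
  "smult ZA = (\<lambda>c \<omega> I. c \<bullet>\<^sub>F \<omega> I)"
proof -
  have "de_rham u v F \<omega> = (\<lambda>_. \<zero>\<^bsub>F\<^esub>) \<longleftrightarrow> diffl \<omega> = 0" if "\<omega> \<in> forms" for \<omega>
    using de_rham_eq[OF that] by (simp add: zero_F zero_fun_def)
  then show "carrier ZA = Zf" by (auto simp: closed_forms_def carrier_log_forms Zf_def)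
qed (auto simp: closed_forms_def log_forms_def zero_F add_F unit_form_def fun_eq_iff)

lemma ZA_mult: "\<alpha> \<in> Zf \<Longrightarrow> \<beta> \<in> Zf \<Longrightarrow> \<alpha> \<otimes>\<^bsub>ZA\<^esub> \<beta> = wedge \<alpha> \<beta>"
  using mult_log_forms[of \<alpha> \<beta>] by (simp add: closed_forms_def Zf_def)

lemma Zgr_iff: "\<omega> \<in> Zgr n \<longleftrightarrow> \<omega> \<in> Zf \<and> (\<forall>I. card I \<noteq> n \<longrightarrow> \<omega> I = 0)"
  by (simp add: closed_forms_deg_def ZA_simps zero_F)

lemma ZfD: "\<omega> \<in> Zf \<Longrightarrow> \<omega> \<in> forms" "\<omega> \<in> Zf \<Longrightarrow> diffl \<omega> = 0"
  by (auto simp: Zf_def)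

lemma Zf_0: "0 \<in> Zf"
  unfolding Zf_def by (simp only: mem_Collect_eq forms_0 diffl_0 simp_thms)

lemma Zf_add: "\<alpha> \<in> Zf \<Longrightarrow> \<beta> \<in> Zf \<Longrightarrow> \<alpha> + \<beta> \<in> Zf"
  by (simp add: Zf_def forms_add diffl_add)

lemma Zf_diff: "\<alpha> \<in> Zf \<Longrightarrow> \<beta> \<in> Zf \<Longrightarrow> \<alpha> - \<beta> \<in> Zf"
  by (simp add: Zf_def forms_diff diffl_diff)

lemma Zf_uminus: "\<alpha> \<in> Zf \<Longrightarrow> - \<alpha> \<in> Zf"
  using Zf_diff[OF Zf_0] by simp

lemma Zf_wedge: "\<alpha> \<in> Zf \<Longrightarrow> \<beta> \<in> Zf \<Longrightarrow> wedge \<alpha> \<beta> \<in> Zf"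
  by (simp add: Zf_def wedge_closed diffl_wedge wedge_0)

lemma forms_smult: "\<omega> \<in> forms \<Longrightarrow> (\<lambda>I. c \<bullet>\<^sub>F \<omega> I) \<in> forms"
  by (auto simp: forms_def smult_closed)

lemma diffl_smult: assumes "\<omega> \<in> forms" shows "diffl (\<lambda>I. c \<bullet>\<^sub>F \<omega> I) = (\<lambda>I. c \<bullet>\<^sub>F diffl \<omega> I)"
proof
  fix K
  have "ext s (\<lambda>I. \<delta> s (c \<bullet>\<^sub>F \<omega> I)) K = c \<bullet>\<^sub>F ext s (\<lambda>I. \<delta> s (\<omega> I)) K" if "s \<in> {1..u}" for s
    by (simp add: ext_def smult_alt \<delta>_smult[OF that formsD(1)[OF assms]])
  then show "diffl (\<lambda>I. c \<bullet>\<^sub>F \<omega> I) K = c \<bullet>\<^sub>F diffl \<omega> K"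
    unfolding diffl_apply smult_sum by (rule sum.cong[OF refl])
qed

lemma Zf_smult: "\<omega> \<in> Zf \<Longrightarrow> (\<lambda>I. c \<bullet>\<^sub>F \<omega> I) \<in> Zf"
  by (simp add: Zf_def forms_smult diffl_smult fun_eq_iff)

lemma \<delta>_one: assumes "s \<in> {1..u}" shows "\<delta> s \<one>\<^bsub>F\<^esub> = 0"
proof -
  note c = \<delta>_closed[OF assms one_closed]
  have "\<delta> s (\<one>\<^bsub>F\<^esub> \<star> \<one>\<^bsub>F\<^esub>) = \<delta> s \<one>\<^bsub>F\<^esub> + \<delta> s \<one>\<^bsub>F\<^esub>"
    using \<delta>_mult[OF assms one_closed one_closed] one_mult[OF c] mult_one[OF c] by simp
  then show ?thesis using one_mult[OF one_closed] by simp
qed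

lemma \<delta>_const: "s \<in> {1..u} \<Longrightarrow> \<delta> s (c \<bullet>\<^sub>F \<one>\<^bsub>F\<^esub>) = 0"
  using \<delta>_smult[OF _ one_closed] \<delta>_one by simp

text \<open>The derivations kill scalars. This puts the unit, the generators \<open>\<eta> s\<close>
  and all constant representatives of cohomology classes into \<open>Z\<close>.\<close>

lemma Zf_const:
  assumes "\<And>I. \<exists>c. \<omega> I = c \<bullet>\<^sub>F \<one>\<^bsub>F\<^esub>" "\<And>I. \<not> I \<subseteq> {1..u} \<Longrightarrow> \<omega> I = 0"
  shows "\<omega> \<in> Zf"
proof -
  have "\<omega> I \<in> carrier F" for I using assms(1)[of I] smult_closed[OF one_closed] by auto
  moreover have "\<delta> s (\<omega> I) = 0" if "s \<in> {1..u}" for s I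
    using assms(1)[of I] \<delta>_const[OF that] by auto
  then have "diffl \<omega> = 0" by (auto simp: fun_eq_iff diffl_apply ext_def intro!: sum.neutral)
  ultimately show ?thesis using assms(2) by (auto simp: Zf_def forms_def)
qed

lemma \<eta>_Zf: "s \<in> {1..u} \<Longrightarrow> \<eta> s \<in> Zf"
  by (rule Zf_const) (auto simp: \<eta>_def intro: exI[of _ 1] exI[of _ 0])

lemma unit_form_Zf: "unit_form \<in> Zf"
  by (rule Zf_const) (auto simp: unit_form_def intro: exI[of _ 1] exI[of _ 0])

definition part :: "nat \<Rightarrow> (nat set \<Rightarrow> 'f) \<Rightarrow> nat set \<Rightarrow> 'f" where
  "part n \<omega> I = (if card I = n then \<omega> I else 0)"

lemma diffl_part: assumes "\<omega> \<in> forms" shows "diffl (part n \<omega>) = part (Suc n) (diffl \<omega>)"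
proof
  fix K
  have "ext s (\<lambda>I. \<delta> s (part n \<omega> I)) K = (if card K = Suc n then ext s (\<lambda>I. \<delta> s (\<omega> I)) K else 0)" if s: "s \<in> {1..u}" for s
  proof (cases "s \<in> K")
    case True
    show ?thesis
    proof (cases "finite K")
      case fin: True
      then have "card K = Suc (card (K - {s}))" using True by (metis card.remove)
      then show ?thesis using True s by (auto simp: ext_def part_def)
    next
      case False
      then have "\<omega> (K - {s}) = 0" using finite_form[OF assms] by simp
      then show ?thesis using s by (auto simp: ext_def part_def)
    qed
  qed (simp add: ext_def)
  then show "diffl (part n \<omega>) K = part (Suc n) (diffl \<omega>) K"
    by (simp add: diffl_apply part_def)
qed

lemma part_Zgr: "\<omega> \<in> Zf \<Longrightarrow> part n \<omega> \<in> Zgr n"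
proof -
  assume \<omega>: "\<omega> \<in> Zf"
  then have "part n \<omega> \<in> forms" by (auto simp: Zf_def forms_def part_def X_0)
  moreover have "diffl (part n \<omega>) = 0" using \<omega> by (auto simp: Zf_def diffl_part part_def fun_eq_iff)
  ultimately show ?thesis by (auto simp: Zgr_iff Zf_def part_def)
qed

lemma Zgr_mult: assumes "\<alpha> \<in> Zgr m" "\<beta> \<in> Zgr n" shows "wedge \<alpha> \<beta> \<in> Zgr (m + n)"
proof -
  have "wedge \<alpha> \<beta> K = 0" if K: "card K \<noteq> m + n" for K
  proof (cases "finite K")
    case True
    show ?thesis
      unfolding wedge_def
    proof (rule sum.neutral, rule ballI)
      fix I assume "I \<in> Pow K"
      then have "card K = card I + card (K - I)" using True by (simp add: card_Diff_subset card_mono finite_subset)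
      then have "\<alpha> I = 0 \<or> \<beta> (K - I) = 0" using K assms by (auto simp: Zgr_iff)
      then show "alt (inversions I (K - I)) (\<alpha> I \<star> \<beta> (K - I)) = 0" by auto
    qed
  qed (simp add: wedge_def)
  then show ?thesis using assms Zf_wedge by (auto simp: Zgr_iff)
qed

lemma eps_upto_0: "k \<le> u \<Longrightarrow> eps_upto k 0 = 0"
  by (induction k) (auto simp: eps_0)

text \<open>The primitive in the Poincare lemma would have degree -1 and so is zero; a closed
  function equals its restriction to the origin, a scalar.\<close>

lemma Zgr_0: assumes "\<omega> \<in> Zgr 0" shows "\<exists>c. \<omega> = (\<lambda>I. c \<bullet>\<^sub>F unit_form I)"
proof -
  have \<omega>: "\<omega> \<in> forms" "diffl \<omega> = 0" "\<forall>I. card I \<noteq> 0 \<longrightarrow> \<omega> I = 0" using assms by (auto simp: Zgr_iff Zf_def)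
  obtain \<psi> where \<psi>: "\<omega> - diffl \<psi> = (\<lambda>K. if K \<inter> {1..u} \<subseteq> {..v} then eps_upto u (\<omega> K) else 0)"
    "\<forall>m. (\<forall>I. card I \<noteq> m \<longrightarrow> \<omega> I = 0) \<longrightarrow> (\<forall>I. Suc (card I) \<noteq> m \<longrightarrow> \<psi> I = 0)"
    using poincare[OF \<omega>(1,2)] by (elim bexE conjE) (rule that)
  have "\<psi> = 0" using \<psi>(2)[rule_format, of 0] \<omega>(3) by (auto simp: fun_eq_iff)
  then have eq: "\<omega> = (\<lambda>K. if K \<inter> {1..u} \<subseteq> {..v} then eps_upto u (\<omega> K) else 0)"
    using \<psi>(1) by (simp only: diffl_0 diff_zero)
  obtain c where c: "eps_upto u (\<omega> {}) = c \<bullet>\<^sub>F \<one>\<^bsub>F\<^esub>" using eps_const[OF formsD(1)[OF \<omega>(1)]] by blast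
  have "\<omega> K = c \<bullet>\<^sub>F unit_form K" for K
  proof (cases "K = {}")
    case True
    have "\<omega> {} = eps_upto u (\<omega> {})" using fun_cong[OF eq, of "{}"] by simp
    then show ?thesis using True c by (simp add: unit_form_def)
  next
    case False
    have "\<omega> K = 0"
    proof (cases "finite K")
      case True
      then show ?thesis using False \<omega>(3) by (auto simp: card_eq_0_iff)
    qed (rule finite_form[OF \<omega>(1)])
    then show ?thesis using False by (simp add: unit_form_def)
  qed
  then show ?thesis by blast
qed

lemma part_large: "\<omega> \<in> forms \<Longrightarrow> u < n \<Longrightarrow> part n \<omega> = 0"
proof
  fix I assume \<omega>: "\<omega> \<in> forms" and n: "u < n"
  show "part n \<omega> I = 0 I"
  proof (cases "I \<subseteq> {1..u}")
    case True
    then have "card I \<le> u" using card_mono[of "{1..u}" I] by simp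
    then show ?thesis using n by (simp add: part_def)
  qed (use formsD(2)[OF \<omega>] in \<open>simp add: part_def\<close>)
qed

lemma ring_ZA: "ring ZA"
proof (rule ringI)
  show "abelian_group ZA"
  proof (rule abelian_groupI)
    show "\<exists>y\<in>carrier ZA. y \<oplus>\<^bsub>ZA\<^esub> x = \<zero>\<^bsub>ZA\<^esub>" if "x \<in> carrier ZA" for x
      using that Zf_uminus[of x] by (intro bexI[of _ "- x"]) (auto simp: ZA_simps)
  qed (simp_all add: ZA_simps Zf_0 Zf_add add.assoc add.commute add.left_commute del: plus_fun_apply zero_fun_apply)
  show "Group.monoid ZA"
    by (rule monoidI) (auto simp: ZA_simps ZA_mult Zf_wedge unit_form_Zf wedge_assoc wedge_unit ZfD)
qed (auto simp: ZA_simps ZA_mult Zf_wedge Zf_add wedge_add simp del: plus_fun_apply)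

lemma finsum_ZA: "(\<And>i. i \<in> S \<Longrightarrow> f i \<in> Zf) \<Longrightarrow> finsum ZA f S = sum f S"
proof -
  interpret R: ring ZA by (rule ring_ZA)
  show "(\<And>i. i \<in> S \<Longrightarrow> f i \<in> Zf) \<Longrightarrow> finsum ZA f S = sum f S"
  proof (induction S rule: infinite_finite_induct)
    case (insert x S)
    then have "finsum ZA f (insert x S) = f x \<oplus>\<^bsub>ZA\<^esub> finsum ZA f S"
      by (intro R.finsum_insert) (auto simp: ZA_simps)
    then show ?case using insert by (simp add: ZA_simps del: plus_fun_apply)
  qed (simp_all add: R.finsum_infinite ZA_simps del: zero_fun_apply)
qed

lemma graded_algebra_ZA: "graded_algebra ZA Zgr"
proof -
  interpret R: ring ZA by (rule ring_ZA)
  show ?thesis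
  proof (rule graded_algebra.intro[OF ring_ZA], rule graded_algebra_axioms.intro)
    show "subgroup (Zgr n) (add_monoid ZA)" for n
    proof (rule R.add.subgroupI)
      show "Zgr n \<noteq> {}" using part_Zgr[OF Zf_0] by blast
      fix x assume x: "x \<in> Zgr n"
      then have "\<ominus>\<^bsub>ZA\<^esub> x = - x"
        using R.minus_equality[of "- x" x] Zf_uminus[of x] by (simp add: ZA_simps Zgr_iff)
      then show "\<ominus>\<^bsub>ZA\<^esub> x \<in> Zgr n" using x Zf_uminus[of x] by (auto simp: Zgr_iff)
    qed (auto simp: ZA_simps Zgr_iff Zf_add)
    fix x assume "x \<in> carrier ZA"
    then have x: "x \<in> Zf" by (simp add: ZA_simps)
    show "\<exists>!c. (\<forall>n. c n \<in> Zgr n) \<and> finite {n. c n \<noteq> \<zero>\<^bsub>ZA\<^esub>} \<and> x = (\<Oplus>\<^bsub>ZA\<^esub>n\<in>{n. c n \<noteq> \<zero>\<^bsub>ZA\<^esub>}. c n)"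
    proof (rule ex1I[of _ "\<lambda>n. part n x"])
      have sub: "{n. part n x \<noteq> 0} \<subseteq> {..u}" using part_large[OF ZfD(1)[OF x]] by (auto simp: not_le[symmetric])
      have "x I = (\<Sum>n\<in>{n. part n x \<noteq> 0}. part n x I)" for I
      proof -
        have "(\<Sum>n\<in>{n. part n x \<noteq> 0}. part n x I) = (\<Sum>n\<in>{n. part n x \<noteq> 0}. if n = card I then x I else 0)"
          by (rule sum.cong) (auto simp: part_def)
        also have "\<dots> = (if card I \<in> {n. part n x \<noteq> 0} then x I else 0)"
          using finite_subset[OF sub] by (simp add: sum.delta)
        also have "\<dots> = x I"
        proof (cases "part (card I) x = 0")
          case True
          then have "part (card I) x I = 0" by simp
          then show ?thesis by (simp add: part_def)
        qed simp
        finally show ?thesis ..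
      qed
      then have "x = (\<Sum>n\<in>{n. part n x \<noteq> 0}. part n x)" by (simp add: fun_eq_iff sum_fun_apply)
      then show "(\<forall>n. part n x \<in> Zgr n) \<and> finite {n. part n x \<noteq> \<zero>\<^bsub>ZA\<^esub>} \<and> x = (\<Oplus>\<^bsub>ZA\<^esub>n\<in>{n. part n x \<noteq> \<zero>\<^bsub>ZA\<^esub>}. part n x)"
        using part_Zgr[OF x] finite_subset[OF sub] finsum_ZA[of "{n. part n x \<noteq> 0}" "\<lambda>n. part n x"]
        by (auto simp: ZA_simps Zgr_iff)
    next
      fix c assume c: "(\<forall>n. c n \<in> Zgr n) \<and> finite {n. c n \<noteq> \<zero>\<^bsub>ZA\<^esub>} \<and> x = (\<Oplus>\<^bsub>ZA\<^esub>n\<in>{n. c n \<noteq> \<zero>\<^bsub>ZA\<^esub>}. c n)"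
      then have fin: "finite {n. c n \<noteq> 0}" and cg: "\<And>n. c n \<in> Zgr n" by (auto simp: ZA_simps)
      have "x = (\<Sum>n\<in>{n. c n \<noteq> 0}. c n)"
        using c finsum_ZA[of "{n. c n \<noteq> 0}" c] cg by (auto simp: ZA_simps Zgr_iff)
      then have xI: "x I = (\<Sum>n\<in>{n. c n \<noteq> 0}. c n I)" for I by (metis sum_fun_apply)
      have "x I = c (card I) I" for I
      proof -
        have "x I = (\<Sum>n\<in>{n. c n \<noteq> 0}. if n = card I then c (card I) I else 0)"
          unfolding xI by (rule sum.cong) (use cg in \<open>auto simp: Zgr_iff\<close>)
        also have "\<dots> = (if card I \<in> {n. c n \<noteq> 0} then c (card I) I else 0)" using fin by (simp add: sum.delta)
        finally show ?thesis by auto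
      qed
      then show "c = (\<lambda>n. part n x)" using cg by (auto simp: fun_eq_iff part_def Zgr_iff)
    qed
  qed (auto simp: ZA_simps ZA_mult Zf_smult Zf_wedge wedge_smult fun_eq_iff VF.scale_right_distrib VF.scale_left_distrib
      Zgr_iff unit_form_Zf unit_form_Zf[unfolded unit_form_def] Zgr_mult[unfolded Zgr_iff] unit_form_def)
qed

lemma additive_graded_algebra_ZA: "additive_graded_algebra ZA Zgr"
proof (rule additive_graded_algebra.intro[OF graded_algebra_ZA], rule additive_graded_algebra_axioms.intro)
  show "vector_space (smult ZA)"
    by standard (auto simp: ZA_simps fun_eq_iff VF.scale_right_distrib VF.scale_left_distrib)
  have "inj (\<lambda>c. (\<lambda>I. c \<bullet>\<^sub>F unit_form I))"
  proof (rule injI)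
    fix c c' assume "(\<lambda>I. c \<bullet>\<^sub>F unit_form I) = (\<lambda>I. c' \<bullet>\<^sub>F unit_form I)"
    then have "c \<bullet>\<^sub>F \<one>\<^bsub>F\<^esub> = c' \<bullet>\<^sub>F \<one>\<^bsub>F\<^esub>" by (auto simp: unit_form_def dest: fun_cong[of _ _ "{}"])
    then show "c = c'" using one_nonzero by simp
  qed
  moreover have "(\<lambda>I. c \<bullet>\<^sub>F unit_form I) \<in> Zgr 0" for c
    using Zf_smult[OF unit_form_Zf] by (auto simp: Zgr_iff unit_form_def)
  ultimately show "bij_betw (\<lambda>c. c \<odot>\<^bsub>ZA\<^esub> \<one>\<^bsub>ZA\<^esub>) UNIV (Zgr 0)"
    by (auto simp: bij_betw_def ZA_simps dest!: Zgr_0)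
qed (auto simp: ZA_simps)

section \<open>The Koszul complex with coefficients in forms and in closed forms\<close>

definition kd :: "((nat \<Rightarrow> nat) \<Rightarrow> nat set \<Rightarrow> 'f) \<Rightarrow> (nat \<Rightarrow> nat) \<Rightarrow> nat set \<Rightarrow> 'f" where
  "kd x a = (\<Sum>s\<in>{1..u}. ext s (x (a(s := Suc (a s)))))"

text \<open>The cohomology class of a closed form, represented by constants: for
  \<open>I \<subseteq> {1..v}\<close>, the value at the origin of the coefficient of the product of
  the \<open>dz_s/z_s\<close> with \<open>s \<in> I\<close>, an iterated residue.\<close>

definition residue_part :: "(nat set \<Rightarrow> 'f) \<Rightarrow> nat set \<Rightarrow> 'f" where
  "residue_part \<omega> I = (if I \<subseteq> {1..v} then eps_upto u (\<omega> I) else 0)"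

lemma eps_add: "t \<in> {1..u} \<Longrightarrow> f \<in> carrier F \<Longrightarrow> g \<in> carrier F \<Longrightarrow> eps t (f + g) = eps t f + eps t g"
  by (simp add: eps_def \<delta>_add J_add \<delta>_closed)

lemma eps_closed: "t \<in> {1..u} \<Longrightarrow> f \<in> carrier F \<Longrightarrow> eps t f \<in> carrier F"
  by (simp add: eps_def X_diff J_closed \<delta>_closed)

lemma eps_upto_closed: "k \<le> u \<Longrightarrow> f \<in> carrier F \<Longrightarrow> eps_upto k f \<in> carrier F"
  by (induction k) (auto simp: eps_closed)

lemma eps_upto_add: "k \<le> u \<Longrightarrow> f \<in> carrier F \<Longrightarrow> g \<in> carrier F \<Longrightarrow> eps_upto k (f + g) = eps_upto k f + eps_upto k g"
  by (induction k) (auto simp: eps_add eps_upto_closed)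

lemma eps_upto_uminus: "f \<in> carrier F \<Longrightarrow> eps_upto u (- f) = - eps_upto u f"
  using eps_upto_add[of u f "- f"] eps_upto_0[of u] X_uminus[of f] by (simp add: eq_neg_iff_add_eq_0 add.commute)

lemma eps_upto_alt: "f \<in> carrier F \<Longrightarrow> eps_upto u (alt n f) = alt n (eps_upto u f)"
  by (auto simp: alt_def eps_upto_uminus)

lemma residue_part_add:
  "\<alpha> \<in> forms \<Longrightarrow> \<beta> \<in> forms \<Longrightarrow> residue_part (\<alpha> + \<beta>) = residue_part \<alpha> + residue_part \<beta>"
  by (auto simp: residue_part_def fun_eq_iff eps_upto_add formsD)

lemma residue_part_0: "residue_part 0 = 0"
  by (auto simp: residue_part_def fun_eq_iff eps_upto_0)

lemma residue_part_diff:
  assumes "\<alpha> \<in> forms" "\<beta> \<in> forms" shows "residue_part (\<alpha> - \<beta>) = residue_part \<alpha> - residue_part \<beta>"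
  using residue_part_add[OF forms_diff[OF assms] assms(2)] by (simp add: algebra_simps)

lemma residue_part_sum:
  "(\<And>i. i \<in> S \<Longrightarrow> f i \<in> forms) \<Longrightarrow> residue_part (sum f S) = (\<Sum>i\<in>S. residue_part (f i))"
proof (induction S rule: infinite_finite_induct)
  case (insert x S)
  then show ?case unfolding sum.insert[OF insert.hyps]
    by (subst residue_part_add) (auto intro: forms_sum simp del: plus_fun_apply)
qed (simp_all only: sum.infinite sum.empty residue_part_0 not_False_eq_True)

text \<open>Index sets inside \<open>{1..v}\<close> cannot contain an ordinary direction: on
  cohomology \<open>\<eta> s\<close> acts by exterior multiplication for \<open>s \<le> v\<close>
  and by zero for \<open>v < s\<close>, where it is the exact form \<open>dz_s\<close>.\<close>

lemma residue_part_ext: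
  assumes "\<omega> \<in> forms"
  shows "residue_part (ext s \<omega>) = (if s \<in> {1..v} then ext s (residue_part \<omega>) else 0)"
proof
  fix K
  show "residue_part (ext s \<omega>) K = (if s \<in> {1..v} then ext s (residue_part \<omega>) else 0) K"
  proof (cases "s \<in> K \<and> s \<in> {1..v}")
    case True
    then have "K \<subseteq> {1..v} \<longleftrightarrow> K - {s} \<subseteq> {1..v}" by blast
    then show ?thesis using True eps_upto_alt[OF formsD(1)[OF assms]] by (simp add: residue_part_def ext_def)
  next
    case False
    then show ?thesis by (auto simp: residue_part_def ext_def eps_upto_0)
  qed
qed

text \<open>On forms supported in subsets of \<open>{1..u}\<close> the remainder left by
  \<open>poincare\<close> is precisely the residue part.\<close>

lemma closed_exact:
  assumes "\<omega> \<in> Zgr (Suc m)" "residue_part \<omega> = 0"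
  obtains \<psi> where "\<psi> \<in> forms" "\<And>I. card I \<noteq> m \<Longrightarrow> \<psi> I = 0" "\<omega> = diffl \<psi>"
proof -
  have \<omega>: "\<omega> \<in> forms" "diffl \<omega> = 0" "\<forall>I. card I \<noteq> Suc m \<longrightarrow> \<omega> I = 0" using assms by (auto simp: Zgr_iff Zf_def)
  obtain \<psi> where \<psi>: "\<psi> \<in> forms" "\<omega> - diffl \<psi> = (\<lambda>K. if K \<inter> {1..u} \<subseteq> {..v} then eps_upto u (\<omega> K) else 0)"
    "\<forall>m. (\<forall>I. card I \<noteq> m \<longrightarrow> \<omega> I = 0) \<longrightarrow> (\<forall>I. Suc (card I) \<noteq> m \<longrightarrow> \<psi> I = 0)"
    using poincare[OF \<omega>(1,2)] by (elim bexE conjE) (rule that)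
  have "(\<lambda>K. if K \<inter> {1..u} \<subseteq> {..v} then eps_upto u (\<omega> K) else 0) = residue_part \<omega>"
  proof
    fix K
    show "(if K \<inter> {1..u} \<subseteq> {..v} then eps_upto u (\<omega> K) else 0) = residue_part \<omega> K"
    proof (cases "K \<subseteq> {1..u}")
      case True
      then have "K \<inter> {1..u} = K" by blast
      moreover have "K \<subseteq> {..v} \<longleftrightarrow> K \<subseteq> {1..v}" using True by (meson atLeastAtMost_iff atMost_iff subset_iff)
      ultimately have "K \<inter> {1..u} \<subseteq> {..v} \<longleftrightarrow> K \<subseteq> {1..v}" by simp
      then show ?thesis by (simp add: residue_part_def)
    next
      case False
      then show ?thesis using formsD(2)[OF \<omega>(1) False] by (simp add: residue_part_def eps_upto_0)
    qed
  qed
  then have "\<omega> = diffl \<psi>" using \<psi>(2) assms(2) by simp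
  then show ?thesis using that[OF \<psi>(1)] \<psi>(3)[rule_format, of "Suc m"] \<omega>(3) by blast
qed

lemma diffl_ext:
  assumes "s \<in> {1..u}" "\<omega> \<in> forms" shows "diffl (ext s \<omega>) = - ext s (diffl \<omega>)"
proof -
  have "ext t (\<lambda>I. \<delta> t (ext s \<omega> I)) = - ext s (ext t (\<lambda>I. \<delta> t (\<omega> I)))" if t: "t \<in> {1..u}" for t
    unfolding \<delta>_ext[OF t assms(2)]
  proof (cases "t = s")
    case False
    then show "ext t (ext s (\<lambda>I. \<delta> t (\<omega> I))) = - ext s (ext t (\<lambda>I. \<delta> t (\<omega> I)))" by (rule ext_ext)
  qed (simp only: ext_ext_same neg_0_equal_iff_equal minus_zero)
  then have "diffl (ext s \<omega>) = (\<Sum>t\<in>{1..u}. - ext s (ext t (\<lambda>I. \<delta> t (\<omega> I))))"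
    unfolding diffl_def by (rule sum.cong[OF refl])
  then show ?thesis unfolding diffl_def ext_sum sum_negf .
qed

lemma kd_forms: "(\<And>a. x a \<in> forms) \<Longrightarrow> kd x a \<in> forms"
  unfolding kd_def by (intro forms_sum forms_ext)

lemma diffl_sum: "(\<And>i. i \<in> S \<Longrightarrow> f i \<in> forms) \<Longrightarrow> diffl (sum f S) = (\<Sum>i\<in>S. diffl (f i))"
proof (induction S rule: infinite_finite_induct)
  case (insert x S)
  then show ?case unfolding sum.insert[OF insert.hyps]
    by (subst diffl_add) (auto intro: forms_sum simp del: plus_fun_apply)
qed (simp_all only: sum.infinite sum.empty diffl_0 not_False_eq_True)

text \<open>The de Rham and Koszul differentials anticommute, because \<open>d\<close> anticommutes
  with each closed one-form; the diagram chase below takes place in the resulting double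
  complex.\<close>

lemma diffl_kd: assumes "\<And>a. x a \<in> forms" shows "diffl (kd x a) = - kd (\<lambda>a. diffl (x a)) a"
proof -
  have "diffl (kd x a) = (\<Sum>s\<in>{1..u}. diffl (ext s (x (a(s := Suc (a s))))))"
    unfolding kd_def by (rule diffl_sum) (intro forms_ext assms)
  also have "\<dots> = (\<Sum>s\<in>{1..u}. - ext s (diffl (x (a(s := Suc (a s))))))"
    by (rule sum.cong[OF refl]) (rule diffl_ext[OF _ assms])
  finally show ?thesis unfolding kd_def sum_negf .
qed

lemma kd_diff: "kd (\<lambda>a. x a - y a) a = kd x a - kd y a"
  unfolding kd_def ext_diff sum_subtractf ..

lemma kd_kd: "kd (kd x) a = 0"
proof -
  have "kd (kd x) a = (\<Sum>s\<in>{1..u}. \<Sum>t\<in>{1..u}. ext s (ext t (x (a(s := Suc (a s), t := Suc ((a(s := Suc (a s))) t))))))"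
    unfolding kd_def ext_sum ..
  also have "\<dots> = 0"
  proof (rule sum_antisymmetric)
    fix s t :: nat assume ne: "s \<noteq> t"
    then have eq: "a(s := Suc (a s), t := Suc ((a(s := Suc (a s))) t)) = a(t := Suc (a t), s := Suc ((a(t := Suc (a t))) s))"
      by (auto simp: fun_eq_iff)
    show "ext s (ext t (x (a(s := Suc (a s), t := Suc ((a(s := Suc (a s))) t))))) =
      - ext t (ext s (x (a(t := Suc (a t), s := Suc ((a(t := Suc (a t))) s)))))"
      unfolding eq by (rule ext_ext[OF ne])
  qed simp_all
  finally show ?thesis .
qed

lemma finite_support_kd:
  assumes "finite {a. x a \<noteq> 0}" shows "finite {a. kd x a \<noteq> 0}"
proof (rule finite_subset)
  show "{a. kd x a \<noteq> 0} \<subseteq> (\<Union>s\<in>{1..u}. (\<lambda>a. a(s := a s - 1)) ` {a. x a \<noteq> 0})"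
  proof
    fix a assume a: "a \<in> {a. kd x a \<noteq> 0}"
    have "\<exists>s\<in>{1..u}. x (a(s := Suc (a s))) \<noteq> 0"
    proof (rule ccontr)
      assume "\<not> (\<exists>s\<in>{1..u}. x (a(s := Suc (a s))) \<noteq> 0)"
      then have "kd x a = 0" unfolding kd_def by (intro sum.neutral ballI) (simp only: ext_0 bex_simps ball_simps not_not)
      then show False using a by simp
    qed
    then obtain s where s: "s \<in> {1..u}" "a(s := Suc (a s)) \<in> {a. x a \<noteq> 0}" by blast
    moreover have "a = (\<lambda>a. a(s := a s - 1)) (a(s := Suc (a s)))" by auto
    ultimately show "a \<in> (\<Union>s\<in>{1..u}. (\<lambda>a. a(s := a s - 1)) ` {a. x a \<noteq> 0})" by blast
  qed
qed (use assms in auto)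

text \<open>All forms make up a free module over the exterior algebra, with functions as
  coefficients, so their Koszul complex is acyclic in positive form degree.\<close>

lemma kd_exact_forms:
  assumes "finite {a. x a \<noteq> 0}" "\<And>a. x a \<in> forms" "\<And>a I. card I \<noteq> Suc m \<Longrightarrow> x a I = 0" "\<And>a. kd x a = 0"
  obtains y where "finite {a. y a \<noteq> 0}" "\<And>a. y a \<in> forms" "\<And>a I. card I \<noteq> m \<Longrightarrow> y a I = 0" "\<And>a. x a = kd y a"
proof -
  have "\<exists>y. finite {a. y a \<noteq> 0} \<and> (\<forall>a I. y a I \<in> carrier F) \<and> (\<forall>a I. \<not> I \<subseteq> {1..u} \<longrightarrow> y a I = 0) \<and>
     (\<forall>a I. card I \<noteq> m \<longrightarrow> y a I = 0) \<and> (\<forall>a. x a = (\<Sum>s\<in>{1..u}. ext s (y (a(s := Suc (a s))))))"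
    by (rule koszul_complex_exact[OF X_0 X_add X_uminus assms(1) _ _ assms(3)])
      (use assms(4) in \<open>simp_all add: kd_def formsD[OF assms(2)]\<close>)
  then obtain y where y: "finite {a. y a \<noteq> 0}" "\<forall>a I. y a I \<in> carrier F" "\<forall>a I. \<not> I \<subseteq> {1..u} \<longrightarrow> y a I = 0"
    "\<forall>a I. card I \<noteq> m \<longrightarrow> y a I = 0" "\<forall>a. x a = (\<Sum>s\<in>{1..u}. ext s (y (a(s := Suc (a s)))))"
    by (elim exE conjE) (rule that)
  show ?thesis
    by (rule that[of y]) (use y in \<open>simp_all add: forms_def kd_def\<close>)
qed

text \<open>Exactness for the cohomology. The residue parts of a Koszul cycle form a cycle over the
  exterior algebra on the first \<open>v\<close> generators, with scalar coefficients, hence bound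
  there. The bounding family has constant coefficients and is therefore closed, so subtracting its
  Koszul boundary stays inside closed forms and removes the residues.\<close>

lemma kd_exact_const:
  assumes fin: "finite {a. x a \<noteq> 0}" and x: "\<And>a. x a \<in> Zgr (Suc m)" and cyc: "\<And>a. kd x a = 0"
  obtains y where "finite {a. y a \<noteq> 0}" "\<And>a. y a \<in> Zgr m" "\<And>a. residue_part (x a - kd y a) = 0"
proof -
  define C where "C = range (\<lambda>c. c \<bullet>\<^sub>F \<one>\<^bsub>F\<^esub>)"
  have C: "0 \<in> C" "\<And>x y. x \<in> C \<Longrightarrow> y \<in> C \<Longrightarrow> x + y \<in> C" "\<And>x. x \<in> C \<Longrightarrow> - x \<in> C"
  proof -
    show "0 \<in> C" unfolding C_def by (rule range_eqI[of _ _ 0]) simp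
    show "x + y \<in> C" if "x \<in> C" "y \<in> C" for x y
      using that unfolding C_def by (auto simp: VF.scale_left_distrib[symmetric])
    show "- x \<in> C" if "x \<in> C" for x
      using that unfolding C_def by (auto simp: VF.scale_minus_left[symmetric] simp del: VF.scale_minus_left)
  qed
  have xf: "x a \<in> forms" for a using x by (auto simp: Zgr_iff Zf_def)
  have "\<exists>y. finite {a. y a \<noteq> 0} \<and> (\<forall>a I. y a I \<in> C) \<and> (\<forall>a I. \<not> I \<subseteq> {1..v} \<longrightarrow> y a I = 0) \<and>
     (\<forall>a I. card I \<noteq> m \<longrightarrow> y a I = 0) \<and> (\<forall>a. residue_part (x a) = (\<Sum>s\<in>{1..v}. ext s (y (a(s := Suc (a s))))))"
  proof (rule koszul_complex_exact[OF C])
    show "finite {a. residue_part (x a) \<noteq> 0}"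
      by (rule finite_support_compose[where h=residue_part, OF fin residue_part_0])
    show "residue_part (x a) I \<in> C" for a I
      using eps_const[OF formsD(1)[OF xf, of a I]] C(1) by (auto simp: residue_part_def C_def)
    show "residue_part (x a) I = 0" if "\<not> I \<subseteq> {1..v}" for a I using that by (simp add: residue_part_def)
    show "residue_part (x a) I = 0" if "card I \<noteq> Suc m" for a I
      using x[of a] that by (auto simp: residue_part_def Zgr_iff eps_upto_0)
    show "(\<Sum>s\<in>{1..v}. ext s (residue_part (x (a(s := Suc (a s)))))) = 0" for a
    proof -
      have "0 = residue_part (kd x a)" unfolding cyc residue_part_0 ..
      also have "\<dots> = (\<Sum>s\<in>{1..u}. residue_part (ext s (x (a(s := Suc (a s))))))"
        unfolding kd_def by (rule residue_part_sum) (intro forms_ext xf)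
      \<comment> \<open>Directions beyond \<open>v\<close> act as zero on residues.\<close>
      also have "\<dots> = (\<Sum>s\<in>{1..v}. residue_part (ext s (x (a(s := Suc (a s))))))"
        by (rule sum.mono_neutral_right) (use v_le_u residue_part_ext[OF xf] in auto)
      also have "\<dots> = (\<Sum>s\<in>{1..v}. ext s (residue_part (x (a(s := Suc (a s))))))"
        by (rule sum.cong) (simp_all only: residue_part_ext[OF xf] if_True)
      finally show ?thesis ..
    qed
  qed
  then obtain y where y: "finite {a. y a \<noteq> 0}" "\<forall>a I. y a I \<in> C" "\<forall>a I. \<not> I \<subseteq> {1..v} \<longrightarrow> y a I = 0"
    "\<forall>a I. card I \<noteq> m \<longrightarrow> y a I = 0" "\<forall>a. residue_part (x a) = (\<Sum>s\<in>{1..v}. ext s (y (a(s := Suc (a s)))))"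
    by (elim exE conjE) (rule that)
  have yZ: "y a \<in> Zgr m" for a
  proof -
    have "y a \<in> Zf"
    proof (rule Zf_const)
      show "\<exists>c. y a I = c \<bullet>\<^sub>F \<one>\<^bsub>F\<^esub>" for I using y(2) by (auto simp: C_def)
      show "y a I = 0" if "\<not> I \<subseteq> {1..u}" for I
        using y(3)[rule_format, of I a] that v_le_u by (meson atLeastatMost_subset_iff order_trans order_refl)
    qed
    then show ?thesis using y(4) by (simp add: Zgr_iff)
  qed
  have yf: "y a \<in> forms" for a using yZ by (auto simp: Zgr_iff Zf_def)
  \<comment> \<open>Restriction fixes scalars, so the constant family is its own residue
    part.\<close>
  have eps_C: "eps_upto k (c \<bullet>\<^sub>F \<one>\<^bsub>F\<^esub>) = c \<bullet>\<^sub>F \<one>\<^bsub>F\<^esub>" if "k \<le> u" for k c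
    using that by (induction k) (auto simp: eps_def \<delta>_const)
  have ry: "residue_part (y a) = y a" for a
  proof
    fix I
    obtain c where "y a I = c \<bullet>\<^sub>F \<one>\<^bsub>F\<^esub>" using y(2) by (auto simp: C_def)
    then show "residue_part (y a) I = y a I"
      using y(3)[rule_format, of I a] eps_C[of u c] by (cases "I \<subseteq> {1..v}") (simp_all add: residue_part_def)
  qed
  have "residue_part (x a - kd y a) = 0" for a
  proof -
    have "residue_part (kd y a) = (\<Sum>s\<in>{1..u}. residue_part (ext s (y (a(s := Suc (a s))))))"
      unfolding kd_def by (rule residue_part_sum) (intro forms_ext yf)
    also have "\<dots> = (\<Sum>s\<in>{1..v}. residue_part (ext s (y (a(s := Suc (a s))))))"
      by (rule sum.mono_neutral_right) (use v_le_u residue_part_ext[OF yf] in auto)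
    also have "\<dots> = (\<Sum>s\<in>{1..v}. ext s (y (a(s := Suc (a s)))))"
      by (rule sum.cong) (simp_all only: residue_part_ext[OF yf] if_True ry)
    also have "\<dots> = residue_part (x a)" using y(5) by simp
    finally show ?thesis unfolding residue_part_diff[OF xf kd_forms[OF yf]] by simp
  qed
  then show ?thesis using that[OF y(1) yZ] by blast
qed

text \<open>Induction on a bound for the homological degree: by the exact sequences \<open>0 \<rightarrow> B \<rightarrow> Z \<rightarrow> H \<rightarrow> 0\<close> and
  \<open>0 \<rightarrow> Z \<rightarrow> \<Omega> \<rightarrow> B \<rightarrow> 0\<close>, homology of \<open>Z\<close> in degree \<open>q\<close> is controlled by the cohomology \<open>H\<close> and by homology
  of \<open>Z\<close> in degree \<open>q - 1\<close>.\<close>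

lemma kd_exact_bounded:
  fixes q m :: nat
  assumes "finite {a. x a \<noteq> 0}" "\<And>a. x a \<in> Zgr (Suc (Suc m))" "\<And>a. kd x a = 0"
    and "\<And>a. q \<le> (\<Sum>s\<in>{1..u}. a s) \<Longrightarrow> x a = 0"
  shows "\<exists>y. finite {a. y a \<noteq> 0} \<and> (\<forall>a. y a \<in> Zgr (Suc m)) \<and> (\<forall>a. x a = kd y a)"
  using assms
proof (induction q arbitrary: x)
  case 0
  have "kd (\<lambda>_. 0) a = 0" for a unfolding kd_def ext_0 by (rule sum.neutral_const)
  moreover have "0 \<in> Zgr (Suc m)" using Zf_0 by (auto simp: Zgr_iff)
  moreover have "x a = 0" for a by (rule 0(4)) (rule le0)
  ultimately have "\<forall>a. x a = kd (\<lambda>_. 0) a" "\<forall>a :: nat \<Rightarrow> nat. 0 \<in> Zgr (Suc m)" by (simp_all only: simp_thms)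
  moreover have "finite {a :: nat \<Rightarrow> nat. (0 :: nat set \<Rightarrow> 'f) \<noteq> 0}" by simp
  ultimately show ?case by (intro exI[where x="\<lambda>_. 0"] conjI)
next
  case (Suc q)
  define nm where "nm a = (\<Sum>s\<in>{1..u}. a s)" for a :: "nat \<Rightarrow> nat"
  have nm: "nm (a(s := Suc (a s))) = Suc (nm a)" if "s \<in> {1..u}" for a s
  proof -
    have "nm (a(s := Suc (a s))) = (\<Sum>t\<in>{1..u}. a t + (if t = s then 1 else 0))"
      unfolding nm_def by (rule sum.cong) auto
    then show ?thesis using that by (simp add: sum.distrib nm_def)
  qed
  obtain y0 where y0: "finite {a. y0 a \<noteq> 0}" "\<And>a. y0 a \<in> Zgr (Suc m)" "\<And>a. residue_part (x a - kd y0 a) = 0"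
    using kd_exact_const[OF Suc.prems(1,2,3)] by metis
  \<comment> \<open>The differential lowers the total index by one and \<open>x\<close> vanishes
    from \<open>Suc q\<close> on, so only values of \<open>y0\<close> up to \<open>Suc q\<close> are
    wanted; cutting off the rest keeps the corrected cycle within the same bound.\<close>
  define y1 where "y1 a = (if nm a < Suc (Suc q) then y0 a else 0)" for a
  have y1Z: "y1 a \<in> Zgr (Suc m)" for a using y0(2) Zf_0 by (auto simp: y1_def Zgr_iff)
  have y1f: "y1 a \<in> forms" for a using y1Z by (auto simp: Zgr_iff Zf_def)
  have y1fin: "finite {a. y1 a \<noteq> 0}" by (rule finite_subset[OF _ y0(1)]) (auto simp: y1_def)
  have kd1: "kd y1 a = (if nm a < Suc q then kd y0 a else 0)" for a
  proof (cases "nm a < Suc q")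
    case True
    then have "kd y1 a = kd y0 a"
      unfolding kd_def by (intro sum.cong[OF refl]) (simp only: y1_def nm if_True Suc_less_eq)
    then show ?thesis using True by simp
  next
    case False
    then have "kd y1 a = (\<Sum>s\<in>{1..u}. 0)"
      unfolding kd_def by (intro sum.cong[OF refl]) (simp only: y1_def nm if_False Suc_less_eq ext_0)
    then show ?thesis using False by (simp only: sum.neutral_const if_False)
  qed
  define x' where "x' a = x a - kd y1 a" for a
  have x'0: "x' a = 0" if "\<not> nm a < Suc q" for a
  proof -
    have "x a = 0" by (rule Suc.prems(4)) (use that in \<open>simp add: nm_def\<close>)
    moreover have "kd y1 a = 0" unfolding kd1 by (rule if_not_P[OF that])
    ultimately show ?thesis unfolding x'_def by (simp only: diff_self)
  qed
  have x'r: "residue_part (x' a) = 0" for a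
    using y0(3)[of a] x'0[of a] kd1[of a] residue_part_0 by (cases "nm a < Suc q") (simp_all add: x'_def)
  have x'Z: "x' a \<in> Zgr (Suc (Suc m))" for a
  proof -
    have d0: "(\<lambda>a. diffl (y1 a)) = (\<lambda>a. 0)" using y1Z by (auto simp: Zgr_iff Zf_def)
    have "diffl (kd y1 a) = 0"
      by (simp only: diffl_kd[OF y1f] d0) (simp only: kd_def ext_0 sum.neutral_const minus_zero)
    moreover have "kd y1 a I = 0" if "card I \<noteq> Suc (Suc m)" for I
    proof -
      have "ext s (y1 b) I = 0" for s b
        by (rule ext_degree[OF y1f _ that]) (use y1Z in \<open>auto simp: Zgr_iff\<close>)
      then show ?thesis by (simp add: kd_def sum_fun_apply)
    qed
    ultimately have "kd y1 a \<in> Zgr (Suc (Suc m))" using kd_forms[OF y1f] by (auto simp: Zgr_iff Zf_def)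
    then show ?thesis using Suc.prems(2)[of a] Zf_diff by (auto simp: x'_def Zgr_iff)
  qed
  have x'fin: "finite {a. x' a \<noteq> 0}"
    unfolding x'_def by (rule finite_support_diff[OF Suc.prems(1) finite_support_kd[OF y1fin]])
  have x'cyc: "kd x' a = 0" for a
    unfolding x'_def kd_diff Suc.prems(3) kd_kd by simp
  \<comment> \<open>Residues being zero, \<open>x'\<close> is exact at each index; demanding
    \<open>w = 0\<close> where \<open>x'\<close> vanishes preserves the support and the
    bound.\<close>
  have "\<exists>w. w \<in> forms \<and> (\<forall>I. card I \<noteq> Suc m \<longrightarrow> w I = 0) \<and> x' a = diffl w \<and> (x' a = 0 \<longrightarrow> w = 0)" for a
  proof (cases "x' a = 0")
    case True
    have "0 \<in> forms \<and> (\<forall>I. card I \<noteq> Suc m \<longrightarrow> (0 :: nat set \<Rightarrow> 'f) I = 0) \<and> x' a = diffl 0 \<and> (x' a = 0 \<longrightarrow> (0 :: nat set \<Rightarrow> 'f) = 0)"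
      unfolding True diffl_0 using forms_0 by simp
    then show ?thesis by (rule exI[where x="0 :: nat set \<Rightarrow> 'f"])
  next
    case False
    obtain w where "w \<in> forms" "\<And>I. card I \<noteq> Suc m \<Longrightarrow> w I = 0" "x' a = diffl w"
      using closed_exact[OF x'Z x'r] by metis
    then show ?thesis using False by blast
  qed
  from choice[OF allI[OF this]] obtain w where w': "\<forall>a. w a \<in> forms \<and> (\<forall>I. card I \<noteq> Suc m \<longrightarrow> w a I = 0) \<and>
    x' a = diffl (w a) \<and> (x' a = 0 \<longrightarrow> w a = 0)" by (rule exE)
  then have w: "w a \<in> forms" "card I \<noteq> Suc m \<Longrightarrow> w a I = 0" "x' a = diffl (w a)" "x' a = 0 \<Longrightarrow> w a = 0" for a I
    by simp_all
  have wfin: "finite {a. w a \<noteq> 0}" by (rule finite_subset[OF _ x'fin]) (use w(4) in auto)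
  \<comment> \<open>Applying \<open>kd\<close> shortens the range of total indices by one: this is
    the drop from \<open>Suc q\<close> to \<open>q\<close> that feeds the induction.\<close>
  have kw0: "kd w a = 0" if "q \<le> nm a" for a
  proof -
    have "w (a(s := Suc (a s))) = 0" if "s \<in> {1..u}" for s
      by (rule w(4), rule x'0) (use \<open>q \<le> nm a\<close> nm[OF that] in simp)
    then show ?thesis unfolding kd_def by (intro sum.neutral ballI) (simp only: ext_0)
  qed
  \<comment> \<open>The family \<open>kd w\<close> consists of closed forms: its differential is
    \<open>- kd x'\<close>, which is 0 since \<open>x'\<close> is a Koszul cycle. Thus it represents
    the image of \<open>x'\<close> under the connecting map.\<close>
  have "\<exists>y. finite {a. y a \<noteq> 0} \<and> (\<forall>a. y a \<in> Zgr (Suc m)) \<and> (\<forall>a. kd w a = kd y a)"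
  proof (rule Suc.IH)
    show "finite {a. kd w a \<noteq> 0}" by (rule finite_support_kd[OF wfin])
    show "kd w a \<in> Zgr (Suc (Suc m))" for a
    proof -
      have eq: "(\<lambda>a. diffl (w a)) = x'" using w(3) by auto
      have "diffl (kd w a) = 0" unfolding diffl_kd[OF w(1)] eq x'cyc by simp
      moreover have "kd w a I = 0" if "card I \<noteq> Suc (Suc m)" for I
      proof -
        have "ext s (w b) I = 0" for s b
          by (rule ext_degree[OF w(1) _ that]) (rule w(2))
        then show ?thesis by (simp add: kd_def sum_fun_apply)
      qed
      ultimately show ?thesis using kd_forms[OF w(1)] by (auto simp: Zgr_iff Zf_def)
    qed
    show "kd (kd w) a = 0" for a by (rule kd_kd)
    show "kd w a = 0" if "q \<le> (\<Sum>s\<in>{1..u}. a s)" for a using kw0 that by (simp add: nm_def)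
  qed
  then obtain y2 where y2: "finite {a. y2 a \<noteq> 0}" "\<forall>a. y2 a \<in> Zgr (Suc m)" "\<forall>a. kd w a = kd y2 a"
    by (elim exE conjE) (rule that)
  have y2Z: "y2 a \<in> forms" "diffl (y2 a) = 0" "card I \<noteq> Suc m \<Longrightarrow> y2 a I = 0" for a I
    using y2(2) by (auto simp: Zgr_iff Zf_def)
  \<comment> \<open>Subtracting the closed family \<open>y2\<close> turns \<open>w\<close> into a
    Koszul cycle of arbitrary forms, and those bound. Applying \<open>d\<close> gives
    \<open>x'\<close> as the Koszul boundary of the exact family
    \<open>- diffl (z a)\<close>.\<close>
  obtain z where z: "finite {a. z a \<noteq> 0}" "\<And>a. z a \<in> forms" "\<And>a I. card I \<noteq> m \<Longrightarrow> z a I = 0" "\<And>a. w a - y2 a = kd z a"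
  proof (rule kd_exact_forms[of "\<lambda>a. w a - y2 a" m])
    show "finite {a. w a - y2 a \<noteq> 0}" by (rule finite_support_diff[OF wfin y2(1)])
    show "w a - y2 a \<in> forms" for a by (intro forms_diff w y2Z)
    show "(w a - y2 a) I = 0" if "card I \<noteq> Suc m" for a I using w(2)[OF that] y2Z(3)[OF that] by simp
    show "kd (\<lambda>a. w a - y2 a) a = 0" for a unfolding kd_diff using y2(3) by simp
  qed (rule that, assumption, blast, blast, blast)
  have x'z: "x' a = - kd (\<lambda>a. diffl (z a)) a" for a
  proof -
    have "x' a = diffl (y2 a + kd z a)" unfolding w(3) z(4)[symmetric] by simp
    also have "\<dots> = - kd (\<lambda>a. diffl (z a)) a"
      unfolding diffl_add[OF y2Z(1) kd_forms[OF z(2)]] y2Z(2) diffl_kd[OF z(2)] by simp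
    finally show ?thesis .
  qed
  show ?case
  proof (intro exI[of _ "\<lambda>a. y1 a - diffl (z a)"] conjI allI)
    show "finite {a. y1 a - diffl (z a) \<noteq> 0}"
      by (rule finite_support_diff[OF y1fin finite_support_compose[where h=diffl, OF z(1) diffl_0]])
    show "y1 a - diffl (z a) \<in> Zgr (Suc m)" for a
    proof -
      have "diffl (z a) \<in> Zf" using diffl_closed[OF z(2)] diffl_diffl[OF z(2)] by (simp add: Zf_def)
      moreover have "diffl (z a) I = 0" if "card I \<noteq> Suc m" for I
        by (rule diffl_degree[OF z(2) _ that]) (rule z(3))
      ultimately show ?thesis using y1Z[of a] Zf_diff by (auto simp: Zgr_iff)
    qed
    show "x a = kd (\<lambda>a. y1 a - diffl (z a)) a" for a
      unfolding kd_diff using x'z[of a] by (simp add: x'_def algebra_simps)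
  qed
qed

text \<open>Finite support bounds the total index, which is the parameter of the induction.\<close>

lemma kd_exact:
  assumes fin: "finite {a. x a \<noteq> 0}" and "\<And>a. x a \<in> Zgr (Suc (Suc m))" "\<And>a. kd x a = 0"
  shows "\<exists>y. finite {a. y a \<noteq> 0} \<and> (\<forall>a. y a \<in> Zgr (Suc m)) \<and> (\<forall>a. x a = kd y a)"
proof -
  obtain q where q: "\<forall>n\<in>(\<lambda>a. \<Sum>s\<in>{1..u}. a s) ` {a. x a \<noteq> 0}. n < q"
    using finite_nat_set_iff_bounded[of "(\<lambda>a. \<Sum>s\<in>{1..u}. a s) ` {a. x a \<noteq> 0}"] fin by blast
  show ?thesis
    by (rule kd_exact_bounded[OF assms, of q]) (use q in \<open>auto simp: not_less[symmetric]\<close>)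
qed

theorem koszul_ZA: "koszul ZA Zgr"
proof -
  interpret additive_graded_algebra ZA Zgr by (rule additive_graded_algebra_ZA)
  have wZ: "\<eta> s \<otimes>\<^bsub>ZA\<^esub> \<omega> = ext s \<omega>" if "s \<in> {1..u}" "\<omega> \<in> Zf" for s \<omega>
    using ZA_mult[OF \<eta>_Zf[OF that(1)] that(2)] wedge_\<eta>[OF ZfD(1)[OF that(2)]] by simp
  interpret koszul_module_algebra ZA Zgr u \<eta>
  proof
    show "\<eta> s \<in> Zgr 1" if "s \<in> {1..u}" for s using \<eta>_Zf[OF that] by (auto simp: Zgr_iff \<eta>_def)
    \<comment> \<open>In this form the relations among the generators are those among the operators
      \<open>ext s\<close>.\<close>
    have ee: "\<eta> s = ext s unit_form" if "s \<in> {1..u}" for s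
      using wedge_\<eta>[OF unit_form_closed, of s] wedge_unit(2)[OF \<eta>_closed[OF that]] by simp
    show "\<eta> s \<otimes>\<^bsub>ZA\<^esub> \<eta> s = 0" if s: "s \<in> {1..u}" for s
      unfolding wZ[OF s \<eta>_Zf[OF s]] by (subst ee[OF s]) (rule ext_ext_same)
    show "\<eta> s \<otimes>\<^bsub>ZA\<^esub> \<eta> t = - (\<eta> t \<otimes>\<^bsub>ZA\<^esub> \<eta> s)" if "s \<in> {1..u}" "t \<in> {1..u}" "s \<noteq> t" for s t
      using ext_ext[OF that(3), of unit_form]
      unfolding wZ[OF that(1) \<eta>_Zf[OF that(2)]] wZ[OF that(2) \<eta>_Zf[OF that(1)]]
        ee[OF that(1), symmetric] ee[OF that(2), symmetric] .
    fix x :: "(nat \<Rightarrow> nat) \<Rightarrow> nat set \<Rightarrow> 'f" and m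
    assume x: "finite {a. x a \<noteq> 0}" "\<And>a. x a \<in> Zgr (Suc (Suc m))"
      "\<And>a. (\<Sum>s\<in>{1..u}. \<eta> s \<otimes>\<^bsub>ZA\<^esub> x (a(s := Suc (a s)))) = 0"
    have k: "(\<Sum>s\<in>{1..u}. \<eta> s \<otimes>\<^bsub>ZA\<^esub> y (a(s := Suc (a s)))) = kd y a" if "\<forall>a. y a \<in> Zgr i" for y i a
      unfolding kd_def by (rule sum.cong[OF refl], rule wZ) (use that in \<open>auto simp: Zgr_iff\<close>)
    have "\<exists>y. finite {a. y a \<noteq> 0} \<and> (\<forall>a. y a \<in> Zgr (Suc m)) \<and> (\<forall>a. x a = kd y a)"
      by (rule kd_exact[OF x(1,2)]) (simp only: x(3) k[OF allI[OF x(2)], symmetric])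
    then obtain y where y: "finite {a. y a \<noteq> 0}" "\<forall>a. y a \<in> Zgr (Suc m)" "\<forall>a. x a = kd y a"
      by (elim exE conjE) (rule that)
    have "\<forall>a. x a = (\<Sum>s\<in>{1..u}. \<eta> s \<otimes>\<^bsub>ZA\<^esub> y (a(s := Suc (a s))))"
      using y(3) k[OF y(2)] by simp
    then show "\<exists>y. finite {a. y a \<noteq> 0} \<and> (\<forall>a. y a \<in> Zgr (Suc m)) \<and>
      (\<forall>a. x a = (\<Sum>s\<in>{1..u}. \<eta> s \<otimes>\<^bsub>ZA\<^esub> y (a(s := Suc (a s)))))"
      using y(1,2) by blast
  qed
  show ?thesis by (rule koszul)
qed

end

section \<open>Polynomials and power series\<close>

lemma finite_multi_index_le:
  assumes "m \<in> multi_index u" shows "finite {a. a \<le> m}"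
proof (rule finite_subset)
  show "{a. a \<le> m} \<subseteq> (\<lambda>g i. if i \<in> {1..u} then g i else 0) ` (PiE {1..u} (\<lambda>i. {..m i}))"
  proof
    fix a assume "a \<in> {a. a \<le> m}"
    then have a: "a i \<le> m i" for i by (simp add: le_fun_def)
    have "a = (\<lambda>i. if i \<in> {1..u} then restrict a {1..u} i else 0)"
    proof
      fix i
      show "a i = (if i \<in> {1..u} then restrict a {1..u} i else 0)"
        using a[of i] assms by (cases "i \<in> {1..u}") (auto simp: multi_index_def)
    qed
    moreover have "restrict a {1..u} \<in> PiE {1..u} (\<lambda>i. {..m i})" using a by auto
    ultimately show "a \<in> (\<lambda>g i. if i \<in> {1..u} then g i else 0) ` (PiE {1..u} (\<lambda>i. {..m i}))" by (rule image_eqI)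
  qed
qed (auto intro: finite_PiE)

lemma multi_index_add:
  assumes "a \<in> multi_index u" "m - a \<in> multi_index u" "a \<le> m" shows "m \<in> multi_index u"
  using assms by (auto simp: multi_index_def le_fun_def fun_diff_def)

text \<open>The laws of the function algebra stated on monomials: commutativity and associativity of
  the weights, and \<open>w_leibniz\<close>, the product rule for a product of two monomials.
  \<open>e_nonzero\<close> permits termwise antiderivatives. With logarithmic poles
  \<open>z_s d/dz_s\<close> must multiply a monomial by its exponent and be invertible off exponent
  0, whence the ordinary weights in \<open>log_case\<close>.\<close>

locale coeff_disk =
  fixes u v :: nat and X :: "((nat \<Rightarrow> nat) \<Rightarrow> 'k::field) set"
    and w :: "(nat \<Rightarrow> nat) \<Rightarrow> (nat \<Rightarrow> nat) \<Rightarrow> nat" and e :: "nat \<Rightarrow> nat"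
  assumes v_le: "v \<le> u"
    and X: "X = UNIV \<or> X = finite_support"
    and w_commute: "w a b = w b a"
    and w_assoc: "w (\<lambda>i. a i + b i) c * w a b = w a (\<lambda>i. b i + c i) * w b c"
    and w_0: "w (\<lambda>_. 0) b = 1"
    and w_leibniz: "s \<in> {1..u} \<Longrightarrow> 0 < a s + b s \<Longrightarrow> e (a s + b s) * w a b =
      (if a s = 0 then 0 else e (a s) * w (a(s := a s - 1)) b) + (if b s = 0 then 0 else e (b s) * w a (b(s := b s - 1)))"
    and e_nonzero: "(of_nat (e (Suc n)) :: 'k) \<noteq> 0"
    and log_case: "0 < v \<Longrightarrow> w = (\<lambda>_ _. 1) \<and> e = (\<lambda>n. n)"
begin

definition F :: "('k, (nat \<Rightarrow> nat) \<Rightarrow> 'k) disk_algebra" where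
  "F = coeff_algebra u X w e"

lemma F_simps:
  "carrier F = {f \<in> X. \<forall>m. m \<notin> multi_index u \<longrightarrow> f m = 0}"
  "f \<otimes>\<^bsub>F\<^esub> g = (\<lambda>m. \<Sum>a\<in>{a. a \<le> m}. of_nat (w a (m - a)) * f a * g (m - a))"
  "\<one>\<^bsub>F\<^esub> = (\<lambda>m. if m = (\<lambda>_. 0) then 1 else 0)"
  "\<zero>\<^bsub>F\<^esub> = 0" "add F = (+)" "c \<odot>\<^bsub>F\<^esub> f = (\<lambda>m. c * f m)"
  "coord F = (\<lambda>i m. if m = (\<lambda>_. 0)(i := 1) then 1 else 0)"
  "partial F = (\<lambda>i f m. of_nat (e (Suc (m i))) * f (m(i := Suc (m i))))"
  by (auto simp: F_def coeff_algebra_def fun_eq_iff)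

lemma in_X:
  assumes "f \<in> X" "\<And>m. g m \<noteq> 0 \<Longrightarrow> \<exists>n. f n \<noteq> 0 \<and> m = h n" shows "g \<in> X"
proof -
  have "{m. g m \<noteq> 0} \<subseteq> h ` {m. f m \<noteq> 0}" using assms(2) by blast
  then have "finite {m. g m \<noteq> 0}" if "finite {m. f m \<noteq> 0}" using that finite_surj by blast
  then show ?thesis using X assms(1) by (auto simp: finite_support_def)
qed

lemma X_add: assumes "f \<in> X" "g \<in> X" shows "f + g \<in> X"
proof -
  have "finite {m. f m + g m \<noteq> 0}" if "finite {m. f m \<noteq> 0}" "finite {m. g m \<noteq> 0}"
    by (rule finite_subset[OF _ finite_UnI[OF that]]) auto
  then show ?thesis using X assms by (auto simp: finite_support_def)
qed

lemma carrierD: "f \<in> carrier F \<Longrightarrow> f \<in> X" "f \<in> carrier F \<Longrightarrow> m \<notin> multi_index u \<Longrightarrow> f m = 0"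
  by (auto simp: F_simps)

lemma one_X: "(\<lambda>m. if m = n then 1 else 0) \<in> X"
  using X by (auto simp: finite_support_def)

definition D :: "nat \<Rightarrow> ((nat \<Rightarrow> nat) \<Rightarrow> 'k) \<Rightarrow> (nat \<Rightarrow> nat) \<Rightarrow> 'k" where
  "D s f m = (if s \<le> v then of_nat (m s) * f m else of_nat (e (Suc (m s))) * f (m(s := Suc (m s))))"

text \<open>On monomials: in a logarithmic variable, the inverse of multiplication by the exponent
  off its kernel; otherwise the termwise antiderivative without constant term in
  \<open>z_s\<close>.\<close>

definition J :: "nat \<Rightarrow> ((nat \<Rightarrow> nat) \<Rightarrow> 'k) \<Rightarrow> (nat \<Rightarrow> nat) \<Rightarrow> 'k" where
  "J s f m = (if m s = 0 then 0 else if s \<le> v then f m / of_nat (m s) else f (m(s := m s - 1)) / of_nat (e (m s)))"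

lemma of_nat_e: "n \<noteq> 0 \<Longrightarrow> (of_nat (e n) :: 'k) \<noteq> 0"
  using e_nonzero[of "n - 1"] by simp

lemma of_nat_nonzero: "0 < v \<Longrightarrow> n \<noteq> 0 \<Longrightarrow> (of_nat n :: 'k) \<noteq> 0"
  using of_nat_e[of n] log_case by simp

text \<open>Multiplication by the coordinate is convolution with one monomial, so a single term
  survives. Off the multi-indices the convolution may range over an infinite set, and vanishing is
  checked separately.\<close>

lemma log_partial_eq:
  assumes "f \<in> carrier F" "s \<in> {1..u}" shows "log_partial v F s f = D s f"
proof (cases "s \<le> v")
  case False
  then show ?thesis by (auto simp: log_partial_def F_simps D_def)
next
  case True
  then have v: "0 < v" using assms(2) by auto
  have "log_partial v F s f m = D s f m" for m
  proof (cases "m \<in> multi_index u")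
    case m: True
    define es :: "nat \<Rightarrow> nat" where "es = (\<lambda>_. 0)(s := 1)"
    have "log_partial v F s f m =
        (\<Sum>a\<in>{a. a \<le> m}. if a = es then of_nat (Suc ((m - es) s)) * f ((m - es)(s := Suc ((m - es) s))) else 0)"
      using True log_case[OF v] unfolding log_partial_def F_simps es_def by (simp cong: if_cong) (rule sum.cong, auto)
    also have "\<dots> = (if es \<le> m then of_nat (Suc ((m - es) s)) * f ((m - es)(s := Suc ((m - es) s))) else 0)"
      using finite_multi_index_le[OF m] by simp
    also have "\<dots> = D s f m"
    proof (cases "m s = 0")
      case True
      then have "\<not> es \<le> m" by (auto simp: le_fun_def es_def)
      then show ?thesis using \<open>s \<le> v\<close> True by (simp add: D_def)
    next
      case False
      then have "es \<le> m" "(m - es)(s := Suc ((m - es) s)) = m" "Suc ((m - es) s) = m s"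
        by (auto simp: le_fun_def es_def fun_eq_iff)
      then show ?thesis using \<open>s \<le> v\<close> by (simp add: D_def)
    qed
    finally show ?thesis .
  next
    case False
    have "f (((m - a))(s := Suc ((m - a) s))) = 0" if "a \<le> m" "a = (\<lambda>_. 0)(s := 1)" for a
    proof -
      have "(m - a)(s := Suc ((m - a) s)) = m"
      proof
        fix i
        have "a i \<le> m i" using that(1) by (simp add: le_fun_def)
        then show "((m - a)(s := Suc ((m - a) s))) i = m i" using that(2) by (cases "i = s") auto
      qed
      then show ?thesis using carrierD(2)[OF assms(1) False] by simp
    qed
    then have "log_partial v F s f m = 0"
      using True unfolding log_partial_def F_simps by (auto intro!: sum.neutral)
    then show ?thesis using True carrierD(2)[OF assms(1) False] by (simp add: D_def)
  qed
  then show ?thesis by auto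
qed

lemma upd_multi_index: "s \<in> {1..u} \<Longrightarrow> m(s := k) \<in> multi_index u \<longleftrightarrow> m \<in> multi_index u"
  by (auto simp: multi_index_def)

lemma D_closed: assumes "f \<in> carrier F" "s \<in> {1..u}" shows "D s f \<in> carrier F"
proof -
  have "D s f \<in> X"
  proof (rule in_X[OF carrierD(1)[OF assms(1)], of _ "\<lambda>m. if s \<le> v then m else m(s := m s - 1)"])
    show "\<exists>n. f n \<noteq> 0 \<and> m = (if s \<le> v then n else n(s := n s - 1))" if "D s f m \<noteq> 0" for m
      using that by (intro exI[of _ "if s \<le> v then m else m(s := Suc (m s))"]) (auto simp: D_def split: if_splits)
  qed
  then show ?thesis
    using carrierD(2)[OF assms(1)] upd_multi_index[OF assms(2)] by (auto simp: F_simps D_def)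
qed

lemma J_closed: assumes "f \<in> carrier F" "s \<in> {1..u}" shows "J s f \<in> carrier F"
proof -
  have "J s f \<in> X"
  proof (rule in_X[OF carrierD(1)[OF assms(1)], of _ "\<lambda>m. if s \<le> v then m else m(s := Suc (m s))"])
    show "\<exists>n. f n \<noteq> 0 \<and> m = (if s \<le> v then n else n(s := Suc (n s)))" if "J s f m \<noteq> 0" for m
      using that by (intro exI[of _ "if s \<le> v then m else m(s := m s - 1)"]) (auto simp: J_def split: if_splits)
  qed
  then show ?thesis
    using carrierD(2)[OF assms(1)] upd_multi_index[OF assms(2)] by (auto simp: F_simps J_def)
qed

lemma carrier_0: "0 \<in> carrier F"
  using X by (auto simp: F_simps finite_support_def)

lemma carrier_add: "f \<in> carrier F \<Longrightarrow> g \<in> carrier F \<Longrightarrow> f + g \<in> carrier F"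
  using X_add by (auto simp: F_simps)

lemma carrier_smult: "f \<in> carrier F \<Longrightarrow> (\<lambda>m. c * f m) \<in> carrier F"
  using in_X[of f "\<lambda>m. c * f m" "\<lambda>m. m"] by (auto simp: F_simps)

lemma carrier_uminus: "f \<in> carrier F \<Longrightarrow> - f \<in> carrier F"
  using in_X[of f "- f" "\<lambda>m. m"] by (auto simp: F_simps)

lemma operators: "de_rham_operators u v (carrier F) (log_partial v F) J"
proof
  show "log_partial v F s x \<in> carrier F" if "s \<in> {1..u}" "x \<in> carrier F" for s x
    using D_closed that by (simp add: log_partial_eq)
  show "log_partial v F s (x + y) = log_partial v F s x + log_partial v F s y"
    if "s \<in> {1..u}" "x \<in> carrier F" "y \<in> carrier F" for s x y
    using that by (simp add: log_partial_eq carrier_add) (auto simp: D_def fun_eq_iff distrib_left)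
  show "J s (x + y) = J s x + J s y" for s x y
    by (auto simp: J_def fun_eq_iff add_divide_distrib)
  show "log_partial v F s (log_partial v F t x) = log_partial v F t (log_partial v F s x)"
    if "s \<in> {1..u}" "t \<in> {1..u}" "x \<in> carrier F" for s t x
  proof (cases "s = t")
    case False
    then show ?thesis
      using that by (simp add: log_partial_eq D_closed) (auto simp: D_def fun_eq_iff fun_upd_twist)
  qed simp
  show "log_partial v F s (J t x) = J t (log_partial v F s x)"
    if "s \<in> {1..u}" "t \<in> {1..u}" "s \<noteq> t" "x \<in> carrier F" for s t x
    using that by (simp add: log_partial_eq J_closed) (auto simp: D_def J_def fun_eq_iff fun_upd_twist)
  show "log_partial v F s (J s x) = J s (log_partial v F s x)" if "s \<in> {1..u}" "s \<le> v" "x \<in> carrier F" for s x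
    using that by (simp add: log_partial_eq J_closed) (auto simp: D_def J_def fun_eq_iff)
  show "log_partial v F s (J s x) = x" if "s \<in> {1..u}" "v < s" "x \<in> carrier F" for s x
    using that by (simp add: log_partial_eq J_closed) (auto simp: D_def J_def fun_eq_iff e_nonzero)
qed (auto intro: carrier_0 carrier_add carrier_uminus J_closed)

lemma mult_in_carrier:
  assumes f: "f \<in> carrier F" and g: "g \<in> carrier F" shows "f \<otimes>\<^bsub>F\<^esub> g \<in> carrier F"
proof -
  have ex: "\<exists>a. a \<le> m \<and> f a \<noteq> 0 \<and> g (m - a) \<noteq> 0" if "(f \<otimes>\<^bsub>F\<^esub> g) m \<noteq> 0" for m
  proof (rule ccontr)
    assume "\<not> ?thesis"
    then have "(f \<otimes>\<^bsub>F\<^esub> g) m = 0" unfolding F_simps by (auto intro!: sum.neutral)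
    then show False using that by simp
  qed
  have "finite {m. (f \<otimes>\<^bsub>F\<^esub> g) m \<noteq> 0}" if "finite {m. f m \<noteq> 0}" "finite {m. g m \<noteq> 0}"
  proof (rule finite_subset)
    show "{m. (f \<otimes>\<^bsub>F\<^esub> g) m \<noteq> 0} \<subseteq> (\<lambda>(a, b) i. a i + b i) ` ({m. f m \<noteq> 0} \<times> {m. g m \<noteq> 0})"
    proof
      fix m assume "m \<in> {m. (f \<otimes>\<^bsub>F\<^esub> g) m \<noteq> 0}"
      then obtain a where a: "a \<le> m" "f a \<noteq> 0" "g (m - a) \<noteq> 0" using ex by blast
      then have "m = (\<lambda>(a, b) i. a i + b i) (a, m - a)" by (auto simp: fun_eq_iff le_fun_def)
      then show "m \<in> (\<lambda>(a, b) i. a i + b i) ` ({m. f m \<noteq> 0} \<times> {m. g m \<noteq> 0})" using a by blast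
    qed
  qed (use that in auto)
  then have "f \<otimes>\<^bsub>F\<^esub> g \<in> X" using X carrierD(1)[OF f] carrierD(1)[OF g] by (auto simp: finite_support_def)
  moreover have "(f \<otimes>\<^bsub>F\<^esub> g) m = 0" if "m \<notin> multi_index u" for m
    using ex[of m] that carrierD(2)[OF f] carrierD(2)[OF g] multi_index_add by blast
  ultimately show ?thesis by (simp add: F_simps(1))
qed

lemma mult_comm: "f \<otimes>\<^bsub>F\<^esub> g = g \<otimes>\<^bsub>F\<^esub> f"
proof
  fix m :: "nat \<Rightarrow> nat"
  have i: "m - (m - a) = a" if "a \<le> m" for a using that by (auto simp: fun_eq_iff le_fun_def)
  show "(f \<otimes>\<^bsub>F\<^esub> g) m = (g \<otimes>\<^bsub>F\<^esub> f) m"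
    unfolding F_simps
    by (rule sum.reindex_bij_witness[where i="\<lambda>a. m - a" and j="\<lambda>a. m - a"])
      (auto simp: i w_commute[of _ "m - _"] mult.assoc mult.left_commute mult.commute le_fun_def)
qed

text \<open>Both sides sum over the ways to write \<open>m\<close> as \<open>a + b + c\<close>, and
  the weights match by \<open>w_assoc\<close>. If infinitely many \<open>a\<close> lie below
  \<open>m\<close>, both sums are 0 by convention.\<close>

lemma mult_associative: "(f \<otimes>\<^bsub>F\<^esub> g) \<otimes>\<^bsub>F\<^esub> h = f \<otimes>\<^bsub>F\<^esub> (g \<otimes>\<^bsub>F\<^esub> h)"
proof
  fix m
  show "((f \<otimes>\<^bsub>F\<^esub> g) \<otimes>\<^bsub>F\<^esub> h) m = (f \<otimes>\<^bsub>F\<^esub> (g \<otimes>\<^bsub>F\<^esub> h)) m"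
  proof (cases "finite {a. a \<le> m}")
    case False
    then show ?thesis by (simp add: F_simps)
  next
    case True
    have fin: "finite {a. a \<le> b}" if "b \<le> m" for b
      by (rule finite_subset[OF _ True]) (use that in auto)
    define t where "t a b c = of_nat (w (\<lambda>i. a i + b i) c * w a b) * (f a * (g b * h c))" for a b c
    have le: "m - a \<le> m" for a by (auto simp: le_fun_def)
    have "((f \<otimes>\<^bsub>F\<^esub> g) \<otimes>\<^bsub>F\<^esub> h) m = (\<Sum>b\<in>{b. b \<le> m}. \<Sum>a\<in>{a. a \<le> b}. t a (b - a) (m - b))"
      unfolding F_simps
    proof (rule sum.cong[OF refl])
      fix b :: "nat \<Rightarrow> nat"
      have "(\<lambda>i. a i + (b - a) i) = b" if "a \<le> b" for a
        using le_funD[OF that] by (simp add: fun_eq_iff)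
      then show "of_nat (w b (m - b)) * (\<Sum>a | a \<le> b. of_nat (w a (b - a)) * f a * g (b - a)) * h (m - b) =
          (\<Sum>a\<in>{a. a \<le> b}. t a (b - a) (m - b))"
        unfolding sum_distrib_left sum_distrib_right by (intro sum.cong refl) (simp add: t_def algebra_simps)
    qed
    also have "\<dots> = (\<Sum>(b, a)\<in>(SIGMA b:{b. b \<le> m}. {a. a \<le> b}). t a (b - a) (m - b))"
      by (rule sum.Sigma) (use True fin in auto)
    also have "\<dots> = (\<Sum>(a, c)\<in>(SIGMA a:{a. a \<le> m}. {c. c \<le> m - a}). t a c (m - a - c))"
    proof (rule sum.reindex_bij_witness[where i="\<lambda>(a, c). (\<lambda>i. a i + c i, a)" and j="\<lambda>(b, a). (a, b - a)"])
      fix p assume "p \<in> (SIGMA b:{b. b \<le> m}. {a. a \<le> b})"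
      then obtain b a where p: "p = (b, a)" "b \<le> m" "a \<le> b" by auto
      then have "m - a - (b - a) = m - b" "(\<lambda>i. a i + (b - a) i) = b" "a \<le> m" "b - a \<le> m - a"
        by (auto simp: fun_eq_iff le_fun_def intro: order_trans diff_le_mono)
      then show "(case (case p of (b, a) \<Rightarrow> (a, b - a)) of (a, c) \<Rightarrow> (\<lambda>i. a i + c i, a)) = p"
        "(case p of (b, a) \<Rightarrow> (a, b - a)) \<in> (SIGMA a:{a. a \<le> m}. {c. c \<le> m - a})"
        "(case (case p of (b, a) \<Rightarrow> (a, b - a)) of (a, c) \<Rightarrow> t a c (m - a - c)) = (case p of (b, a) \<Rightarrow> t a (b - a) (m - b))"
        by (simp_all add: p(1))
    next
      fix q assume "q \<in> (SIGMA a:{a. a \<le> m}. {c. c \<le> m - a})"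
      then obtain a c where q: "q = (a, c)" "\<And>i. a i \<le> m i" "\<And>i. c i \<le> m i - a i" by (auto simp: le_fun_def)
      have "a i + c i \<le> m i" for i using q(2)[of i] q(3)[of i] by linarith
      then show "(case q of (a, c) \<Rightarrow> (\<lambda>i. a i + c i, a)) \<in> (SIGMA b:{b. b \<le> m}. {a. a \<le> b})"
        "(case (case q of (a, c) \<Rightarrow> (\<lambda>i. a i + c i, a)) of (b, a) \<Rightarrow> (a, b - a)) = q"
        by (auto simp: q(1) le_fun_def fun_eq_iff)
    qed
    also have "\<dots> = (\<Sum>a\<in>{a. a \<le> m}. \<Sum>c\<in>{c. c \<le> m - a}. t a c (m - a - c))"
      by (rule sum.Sigma[symmetric]) (use True fin le in auto)
    also have "\<dots> = (f \<otimes>\<^bsub>F\<^esub> (g \<otimes>\<^bsub>F\<^esub> h)) m"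
      unfolding F_simps
    proof (rule sum.cong[OF refl])
      fix a :: "nat \<Rightarrow> nat"
      have "(\<lambda>i. c i + (m - a - c) i) = m - a" if "c \<le> m - a" for c
      proof
        fix i show "c i + (m - a - c) i = (m - a) i" using le_funD[OF that, of i] by simp
      qed
      then have "t a c (m - a - c) = of_nat (w a (m - a) * w c (m - a - c)) * (f a * (g c * h (m - a - c)))"
        if "c \<le> m - a" for c
        using w_assoc[of a c "m - a - c"] that unfolding t_def by simp
      then show "(\<Sum>c\<in>{c. c \<le> m - a}. t a c (m - a - c)) =
          of_nat (w a (m - a)) * f a * (\<Sum>c | c \<le> m - a. of_nat (w c (m - a - c)) * g c * h (m - a - c))"
        unfolding sum_distrib_left by (intro sum.cong refl) (simp add: mult.assoc mult.left_commute)
    qed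
    finally show ?thesis .
  qed
qed

text \<open>In a logarithmic variable the exponent of \<open>m\<close> is the sum of those of
  \<open>a\<close> and \<open>m - a\<close>. In an ordinary one \<open>w_leibniz\<close> splits each
  term of the product at the raised index into two, and each half is reindexed to the convolution at
  \<open>m\<close>.\<close>

lemma D_mult: 
  assumes s: "s \<in> {1..u}" and f: "f \<in> carrier F" and g: "g \<in> carrier F"
  shows "D s (f \<otimes>\<^bsub>F\<^esub> g) = D s f \<otimes>\<^bsub>F\<^esub> g + f \<otimes>\<^bsub>F\<^esub> D s g"
proof
  fix m
  show "D s (f \<otimes>\<^bsub>F\<^esub> g) m = (D s f \<otimes>\<^bsub>F\<^esub> g + f \<otimes>\<^bsub>F\<^esub> D s g) m"
  proof (cases "m \<in> multi_index u")
    case False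
    then show ?thesis
      using carrierD(2)[OF D_closed[OF mult_in_carrier[OF f g] s]] carrierD(2)[OF mult_in_carrier[OF D_closed[OF f s] g]]
        carrierD(2)[OF mult_in_carrier[OF f D_closed[OF g s]]] by simp
  next
    case m: True
    show ?thesis
    proof (cases "s \<le> v")
      case True
      have "m s = a s + (m - a) s" if "a \<le> m" for a using that by (simp add: le_fun_def)
      then have "(of_nat (m s) :: 'k) = of_nat (a s) + of_nat ((m - a) s)" if "a \<le> m" for a
        using that by (metis of_nat_add)
      then show ?thesis
        using True by (simp add: D_def F_simps sum_distrib_left sum.distrib[symmetric])
          (rule sum.cong, simp_all add: algebra_simps)
    next
      case False
      \<comment> \<open>The coefficient of the derivative at \<open>m\<close> is taken from the
        coefficient of the product at this raised index.\<close>
      define m' where "m' = m(s := Suc (m s))"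
      have m's: "m' s = Suc (m s)" by (simp add: m'_def)
      have fin: "finite {a. a \<le> m'}" by (rule finite_multi_index_le[of _ u]) (use m upd_multi_index[OF s] in \<open>simp add: m'_def\<close>)
      define P where "P a = of_nat (e (a s) * w (a(s := a s - 1)) (m' - a)) * (f a * g (m' - a))" for a
      define Q where "Q a = of_nat (e ((m' - a) s) * w a ((m' - a)(s := (m' - a) s - 1))) * (f a * g (m' - a))" for a
      have "D s (f \<otimes>\<^bsub>F\<^esub> g) m = (\<Sum>a\<in>{a. a \<le> m'}. (if a s = 0 then 0 else P a) + (if (m' - a) s = 0 then 0 else Q a))"
      proof -
        have "of_nat (e (Suc (m s))) * (of_nat (w a (m' - a)) * f a * g (m' - a)) =
            (if a s = 0 then 0 else P a) + (if (m' - a) s = 0 then 0 else Q a)" if "a \<le> m'" for a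
        proof -
          have as: "a s + (m' - a) s = Suc (m s)" using that m's by (simp add: le_fun_def) (metis le_add_diff_inverse)
          have "(of_nat (e (Suc (m s)) * w a (m' - a)) :: 'k) =
             of_nat ((if a s = 0 then 0 else e (a s) * w (a(s := a s - 1)) (m' - a)) +
               (if (m' - a) s = 0 then 0 else e ((m' - a) s) * w a ((m' - a)(s := (m' - a) s - 1))))"
            using w_leibniz[OF s, of a "m' - a"] unfolding as by simp
          then have "of_nat (e (Suc (m s)) * w a (m' - a)) * (f a * g (m' - a)) =
             of_nat ((if a s = 0 then 0 else e (a s) * w (a(s := a s - 1)) (m' - a)) +
               (if (m' - a) s = 0 then 0 else e ((m' - a) s) * w a ((m' - a)(s := (m' - a) s - 1)))) * (f a * g (m' - a))"
            by (rule arg_cong)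
          then show ?thesis by (auto simp: P_def Q_def algebra_simps)
        qed
        then show ?thesis
          using False by (simp add: D_def F_simps m'_def[symmetric] sum_distrib_left)
      qed
      also have "\<dots> = (\<Sum>a\<in>{a. a \<le> m'}. if a s = 0 then 0 else P a) + (\<Sum>a\<in>{a. a \<le> m'}. if (m' - a) s = 0 then 0 else Q a)"
        by (rule sum.distrib)
      also have "(\<Sum>a\<in>{a. a \<le> m'}. if a s = 0 then 0 else P a) = (D s f \<otimes>\<^bsub>F\<^esub> g) m"
      proof -
        have "(\<Sum>a\<in>{a. a \<le> m'}. if a s = 0 then 0 else P a) = (\<Sum>a\<in>{a. a \<le> m' \<and> a s \<noteq> 0}. P a)"
          by (rule sum.mono_neutral_cong_right) (use fin in auto)
        also have "\<dots> = (\<Sum>a\<in>{a. a \<le> m}. of_nat (w a (m - a)) * D s f a * g (m - a))"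
        proof (rule sum.reindex_bij_witness[where i="\<lambda>a. a(s := Suc (a s))" and j="\<lambda>a. a(s := a s - 1)"])
          fix a assume "a \<in> {a. a \<le> m' \<and> a s \<noteq> 0}"
          then have a: "\<And>i. a i \<le> m' i" "a s \<noteq> 0" by (auto simp: le_fun_def)
          have "m - a(s := a s - 1) = m' - a" using a by (auto simp: fun_eq_iff m'_def)
          then show "of_nat (w (a(s := a s - 1)) (m - a(s := a s - 1))) * D s f (a(s := a s - 1)) * g (m - a(s := a s - 1)) = P a"
            using False a(2) by (simp add: P_def D_def algebra_simps)
          show "a(s := a s - 1) \<in> {a. a \<le> m}"
          proof -
            have "(a(s := a s - 1)) i \<le> m i" for i using a(1)[of i] a(2) by (auto simp: m'_def split: if_splits)
            then show ?thesis by (simp add: le_fun_def)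
          qed
        next
          fix a assume "a \<in> {a. a \<le> m}"
          then have a: "\<And>i. a i \<le> m i" by (auto simp: le_fun_def)
          then show "a(s := Suc (a s)) \<in> {a. a \<le> m' \<and> a s \<noteq> 0}" by (auto simp: le_fun_def m'_def)
        qed auto
        finally show ?thesis by (simp add: F_simps)
      qed
      also have "(\<Sum>a\<in>{a. a \<le> m'}. if (m' - a) s = 0 then 0 else Q a) = (f \<otimes>\<^bsub>F\<^esub> D s g) m"
      proof -
        \<comment> \<open>An index below \<open>m'\<close> but not below \<open>m\<close> has the
          full exponent \<open>m' s\<close>, and there the summand is the zero branch.\<close>
        have "(\<Sum>a\<in>{a. a \<le> m'}. if (m' - a) s = 0 then 0 else Q a) = (\<Sum>a\<in>{a. a \<le> m}. Q a)"
        proof (rule sum.mono_neutral_cong_right)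
          show "{a. a \<le> m} \<subseteq> {a. a \<le> m'}"
            by (auto simp: le_fun_def m'_def le_SucI)
          show "\<forall>a\<in>{a. a \<le> m'} - {a. a \<le> m}. (if (m' - a) s = 0 then 0 else Q a) = 0"
          proof
            fix a assume "a \<in> {a. a \<le> m'} - {a. a \<le> m}"
            then obtain i where i: "\<not> a i \<le> m i" "a i \<le> m' i" by (auto simp: le_fun_def)
            then have "i = s" by (auto simp: m'_def split: if_splits)
            then show "(if (m' - a) s = 0 then 0 else Q a) = 0" using i by (simp add: m'_def)
          qed
          fix a assume "a \<in> {a. a \<le> m}"
          then have "a s \<le> m s" by (simp add: le_fun_def)
          then show "(if (m' - a) s = 0 then 0 else Q a) = Q a" by (simp add: m'_def)
        qed (rule fin)
        also have "\<dots> = (\<Sum>a\<in>{a. a \<le> m}. of_nat (w a (m - a)) * f a * D s g (m - a))"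
        proof (rule sum.cong[OF refl])
          fix a assume "a \<in> {a. a \<le> m}"
          then have a: "\<And>i. a i \<le> m i" by (auto simp: le_fun_def)
          have 1: "(m' - a) s = Suc ((m - a) s)" using a[of s] by (simp add: m'_def Suc_diff_le)
          have 2: "(m' - a)(s := (m' - a) s - 1) = m - a" unfolding 1 by (auto simp: fun_eq_iff m'_def)
          have 3: "(m - a)(s := Suc ((m - a) s)) = m' - a" unfolding 1[symmetric] by (auto simp: fun_eq_iff m'_def)
          show "Q a = of_nat (w a (m - a)) * f a * D s g (m - a)"
            unfolding Q_def 2 using False using 1 by (simp add: D_def 3[simplified] algebra_simps)
        qed
        finally show ?thesis by (simp add: F_simps)
      qed
      finally show ?thesis by simp
    qed
  qed
qed

theorem log_disk: "log_disk u v F J"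
proof -
  interpret dR: de_rham_operators u v "carrier F" "log_partial v F" J by (rule operators)
  show ?thesis
  proof (rule log_disk.intro[OF operators], rule log_disk_axioms.intro)
    show "v \<le> u" by (rule v_le)
    show "f \<otimes>\<^bsub>F\<^esub> g \<in> carrier F" if "f \<in> carrier F" "g \<in> carrier F" for f g using mult_in_carrier[OF that] .
    show "\<one>\<^bsub>F\<^esub> \<in> carrier F" using one_X by (auto simp: F_simps multi_index_def)
    show "\<one>\<^bsub>F\<^esub> \<noteq> 0" by (auto simp: F_simps fun_eq_iff intro!: exI[of _ "\<lambda>_. 0"])
    show "c \<odot>\<^bsub>F\<^esub> f \<in> carrier F" if "f \<in> carrier F" for f c using carrier_smult[OF that] by (simp add: F_simps(6))
    show "f \<otimes>\<^bsub>F\<^esub> (g + h) = f \<otimes>\<^bsub>F\<^esub> g + f \<otimes>\<^bsub>F\<^esub> h" for f g h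
      by (auto simp: F_simps fun_eq_iff distrib_left sum.distrib)
    show "(f \<otimes>\<^bsub>F\<^esub> g) \<otimes>\<^bsub>F\<^esub> h = f \<otimes>\<^bsub>F\<^esub> (g \<otimes>\<^bsub>F\<^esub> h)" for f g h by (rule mult_associative)
    show "f \<otimes>\<^bsub>F\<^esub> g = g \<otimes>\<^bsub>F\<^esub> f" for f g by (rule mult_comm)
    show "\<one>\<^bsub>F\<^esub> \<otimes>\<^bsub>F\<^esub> f = f" if f: "f \<in> carrier F" for f
    proof
      fix m
      show "(\<one>\<^bsub>F\<^esub> \<otimes>\<^bsub>F\<^esub> f) m = f m"
      proof (cases "m \<in> multi_index u")
        case True
        have "(\<one>\<^bsub>F\<^esub> \<otimes>\<^bsub>F\<^esub> f) m = (\<Sum>a\<in>{a. a \<le> m}. if a = (\<lambda>_. 0) then f m else 0)"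
          unfolding F_simps by (rule sum.cong) (auto simp: w_0 fun_diff_def)
        then show ?thesis using finite_multi_index_le[OF True] by (simp add: le_fun_def)
      next
        case False
        then have "(\<one>\<^bsub>F\<^esub> \<otimes>\<^bsub>F\<^esub> f) m = 0"
          using carrierD(2)[OF f] unfolding F_simps by (auto intro!: sum.neutral simp: fun_diff_def)
        then show ?thesis using carrierD(2)[OF f False] by simp
      qed
    qed
    show "vector_space (smult F)" by standard (auto simp: F_simps fun_eq_iff algebra_simps)
    show "(c \<odot>\<^bsub>F\<^esub> f) \<otimes>\<^bsub>F\<^esub> g = c \<odot>\<^bsub>F\<^esub> (f \<otimes>\<^bsub>F\<^esub> g)" for c f g
      by (auto simp: F_simps fun_eq_iff sum_distrib_left algebra_simps intro!: sum.cong)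
    show "log_partial v F s (c \<odot>\<^bsub>F\<^esub> f) = c \<odot>\<^bsub>F\<^esub> log_partial v F s f" if "s \<in> {1..u}" "f \<in> carrier F" for s c f
      using that carrier_smult[OF that(2), of c] by (simp add: F_simps(6) log_partial_eq) (auto simp: D_def fun_eq_iff)
    show "log_partial v F s (f \<otimes>\<^bsub>F\<^esub> g) = log_partial v F s f \<otimes>\<^bsub>F\<^esub> g + f \<otimes>\<^bsub>F\<^esub> log_partial v F s g"
      if "s \<in> {1..u}" "f \<in> carrier F" "g \<in> carrier F" for s f g
      using D_mult[OF that] that by (simp add: log_partial_eq mult_in_carrier)
    \<comment> \<open>What remains after subtracting \<open>J s (D s f)\<close> is the sum of the
      monomials free of \<open>z_s\<close>, in logarithmic and ordinary variables alike.\<close>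
    have eps: "dR.eps s f = (\<lambda>m. if m s = 0 then f m else 0)" if "s \<in> {1..u}" "f \<in> carrier F" for s f
      using that of_nat_e of_nat_nonzero
      by (auto simp: dR.eps_def log_partial_eq fun_eq_iff D_def J_def)
    show "\<exists>c. dR.eps_upto u f = c \<odot>\<^bsub>F\<^esub> \<one>\<^bsub>F\<^esub>" if f: "f \<in> carrier F" for f
    proof -
      have "dR.eps_upto k f = (\<lambda>m. if \<forall>t\<in>{1..k}. m t = 0 then f m else 0) \<and> dR.eps_upto k f \<in> carrier F" if "k \<le> u" for k
        using that
      proof (induction k)
        case 0
        then show ?case using f by simp
      next
        case (Suc k)
        then have IH: "dR.eps_upto k f = (\<lambda>m. if \<forall>t\<in>{1..k}. m t = 0 then f m else 0)" "dR.eps_upto k f \<in> carrier F"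
          and k: "Suc k \<in> {1..u}" by auto
        have "dR.eps (Suc k) (dR.eps_upto k f) \<in> carrier F"
          unfolding dR.eps_def by (intro dR.X_diff IH(2) dR.J_closed dR.\<delta>_closed k)
        moreover have "dR.eps (Suc k) (dR.eps_upto k f) = (\<lambda>m. if \<forall>t\<in>{1..Suc k}. m t = 0 then f m else 0)"
          unfolding eps[OF k IH(2)] unfolding IH(1) by (auto simp: fun_eq_iff atLeastAtMostSuc_conv)
        ultimately show ?case by simp
      qed
      then have "dR.eps_upto u f = (\<lambda>m. if \<forall>t\<in>{1..u}. m t = 0 then f m else 0)" by blast
      also have "\<dots> = f (\<lambda>_. 0) \<odot>\<^bsub>F\<^esub> \<one>\<^bsub>F\<^esub>"
      proof
        fix m
        show "(if \<forall>t\<in>{1..u}. m t = 0 then f m else 0) = (f (\<lambda>_. 0) \<odot>\<^bsub>F\<^esub> \<one>\<^bsub>F\<^esub>) m"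
        proof (cases "m \<in> multi_index u")
          case True
          then have "(\<forall>t\<in>{1..u}. m t = 0) \<longleftrightarrow> m = (\<lambda>_. 0)" by (auto simp: multi_index_def fun_eq_iff)
          then show ?thesis by (auto simp: F_simps)
        next
          case False
          then have "m \<noteq> (\<lambda>_. 0)" by (auto simp: multi_index_def)
          then show ?thesis using carrierD(2)[OF f False] by (simp add: F_simps)
        qed
      qed
      finally show ?thesis by blast
    qed
  qed (simp_all add: F_simps)
qed

theorem koszul: "koszul (closed_forms u v (coeff_algebra u X w e)) (closed_forms_deg u v (coeff_algebra u X w e))"
  using log_disk.koszul_ZA[OF log_disk] unfolding F_def .

end

lemma ordinary_coeff_disk:
  assumes "v \<le> u" "X = UNIV \<or> X = finite_support"
  shows "coeff_disk u v (X :: ((nat \<Rightarrow> nat) \<Rightarrow> 'k::field_char_0) set) (\<lambda>_ _. 1) (\<lambda>n. n)"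
  by standard (use assms in \<open>auto simp: of_nat_eq_0_iff[where 'a='k] simp del: of_nat_Suc\<close>)

text \<open>The weights are products over the coordinates, so the laws are binomial identities in
  one variable: associativity is the trinomial identity and the product rule is Pascal's rule in the
  factor \<open>s\<close>. Differentiation only shifts exponents, so there is nothing to divide by
  and any field is allowed.\<close>

lemma divided_power_coeff_disk:
  assumes "X = UNIV \<or> X = finite_support"
  shows "coeff_disk u 0 (X :: ((nat \<Rightarrow> nat) \<Rightarrow> 'k::field) set) (divided_power_weight u) (\<lambda>_. 1)"
proof
  fix a b c :: "nat \<Rightarrow> nat"
  show "divided_power_weight u a b = divided_power_weight u b a"
    unfolding divided_power_weight_def
  proof (rule prod.cong[OF refl])
    fix i
    show "(a i + b i) choose (a i) = (b i + a i) choose (b i)"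
      using binomial_symmetric[of "a i" "a i + b i"] by (simp add: add.commute)
  qed
  show "divided_power_weight u (\<lambda>i. a i + b i) c * divided_power_weight u a b =
    divided_power_weight u a (\<lambda>i. b i + c i) * divided_power_weight u b c"
    unfolding divided_power_weight_def prod.distrib[symmetric]
  proof (rule prod.cong[OF refl])
    fix i
    have "(a i + b i + c i choose (a i + b i)) * (a i + b i choose a i) =
        (a i + b i + c i choose a i) * (a i + b i + c i - a i choose (a i + b i - a i))"
      by (rule choose_mult) auto
    then show "(a i + b i + c i choose (a i + b i)) * (a i + b i choose a i) =
        (a i + (b i + c i) choose a i) * (b i + c i choose b i)"
      by (simp add: add.assoc)
  qed
  show "divided_power_weight u (\<lambda>_. 0) b = 1" by (simp add: divided_power_weight_def)
  fix s assume s: "s \<in> {1..u}" and pos: "0 < a s + b s"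
  define R where "R = (\<Prod>i\<in>{1..u} - {s}. (a i + b i) choose (a i))"
  have split: "divided_power_weight u a' b' = ((a' s + b' s) choose (a' s)) * (\<Prod>i\<in>{1..u} - {s}. (a' i + b' i) choose (a' i))" for a' b'
    unfolding divided_power_weight_def by (rule prod.remove) (use s in auto)
  have R1: "(\<Prod>i\<in>{1..u} - {s}. ((a(s := k)) i + b i) choose ((a(s := k)) i)) = R"
    and R2: "(\<Prod>i\<in>{1..u} - {s}. (a i + (b(s := k)) i) choose (a i)) = R" for k
    unfolding R_def by (auto intro!: prod.cong)
  have pascal: "(a s + b s choose a s) = (if a s = 0 then 0 else (a s - 1 + b s) choose (a s - 1)) +
      (if b s = 0 then 0 else (a s + (b s - 1)) choose (a s))"
    using pos by (cases "a s"; cases "b s") auto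
  show "1 * divided_power_weight u a b = (if a s = 0 then 0 else 1 * divided_power_weight u (a(s := a s - 1)) b) +
      (if b s = 0 then 0 else 1 * divided_power_weight u a (b(s := b s - 1)))"
    unfolding split[of a b] split[of "a(s := a s - 1)" b] split[of a "b(s := b s - 1)"] R1 R2 R_def[symmetric] pascal
    by (simp add: distrib_right)
qed (use assms in auto)

section \<open>Smooth and holomorphic functions\<close>

lemma continuous_on_coordinate: "continuous_on S f \<Longrightarrow> continuous_on S (\<lambda>z. f z i)"
  by (rule continuous_on_product_then_coordinatewise)

lemma continuous_on_fun_upd:
  assumes "continuous_on S f" "continuous_on S g"
  shows "continuous_on S (\<lambda>z. (f z)(i := g z))"
proof (rule continuous_on_coordinatewise_then_product)
  show "continuous_on S (\<lambda>z. ((f z)(i := g z)) j)" for j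
    by (cases "j = i") (simp_all add: assms continuous_on_coordinate)
qed

locale polydisk_functions =
  fixes u :: nat and r :: "nat \<Rightarrow> real" and D :: "(nat \<Rightarrow> 'k::{real_normed_field, banach}) set"
  assumes r_pos: "i \<in> {1..u} \<Longrightarrow> 0 < r i"
    and D: "D = polydisk u r"
begin

abbreviation pd :: "nat \<Rightarrow> ((nat \<Rightarrow> 'k) \<Rightarrow> 'k) \<Rightarrow> (nat \<Rightarrow> 'k) \<Rightarrow> 'k" where
  "pd \<equiv> partial_deriv D"

lemma D_upd: "p \<in> D \<Longrightarrow> i \<in> {1..u} \<Longrightarrow> norm t < r i \<Longrightarrow> p(i := t) \<in> D"
  by (auto simp: D polydisk_def)

lemma D_norm: "p \<in> D \<Longrightarrow> i \<in> {1..u} \<Longrightarrow> norm (p i) < r i"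
  by (auto simp: D polydisk_def)

lemma D_shrink: "p \<in> D \<Longrightarrow> i \<in> {1..u} \<Longrightarrow> x \<in> {0..1} \<Longrightarrow> p(i := of_real x * p i) \<in> D"
  using mult_left_le_one_le[of "norm (p i)" x] D_norm[of p i]
  by (intro D_upd) (auto simp: norm_mult)

lemma D_zero: "p \<in> D \<Longrightarrow> i \<in> {1..u} \<Longrightarrow> p(i := 0) \<in> D"
  using r_pos by (intro D_upd) auto

lemma ball_convex: "convex (ball (0::'k) R)" "open (ball (0::'k) R)"
  by auto

definition reg :: "((nat \<Rightarrow> 'k) \<Rightarrow> 'k) \<Rightarrow> bool" where
  "reg f \<longleftrightarrow> continuous_on D f \<and>
     (\<forall>p\<in>D. \<forall>i\<in>{1..u}. (\<lambda>t. f (p(i := t))) field_differentiable at (p i))"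

definition Sm :: "((nat \<Rightarrow> 'k) \<Rightarrow> 'k) set" where
  "Sm = {f. (\<forall>p. p \<notin> D \<longrightarrow> f p = 0) \<and> (\<forall>js. set js \<subseteq> {1..u} \<longrightarrow> reg (fold pd js f))}"

lemma SmD:
  assumes "f \<in> Sm"
  shows "p \<notin> D \<Longrightarrow> f p = 0" "reg f" "continuous_on D f" "i \<in> {1..u} \<Longrightarrow> pd i f \<in> Sm"
proof -
  show "p \<notin> D \<Longrightarrow> f p = 0" using assms by (auto simp: Sm_def)
  show "reg f" using assms by (auto simp: Sm_def dest: spec[of _ "[]"])
  then show "continuous_on D f" by (simp add: reg_def)
  assume i: "i \<in> {1..u}"
  have "reg (fold pd js (pd i f))" if "set js \<subseteq> {1..u}" for js
  proof -
    have "\<forall>js. set js \<subseteq> {1..u} \<longrightarrow> reg (fold pd js f)" using assms by (simp add: Sm_def)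
    from this[rule_format, of "i # js"] show ?thesis using i that by simp
  qed
  then show "pd i f \<in> Sm" by (auto simp: Sm_def partial_deriv_def)
qed

text \<open>Iterated derivatives never leave \<open>C\<close>, by induction on the list of
  directions. A whole class of functions can thus be shown smooth at once, without formulas for
  higher derivatives.\<close>

lemma Sm_coinduct:
  assumes "f \<in> C" "\<And>f. f \<in> C \<Longrightarrow> (\<forall>p. p \<notin> D \<longrightarrow> f p = 0) \<and> reg f \<and> (\<forall>i\<in>{1..u}. pd i f \<in> C)"
  shows "f \<in> Sm"
proof -
  have "reg (fold pd js f)" if "set js \<subseteq> {1..u}" for js
    using assms(1) that
  proof (induction js arbitrary: f)
    case Nil
    then show ?case using assms(2) by simp
  next
    case (Cons i js)
    then show ?case using assms(2)[OF Cons.prems(1)] by simp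
  qed
  then show ?thesis using assms by (auto simp: Sm_def)
qed

lemma reg_deriv:
  assumes "reg f" "p \<in> D" "i \<in> {1..u}" "norm t0 < r i"
  shows "((\<lambda>t. f (p(i := t))) has_field_derivative pd i f (p(i := t0))) (at t0)"
proof -
  have p: "p(i := t0) \<in> D" by (rule D_upd) (use assms in auto)
  then have "(\<lambda>t. f ((p(i := t0))(i := t))) field_differentiable at ((p(i := t0)) i)"
    using assms unfolding reg_def by blast
  then show ?thesis using p by (simp add: field_differentiable_derivI partial_deriv_def)
qed

lemma partial_eqI:
  assumes "p \<in> D" "((\<lambda>t. f (p(i := t))) has_field_derivative y) (at (p i))"
  shows "pd i f p = y"
  using assms by (simp add: partial_deriv_def DERIV_imp_deriv)

lemma reg_deriv_at: "reg f \<Longrightarrow> p \<in> D \<Longrightarrow> i \<in> {1..u} \<Longrightarrow> ((\<lambda>t. f (p(i := t))) has_field_derivative pd i f p) (at (p i))"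
  using reg_deriv[of f p i "p i"] D_norm by simp

lemma regI:
  assumes "continuous_on D f"
    "\<And>p i. p \<in> D \<Longrightarrow> i \<in> {1..u} \<Longrightarrow> ((\<lambda>t. f (p(i := t))) has_field_derivative g i p) (at (p i))"
  shows "reg f" and "\<And>p i. p \<in> D \<Longrightarrow> i \<in> {1..u} \<Longrightarrow> pd i f p = g i p"
proof -
  show "reg f" unfolding reg_def field_differentiable_def using assms by blast
  show "pd i f p = g i p" if "p \<in> D" "i \<in> {1..u}" for p i
    by (rule partial_eqI[OF that(1) assms(2)[OF that]])
qed

section \<open>Averages along a coordinate and closure properties of \<open>Sm\<close>\<close>

definition one_D :: "(nat \<Rightarrow> 'k) \<Rightarrow> 'k" where "one_D p = (if p \<in> D then 1 else 0)"
definition coord_D :: "nat \<Rightarrow> (nat \<Rightarrow> 'k) \<Rightarrow> 'k" where "coord_D i p = (if p \<in> D then p i else 0)"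

text \<open>\<open>z_t H t 0 f\<close> is the antiderivative along \<open>z_t\<close>. Each
  differentiation in \<open>z_t\<close> under the integral sign brings out a factor
  \<open>x\<close>; the weights \<open>x ^ n\<close> make the family stable under partial
  derivatives.\<close>

definition H :: "nat \<Rightarrow> nat \<Rightarrow> ((nat \<Rightarrow> 'k) \<Rightarrow> 'k) \<Rightarrow> (nat \<Rightarrow> 'k) \<Rightarrow> 'k" where
  "H t n f p = (if p \<in> D then integral {0..1} (\<lambda>x. of_real x ^ n * f (p(t := of_real x * p t))) else 0)"

lemma continuous_on_shrink:
  fixes f :: "(nat \<Rightarrow> 'k) \<Rightarrow> 'k"
  assumes f: "continuous_on D f" and t: "t \<in> {1..u}" and g: "continuous_on S g" and x: "continuous_on S x"
    and S: "\<And>z. z \<in> S \<Longrightarrow> g z \<in> D" "\<And>z. z \<in> S \<Longrightarrow> x z \<in> {0..1}"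
  shows "continuous_on S (\<lambda>z. of_real (x z) ^ n * f ((g z)(t := of_real (x z) * g z t)))"
proof -
  have "continuous_on S (\<lambda>z. (g z)(t := of_real (x z) * g z t))"
    by (rule continuous_on_fun_upd[OF g], rule continuous_on_mult[OF continuous_on_of_real[OF x] continuous_on_coordinate[OF g]])
  then have "continuous_on S (\<lambda>z. f ((g z)(t := of_real (x z) * g z t)))"
    by (rule continuous_on_compose2[OF f]) (use D_shrink[OF S(1) t S(2)] in blast)
  then show ?thesis
    by (intro continuous_on_mult continuous_on_power continuous_on_of_real x)
qed

lemma integrable_H:
  fixes f :: "(nat \<Rightarrow> 'k) \<Rightarrow> 'k"
  assumes f: "continuous_on D f" and t: "t \<in> {1..u}" and p: "p \<in> D"
  shows "(\<lambda>x. of_real x ^ n * f (p(t := of_real x * p t))) integrable_on {0..1}"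
proof (rule integrable_continuous_interval)
  show "continuous_on {0..1} (\<lambda>x. of_real x ^ n * f (p(t := of_real x * p t)))"
    by (rule continuous_on_shrink[OF f t, of "{0..1}" "\<lambda>_. p" "\<lambda>x. x"])
      (use p in \<open>auto intro: continuous_on_const continuous_on_id\<close>)
qed

lemma H_continuous:
  assumes f: "continuous_on D f" and t: "t \<in> {1..u}" shows "continuous_on D (H t n f)"
proof -
  have "continuous_on (D \<times> cbox 0 1) (\<lambda>z. of_real (snd z) ^ n * f ((fst z)(t := of_real (snd z) * fst z t)))"
    by (rule continuous_on_shrink[OF f t, of "D \<times> cbox 0 1" fst snd]) (auto intro: continuous_on_fst continuous_on_snd continuous_on_id)
  then have "continuous_on D (\<lambda>p. integral (cbox 0 1) (\<lambda>x. of_real x ^ n * f (p(t := of_real x * p t))))"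
    by (intro integral_continuous_on_param) (simp add: case_prod_unfold)
  then show ?thesis by (rule continuous_on_eq) (simp add: H_def)
qed

text \<open>Differentiation under the integral sign, legitimate by the joint continuity of
  \<open>pd s f\<close> along the scaled segment.\<close>

lemma H_deriv:
  assumes f: "reg f" and df: "continuous_on D (pd s f)" and t: "t \<in> {1..u}" and s: "s \<in> {1..u}" and p: "p \<in> D"
  shows "((\<lambda>\<tau>. H t n f (p(s := \<tau>))) has_field_derivative H t (if s = t then Suc n else n) (pd s f) p) (at (p s))"
proof -
  let ?U = "ball (0::'k) (r s)"
  \<comment> \<open>The variable is set before scaling, so for \<open>s = t\<close> the integrand
    sees \<open>x \<tau>\<close>, and the chain rule yields the factor
    \<open>c x = x\<close>.\<close>
  define q where "q \<tau> x = (p(s := \<tau>))(t := of_real x * (p(s := \<tau>)) t)" for \<tau> and x :: real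
  define c where "c x = (if s = t then of_real x else 1 :: 'k)" for x :: real
  have pU: "p(s := \<tau>) \<in> D" if "\<tau> \<in> ?U" for \<tau> using D_upd[OF p s] that by simp
  have fc: "continuous_on D f" using f by (simp add: reg_def)
  have der: "((\<lambda>\<tau>. f (q \<tau> x)) has_field_derivative c x * pd s f (q \<tau> x)) (at \<tau>)" if "\<tau> \<in> ?U" "x \<in> {0..1}" for \<tau> x
  proof (cases "s = t")
    case True
    have nrm: "norm (of_real x * \<tau>) < r s"
      using that mult_left_le_one_le[of "norm \<tau>" x] by (auto simp: norm_mult)
    have "((\<lambda>\<tau>. f (p(s := of_real x * \<tau>))) has_field_derivative pd s f (p(s := of_real x * \<tau>)) * of_real x) (at \<tau>)"
      by (rule DERIV_chain2[where f="\<lambda>\<tau>. f (p(s := \<tau>))" and g="\<lambda>\<tau>. of_real x * \<tau>", OF reg_deriv[OF f p s nrm]]) (auto intro!: derivative_eq_intros)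
    then show ?thesis using True by (simp add: q_def c_def mult.commute)
  next
    case False
    have pt: "p(t := of_real x * p t) \<in> D" by (rule D_shrink[OF p t that(2)])
    have "q \<tau> x = (p(t := of_real x * p t))(s := \<tau>)" for \<tau> using False by (auto simp: q_def)
    then show ?thesis using reg_deriv[OF f pt s, of \<tau>] that False by (simp add: c_def)
  qed
  have "((\<lambda>\<tau>. integral (cbox 0 1) (\<lambda>x. of_real x ^ n * f (q \<tau> x))) has_field_derivative
      integral (cbox 0 1) (\<lambda>x. of_real x ^ n * (c x * pd s f (q (p s) x)))) (at (p s) within ?U)"
  proof (rule leibniz_rule_field_derivative)
    show "((\<lambda>\<tau>. of_real x ^ n * f (q \<tau> x)) has_field_derivative of_real x ^ n * (c x * pd s f (q \<tau> x))) (at \<tau> within ?U)"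
      if "\<tau> \<in> ?U" "x \<in> cbox 0 1" for \<tau> x
      by (rule has_field_derivative_at_within, rule DERIV_cmult, rule der) (use that in auto)
    show "(\<lambda>x. of_real x ^ n * f (q \<tau> x)) integrable_on cbox 0 1" if "\<tau> \<in> ?U" for \<tau>
      using integrable_H[OF fc t pU[OF that], of n] by (simp add: q_def)
    have 1: "continuous_on (?U \<times> cbox 0 1) (\<lambda>z. of_real (snd z) ^ n * pd s f ((p(s := fst z))(t := of_real (snd z) * (p(s := fst z)) t)))"
      by (rule continuous_on_shrink[OF df t, of "?U \<times> cbox 0 1" "\<lambda>z. p(s := fst z)" snd])
        (use pU in \<open>auto intro!: continuous_on_fun_upd continuous_on_const continuous_on_fst continuous_on_snd continuous_on_id\<close>)
    have "continuous_on (?U \<times> cbox 0 1) (\<lambda>z. c (snd z) * (of_real (snd z) ^ n * pd s f ((p(s := fst z))(t := of_real (snd z) * (p(s := fst z)) t))))"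
    proof (rule continuous_on_mult[OF _ 1])
      show "continuous_on (?U \<times> cbox 0 1) (\<lambda>z. c (snd z))"
        unfolding c_def by (cases "s = t") (auto intro!: continuous_on_of_real continuous_on_snd continuous_on_id)
    qed
    then show "continuous_on (?U \<times> cbox 0 1) (\<lambda>(\<tau>, x). of_real x ^ n * (c x * pd s f (q \<tau> x)))"
      by (simp add: case_prod_unfold q_def mult.left_commute)
    show "p s \<in> ?U" using D_norm[OF p s] by simp
  qed (rule ball_convex)
  then have *: "((\<lambda>\<tau>. integral (cbox 0 1) (\<lambda>x. of_real x ^ n * f (q \<tau> x))) has_field_derivative
      integral (cbox 0 1) (\<lambda>x. of_real x ^ n * (c x * pd s f (q (p s) x)))) (at (p s))"
    using D_norm[OF p s] by (subst (asm) at_within_open) auto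
  have "integral (cbox 0 1) (\<lambda>x. of_real x ^ n * (c x * pd s f (q (p s) x))) = H t (if s = t then Suc n else n) (pd s f) p"
    using p by (auto simp: H_def q_def c_def mult.assoc mult.left_commute intro!: integral_cong)
  moreover have "((\<lambda>\<tau>. H t n f (p(s := \<tau>))) has_field_derivative
      integral (cbox 0 1) (\<lambda>x. of_real x ^ n * (c x * pd s f (q (p s) x)))) (at (p s))"
    by (rule has_field_derivative_transform_within_open[OF * ball_convex(2)[of "r s"]])
      (use D_norm[OF p s] pU in \<open>auto simp: H_def q_def\<close>)
  ultimately show ?thesis by simp
qed

text \<open>Closes \<^term>\<open>Sm\<close> under all operations needed; by coinduction nothing is added.\<close>

inductive_set Cl :: "((nat \<Rightarrow> 'k) \<Rightarrow> 'k) set" where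
  base: "f \<in> Sm \<Longrightarrow> f \<in> Cl"
| zero: "(\<lambda>_. 0) \<in> Cl"
| one: "one_D \<in> Cl"
| coord: "i \<in> {1..u} \<Longrightarrow> coord_D i \<in> Cl"
| add: "f \<in> Cl \<Longrightarrow> g \<in> Cl \<Longrightarrow> (\<lambda>p. f p + g p) \<in> Cl"
| mult: "f \<in> Cl \<Longrightarrow> g \<in> Cl \<Longrightarrow> (\<lambda>p. f p * g p) \<in> Cl"
| smult: "f \<in> Cl \<Longrightarrow> (\<lambda>p. c * f p) \<in> Cl"
| mean: "f \<in> Sm \<Longrightarrow> t \<in> {1..u} \<Longrightarrow> H t n f \<in> Cl"

lemma deriv_transform:
  assumes "p \<in> D" "i \<in> {1..u}" "(g has_field_derivative y) (at (p i))" "\<And>t. norm t < r i \<Longrightarrow> g t = f (p(i := t))"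
  shows "((\<lambda>t. f (p(i := t))) has_field_derivative y) (at (p i))"
  by (rule has_field_derivative_transform_within_open[OF assms(3) ball_convex(2)[of "r i"]])
    (use D_norm[OF assms(1,2)] assms(4) in auto)

lemma deriv_one_D: "p \<in> D \<Longrightarrow> i \<in> {1..u} \<Longrightarrow> ((\<lambda>t. one_D (p(i := t))) has_field_derivative 0) (at (p i))"
  by (rule deriv_transform[OF _ _ DERIV_const[of 1]]) (simp_all add: one_D_def D_upd del: fun_upd_apply)

lemma deriv_coord_D:
  assumes "p \<in> D" "i \<in> {1..u}"
  shows "((\<lambda>t. coord_D j (p(i := t))) has_field_derivative (if i = j then 1 else 0)) (at (p i))"
proof (cases "i = j")
  case True
  have "((\<lambda>t. coord_D j (p(i := t))) has_field_derivative 1) (at (p i))"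
    by (rule deriv_transform[OF assms DERIV_ident]) (use True D_upd[OF assms] in \<open>simp add: coord_D_def fun_upd_same del: fun_upd_apply\<close>)
  then show ?thesis using True by simp
next
  case False
  have "((\<lambda>t. coord_D j (p(i := t))) has_field_derivative 0) (at (p i))"
    by (rule deriv_transform[OF assms DERIV_const[of "p j"]]) (use False D_upd[OF assms] in \<open>simp add: coord_D_def fun_upd_other del: fun_upd_apply\<close>)
  then show ?thesis using False by simp
qed

lemma partial_outside: "p \<notin> D \<Longrightarrow> pd i f p = 0"
  by (simp add: partial_deriv_def)

lemma partial_one_D: "i \<in> {1..u} \<Longrightarrow> pd i one_D = (\<lambda>_. 0)"
  using partial_eqI[OF _ deriv_one_D] partial_outside by (metis (no_types))

lemma partial_coord_D: "i \<in> {1..u} \<Longrightarrow> pd i (coord_D j) = (if i = j then one_D else (\<lambda>_. 0))"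
proof
  fix p assume i: "i \<in> {1..u}"
  show "pd i (coord_D j) p = (if i = j then one_D else (\<lambda>_. 0)) p"
    using partial_eqI[OF _ deriv_coord_D[OF _ i], of p j] by (cases "p \<in> D") (simp_all add: partial_outside one_D_def)
qed

lemma partial_add:
  assumes "reg f" "reg g" "i \<in> {1..u}" shows "pd i (\<lambda>p. f p + g p) = (\<lambda>p. pd i f p + pd i g p)"
proof
  fix p show "pd i (\<lambda>p. f p + g p) p = pd i f p + pd i g p"
    using partial_eqI[OF _ DERIV_add[OF reg_deriv_at[OF assms(1) _ assms(3)] reg_deriv_at[OF assms(2) _ assms(3)]]]
    by (cases "p \<in> D") (auto simp: partial_outside)
qed

lemma partial_mult:
  assumes "reg f" "reg g" "i \<in> {1..u}" shows "pd i (\<lambda>p. f p * g p) = (\<lambda>p. pd i f p * g p + f p * pd i g p)"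
proof
  fix p show "pd i (\<lambda>p. f p * g p) p = pd i f p * g p + f p * pd i g p"
    using partial_eqI[OF _ DERIV_mult[OF reg_deriv_at[OF assms(1) _ assms(3)] reg_deriv_at[OF assms(2) _ assms(3)]]]
    by (cases "p \<in> D") (auto simp: partial_outside mult.commute)
qed

lemma partial_smult:
  assumes "reg f" "i \<in> {1..u}" shows "pd i (\<lambda>p. c * f p) = (\<lambda>p. c * pd i f p)"
proof
  fix p show "pd i (\<lambda>p. c * f p) p = c * pd i f p"
    using partial_eqI[OF _ DERIV_cmult[OF reg_deriv_at[OF assms(1) _ assms(2)]]]
    by (cases "p \<in> D") (auto simp: partial_outside)
qed

lemma partial_H:
  assumes "f \<in> Sm" "s \<in> {1..u}" "t \<in> {1..u}"
  shows "pd s (H t n f) = H t (if s = t then Suc n else n) (pd s f)"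
proof
  fix p show "pd s (H t n f) p = H t (if s = t then Suc n else n) (pd s f) p"
  proof (cases "p \<in> D")
    case True
    show ?thesis
      by (rule partial_eqI[OF True H_deriv[OF SmD(2)[OF assms(1)] SmD(3)[OF SmD(4)[OF assms(1,2)]] assms(3,2) True]])
  qed (simp add: partial_outside H_def)
qed

lemma Cl_step:
  assumes "f \<in> Cl" shows "(\<forall>p. p \<notin> D \<longrightarrow> f p = 0) \<and> reg f \<and> (\<forall>i\<in>{1..u}. pd i f \<in> Cl)"
  using assms
proof induction
  case (base f)
  then show ?case using SmD[OF base] Cl.base by blast
next
  case zero
  have "reg (\<lambda>_. 0)" by (auto simp: reg_def)
  moreover have "pd i (\<lambda>_. 0) = (\<lambda>_. 0)" for i by (auto simp: partial_deriv_def)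
  ultimately show ?case using Cl.zero by simp
next
  case one
  have "continuous_on D one_D" by (rule continuous_on_eq[OF continuous_on_const[of _ 1]]) (simp add: one_D_def)
  then have "reg one_D" by (rule regI(1)[OF _ deriv_one_D])
  then show ?case using Cl.zero by (auto simp: partial_one_D) (simp add: one_D_def)
next
  case (coord i)
  have "continuous_on D (\<lambda>p. p i)" by (rule continuous_on_coordinate[OF continuous_on_id])
  then have "continuous_on D (coord_D i)" by (rule continuous_on_eq) (simp add: coord_D_def)
  then have "reg (coord_D i)" by (rule regI(1)[OF _ deriv_coord_D])
  then show ?case using Cl.zero Cl.one by (auto simp: partial_coord_D) (simp add: coord_D_def)
next
  case (add f g)
  then have "continuous_on D (\<lambda>p. f p + g p)" by (auto simp: reg_def intro: continuous_intros)
  then have "reg (\<lambda>p. f p + g p)"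
  proof (rule regI(1)[where g="\<lambda>i p. pd i f p + pd i g p"])
    show "((\<lambda>t. f (p(i := t)) + g (p(i := t))) has_field_derivative pd i f p + pd i g p) (at (p i))"
      if "p \<in> D" "i \<in> {1..u}" for p i
      by (intro DERIV_add reg_deriv_at that) (use add.IH in simp_all)
  qed
  moreover have "pd i (\<lambda>p. f p + g p) \<in> Cl" if "i \<in> {1..u}" for i
    unfolding partial_add[OF conjunct1[OF conjunct2[OF add.IH(1)]] conjunct1[OF conjunct2[OF add.IH(2)]] that]
    by (rule Cl.add[OF bspec[OF conjunct2[OF conjunct2[OF add.IH(1)]] that] bspec[OF conjunct2[OF conjunct2[OF add.IH(2)]] that]])
  ultimately show ?case using add.IH by simp
next
  case (mult f g)
  then have "continuous_on D (\<lambda>p. f p * g p)" by (auto simp: reg_def intro: continuous_intros)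
  then have "reg (\<lambda>p. f p * g p)"
  proof (rule regI(1)[where g="\<lambda>i p. pd i f p * g p + pd i g p * f p"])
    show "((\<lambda>t. f (p(i := t)) * g (p(i := t))) has_field_derivative pd i f p * g p + pd i g p * f p) (at (p i))"
      if "p \<in> D" "i \<in> {1..u}" for p i
      using DERIV_mult[OF reg_deriv_at[OF _ that, of f] reg_deriv_at[OF _ that, of g]] mult.IH by simp
  qed
  moreover have "pd i (\<lambda>p. f p * g p) \<in> Cl" if "i \<in> {1..u}" for i
    unfolding partial_mult[OF conjunct1[OF conjunct2[OF mult.IH(1)]] conjunct1[OF conjunct2[OF mult.IH(2)]] that]
    by (rule Cl.add[OF Cl.mult[OF bspec[OF conjunct2[OF conjunct2[OF mult.IH(1)]] that] mult.hyps(2)]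
        Cl.mult[OF mult.hyps(1) bspec[OF conjunct2[OF conjunct2[OF mult.IH(2)]] that]]])
  ultimately show ?case using mult.IH by simp
next
  case (smult f c)
  then have "continuous_on D (\<lambda>p. c * f p)" by (auto simp: reg_def intro: continuous_intros)
  then have "reg (\<lambda>p. c * f p)"
  proof (rule regI(1)[where g="\<lambda>i p. c * pd i f p"])
    show "((\<lambda>t. c * f (p(i := t))) has_field_derivative c * pd i f p) (at (p i))"
      if "p \<in> D" "i \<in> {1..u}" for p i
      by (intro DERIV_cmult reg_deriv_at that) (use smult.IH in simp_all)
  qed
  moreover have "pd i (\<lambda>p. c * f p) \<in> Cl" if "i \<in> {1..u}" for i
    unfolding partial_smult[OF conjunct1[OF conjunct2[OF smult.IH]] that]
    by (rule Cl.smult[OF bspec[OF conjunct2[OF conjunct2[OF smult.IH]] that]])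
  ultimately show ?case using smult.IH by simp
next
  \<comment> \<open>Averages are taken of members of \<open>Sm\<close> only, whose derivatives are
    already known to be continuous; those derivatives are in \<open>Sm\<close> again, so the rule
    reproduces itself.\<close>
  case (mean f t n)
  have "reg (H t n f)"
    by (rule regI(1)[OF H_continuous[OF SmD(3)[OF mean(1)] mean(2)]
      H_deriv[OF SmD(2)[OF mean(1)] SmD(3)[OF SmD(4)[OF mean(1)]] mean(2)]])
  moreover have "pd i (H t n f) \<in> Cl" if "i \<in> {1..u}" for i
    unfolding partial_H[OF mean(1) that mean(2)] by (rule Cl.mean[OF SmD(4)[OF mean(1) that] mean(2)])
  moreover have "H t n f p = 0" if "p \<notin> D" for p using that by (simp add: H_def)
  ultimately show ?case by blast
qed

lemma Cl_Sm: "Cl = Sm"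
  using Sm_coinduct[of _ Cl] Cl_step Cl.base by blast

lemmas Sm_intros = Cl.intros[unfolded Cl_Sm]

text \<open>The fundamental theorem of calculus on the segment from \<open>p(t := 0)\<close> to
  \<open>p\<close>.\<close>

lemma mean_partial:
  assumes f: "f \<in> Sm" and t: "t \<in> {1..u}" and p: "p \<in> D"
  shows "p t * H t 0 (pd t f) p = f p - f (p(t := 0))"
proof -
  have dv: "((\<lambda>x. f (p(t := of_real x * p t))) has_vector_derivative p t * pd t f (p(t := of_real x * p t))) (at x within {0..1})"
    if "x \<in> {0..1}" for x
  proof -
    have "norm (of_real x * p t) < r t"
      using that mult_left_le_one_le[of "norm (p t)" x] D_norm[OF p t] by (auto simp: norm_mult)
    from reg_deriv[OF SmD(2)[OF f] p t this]
    have "((\<lambda>\<tau>. f (p(t := \<tau>))) has_field_derivative pd t f (p(t := of_real x * p t))) (at (of_real x * p t) within (\<lambda>x. of_real x * p t) ` {0..1})"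
      by (rule has_field_derivative_at_within)
    moreover have "((\<lambda>x. of_real x * p t) has_vector_derivative p t) (at x within {0..1})"
      by (auto intro!: derivative_eq_intros)
    ultimately show ?thesis
      using field_vector_diff_chain_within[of "\<lambda>x. of_real x * p t" "p t" x "{0..1}" "\<lambda>\<tau>. f (p(t := \<tau>))"]
      by (simp add: o_def)
  qed
  then have "((\<lambda>x. p t * pd t f (p(t := of_real x * p t))) has_integral f (p(t := of_real 1 * p t)) - f (p(t := of_real 0 * p t))) {0..1}"
    by (intro fundamental_theorem_of_calculus zero_le_one)
  then have "((\<lambda>x. p t * pd t f (p(t := of_real x * p t))) has_integral f p - f (p(t := 0))) {0..1}" by simp
  then have "integral {0..1} (\<lambda>x. p t * pd t f (p(t := of_real x * p t))) = f p - f (p(t := 0))"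
    by (rule integral_unique)
  then show ?thesis using p by (simp add: H_def)
qed

text \<open>The fundamental theorem of calculus for \<open>x f(..., x z_t, ...)\<close>, whose
  derivative in \<open>x\<close> consists of the two integrands on the left.\<close>

lemma mean_derivation:
  assumes f: "f \<in> Sm" and t: "t \<in> {1..u}" and p: "p \<in> D"
  shows "H t 0 f p + p t * H t 1 (pd t f) p = f p"
proof -
  have dv: "((\<lambda>x. of_real x * f (p(t := of_real x * p t))) has_vector_derivative
      f (p(t := of_real x * p t)) + p t * (of_real x * pd t f (p(t := of_real x * p t)))) (at x within {0..1})"
    if "x \<in> {0..1}" for x
  proof -
    have "norm (of_real x * p t) < r t"
      using that mult_left_le_one_le[of "norm (p t)" x] D_norm[OF p t] by (auto simp: norm_mult)
    from reg_deriv[OF SmD(2)[OF f] p t this]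
    have "((\<lambda>\<tau>. f (p(t := \<tau>))) has_field_derivative pd t f (p(t := of_real x * p t))) (at (of_real x * p t) within (\<lambda>x. of_real x * p t) ` {0..1})"
      by (rule has_field_derivative_at_within)
    moreover have "((\<lambda>x. of_real x * p t) has_vector_derivative p t) (at x within {0..1})"
      by (auto intro!: derivative_eq_intros)
    ultimately have 1: "((\<lambda>x. f (p(t := of_real x * p t))) has_vector_derivative p t * pd t f (p(t := of_real x * p t))) (at x within {0..1})"
      using field_vector_diff_chain_within[of "\<lambda>x. of_real x * p t" "p t" x "{0..1}" "\<lambda>\<tau>. f (p(t := \<tau>))"]
      by (simp add: o_def)
    have 2: "((\<lambda>x. of_real x :: 'k) has_vector_derivative 1) (at x within {0..1})"
      by (auto intro!: derivative_eq_intros)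
    show ?thesis
      using has_vector_derivative_mult[OF 2 1] by (simp add: algebra_simps)
  qed
  then have "((\<lambda>x. f (p(t := of_real x * p t)) + p t * (of_real x * pd t f (p(t := of_real x * p t)))) has_integral
      of_real 1 * f (p(t := of_real 1 * p t)) - of_real 0 * f (p(t := of_real 0 * p t))) {0..1}"
    by (intro fundamental_theorem_of_calculus zero_le_one)
  then have "((\<lambda>x. f (p(t := of_real x * p t)) + p t * (of_real x * pd t f (p(t := of_real x * p t)))) has_integral f p) {0..1}"
    by simp
  then have "integral {0..1} (\<lambda>x. f (p(t := of_real x * p t)) + p t * (of_real x * pd t f (p(t := of_real x * p t)))) = f p"
    by (rule integral_unique)
  moreover have "integral {0..1} (\<lambda>x. f (p(t := of_real x * p t)) + p t * (of_real x * pd t f (p(t := of_real x * p t)))) =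
      integral {0..1} (\<lambda>x. f (p(t := of_real x * p t))) + integral {0..1} (\<lambda>x. p t * (of_real x * pd t f (p(t := of_real x * p t))))"
  proof (rule integral_add)
    show "(\<lambda>x. f (p(t := of_real x * p t))) integrable_on {0..1}"
      using integrable_H[OF SmD(3)[OF f] t p, of 0] by simp
    have "(\<lambda>x. of_real x * pd t f (p(t := of_real x * p t))) integrable_on {0..1}"
      using integrable_H[OF SmD(3)[OF SmD(4)[OF f t]] t p, of 1] by simp
    from has_integral_mult_right[OF integrable_integral[OF this], of "p t"]
    show "(\<lambda>x. p t * (of_real x * pd t f (p(t := of_real x * p t)))) integrable_on {0..1}"
      unfolding integrable_on_def by (rule exI)
  qed
  ultimately show ?thesis using p by (simp add: H_def)
qed

lemma H_Sm: "f \<in> Sm \<Longrightarrow> t \<in> {1..u} \<Longrightarrow> H t n f \<in> Sm"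
  by (rule Sm_intros(8))

lemma coord_mult_Sm: "f \<in> Sm \<Longrightarrow> t \<in> {1..u} \<Longrightarrow> (\<lambda>p. coord_D t p * f p) \<in> Sm"
  by (rule Sm_intros(6)[OF Sm_intros(4)])

lemma H_add:
  assumes "f \<in> Sm" "g \<in> Sm" "t \<in> {1..u}"
  shows "H t n (\<lambda>p. f p + g p) = (\<lambda>p. H t n f p + H t n g p)"
proof
  fix p show "H t n (\<lambda>p. f p + g p) p = H t n f p + H t n g p"
  proof (cases "p \<in> D")
    case True
    show ?thesis
      using integral_add[OF integrable_H[OF SmD(3)[OF assms(1)] assms(3) True, of n] integrable_H[OF SmD(3)[OF assms(2)] assms(3) True, of n]] True
      by (simp add: H_def distrib_left del: fun_upd_apply)
  qed (simp add: H_def)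
qed

lemma H_coord_other:
  assumes "s \<noteq> t" "t \<in> {1..u}"
  shows "H t n (\<lambda>p. coord_D s p * f p) = (\<lambda>p. coord_D s p * H t n f p)"
proof
  fix p show "H t n (\<lambda>p. coord_D s p * f p) p = coord_D s p * H t n f p"
  proof (cases "p \<in> D")
    case True
    have "integral {0..1} (\<lambda>x. of_real x ^ n * (coord_D s (p(t := of_real x * p t)) * f (p(t := of_real x * p t)))) =
        integral {0..1} (\<lambda>x. p s * (of_real x ^ n * f (p(t := of_real x * p t))))"
      by (rule integral_cong) (use D_shrink[OF True assms(2)] assms(1) in \<open>simp add: coord_D_def fun_upd_other mult.left_commute del: fun_upd_apply\<close>)
    then show ?thesis using True by (simp add: H_def coord_D_def del: fun_upd_apply)
  qed (simp add: H_def)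
qed

lemma H_coord_same:
  assumes "t \<in> {1..u}"
  shows "H t n (\<lambda>p. coord_D t p * f p) = (\<lambda>p. coord_D t p * H t (Suc n) f p)"
proof
  fix p show "H t n (\<lambda>p. coord_D t p * f p) p = coord_D t p * H t (Suc n) f p"
  proof (cases "p \<in> D")
    case True
    have "integral {0..1} (\<lambda>x. of_real x ^ n * (coord_D t (p(t := of_real x * p t)) * f (p(t := of_real x * p t)))) =
        integral {0..1} (\<lambda>x. p t * (of_real x ^ Suc n * f (p(t := of_real x * p t))))"
      by (rule integral_cong) (use D_shrink[OF True assms] in \<open>simp add: coord_D_def fun_upd_same mult.left_commute mult.assoc del: fun_upd_apply\<close>)
    then show ?thesis using True by (simp add: H_def coord_D_def del: fun_upd_apply)
  qed (simp add: H_def)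
qed

lemma partial_coord_other:
  assumes "f \<in> Sm" "s \<in> {1..u}" "t \<in> {1..u}" "s \<noteq> t"
  shows "pd s (\<lambda>p. coord_D t p * f p) = (\<lambda>p. coord_D t p * pd s f p)"
  using partial_mult[OF SmD(2)[OF Sm_intros(4)[OF assms(3)]] SmD(2)[OF assms(1)] assms(2)] partial_coord_D[OF assms(2), of t] assms(4)
  by simp

lemma partial_coord_same:
  assumes "f \<in> Sm" "t \<in> {1..u}"
  shows "pd t (\<lambda>p. coord_D t p * f p) = (\<lambda>p. f p + coord_D t p * pd t f p)"
  using partial_mult[OF SmD(2)[OF Sm_intros(4)[OF assms(2)]] SmD(2)[OF assms(1)] assms(2)] partial_coord_D[OF assms(2), of t] SmD(1)[OF assms(1)]
  by (auto simp: one_D_def fun_eq_iff)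

section \<open>Antiderivatives, restriction and mixed derivatives\<close>

definition prim :: "nat \<Rightarrow> ((nat \<Rightarrow> 'k) \<Rightarrow> 'k) \<Rightarrow> (nat \<Rightarrow> 'k) \<Rightarrow> 'k" where
  "prim t f = (\<lambda>p. coord_D t p * H t 0 f p)"

definition restr :: "nat \<Rightarrow> ((nat \<Rightarrow> 'k) \<Rightarrow> 'k) \<Rightarrow> (nat \<Rightarrow> 'k) \<Rightarrow> 'k" where
  "restr t f p = (if p \<in> D then f (p(t := 0)) else 0)"

lemma prim_Sm: "f \<in> Sm \<Longrightarrow> t \<in> {1..u} \<Longrightarrow> prim t f \<in> Sm"
  unfolding prim_def by (intro coord_mult_Sm H_Sm)

lemma mean_derivation':
  assumes "f \<in> Sm" "t \<in> {1..u}" shows "(\<lambda>p. H t 0 f p + coord_D t p * H t (Suc 0) (pd t f) p) = f"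
proof
  fix p show "H t 0 f p + coord_D t p * H t (Suc 0) (pd t f) p = f p"
    using mean_derivation[OF assms, of p] SmD(1)[OF assms(1), of p] by (cases "p \<in> D") (simp_all add: coord_D_def H_def)
qed

lemma partial_prim: assumes "f \<in> Sm" "t \<in> {1..u}" shows "pd t (prim t f) = f"
  unfolding prim_def partial_coord_same[OF H_Sm[OF assms] assms(2)] partial_H[OF assms(1,2,2)]
  using mean_derivation'[OF assms] by simp

text \<open>\<open>H t 0 (pd t g)\<close> is the Hadamard quotient of \<open>g - g(z_t = 0)\<close>
  by \<open>z_t\<close>, so it undoes multiplication by the coordinate. By the product rule the
  claim becomes \<open>mean_derivation'\<close>.\<close>

lemma mean_partial_coord: assumes "f \<in> Sm" "t \<in> {1..u}" shows "H t 0 (pd t (\<lambda>p. coord_D t p * f p)) = f"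
  unfolding partial_coord_same[OF assms] H_add[OF assms(1) coord_mult_Sm[OF SmD(4)[OF assms] assms(2)] assms(2)] H_coord_same[OF assms(2)]
  by (rule mean_derivation'[OF assms])

lemma prim_partial:
  assumes "f \<in> Sm" "t \<in> {1..u}" shows "(\<lambda>p. restr t f p + prim t (pd t f) p) = f"
proof
  fix p show "restr t f p + prim t (pd t f) p = f p"
    using mean_partial[OF assms, of p] SmD(1)[OF assms(1), of p] by (cases "p \<in> D") (simp_all add: coord_D_def prim_def restr_def)
qed

lemma restr_Sm: assumes "f \<in> Sm" "t \<in> {1..u}" shows "restr t f \<in> Sm"
proof -
  have "restr t f = (\<lambda>p. f p + (-1) * prim t (pd t f) p)"
  proof
    fix p show "restr t f p = f p + (-1) * prim t (pd t f) p"
      using fun_cong[OF prim_partial[OF assms], of p] by (simp add: eq_diff_eq)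
  qed
  moreover have "(\<lambda>p. f p + (-1) * prim t (pd t f) p) \<in> Sm"
    by (rule Sm_intros(5)[OF assms(1) Sm_intros(7)[OF prim_Sm[OF SmD(4)[OF assms] assms(2)]]])
  ultimately show ?thesis by simp
qed

lemma partial_restr:
  assumes "f \<in> Sm" "s \<in> {1..u}" "t \<in> {1..u}" "s \<noteq> t" shows "pd s (restr t f) = restr t (pd s f)"
proof
  fix p show "pd s (restr t f) p = restr t (pd s f) p"
  proof (cases "p \<in> D")
    case True
    have 0: "p(t := 0) \<in> D" by (rule D_zero[OF True assms(3)])
    have "((\<lambda>\<tau>. f ((p(t := 0))(s := \<tau>))) has_field_derivative pd s f (p(t := 0))) (at (p s))"
      using reg_deriv_at[OF SmD(2)[OF assms(1)] 0 assms(2)] assms(4) by simp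
    then have "((\<lambda>\<tau>. restr t f (p(s := \<tau>))) has_field_derivative pd s f (p(t := 0))) (at (p s))"
      by (rule deriv_transform[OF True assms(2)])
        (simp add: restr_def D_upd[OF True assms(2)] fun_upd_twist[OF assms(4)] del: fun_upd_apply)
    then have "pd s (restr t f) p = pd s f (p(t := 0))" by (rule partial_eqI[OF True])
    then show ?thesis using True by (simp add: restr_def)
  qed (simp add: restr_def partial_outside)
qed

lemma partial_prim_other:
  assumes "f \<in> Sm" "s \<in> {1..u}" "t \<in> {1..u}" "s \<noteq> t" shows "pd s (prim t f) = prim t (pd s f)"
  unfolding prim_def partial_coord_other[OF H_Sm[OF assms(1,3)] assms(2,3,4)] partial_H[OF assms(1,2,3)]
  using assms(4) by simp

text \<open>Write \<open>f\<close> as its restriction plus \<open>prim t (pd t f)\<close> and apply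
  \<open>pd s\<close>, which commutes with restriction and with \<open>prim t\<close> for
  \<open>s \<noteq> t\<close>. Comparison with the same decomposition of \<open>pd s f\<close>
  equates the antiderivatives of the two mixed derivatives, and \<open>pd t\<close> removes the
  antiderivative.\<close>

lemma partial_commute:
  assumes "f \<in> Sm" "s \<in> {1..u}" "t \<in> {1..u}" shows "pd s (pd t f) = pd t (pd s f)"
proof (cases "s = t")
  case False
  have "pd s f = pd s (\<lambda>p. restr t f p + prim t (pd t f) p)"
    by (simp only: prim_partial[OF assms(1,3)])
  also have "\<dots> = (\<lambda>p. restr t (pd s f) p + prim t (pd s (pd t f)) p)"
    by (simp only: partial_add[OF SmD(2)[OF restr_Sm[OF assms(1,3)]] SmD(2)[OF prim_Sm[OF SmD(4)[OF assms(1,3)] assms(3)]] assms(2)]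
        partial_restr[OF assms(1,2,3) False] partial_prim_other[OF SmD(4)[OF assms(1,3)] assms(2,3) False])
  finally have "prim t (pd s (pd t f)) p = prim t (pd t (pd s f)) p" for p
    using fun_cong[OF prim_partial[OF SmD(4)[OF assms(1,2)] assms(3)], of p] by (metis add_left_cancel)
  then have "prim t (pd s (pd t f)) = prim t (pd t (pd s f))" ..
  then have "pd t (prim t (pd s (pd t f))) = pd t (prim t (pd t (pd s f)))" by (rule arg_cong)
  then show ?thesis
    by (simp only: partial_prim[OF SmD(4)[OF SmD(4)[OF assms(1,3)] assms(2)] assms(3)] partial_prim[OF SmD(4)[OF SmD(4)[OF assms(1,2)] assms(3)] assms(3)])
qed simp

definition dlog :: "nat \<Rightarrow> nat \<Rightarrow> ((nat \<Rightarrow> 'k) \<Rightarrow> 'k) \<Rightarrow> (nat \<Rightarrow> 'k) \<Rightarrow> 'k" where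
  "dlog v s f = (if s \<le> v then (\<lambda>p. coord_D s p * pd s f p) else pd s f)"

text \<open>For a logarithmic variable, \<open>H t 0 (pd t f)\<close> is the quotient of
  \<open>f - f(z_t = 0)\<close> by \<open>z_t\<close>, regular across the hyperplane; integrating it
  inverts \<open>z_t d/dz_t\<close> up to restriction to \<open>z_t = 0\<close>.\<close>

definition prim_log :: "nat \<Rightarrow> nat \<Rightarrow> ((nat \<Rightarrow> 'k) \<Rightarrow> 'k) \<Rightarrow> (nat \<Rightarrow> 'k) \<Rightarrow> 'k" where
  "prim_log v t f = (if t \<le> v then prim t (H t 0 (pd t f)) else prim t f)"

lemma dlog_Sm: "f \<in> Sm \<Longrightarrow> s \<in> {1..u} \<Longrightarrow> dlog v s f \<in> Sm"
  by (simp only: dlog_def SmD(4) coord_mult_Sm split: if_split) simp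

lemma prim_log_Sm: "f \<in> Sm \<Longrightarrow> t \<in> {1..u} \<Longrightarrow> prim_log v t f \<in> Sm"
  by (simp only: prim_log_def SmD(4) H_Sm prim_Sm split: if_split) simp

lemma dlog_pd:
  assumes "f \<in> Sm" "s \<in> {1..u}" "t \<in> {1..u}" "s \<noteq> t" shows "dlog v s (pd t f) = pd t (dlog v s f)"
  using partial_coord_other[OF SmD(4)[OF assms(1,2)] assms(3,2)] assms(4) partial_commute[OF assms(1-3)] by (simp add: dlog_def)

lemma dlog_H:
  assumes "f \<in> Sm" "s \<in> {1..u}" "t \<in> {1..u}" "s \<noteq> t" shows "dlog v s (H t 0 f) = H t 0 (dlog v s f)"
  using partial_H[OF assms(1-3), of 0] H_coord_other[OF assms(4,3)] assms(4) by (simp add: dlog_def)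

lemma dlog_prim:
  assumes "f \<in> Sm" "s \<in> {1..u}" "t \<in> {1..u}" "s \<noteq> t" shows "dlog v s (prim t f) = prim t (dlog v s f)"
  using partial_prim_other[OF assms] H_coord_other[OF assms(4,3), of 0] by (simp add: dlog_def prim_def mult.left_commute)

lemma dlog_commute:
  assumes "f \<in> Sm" "s \<in> {1..u}" "t \<in> {1..u}" shows "dlog v s (dlog v t f) = dlog v t (dlog v s f)"
proof (cases "s = t")
  case False
  have "dlog v s (\<lambda>p. coord_D t p * g p) = (\<lambda>p. coord_D t p * dlog v s g p)" if "g \<in> Sm" for g
    using partial_coord_other[OF that assms(2,3) False] by (simp add: dlog_def mult.left_commute)
  from this[OF SmD(4)[OF assms(1,3)]] show ?thesis
    using dlog_pd[OF assms False, of v] by (simp add: dlog_def[of v t])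
qed simp

lemma dlog_prim_log:
  assumes "f \<in> Sm" "s \<in> {1..u}" "t \<in> {1..u}" "s \<noteq> t" shows "dlog v s (prim_log v t f) = prim_log v t (dlog v s f)"
  using dlog_prim[OF assms, of v] dlog_prim[OF H_Sm[OF SmD(4)[OF assms(1,3)] assms(3)] assms(2-4), of v 0]
    dlog_H[OF SmD(4)[OF assms(1,3)] assms(2-4), of v] dlog_pd[OF assms, of v]
  by (simp add: prim_log_def)

lemma dlog_prim_log_same:
  assumes "f \<in> Sm" "t \<in> {1..u}" "t \<le> v" shows "dlog v t (prim_log v t f) = prim t (pd t f)"
  using partial_prim[OF H_Sm[OF SmD(4)[OF assms(1,2)] assms(2)] assms(2), of 0] assms(3)
  by (simp add: dlog_def prim_log_def prim_def)

lemma prim_log_dlog: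
  assumes "f \<in> Sm" "t \<in> {1..u}" shows "prim_log v t (dlog v t f) = prim t (pd t f)"
  using mean_partial_coord[OF SmD(4)[OF assms] assms(2)] by (simp add: dlog_def prim_log_def)

lemma prim_add:
  assumes "f \<in> Sm" "g \<in> Sm" "t \<in> {1..u}" shows "prim t (\<lambda>p. f p + g p) = (\<lambda>p. prim t f p + prim t g p)"
  unfolding prim_def H_add[OF assms] by (simp add: distrib_left)

lemma prim_log_add:
  assumes "f \<in> Sm" "g \<in> Sm" "t \<in> {1..u}"
  shows "prim_log v t (\<lambda>p. f p + g p) = (\<lambda>p. prim_log v t f p + prim_log v t g p)"
  unfolding prim_log_def partial_add[OF SmD(2)[OF assms(1)] SmD(2)[OF assms(2)] assms(3)]
    H_add[OF SmD(4)[OF assms(1,3)] SmD(4)[OF assms(2,3)] assms(3)]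
    prim_add[OF H_Sm[OF SmD(4)[OF assms(1,3)] assms(3)] H_Sm[OF SmD(4)[OF assms(2,3)] assms(3)] assms(3)] prim_add[OF assms]
  by simp

lemma dlog_add:
  assumes "f \<in> Sm" "g \<in> Sm" "s \<in> {1..u}"
  shows "dlog v s (\<lambda>p. f p + g p) = (\<lambda>p. dlog v s f p + dlog v s g p)"
  unfolding dlog_def partial_add[OF SmD(2)[OF assms(1)] SmD(2)[OF assms(2)] assms(3)] by (simp add: distrib_left)

theorem log_disk:
  assumes "v \<le> u" "carrier F = Sm" "F = function_algebra D X"
  shows "log_disk u v F (prim_log v)"
proof -
  have lp: "log_partial v F = dlog v"
    by (auto simp: fun_eq_iff log_partial_def dlog_def assms(3) function_algebra_def coord_D_def)
  have fa: "\<zero>\<^bsub>F\<^esub> = 0" "add F = (+)" "f \<otimes>\<^bsub>F\<^esub> g = (\<lambda>p. f p * g p)" "\<one>\<^bsub>F\<^esub> = one_D" "c \<odot>\<^bsub>F\<^esub> f = (\<lambda>p. c * f p)" for f g c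
    by (simp_all add: assms(3) function_algebra_def fun_eq_iff one_D_def)
  have operators: "de_rham_operators u v (carrier F) (log_partial v F) (prim_log v)"
    unfolding assms(2) lp
  proof
    show "0 \<in> Sm" using Sm_intros(2) by (simp add: zero_fun_def)
    show "f + g \<in> Sm" if "f \<in> Sm" "g \<in> Sm" for f g using Sm_intros(5)[OF that] by (simp add: plus_fun_def)
    show "- f \<in> Sm" if "f \<in> Sm" for f using Sm_intros(7)[OF that, of "-1"] by (simp add: fun_Compl_def)
    show "dlog v s (f + g) = dlog v s f + dlog v s g" if "s \<in> {1..u}" "f \<in> Sm" "g \<in> Sm" for s f g
      using dlog_add[OF that(2,3,1), of v] by (simp add: plus_fun_def)
    show "prim_log v s (f + g) = prim_log v s f + prim_log v s g" if "s \<in> {1..u}" "f \<in> Sm" "g \<in> Sm" for s f g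
      using prim_log_add[OF that(2,3,1), of v] by (simp add: plus_fun_def)
    show "dlog v s (prim_log v s f) = prim_log v s (dlog v s f)" if "s \<in> {1..u}" "s \<le> v" "f \<in> Sm" for s f
      using dlog_prim_log_same[OF that(3,1,2)] prim_log_dlog[OF that(3,1)] by simp
    show "dlog v s (prim_log v s f) = f" if "s \<in> {1..u}" "v < s" "f \<in> Sm" for s f
      using partial_prim[OF that(3,1)] that(2) by (simp add: dlog_def prim_log_def)
  qed (blast intro: dlog_Sm prim_log_Sm dlog_commute dlog_prim_log)+
  interpret dR: de_rham_operators u v "carrier F" "log_partial v F" "prim_log v" by (rule operators)
  have eps: "dR.eps t f = restr t f" if "f \<in> Sm" "t \<in> {1..u}" for f t
  proof
    fix p show "dR.eps t f p = restr t f p"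
      unfolding dR.eps_def unfolding lp prim_log_dlog[OF that] using fun_cong[OF prim_partial[OF that], of p]
      by (simp add: eq_diff_eq diff_eq_eq)
  qed
  show ?thesis
  proof (rule log_disk.intro[OF operators], rule log_disk_axioms.intro)
    show "v \<le> u" by (rule assms(1))
    show "\<zero>\<^bsub>F\<^esub> = 0" "add F = (+)" by (rule fa)+
    show "f \<otimes>\<^bsub>F\<^esub> g \<in> carrier F" if "f \<in> carrier F" "g \<in> carrier F" for f g
      using that Sm_intros(6) by (simp add: assms(2) fa)
    show "\<one>\<^bsub>F\<^esub> \<in> carrier F" using Sm_intros(3) by (simp add: assms(2) fa)
    have "(\<lambda>_. 0) \<in> D" using r_pos by (auto simp: D polydisk_def)
    then have "one_D (\<lambda>_. 0) \<noteq> (0 :: (nat \<Rightarrow> 'k) \<Rightarrow> 'k) (\<lambda>_. 0)" by (simp add: one_D_def)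
    then show "\<one>\<^bsub>F\<^esub> \<noteq> 0" unfolding fa by metis
    show "c \<odot>\<^bsub>F\<^esub> f \<in> carrier F" if "f \<in> carrier F" for f c
      using that Sm_intros(7) by (simp add: assms(2) fa)
    show "f \<otimes>\<^bsub>F\<^esub> (g + h) = f \<otimes>\<^bsub>F\<^esub> g + f \<otimes>\<^bsub>F\<^esub> h" "(f \<otimes>\<^bsub>F\<^esub> g) \<otimes>\<^bsub>F\<^esub> h = f \<otimes>\<^bsub>F\<^esub> (g \<otimes>\<^bsub>F\<^esub> h)"
      "f \<otimes>\<^bsub>F\<^esub> g = g \<otimes>\<^bsub>F\<^esub> f" "(c \<odot>\<^bsub>F\<^esub> f) \<otimes>\<^bsub>F\<^esub> g = c \<odot>\<^bsub>F\<^esub> (f \<otimes>\<^bsub>F\<^esub> g)" for c f g h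
      by (auto simp: fa fun_eq_iff algebra_simps)
    show "\<one>\<^bsub>F\<^esub> \<otimes>\<^bsub>F\<^esub> f = f" if "f \<in> carrier F" for f
      using that SmD(1)[of f] by (auto simp: assms(2) fa fun_eq_iff one_D_def)
    show "vector_space (smult F)" by standard (auto simp: fa fun_eq_iff algebra_simps)
    show "log_partial v F s (c \<odot>\<^bsub>F\<^esub> f) = c \<odot>\<^bsub>F\<^esub> log_partial v F s f" if "s \<in> {1..u}" "f \<in> carrier F" for s c f
      using that partial_smult[OF SmD(2), of f s c] by (simp add: assms(2) fa lp dlog_def mult.left_commute)
    show "log_partial v F s (f \<otimes>\<^bsub>F\<^esub> g) = log_partial v F s f \<otimes>\<^bsub>F\<^esub> g + f \<otimes>\<^bsub>F\<^esub> log_partial v F s g"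
      if "s \<in> {1..u}" "f \<in> carrier F" "g \<in> carrier F" for s f g
    proof -
      have "pd s (\<lambda>p. f p * g p) = (\<lambda>p. pd s f p * g p + f p * pd s g p)"
        using that partial_mult[OF SmD(2) SmD(2), of f g s] by (simp add: assms(2))
      then show ?thesis by (simp add: fa lp dlog_def plus_fun_def algebra_simps)
    qed
    show "\<exists>c. dR.eps_upto u f = c \<odot>\<^bsub>F\<^esub> \<one>\<^bsub>F\<^esub>" if "f \<in> carrier F" for f
    proof -
      have f: "f \<in> Sm" using that assms(2) by simp
      \<comment> \<open>Membership in \<open>Sm\<close> is carried along because \<open>eps\<close>
        is identified with \<open>restr\<close> only there.\<close>
      have "dR.eps_upto k f \<in> Sm \<and> (\<forall>p\<in>D. dR.eps_upto k f p = f (\<lambda>i. if i \<in> {1..k} then 0 else p i))" if "k \<le> u" for k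
        using that
      proof (induction k)
        case 0
        then show ?case using f by simp
      next
        case (Suc k)
        then have IH: "dR.eps_upto k f \<in> Sm" "\<And>p. p \<in> D \<Longrightarrow> dR.eps_upto k f p = f (\<lambda>i. if i \<in> {1..k} then 0 else p i)"
          and k: "Suc k \<in> {1..u}" by auto
        have "(\<lambda>i. if i \<in> {1..k} then 0 else (p(Suc k := 0)) i) = (\<lambda>i. if i \<in> {1..Suc k} then 0 else p i)" for p :: "nat \<Rightarrow> 'k"
          by (auto simp: fun_eq_iff)
        then have "dR.eps_upto (Suc k) f p = f (\<lambda>i. if i \<in> {1..Suc k} then 0 else p i)" if "p \<in> D" for p
          using IH(2)[OF D_zero[OF that k]] that by (simp add: eps[OF IH(1) k] restr_def del: fun_upd_apply)
        moreover have "dR.eps_upto (Suc k) f \<in> Sm" using restr_Sm[OF IH(1) k] by (simp add: eps[OF IH(1) k])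
        ultimately show ?case by blast
      qed
      then have u: "dR.eps_upto u f \<in> Sm" "\<And>p. p \<in> D \<Longrightarrow> dR.eps_upto u f p = f (\<lambda>i. if i \<in> {1..u} then 0 else p i)" by auto
      have "(\<lambda>i. if i \<in> {1..u} then 0 else p i) = (\<lambda>_. 0)" if "p \<in> D" for p
        using that by (auto simp: D polydisk_def)
      then have "dR.eps_upto u f = f (\<lambda>_. 0) \<odot>\<^bsub>F\<^esub> \<one>\<^bsub>F\<^esub>"
        using u(2) SmD(1)[OF u(1)] by (auto simp: fa fun_eq_iff one_D_def)
      then show ?thesis by blast
    qed
  qed
qed

lemma koszul:
  assumes "v \<le> u" "Sm = {f \<in> X. \<forall>p. p \<notin> D \<longrightarrow> f p = 0}"
  shows "koszul (closed_forms u v (function_algebra D X)) (closed_forms_deg u v (function_algebra D X))"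
  by (rule log_disk.koszul_ZA[OF log_disk[OF assms(1) _ refl]]) (simp add: function_algebra_def assms(2))

end

section \<open>Holomorphic functions through the Cauchy formula\<close>

lemma (in polydisk_functions) continuous_on_D_local:
  assumes "\<And>p. p \<in> D \<Longrightarrow> \<exists>U. open U \<and> p \<in> U \<and> continuous_on (D \<inter> U) f"
  shows "continuous_on D f"
  unfolding continuous_on_eq_continuous_within
proof
  fix p assume p: "p \<in> D"
  then obtain U where U: "open U" "p \<in> U" "continuous_on (D \<inter> U) f" using assms by blast
  then have "continuous (at p within D \<inter> U) f"
    using p by (simp add: continuous_on_eq_continuous_within)
  moreover have "at p within D \<inter> U = at p within D"
    by (rule at_within_nhd[OF U(2,1)]) auto
  ultimately show "continuous (at p within D) f" by simp
qed

text \<open>The kernel of Cauchy's formula for a first derivative, \<open>1/(2 pi i)\<close> times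
  \<open>d\<zeta> / \<zeta>^2\<close> on the circle of radius \<open>\<rho>\<close> parametrised by
  \<open>[0, 1]\<close>. It does not depend on the point, which enters only through the argument of
  \<open>f\<close>.\<close>

definition cauchy_weight :: "real \<Rightarrow> real \<Rightarrow> complex" where
  "cauchy_weight \<rho> x = 1 / (2 * of_real pi * \<i>) *
     (1 / (of_real \<rho> * exp (2 * of_real pi * \<i> * of_real x)) ^ 2 * (2 * pi * \<i> * \<rho> * exp (2 * of_real pi * \<i> * x)))"

locale holomorphic_polydisk = polydisk_functions u r D
  for u r and D :: "(nat \<Rightarrow> complex) set"
begin

definition Hol :: "((nat \<Rightarrow> complex) \<Rightarrow> complex) set" where
  "Hol = {f. (\<forall>p. p \<notin> D \<longrightarrow> f p = 0) \<and> continuous_on D f \<and>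
     (\<forall>p\<in>D. \<forall>i\<in>{1..u}. (\<lambda>t. f (p(i := t))) holomorphic_on ball 0 (r i))}"

lemma Hol_reg: "f \<in> Hol \<Longrightarrow> reg f"
proof -
  assume f: "f \<in> Hol"
  have "(\<lambda>t. f (p(i := t))) field_differentiable at (p i)" if "p \<in> D" "i \<in> {1..u}" for p i
  proof (rule holomorphic_on_imp_differentiable_at)
    show "(\<lambda>t. f (p(i := t))) holomorphic_on ball 0 (r i)" using f that by (simp add: Hol_def)
    show "p i \<in> ball 0 (r i)" using D_norm[OF that] by simp
  qed simp
  then show "reg f" using f by (simp add: reg_def Hol_def)
qed

text \<open>Cauchy's formula in the variable \<open>i\<close> on a circle about \<open>p i\<close>,
  which stays inside the disk by the condition on \<open>\<rho>\<close>. It expresses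
  \<open>pd i f\<close> by values of \<open>f\<close>, whose continuity is given.\<close>

lemma partial_cauchy:
  assumes f: "f \<in> Hol" and p: "p \<in> D" and i: "i \<in> {1..u}" and \<rho>: "0 < \<rho>" "norm (p i) + \<rho> < r i"
  shows "pd i f p = integral {0..1} (\<lambda>x. cauchy_weight \<rho> x * f (p(i := p i + of_real \<rho> * exp (2 * of_real pi * \<i> * of_real x))))"
proof -
  let ?g = "\<lambda>t. f (p(i := t))"
  let ?E = "\<lambda>x. exp (2 * of_real pi * \<i> * of_real x)"
  have hol: "?g holomorphic_on ball 0 (r i)" using f p i by (simp add: Hol_def)
  have sub: "cball (p i) \<rho> \<subseteq> ball 0 (r i)"
  proof
    fix t assume "t \<in> cball (p i) \<rho>"
    then have "norm (t - p i) \<le> \<rho>" by (simp add: dist_norm norm_minus_commute)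
    then have "norm t < r i" using norm_triangle_sub[of t "p i"] \<rho>(2) by linarith
    then show "t \<in> ball 0 (r i)" by simp
  qed
  have "(?g has_field_derivative (1 / (2 * of_real pi * \<i>) * contour_integral (circlepath (p i) \<rho>) (\<lambda>t. ?g t / (t - p i) ^ 2))) (at (p i))"
  proof (rule Cauchy_derivative_integral_circlepath(2))
    show "continuous_on (cball (p i) \<rho>) ?g"
      by (rule continuous_on_subset[OF holomorphic_on_imp_continuous_on[OF hol] sub])
    show "?g holomorphic_on ball (p i) \<rho>"
      by (rule holomorphic_on_subset[OF hol]) (use sub in auto)
    show "p i \<in> ball (p i) \<rho>" using \<rho>(1) by simp
  qed
  then have "pd i f p = 1 / (2 * of_real pi * \<i>) * contour_integral (circlepath (p i) \<rho>) (\<lambda>t. ?g t / (t - p i) ^ 2)"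
    by (rule partial_eqI[OF p])
  also have "\<dots> = 1 / (2 * of_real pi * \<i>) * integral {0..1} (\<lambda>x. ?g (p i + of_real \<rho> * ?E x) / (of_real \<rho> * ?E x) ^ 2 * (2 * pi * \<i> * \<rho> * exp (2 * of_real pi * \<i> * x)))"
    unfolding contour_integral_integral vector_derivative_circlepath by (simp add: circlepath)
  also have "\<dots> = integral {0..1} (\<lambda>x. 1 / (2 * of_real pi * \<i>) * (?g (p i + of_real \<rho> * ?E x) / (of_real \<rho> * ?E x) ^ 2 * (2 * pi * \<i> * \<rho> * exp (2 * of_real pi * \<i> * x))))"
    by (rule integral_mult_right[symmetric])
  also have "\<dots> = integral {0..1} (\<lambda>x. cauchy_weight \<rho> x * f (p(i := p i + of_real \<rho> * ?E x)))"
    unfolding cauchy_weight_def by (rule integral_cong) (simp only: divide_inverse mult_1_left mult_ac)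
  finally show ?thesis .
qed

lemma continuous_on_cauchy_weight: "\<rho> > 0 \<Longrightarrow> continuous_on S (cauchy_weight \<rho>)"
  unfolding cauchy_weight_def by (auto intro!: continuous_intros)

lemma continuous_on_cauchy:
  assumes f: "continuous_on D f" and i: "i \<in> {1..u}" and \<rho>: "0 < \<rho>"
    and g: "continuous_on S g" and x: "continuous_on S x"
    and S: "\<And>z. z \<in> S \<Longrightarrow> g z \<in> D" "\<And>z. z \<in> S \<Longrightarrow> norm (g z i) + \<rho> < r i"
  shows "continuous_on S (\<lambda>z. cauchy_weight \<rho> (x z) * f ((g z)(i := g z i + of_real \<rho> * exp (2 * of_real pi * \<i> * of_real (x z)))))"
proof (rule continuous_on_mult)
  show "continuous_on S (\<lambda>z. cauchy_weight \<rho> (x z))"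
    by (rule continuous_on_compose2[OF continuous_on_cauchy_weight[OF \<rho>, of UNIV] x]) simp
  have "continuous_on S (\<lambda>z. g z i + of_real \<rho> * exp (2 * of_real pi * \<i> * of_real (x z)))"
    by (intro continuous_on_add continuous_on_coordinate[OF g] continuous_on_mult continuous_on_const continuous_on_exp continuous_on_of_real x)
  then have 1: "continuous_on S (\<lambda>z. (g z)(i := g z i + of_real \<rho> * exp (2 * of_real pi * \<i> * of_real (x z))))"
    by (rule continuous_on_fun_upd[OF g])
  show "continuous_on S (\<lambda>z. f ((g z)(i := g z i + of_real \<rho> * exp (2 * of_real pi * \<i> * of_real (x z)))))"
  proof (rule continuous_on_compose2[OF f 1], rule image_subsetI)
    fix z assume z: "z \<in> S"
    have "norm (of_real \<rho> * exp (2 * of_real pi * \<i> * of_real (x z)) :: complex) = \<rho>"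
      using \<rho> by (simp add: norm_mult)
    then have "norm (g z i + of_real \<rho> * exp (2 * of_real pi * \<i> * of_real (x z))) < r i"
      using norm_triangle_ineq[of "g z i" "of_real \<rho> * exp (2 * of_real pi * \<i> * of_real (x z))"] S(2)[OF z] by linarith
    then show "(g z)(i := g z i + of_real \<rho> * exp (2 * of_real pi * \<i> * of_real (x z))) \<in> D"
      by (rule D_upd[OF S(1)[OF z] i])
  qed
qed

text \<open>Near a point \<open>q\<close> one radius, half the distance of \<open>q i\<close> to the
  boundary, serves all points, and the integral depends continuously on them. No radius suits the
  whole polydisk, so the argument is local.\<close>

lemma Hol_partial_continuous:
  assumes f: "f \<in> Hol" and i: "i \<in> {1..u}" shows "continuous_on D (pd i f)"
proof (rule continuous_on_D_local)
  fix q assume q: "q \<in> D"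
  define \<rho> where "\<rho> = (r i - norm (q i)) / 2"
  have \<rho>: "0 < \<rho>" "norm (q i) < r i - \<rho>" using D_norm[OF q i] by (auto simp: \<rho>_def field_simps)
  define U where "U = {p :: nat \<Rightarrow> complex. norm (p i) < r i - \<rho>}"
  have "open U"
    unfolding U_def by (rule open_Collect_less[OF continuous_on_norm[OF continuous_on_coordinate[OF continuous_on_id]] continuous_on_const])
  moreover have "q \<in> U" using \<rho>(2) by (simp add: U_def)
  moreover have "continuous_on (D \<inter> U) (pd i f)"
  proof -
    have "continuous_on ((D \<inter> U) \<times> cbox 0 1) (\<lambda>z. cauchy_weight \<rho> (snd z) * f ((fst z)(i := fst z i + of_real \<rho> * exp (2 * of_real pi * \<i> * of_real (snd z)))))"
      by (rule continuous_on_cauchy[OF _ i \<rho>(1)])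
        (use f in \<open>auto simp: Hol_def U_def intro: continuous_on_fst continuous_on_snd continuous_on_id\<close>)
    then have "continuous_on (D \<inter> U) (\<lambda>p. integral (cbox 0 1) (\<lambda>x. cauchy_weight \<rho> x * f (p(i := p i + of_real \<rho> * exp (2 * of_real pi * \<i> * of_real x)))))"
      by (intro integral_continuous_on_param) (simp add: case_prod_unfold)
    then show ?thesis
      by (rule continuous_on_eq) (use partial_cauchy[OF f _ i \<rho>(1)] in \<open>auto simp: U_def\<close>)
  qed
  ultimately show "\<exists>U. open U \<and> q \<in> U \<and> continuous_on (D \<inter> U) (pd i f)" by blast
qed

text \<open>Along \<open>i\<close> this is the derivative of a holomorphic function of one variable.
  Along another direction \<open>j\<close> the coordinate \<open>p i\<close> does not move, so a
  fixed circle serves and the Cauchy integral is differentiated under the integral sign, the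
  continuity of \<open>pd j f\<close> being known.\<close>

lemma Hol_partial: assumes f: "f \<in> Hol" and i: "i \<in> {1..u}" shows "pd i f \<in> Hol"
proof -
  have "(\<lambda>t. pd i f (p(j := t))) holomorphic_on ball 0 (r j)" if p: "p \<in> D" and j: "j \<in> {1..u}" for p j
  proof (cases "j = i")
    case True
    have "(\<lambda>t. f (p(i := t))) holomorphic_on ball 0 (r i)" using f p i by (simp add: Hol_def)
    then have "deriv (\<lambda>t. f (p(i := t))) holomorphic_on ball 0 (r i)" by (rule holomorphic_deriv) simp
    moreover have "deriv (\<lambda>t. f (p(i := t))) t = pd i f (p(i := t))" if "t \<in> ball 0 (r i)" for t
      by (rule DERIV_imp_deriv[OF reg_deriv[OF Hol_reg[OF f] p i]]) (use that in simp)
    ultimately have "(\<lambda>t. pd i f (p(i := t))) holomorphic_on ball 0 (r i)" by (rule holomorphic_transform)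
    then show ?thesis using True by simp
  next
    case False
    let ?E = "\<lambda>x. exp (2 * of_real pi * \<i> * of_real x)"
    define \<rho> where "\<rho> = (r i - norm (p i)) / 2"
    have \<rho>: "0 < \<rho>" "norm (p i) + \<rho> < r i" using D_norm[OF p i] by (auto simp: \<rho>_def field_simps)
    have pU: "p(j := t) \<in> D" if "t \<in> ball 0 (r j)" for t :: complex by (rule D_upd[OF p j]) (use that in simp)
    have pi: "(p(j := t)) i = p i" for t :: complex using False by simp
    have pE: "p(i := p i + of_real \<rho> * ?E x) \<in> D" for x
    proof (rule D_upd[OF p i])
      have "norm (of_real \<rho> * ?E x :: complex) = \<rho>" using \<rho> by (simp add: norm_mult)
      then show "norm (p i + of_real \<rho> * ?E x) < r i"
        using norm_triangle_ineq[of "p i" "of_real \<rho> * ?E x"] \<rho>(2) by linarith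
    qed
    have "(\<lambda>t. integral (cbox 0 1) (\<lambda>x. cauchy_weight \<rho> x * f ((p(j := t))(i := (p(j := t)) i + of_real \<rho> * ?E x)))) holomorphic_on ball 0 (r j)"
    proof (rule leibniz_rule_holomorphic)
      show "((\<lambda>t. cauchy_weight \<rho> x * f ((p(j := t))(i := (p(j := t)) i + of_real \<rho> * ?E x))) has_field_derivative
          cauchy_weight \<rho> x * pd j f ((p(j := t))(i := (p(j := t)) i + of_real \<rho> * ?E x))) (at t within ball 0 (r j))"
        if t: "t \<in> ball 0 (r j)" for t x
      proof (rule has_field_derivative_at_within, rule DERIV_cmult)
        have "norm t < r j" using t by simp
        from reg_deriv[OF Hol_reg[OF f] pE[of x] j this]
        show "((\<lambda>t. f ((p(j := t))(i := (p(j := t)) i + of_real \<rho> * ?E x))) has_field_derivative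
          pd j f ((p(j := t))(i := (p(j := t)) i + of_real \<rho> * ?E x))) (at t)"
          unfolding pi using False by (simp add: fun_upd_twist del: fun_upd_apply)
      qed
      show "(\<lambda>x. cauchy_weight \<rho> x * f ((p(j := t))(i := (p(j := t)) i + of_real \<rho> * ?E x))) integrable_on cbox 0 1"
        if t: "t \<in> ball 0 (r j)" for t
        by (rule integrable_continuous, rule continuous_on_cauchy[OF _ i \<rho>(1), where g="\<lambda>_. p(j := t)" and x="\<lambda>x. x"])
          (use f pU[OF t] pi \<rho>(2) in \<open>simp_all add: Hol_def continuous_on_id continuous_on_const del: fun_upd_apply\<close>)
      have "continuous_on (ball 0 (r j) \<times> cbox 0 1) (\<lambda>z. cauchy_weight \<rho> (snd z) * pd j f ((p(j := fst z))(i := (p(j := fst z)) i + of_real \<rho> * ?E (snd z))))"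
      proof (rule continuous_on_cauchy[OF Hol_partial_continuous[OF f j] i \<rho>(1), where g="\<lambda>z. p(j := fst z)" and x=snd])
        show "continuous_on (ball 0 (r j) \<times> cbox 0 1) (\<lambda>z. p(j := fst z))"
          by (intro continuous_on_fun_upd continuous_on_const continuous_on_fst continuous_on_id)
        show "continuous_on (ball 0 (r j) \<times> cbox 0 1) snd" by (intro continuous_on_snd continuous_on_id)
        show "p(j := fst z) \<in> D" if "z \<in> ball 0 (r j) \<times> cbox 0 1" for z using pU[of "fst z"] that by auto
        show "norm ((p(j := fst z)) i) + \<rho> < r i" for z :: "complex \<times> real" unfolding pi by (rule \<rho>(2))
      qed
      then show "continuous_on (ball 0 (r j) \<times> cbox 0 1) (\<lambda>(t, x). cauchy_weight \<rho> x * pd j f ((p(j := t))(i := (p(j := t)) i + of_real \<rho> * ?E x)))"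
        by (simp add: case_prod_unfold del: fun_upd_apply)
    qed (rule ball_convex)
    then show ?thesis
    proof (rule holomorphic_transform)
      fix t :: complex assume t: "t \<in> ball 0 (r j)"
      have "norm ((p(j := t)) i) + \<rho> < r i" unfolding pi by (rule \<rho>(2))
      from partial_cauchy[OF f pU[OF t] i \<rho>(1) this, symmetric]
      show "integral (cbox 0 1) (\<lambda>x. cauchy_weight \<rho> x * f ((p(j := t))(i := (p(j := t)) i + of_real \<rho> * ?E x))) = pd i f (p(j := t))"
        unfolding cbox_interval .
    qed
  qed
  then show ?thesis using Hol_partial_continuous[OF assms] partial_outside by (simp add: Hol_def)
qed

text \<open>Holomorphic functions are stable under partial derivatives and hence lie in
  \<open>Sm\<close> by coinduction; conversely, one complex derivative in each variable together
  with continuity is all that \<open>Hol\<close> asks.\<close>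

lemma Hol_eq_Sm: "Hol = Sm"
proof (intro equalityI subsetI)
  fix f assume "f \<in> Hol"
  then show "f \<in> Sm"
  proof (rule Sm_coinduct)
    show "(\<forall>p. p \<notin> D \<longrightarrow> f p = 0) \<and> reg f \<and> (\<forall>i\<in>{1..u}. pd i f \<in> Hol)" if f: "f \<in> Hol" for f
      using Hol_reg[OF f] Hol_partial[OF f] f unfolding Hol_def by blast
  qed
next
  fix f assume f: "f \<in> Sm"
  have "(\<lambda>t. f (p(i := t))) holomorphic_on ball 0 (r i)" if "p \<in> D" "i \<in> {1..u}" for p i
    unfolding holomorphic_on_def field_differentiable_def
  proof
    fix t :: complex assume "t \<in> ball 0 (r i)"
    then have "norm t < r i" by simp
    from has_field_derivative_at_within[OF reg_deriv[OF SmD(2)[OF f] that this], of "ball 0 (r i)"]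
    show "\<exists>f'. ((\<lambda>t. f (p(i := t))) has_field_derivative f') (at t within ball 0 (r i))" by (rule exI)
  qed
  then show "f \<in> Hol" using SmD(1,3)[OF f] by (simp add: Hol_def)
qed

end

lemma (in polydisk_functions) smooth_eq_Sm:
  "Sm = {f \<in> {f. \<forall>js. set js \<subseteq> {1..u} \<longrightarrow> (let g = fold (partial_deriv D) js f in
        continuous_on D g \<and> (\<forall>p\<in>D. \<forall>i\<in>{1..u}. (\<lambda>t. g (p(i := t))) field_differentiable at (p i)))}.
      \<forall>p. p \<notin> D \<longrightarrow> f p = 0}"
  unfolding Sm_def reg_def Let_def by blast

text \<open>In the divided power cases the restriction to \<open>v = 0\<close> is forced:
  \<open>dp_log_not_koszul\<close> refutes the property for \<open>1 \<le> v\<close>,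
  \<open>v \<le> u\<close>.\<close>

theorem mainTheorem1:
  fixes u v :: nat
  assumes "v \<le> u"
  shows
    "koszul (closed_forms u v (polynomial_functions u :: ('k::field_char_0, _) disk_algebra))
       (closed_forms_deg u v (polynomial_functions u)) \<and>
     koszul (closed_forms u v (power_series_functions u :: ('k::field_char_0, _) disk_algebra))
       (closed_forms_deg u v (power_series_functions u)) \<and>
     (\<forall>r. (\<forall>i\<in>{1..u}. 0 < r i) \<longrightarrow>
       koszul (closed_forms u v (holomorphic_functions u r))
         (closed_forms_deg u v (holomorphic_functions u r))) \<and>
     (\<forall>r. (\<forall>i\<in>{1..u}. 0 < r i) \<longrightarrow>
       koszul (closed_forms u v (smooth_functions u r))
         (closed_forms_deg u v (smooth_functions u r))) \<and>
     (v = 0 \<longrightarrow>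
       koszul (closed_forms u v (dp_polynomial_functions u :: ('p::field_prime_char, _) disk_algebra))
         (closed_forms_deg u v (dp_polynomial_functions u)) \<and>
       koszul (closed_forms u v (dp_series_functions u :: ('p::field_prime_char, _) disk_algebra))
         (closed_forms_deg u v (dp_series_functions u)))"
proof (intro conjI allI impI)
  show "koszul (closed_forms u v (polynomial_functions u :: ('k, _) disk_algebra))
       (closed_forms_deg u v (polynomial_functions u))"
    unfolding polynomial_functions_def by (rule coeff_disk.koszul[OF ordinary_coeff_disk[OF assms]]) simp
  show "koszul (closed_forms u v (power_series_functions u :: ('k, _) disk_algebra))
       (closed_forms_deg u v (power_series_functions u))"
    unfolding power_series_functions_def by (rule coeff_disk.koszul[OF ordinary_coeff_disk[OF assms]]) simp
  show "koszul (closed_forms u v (holomorphic_functions u r)) (closed_forms_deg u v (holomorphic_functions u r))"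
    if "\<forall>i\<in>{1..u}. 0 < r i" for r
  proof -
    interpret holomorphic_polydisk u r "polydisk u r" by unfold_locales (use that in auto)
    show ?thesis
      unfolding holomorphic_functions_def Let_def
      by (rule koszul[OF assms]) (unfold Hol_eq_Sm[symmetric] Hol_def, blast)
  qed
  show "koszul (closed_forms u v (smooth_functions u r)) (closed_forms_deg u v (smooth_functions u r))"
    if "\<forall>i\<in>{1..u}. 0 < r i" for r
  proof -
    interpret polydisk_functions u r "polydisk u r :: (nat \<Rightarrow> real) set" by unfold_locales (use that in auto)
    show ?thesis
      \<comment> \<open>Over the reals, differentiability means having a real number as derivative,
        which is differentiability over the base field.\<close>
      unfolding smooth_functions_def Let_def real_differentiable_def
      by (rule koszul[OF assms smooth_eq_Sm[unfolded Let_def field_differentiable_def]])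
  qed
  assume v: "v = 0"
  show "koszul (closed_forms u v (dp_polynomial_functions u :: ('p, _) disk_algebra))
         (closed_forms_deg u v (dp_polynomial_functions u))"
    unfolding dp_polynomial_functions_def v by (rule coeff_disk.koszul[OF divided_power_coeff_disk]) simp
  show "koszul (closed_forms u v (dp_series_functions u :: ('p, _) disk_algebra))
         (closed_forms_deg u v (dp_series_functions u))"
    unfolding dp_series_functions_def v by (rule coeff_disk.koszul[OF divided_power_coeff_disk]) simp
qed

end
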